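(* Let $N\ge1$, let $p\ge1$ be an integer, let $D$ be a countable dense subset of $\mathbb R^{2N}$, let $f\in\mathfrak{LC}_p(\mathbb R^{2N},\mathbb R^N)$ and $\mathcal C=C([-1,0],\mathbb R^N)$. For $(E,\mathcal T)\in\{(\mathfrak{LC}_p,\mathcal T_B),(\mathfrak{LC}_p,\mathcal T_D),(\mathfrak{LC},\sigma_D)\}$ (spaces of functions $\mathbb R\times\mathbb R^{2N}\to\mathbb R^N$) let $$\mathcal U_{(E,\mathcal T)}=\{(t,g,\phi): g\in\mathrm{Hull}_{(E,\mathcal T)}(f),\ \phi\in\mathcal C,\ t\in I_{g,\phi},\ t\ge0\}$$ and consider the map $$\mathcal U_{(E,\mathcal T)}\to\mathrm{Hull}_{(E,\mathcal T)}(f)\times\mathcal C,\qquad (t,g,\phi)\mapsto\big(g_t,x_t(\cdot,g,\phi)\big).\qquad( * )$$ (i) If $(E,\mathcal T)=(\mathfrak{LC}_p,\mathcal T_B)$, the map $( * )$ defines a local continuous skew-product semiflow on $\mathrm{Hull}_{(\mathfrak{LC}_p,\mathcal T_B)}(f)\times\mathcal C$. (ii) If $f$ has $L^p_{loc}$-bounded $l$-bounds and $(E,\mathcal T)=(\mathfrak{LC}_p,\mathcal T_D)$, the map $( * )$ defines a local continuous skew-product semiflow on $\mathrm{Hull}_{(\mathfrak{LC}_p,\mathcal T_D)}(f)\times\mathcal C$. (iii) If $f$ has $L^1_{loc}$-equicontinuous $m$-bounds, $L^1_{loc}$-bounded $l$-bounds and $(E,\mathcal T)=(\mathfrak{LC},\sigma_D)$,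 the map $( * )$ defines a local continuous skew-product semiflow on $\mathrm{Hull}_{(\mathfrak{LC},\sigma_D)}(f)\times\mathcal C$.
   Context: $B_j$ is the closed ball of radius $j$ centered at the origin; $C(I,W)$ is the space of continuous functions $I\to W$; $\mathcal C$ carries the sup norm. $L^p_{loc}$ is the set of real functions on $\mathbb R$ belonging to $L^p(I)$ for every compact interval $I$. $\mathfrak{LC}_p(\mathbb R^{2N},\mathbb R^N)$ is the set of functions $f:\mathbb R\times\mathbb R^{2N}\to\mathbb R^N$ such that: $f$ is Borel measurable; for every compact $K\subset\mathbb R^{2N}$ there are $m^K,l^K\in L^p_{loc}$ such that for a.e. $t\in\mathbb R$, $|f(t,z)|\le m^K(t)$ and $|f(t,z_1)-f(t,z_2)|\le l^K(t)|z_1-z_2|$ for all $z,z_1,z_2\in K$. Functions differing only on a negligible set are identified. $\mathfrak{LC}=\mathfrak{LC}_1$. Topologies, generated by the following seminorms over all $I=[q_1,q_2]$, $q_1,q_2\in\mathbb Q$, $j\in\mathbb N$: - $\mathcal T_B$: $\sup_{z\in C(I,B_j)}[\int_I|f(t,z(t))|^pdt]^{1/p}$, $B_j\subset\mathbb R^{2N}$; - $\mathcal T_D$: $[\int_I|f(t,z)|^pdt]^{1/p}$, $z\in D$; - $\sigma_D$: $|\int_If(t,z)dt|$, $z\in D$. Time translation: $f_t(s,z)=f(s+t,z)$. $\mathrm{Hull}_{(E,\mathcal T)}(f)$ is the closure of $\{f_t: t\in\mathbb R\}$ in $(E,\mathcal T)$, with the induced topology. Optimal bounds of $g$ on $B_j\subset\mathbb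 R^{2N}$: $m^j_g(t)=\sup_{z\in B_j}|g(t,z)|$, $l^j_g(t)=\sup_{z_1\ne z_2\in B_j}|g(t,z_1)-g(t,z_2)|/|z_1-z_2|$. $f$ has $L^q_{loc}$-bounded $l$-bounds ($q\in\{1,p\}$) if $\sup_{\tau\in\mathbb R}\int_{-r}^r l^j_{f_\tau}(t)^q\,dt<\infty$ for every $j\in\mathbb N$, $r>0$. $f$ has $L^1_{loc}$-equicontinuous $m$-bounds if for every $j\in\mathbb N$, $r,\varepsilon>0$ there is $\delta>0$ with $\sup_{\tau\in\mathbb R}\int_s^t m^j_{f_\tau}(u)\,du<\varepsilon$ whenever $-r\le s\le t\le r$, $t-s<\delta$. For $g\in\mathfrak{LC}(\mathbb R^{2N},\mathbb R^N)$ and $\phi\in\mathcal C$, $x(\cdot,g,\phi)$ denotes the unique maximal continuous (Carathéodory) solution, with maximal interval of definition $I_{g,\phi}=[-1,b_{g,\phi})$, of $\dot x=g(t,x(t),x(t-1))$ for $t>0$, $x(t)=\phi(t)$ for $t\in[-1,0]$. For $t\ge0$, $x_t(\cdot,g,\phi)\in\mathcal C$ is $s\mapsto x(t+s,g,\phi)$, $s\in[-1,0]$. A local continuous semiflow on a topological space $X$ is a continuous map $\Phi:\mathcal U\to X$, with $\mathcal U\subset[0,\infty)\times X$ relatively open and containing $\{0\}\times X$, such that $\Phi(0,x)=x$ and $\Phi(t+s,x)=\Phi(t,\Phi(s,x))$ whenever $(s,x)\in\mathcal U$ and $(t,\Phi(s,x))\in\mathcal U$. It is a skew-product semiflow if $X=Y\times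 Z$ and the $Y$-component of $\Phi(t,y,z)$ depends only on $(t,y)$. *)

theory Defs
  imports "HOL-Analysis.Analysis"
begin

section \<open>Caratheodory functions\<close>

text \<open>With \<open>'v\<close> the space of dimension \<open>N\<close>, the product type \<open>'v \<times> 'v\<close> carries the Euclidean norm
  of dimension \<open>2N\<close>. The first argument is time.\<close>

type_synonym 'v delay_field = "real \<Rightarrow> 'v \<times> 'v \<Rightarrow> 'v"

definition Lp_loc :: "nat \<Rightarrow> (real \<Rightarrow> real) set" where
  "Lp_loc p = {h \<in> borel_measurable lebesgue.
     \<forall>a b. set_integrable lebesgue {a..b} (\<lambda>t. \<bar>h t\<bar> ^ p)}"

definition LC :: "nat \<Rightarrow> ('v::euclidean_space) delay_field set" where
  "LC p = {f. (\<lambda>(t, z). f t z) \<in> borel_measurable borel \<and>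
     (\<forall>K. compact K \<longrightarrow> (\<exists>m\<in>Lp_loc p. \<exists>l\<in>Lp_loc p. AE t in lebesgue.
        (\<forall>z\<in>K. norm (f t z) \<le> m t) \<and>
        (\<forall>z1\<in>K. \<forall>z2\<in>K. norm (f t z1 - f t z2) \<le> l t * norm (z1 - z2))))}"

definition ae_rel :: "nat \<Rightarrow> (('v::euclidean_space) delay_field \<times> 'v delay_field) set" where
  "ae_rel p = {(f, g). f \<in> LC p \<and> g \<in> LC p \<and> negligible {(t, z). f t z \<noteq> g t z}}"

text \<open>Functions that differ only on a negligible set are identified, so the points of the function
  spaces are equivalence classes.\<close>

definition LC_classes :: "nat \<Rightarrow> ('v::euclidean_space) delay_field set set" where
  "LC_classes p = LC p // ae_rel p"

definition LC_class :: "nat \<Rightarrow> ('v::euclidean_space) delay_field \<Rightarrow> 'v delay_field set" where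
  "LC_class p f = ae_rel p `` {f}"

definition translate :: "real \<Rightarrow> ('v::euclidean_space) delay_field \<Rightarrow> 'v delay_field" where
  "translate t f = (\<lambda>s z. f (s + t) z)"

section \<open>Topologies and hulls\<close>

definition seminorms_TB :: "nat \<Rightarrow> (('v::euclidean_space) delay_field \<Rightarrow> real) set" where
  "seminorms_TB p = {\<rho>. \<exists>q1\<in>\<rat>. \<exists>q2\<in>\<rat>. \<exists>j::nat. q1 \<le> q2 \<and>
     \<rho> = (\<lambda>f. SUP z \<in> {z. continuous_on {q1..q2} z \<and> z ` {q1..q2} \<subseteq> cball 0 (real j)}.
            root p (LINT t:{q1..q2}|lebesgue. norm (f t (z t)) ^ p))}"

definition seminorms_TD ::
    "nat \<Rightarrow> ('v \<times> 'v) set \<Rightarrow> (('v::euclidean_space) delay_field \<Rightarrow> real) set" where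
  "seminorms_TD p D = {\<rho>. \<exists>q1\<in>\<rat>. \<exists>q2\<in>\<rat>. \<exists>z\<in>D. q1 \<le> q2 \<and>
     \<rho> = (\<lambda>f. root p (LINT t:{q1..q2}|lebesgue. norm (f t z) ^ p))}"

definition seminorms_sigmaD ::
    "('v \<times> 'v) set \<Rightarrow> (('v::euclidean_space) delay_field \<Rightarrow> real) set" where
  "seminorms_sigmaD D = {\<rho>. \<exists>q1\<in>\<rat>. \<exists>q2\<in>\<rat>. \<exists>z\<in>D. q1 \<le> q2 \<and>
     \<rho> = (\<lambda>f. norm (LINT t:{q1..q2}|lebesgue. f t z))}"

text \<open>The subbasis consists of the open seminorm balls around the classes of the functions \<open>h\<close>.
  On \<open>LC p\<close> the seminorms above do not depend on the choice of representatives.\<close>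

definition seminorm_topology ::
    "('v::euclidean_space) delay_field set set \<Rightarrow> ('v delay_field \<Rightarrow> real) set
      \<Rightarrow> 'v delay_field set topology" where
  "seminorm_topology E P = topology_generated_by
     {{G \<in> E. \<exists>g\<in>G. \<rho> (g - h) < \<epsilon>} | \<rho> h \<epsilon>. \<rho> \<in> P \<and> h \<in> \<Union>E \<and> 0 < \<epsilon>}"

definition TB :: "nat \<Rightarrow> ('v::euclidean_space) delay_field set topology" where
  "TB p = seminorm_topology (LC_classes p) (seminorms_TB p)"

definition TD :: "nat \<Rightarrow> ('v \<times> 'v) set \<Rightarrow> ('v::euclidean_space) delay_field set topology" where
  "TD p D = seminorm_topology (LC_classes p) (seminorms_TD p D)"

definition sigmaD :: "('v \<times> 'v) set \<Rightarrow> ('v::euclidean_space) delay_field set topology" where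
  "sigmaD D = seminorm_topology (LC_classes 1) (seminorms_sigmaD D)"

text \<open>Here \<open>T\<close> is a topology on \<open>LC_classes p\<close>.\<close>

definition Hull :: "nat \<Rightarrow> ('v::euclidean_space) delay_field set topology \<Rightarrow> 'v delay_field
    \<Rightarrow> 'v delay_field set topology" where
  "Hull p T f = subtopology T (T closure_of range (\<lambda>t. LC_class p (translate t f)))"

section \<open>Optimal bounds\<close>

definition mbound :: "nat \<Rightarrow> ('v::euclidean_space) delay_field \<Rightarrow> real \<Rightarrow> ennreal" where
  "mbound j g t = (SUP z \<in> cball 0 (real j). ennreal (norm (g t z)))"

definition lbound :: "nat \<Rightarrow> ('v::euclidean_space) delay_field \<Rightarrow> real \<Rightarrow> ennreal" where
  "lbound j g t = (SUP (z1, z2) \<in> {(z1, z2). z1 \<in> cball 0 (real j) \<and> z2 \<in> cball 0 (real j) \<and> z1 \<noteq> z2}.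
     ennreal (norm (g t z1 - g t z2) / norm (z1 - z2)))"

definition Lloc_bounded_lbounds :: "nat \<Rightarrow> ('v::euclidean_space) delay_field \<Rightarrow> bool" where
  "Lloc_bounded_lbounds q f \<longleftrightarrow> (\<forall>j::nat. \<forall>r>0.
     (SUP \<tau>::real. \<integral>\<^sup>+ t \<in> {-r..r}. lbound j (translate \<tau> f) t ^ q \<partial>lebesgue) < \<infinity>)"

definition L1loc_equicontinuous_mbounds :: "('v::euclidean_space) delay_field \<Rightarrow> bool" where
  "L1loc_equicontinuous_mbounds f \<longleftrightarrow> (\<forall>j::nat. \<forall>r>0. \<forall>\<epsilon>>0. \<exists>\<delta>>0. \<forall>s t.
     -r \<le> s \<and> s \<le> t \<and> t \<le> r \<and> t - s < \<delta> \<longrightarrow>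
     (SUP \<tau>::real. \<integral>\<^sup>+ u \<in> {s..t}. mbound j (translate \<tau> f) u \<partial>lebesgue) < ennreal \<epsilon>)"

section \<open>Solutions of the delay equation\<close>

text \<open>The elements of this function space are extensional: they take the value \<open>undefined\<close>
  outside \<open>{-1..0}\<close>.\<close>

definition history_space :: "(real \<Rightarrow> 'v::euclidean_space) metric" where
  "history_space = cfunspace (top_of_set {-1..0}) euclidean_metric"

text \<open>The library has no notion of absolute continuity for functions on an interval. A division
  of its own union is a finite family of nonempty compact intervals with disjoint interiors.\<close>

definition abs_continuous_on :: "real \<Rightarrow> real \<Rightarrow> (real \<Rightarrow> 'v::euclidean_space) \<Rightarrow> bool" where
  "abs_continuous_on a b x \<longleftrightarrow> (\<forall>\<epsilon>>0. \<exists>\<delta>>0. \<forall>\<D>.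
     \<D> division_of \<Union>\<D> \<and> \<Union>\<D> \<subseteq> {a..b} \<and> (\<Sum>k\<in>\<D>. Sup k - Inf k) < \<delta> \<longrightarrow>
     (\<Sum>k\<in>\<D>. norm (x (Sup k) - x (Inf k))) < \<epsilon>)"

definition life_interval :: "ereal \<Rightarrow> real set" where
  "life_interval b = {t. -1 \<le> t \<and> ereal t < b}"

definition caratheodory_solution ::
    "('v::euclidean_space) delay_field \<Rightarrow> (real \<Rightarrow> 'v) \<Rightarrow> ereal \<Rightarrow> (real \<Rightarrow> 'v) \<Rightarrow> bool" where
  "caratheodory_solution g \<phi> b x \<longleftrightarrow>
     0 < b \<and>
     continuous_on (life_interval b) x \<and>
     (\<forall>t\<in>{-1..0}. x t = \<phi> t) \<and>
     (\<forall>c\<ge>0. ereal c < b \<longrightarrow> abs_continuous_on 0 c x) \<and>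
     (AE t in lebesgue. 0 < t \<and> ereal t < b \<longrightarrow>
        (x has_vector_derivative g t (x t, x (t - 1))) (at t))"

definition maximal_solution ::
    "('v::euclidean_space) delay_field \<Rightarrow> (real \<Rightarrow> 'v) \<Rightarrow> ereal \<Rightarrow> (real \<Rightarrow> 'v) \<Rightarrow> bool" where
  "maximal_solution g \<phi> b x \<longleftrightarrow>
     caratheodory_solution g \<phi> b x \<and>
     (\<forall>c y. caratheodory_solution g \<phi> c y \<and> b \<le> c \<and> (\<forall>t\<in>life_interval b. y t = x t) \<longrightarrow> c = b)"

text \<open>The maximal solution of a class is the common maximal solution of all its representatives;
  extensionality makes it unique as a total function.\<close>

definition max_sol ::
    "('v::euclidean_space) delay_field set \<Rightarrow> (real \<Rightarrow> 'v) \<Rightarrow> ereal \<times> (real \<Rightarrow> 'v)" where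
  "max_sol G \<phi> = (THE (b, x). x \<in> extensional (life_interval b) \<and> (\<forall>g\<in>G. maximal_solution g \<phi> b x))"

definition sol_interval :: "('v::euclidean_space) delay_field set \<Rightarrow> (real \<Rightarrow> 'v) \<Rightarrow> real set" where
  "sol_interval G \<phi> = life_interval (fst (max_sol G \<phi>))"

definition sol :: "('v::euclidean_space) delay_field set \<Rightarrow> (real \<Rightarrow> 'v) \<Rightarrow> real \<Rightarrow> 'v" where
  "sol G \<phi> = snd (max_sol G \<phi>)"

definition flow_domain :: "('v::euclidean_space) delay_field set topology
    \<Rightarrow> (real \<times> 'v delay_field set \<times> (real \<Rightarrow> 'v)) set" where
  "flow_domain H = {(t, G, \<phi>). G \<in> topspace H \<and> \<phi> \<in> mspace history_space \<and>
     t \<in> sol_interval G \<phi> \<and> 0 \<le> t}"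

definition flow :: "real \<times> ('v::euclidean_space) delay_field set \<times> (real \<Rightarrow> 'v)
    \<Rightarrow> 'v delay_field set \<times> (real \<Rightarrow> 'v)" where
  "flow = (\<lambda>(t, G, \<phi>). (translate t ` G, restrict (\<lambda>s. sol G \<phi> (t + s)) {-1..0}))"

section \<open>Semiflows\<close>

text \<open>The semiflow identity presupposes that its left-hand side is defined, so membership of
  \<open>(t + s, x)\<close> in the domain is part of it.\<close>

definition local_semiflow :: "'x topology \<Rightarrow> (real \<times> 'x) set \<Rightarrow> (real \<times> 'x \<Rightarrow> 'x) \<Rightarrow> bool" where
  "local_semiflow X U \<Phi> \<longleftrightarrow>
     openin (prod_topology (top_of_set {0..}) X) U \<and>
     {0} \<times> topspace X \<subseteq> U \<and>
     continuous_map (subtopology (prod_topology (top_of_set {0..}) X) U) X \<Phi> \<and>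
     (\<forall>x\<in>topspace X. \<Phi> (0, x) = x) \<and>
     (\<forall>s t x. (s, x) \<in> U \<and> (t, \<Phi> (s, x)) \<in> U \<longrightarrow>
        (t + s, x) \<in> U \<and> \<Phi> (t + s, x) = \<Phi> (t, \<Phi> (s, x)))"

definition local_skew_product_semiflow ::
    "'y topology \<Rightarrow> 'z topology \<Rightarrow> (real \<times> 'y \<times> 'z) set \<Rightarrow> (real \<times> 'y \<times> 'z \<Rightarrow> 'y \<times> 'z) \<Rightarrow> bool" where
  "local_skew_product_semiflow Y Z U \<Phi> \<longleftrightarrow>
     local_semiflow (prod_topology Y Z) U \<Phi> \<and>
     (\<forall>t y z z'. (t, y, z) \<in> U \<and> (t, y, z') \<in> U \<longrightarrow> fst (\<Phi> (t, y, z)) = fst (\<Phi> (t, y, z')))"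

end

theory Submission
  imports Defs
begin

text \<open>In all three topologies the hull consists of limits of translates of \<open>f\<close>, and everything reduces
  to two facts: joint continuity of \<open>(t, g) \<mapsto> g\<^sub>t\<close>, and the following error estimate. If \<open>h\<close> is close
  to \<open>g\<close> and \<open>y\<close> is a bounded solution for \<open>h\<close>, then \<open>\<integral> h(s, z(s)) - g(s, z(s)) ds\<close> is small for
  \<open>z(s) = (y(s), y(s - 1))\<close>. Since \<open>g\<close> is locally Lipschitz with an integrable constant, Gronwall's
  inequality then bounds the distance between the solutions for \<open>h\<close> and \<open>g\<close>, and a first exit argument
  gives openness of the domain.

  For \<open>T\<^sub>B\<close> the error estimate is immediate, as \<open>z\<close> is one of the curves in the seminorm. For \<open>T\<^sub>D\<close> and
  \<open>\<sigma>\<^sub>D\<close> the curve is approximated by step functions with values in a finite subset of \<open>D\<close>, at a cost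
  proportional to \<open>\<integral> l\<close>; the bounds on the translates of \<open>f\<close> pass to the hull by testing them along such
  step functions on rational grids. The finite subset must not depend on \<open>z\<close>, but for \<open>T\<^sub>D\<close> the grid may,
  because the error is estimated by a sum of norms over that subset. For \<open>\<sigma>\<^sub>D\<close> the grid has to be fixed in
  advance as well, which is possible because equicontinuous \<open>m\<close>-bounds make the solutions for all \<open>h\<close> in
  the hull equicontinuous.\<close>

section \<open>Absolutely continuous functions\<close>

text \<open>The obstacle is that a weak limit g of translates inherits no pointwise bound:
  \<open>\<sigma>\<^sub>D\<close> sees only the vectors \<integral> g(s, d) ds over rational
  intervals, so integrals of norms are out of its reach. What does pass to the limit is an estimate
  for the norm of a difference of integrals along two nearby bounded curves, with one constant for
  all translates. This form suffices because Gronwall is run only with the Lipschitz bound of the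
  fixed centre g, while the neighbouring h enters through the single vector \<integral> (h - g)
  along its own solution. Since an element of the \<open>TD\<close> hull also lies in the
  \<open>sigmaD\<close> hull, the same limit estimates serve both topologies. Points of the hull are
  treated through one translate chosen for a finite family of seminorms, not through sequences. A
  recurring difficulty is that times and end points are arbitrary while the seminorms live on
  rational intervals: where norms are integrated the interval is simply enlarged; in the weak
  topology it is cut at rational points and the remainders are made small by the m-bounds.\<close>

lemma AE_lebesgue_negligibleD:
  assumes "AE t in lebesgue. P t"
  obtains N where "negligible N" "\<And>t. t \<notin> N \<Longrightarrow> P t"
  using assms unfolding eventually_ae_filter_negligible by blast

lemma AE_lebesgue_negligibleI:
  assumes "negligible N" "\<And>t. t \<notin> N \<Longrightarrow> P t"
  shows "AE t in lebesgue. P t"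
  using assms unfolding eventually_ae_filter_negligible by blast

text \<open>Changing h to norm (f t) on the exceptional null set turns the a.e. bound into a bound
  everywhere without altering integrals, so the pointwise domination rules for the gauge integral
  apply.\<close>

lemma integrable_dominated_AE:
  fixes f :: "real \<Rightarrow> 'v::euclidean_space"
  assumes f: "f \<in> borel_measurable (lebesgue_on {a..b})" and h: "h integrable_on {a..b}"
    and le: "AE t in lebesgue. t \<in> {a..b} \<longrightarrow> norm (f t) \<le> h t"
  shows "f absolutely_integrable_on {a..b}"
    and "norm (integral {a..b} f) \<le> integral {a..b} h"
    and "integral {a..b} (\<lambda>t. norm (f t)) \<le> integral {a..b} h"
proof -
  obtain N where N: "negligible N" "\<And>t. t \<notin> N \<Longrightarrow> t \<in> {a..b} \<Longrightarrow> norm (f t) \<le> h t"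
    using le by (rule AE_lebesgue_negligibleD) auto
  define h' where "h' t = (if t \<in> N then norm (f t) else h t)" for t
  have h': "h' integrable_on {a..b}"
    by (rule integrable_spike[OF h N(1)]) (auto simp: h'_def)
  have le': "norm (f t) \<le> h' t" if "t \<in> {a..b}" for t
    using N(2)[of t] that by (auto simp: h'_def)
  show ai: "f absolutely_integrable_on {a..b}"
    by (rule measurable_bounded_by_integrable_imp_absolutely_integrable[OF f _ h' le']) auto
  have eq: "integral {a..b} h = integral {a..b} h'"
    by (rule integral_spike[OF N(1)]) (auto simp: h'_def)
  show "norm (integral {a..b} f) \<le> integral {a..b} h"
    unfolding eq using ai le' h' by (intro integral_norm_bound_integral) (auto simp: set_lebesgue_integral_eq_integral)
  show "integral {a..b} (\<lambda>t. norm (f t)) \<le> integral {a..b} h"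
    unfolding eq using ai le' h' by (intro integral_le) (auto simp: absolutely_integrable_on_def)
qed

lemma dominated_convergence_AE:
  fixes f :: "nat \<Rightarrow> real \<Rightarrow> 'v::euclidean_space"
  assumes f: "\<And>k. f k \<in> borel_measurable (lebesgue_on {a..b})" and h: "h integrable_on {a..b}"
    and le: "AE t in lebesgue. t \<in> {a..b} \<longrightarrow> (\<forall>k. norm (f k t) \<le> h t)"
    and lim: "AE t in lebesgue. t \<in> {a..b} \<longrightarrow> (\<lambda>k. f k t) \<longlonglongrightarrow> f' t"
  shows "f' integrable_on {a..b}" and "(\<lambda>k. integral {a..b} (f k)) \<longlonglongrightarrow> integral {a..b} f'"
proof -
  from le lim have "AE t in lebesgue. t \<in> {a..b} \<longrightarrow> (\<forall>k. norm (f k t) \<le> h t) \<and> (\<lambda>k. f k t) \<longlonglongrightarrow> f' t"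
    by eventually_elim auto
  then obtain N where N: "negligible N"
    "\<And>t. t \<notin> N \<Longrightarrow> t \<in> {a..b} \<Longrightarrow> (\<forall>k. norm (f k t) \<le> h t) \<and> (\<lambda>k. f k t) \<longlonglongrightarrow> f' t"
    by (rule AE_lebesgue_negligibleD) auto
  define g where "g k t = (if t \<in> N then 0 else f k t)" for k t
  define g' where "g' t = (if t \<in> N then 0 else f' t)" for t
  define h' where "h' t = (if t \<in> N then 0 else h t)" for t
  have fi: "f k integrable_on {a..b}" for k
    using integrable_dominated_AE(1)[OF f h, of k] eventually_mono[OF le]
    by (auto simp: absolutely_integrable_on_def)
  have gi: "g k integrable_on {a..b}" for k
    by (rule integrable_spike[OF fi N(1)]) (auto simp: g_def)
  have hi: "h' integrable_on {a..b}"
    by (rule integrable_spike[OF h N(1)]) (auto simp: h'_def)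
  have *: "g' integrable_on {a..b}" "(\<lambda>k. integral {a..b} (g k)) \<longlonglongrightarrow> integral {a..b} g'"
    using dominated_convergence[of g "{a..b}" h' g'] gi hi N(2)
    by (auto simp: g_def h'_def g'_def)
  show "f' integrable_on {a..b}"
    by (rule integrable_spike[OF *(1) N(1)]) (auto simp: g'_def)
  have "integral {a..b} (g k) = integral {a..b} (f k)" for k
    by (rule integral_spike[OF N(1)]) (auto simp: g_def)
  moreover have "integral {a..b} g' = integral {a..b} f'"
    by (rule integral_spike[OF N(1)]) (auto simp: g'_def)
  ultimately show "(\<lambda>k. integral {a..b} (f k)) \<longlonglongrightarrow> integral {a..b} f'"
    using * by simp
qed

text \<open>Turns the total length in \<open>abs_continuous_on\<close> into the measure of the
  union, which can be compared with the measure of an open set containing the intervals.\<close>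

lemma sum_division_lengths:
  fixes \<D> :: "real set set"
  assumes D: "\<D> division_of \<Union>\<D>"
  shows "(\<Sum>k\<in>\<D>. Sup k - Inf k) = measure lebesgue (\<Union>\<D>)" and "\<Union>\<D> \<in> lmeasurable"
proof -
  have k: "\<exists>u v. k = {u..v} \<and> u \<le> v" if "k \<in> \<D>" for k
    using division_ofD(3,4)[OF D that] by fastforce
  show m: "\<Union>\<D> \<in> lmeasurable"
    using D k by (intro fmeasurable.finite_Union) (force simp: division_of_def)+
  have "measure lebesgue (\<Union>\<D>) = integral (\<Union>\<D>) (\<lambda>x. 1)"
    using m by (rule lmeasure_integral)
  also have "\<dots> = (\<Sum>k\<in>\<D>. integral k (\<lambda>x. 1))"
    using m D integrable_on_const by (intro integral_combine_division_topdown) blast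
  also have "\<dots> = (\<Sum>k\<in>\<D>. Sup k - Inf k)"
  proof (rule sum.cong[OF refl])
    fix k assume "k \<in> \<D>"
    then obtain u v where "k = {u..v}" "u \<le> v" using k by blast
    then show "integral k (\<lambda>x. 1) = Sup k - Inf k" by simp
  qed
  finally show "(\<Sum>k\<in>\<D>. Sup k - Inf k) = measure lebesgue (\<Union>\<D>)" by simp
qed

text \<open>The exceptional null set is handled by the gauge: intervals tagged in it lie in an open set of
  small measure, where absolute continuity controls the increments.\<close>

lemma abs_continuous_FTC:
  fixes x :: "real \<Rightarrow> 'v::euclidean_space"
  assumes ab: "a \<le> b" and ac: "abs_continuous_on a b x"
    and der: "AE t in lebesgue. a < t \<and> t < b \<longrightarrow> (x has_vector_derivative h t) (at t)"
  shows "(h has_integral (x b - x a)) {a..b}"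
proof (cases "a = b")
  case True
  then show ?thesis using has_integral_refl(2)[of h b] by simp
next
  case False
  with ab have ab: "a < b" by simp
  obtain N0 where N0: "negligible N0"
    "\<And>t. t \<notin> N0 \<Longrightarrow> a < t \<Longrightarrow> t < b \<Longrightarrow> (x has_vector_derivative h t) (at t)"
    using der by (rule AE_lebesgue_negligibleD) auto
  \<comment> \<open>The end points go into the null set because the derivative is assumed only for a
    < t < b.\<close>
  define N where "N = N0 \<union> {a, b}"
  have N: "negligible N"
    using N0 by (auto simp: N_def)
  have Nd: "(x has_vector_derivative h t) (at t)" if "t \<in> {a..b} - N" for t
    using N0(2)[of t] that by (auto simp: N_def)
  \<comment> \<open>With the value 0 on N, a tag in N contributes nothing to the Riemann sum; only
    the increment of x over its interval has to be small.\<close>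
  define h' where "h' t = (if t \<in> N then 0 else h t)" for t
  have "(h' has_integral (x b - x a)) {a..b}"
    unfolding has_integral_factor_content_real
  proof (intro allI impI)
    fix e :: real assume "e > 0"
    \<comment> \<open>Half of the permitted error e * (b - a) goes to the intervals tagged in N, the
      other half to the derivative estimate with e/2 at the remaining tags.\<close>
    define e1 where "e1 = e * (b - a) / 2"
    have e1: "e1 > 0" using \<open>e > 0\<close> ab by (simp add: e1_def)
    obtain \<delta> where \<delta>: "\<delta> > 0"
      and ac': "\<And>\<D>. \<D> division_of \<Union>\<D> \<Longrightarrow> \<Union>\<D> \<subseteq> {a..b} \<Longrightarrow> (\<Sum>k\<in>\<D>. Sup k - Inf k) < \<delta>
          \<Longrightarrow> (\<Sum>k\<in>\<D>. norm (x (Sup k) - x (Inf k))) < e1"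
      using ac[unfolded abs_continuous_on_def, rule_format, OF e1] by auto
    obtain U where U: "open U" "N \<subseteq> U" "emeasure lebesgue (U - N) < ennreal \<delta>"
      by (rule sets_lebesgue_outer_open[OF negligible_imp_sets[OF N] \<delta>])
    have Um: "emeasure lebesgue U < ennreal \<delta>"
      using U emeasure_Diff_null_set[of N lebesgue U] N
      by (simp add: negligible_iff_null_sets borel_open)
    have "\<exists>d>0. (t \<in> N \<longrightarrow> ball t d \<subseteq> U) \<and>
        (t \<in> {a..b} - N \<longrightarrow> (\<forall>y. \<bar>y - t\<bar> < d \<longrightarrow> norm (x y - x t - (y - t) *\<^sub>R h t) \<le> e/2 * \<bar>y - t\<bar>))" for t
    proof (cases "t \<in> N")
      case True
      then show ?thesis using U openE[of U t] by blast
    next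
      case False
      show ?thesis
      proof (cases "t \<in> {a..b}")
        case True
        with False Nd[of t] have "(x has_vector_derivative h t) (at t)" by auto
        then have "\<exists>d>0. \<forall>y. norm (y - t) < d \<longrightarrow> norm (x y - x t - (y - t) *\<^sub>R h t) \<le> e/2 * norm (y - t)"
          using half_gt_zero[OF \<open>e > 0\<close>]
          unfolding has_vector_derivative_def has_derivative_at_alt by blast
        then show ?thesis using False by auto
      qed (use False in \<open>auto intro: exI[of _ 1]\<close>)
    qed
    then obtain d where d: "\<And>t. d t > 0" "\<And>t. t \<in> N \<Longrightarrow> ball t (d t) \<subseteq> U"
      "\<And>t y. t \<in> {a..b} - N \<Longrightarrow> \<bar>y - t\<bar> < d t \<Longrightarrow> norm (x y - x t - (y - t) *\<^sub>R h t) \<le> e/2 * \<bar>y - t\<bar>"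
      by metis
    show "\<exists>d. gauge d \<and> (\<forall>p. p tagged_division_of {a..b} \<and> d fine p \<longrightarrow>
            norm ((\<Sum>(t, k)\<in>p. Henstock_Kurzweil_Integration.content k *\<^sub>R h' t) - (x b - x a)) \<le> e * Henstock_Kurzweil_Integration.content {a..b})"
    proof (rule exI, safe)
      show "gauge (\<lambda>t. ball t (d t))"
        using d(1) gauge_ball_dependent by blast
    next
      fix p
      assume ptag: "p tagged_division_of {a..b}" and fine: "(\<lambda>t. ball t (d t)) fine p"
      note tag = tagged_division_ofD[OF ptag]
      have ba: "b - a = (\<Sum>(t,K)\<in>p. Sup K - Inf K)" "x b - x a = (\<Sum>(t,K)\<in>p. x (Sup K) - x (Inf K))"
        using additive_tagged_division_1[OF less_imp_le[OF ab] ptag, where f= "\<lambda>x. x"]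
          additive_tagged_division_1[OF less_imp_le[OF ab] ptag, where f= x] by simp_all
      have K: "\<exists>u v. K = {u..v} \<and> u \<le> t \<and> t \<le> v \<and> a \<le> u \<and> v \<le> b \<and> {u..v} \<subseteq> ball t (d t)" if tK: "(t,K) \<in> p" for t K
      proof -
        obtain u v where uv: "K = {u..v}" using tag(4)[OF tK] by auto
        with tag(2,3)[OF tK] fine tK show ?thesis by (auto simp: fine_def)
      qed
      \<comment> \<open>Degenerate intervals are left out: two tags may carry the same one, which
        would break injectivity of \<open>snd\<close>, and their increments vanish anyway.\<close>
      define p1 where "p1 = {(t,K)\<in>p. t \<in> N \<and> interior K \<noteq> {}}"
      have p1: "p1 \<subseteq> p" by (auto simp: p1_def)
      have "p1 tagged_partial_division_of {a..b}"
        using tagged_partial_division_subset[OF _ p1] ptag[unfolded tagged_division_of_def] by blast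
      then have div: "snd ` p1 division_of \<Union>(snd ` p1)"
        by (rule partial_division_of_tagged_division)
      have inj: "inj_on snd p1"
      proof (rule inj_onI)
        fix q r assume "q \<in> p1" "r \<in> p1" "snd q = snd r"
        then show "q = r"
          using tag(5)[of "fst q" "snd q" "fst r" "snd r"] by (cases q; cases r) (auto simp: p1_def)
      qed
      have sub: "\<Union>(snd ` p1) \<subseteq> U" "\<Union>(snd ` p1) \<subseteq> {a..b}"
      proof -
        have "K \<subseteq> U" if "(t,K) \<in> p1" for t K
          using that K[of t K] d(2)[of t] by (auto simp: p1_def)
        then show "\<Union>(snd ` p1) \<subseteq> U" by fastforce
        show "\<Union>(snd ` p1) \<subseteq> {a..b}"
          using tag(3) p1 by fastforce
      qed
      have "measure lebesgue (\<Union>(snd ` p1)) < \<delta>"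
      proof -
        have "emeasure lebesgue (\<Union>(snd ` p1)) \<le> emeasure lebesgue U"
          using sub U by (intro emeasure_mono) (auto simp: borel_open)
        with Um have "emeasure lebesgue (\<Union>(snd ` p1)) < ennreal \<delta>" by simp
        then show ?thesis
          using sum_division_lengths(2)[OF div] \<delta>
          by (simp add: emeasure_eq_measure2 ennreal_less_iff)
      qed
      then have "(\<Sum>K\<in>snd ` p1. norm (x (Sup K) - x (Inf K))) < e1"
        using ac'[OF div sub(2)] sum_division_lengths(1)[OF div] by simp
      then have s1: "(\<Sum>(t,K)\<in>p1. norm (x (Sup K) - x (Inf K))) < e1"
        by (simp add: sum.reindex[OF inj] split_def o_def)
      let ?f = "\<lambda>(t,K). norm (Henstock_Kurzweil_Integration.content K *\<^sub>R h' t - (x (Sup K) - x (Inf K)))"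
      have bound: "?f (t,K) \<le> (if (t,K) \<in> p1 then norm (x (Sup K) - x (Inf K)) else 0) + e/2 * (Sup K - Inf K)"
        if "(t,K) \<in> p" for t K
      proof -
        obtain u v where uv: "K = {u..v}" "u \<le> t" "t \<le> v" "a \<le> u" "v \<le> b" "{u..v} \<subseteq> ball t (d t)"
          using K[OF \<open>(t,K)\<in>p\<close>] by blast
        have uv': "u \<le> v" using uv by simp
        consider "(t,K) \<in> p1" | "t \<in> N" "u = v" | "t \<notin> N"
          using \<open>(t,K)\<in>p\<close> uv uv' by (cases "u = v") (auto simp: p1_def)
        then show ?thesis
        proof cases
          case 1
          then have "h' t = 0" by (auto simp: p1_def h'_def)
          then show ?thesis using 1 uv uv' \<open>e > 0\<close> by (simp add: norm_minus_commute)
        next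
          case 2
          then show ?thesis using uv by simp
        next
          case 3
          then have tt: "t \<in> {a..b} - N" using uv by auto
          have "\<bar>u - t\<bar> < d t" "\<bar>v - t\<bar> < d t"
            using uv(6) uv' by (auto simp: subset_iff dist_real_def)
          then have du: "norm (x u - x t - (u - t) *\<^sub>R h t) \<le> e/2 * \<bar>u - t\<bar>"
            and dv: "norm (x v - x t - (v - t) *\<^sub>R h t) \<le> e/2 * \<bar>v - t\<bar>"
            using d(3)[OF tt] by blast+
          \<comment> \<open>Straddle estimate: as t lies between u and v, the errors on its two
            sides add up to e/2 times the full length v - u.\<close>
          have "norm ((v - u) *\<^sub>R h t - (x v - x u)) = norm ((x u - x t - (u - t) *\<^sub>R h t) - (x v - x t - (v - t) *\<^sub>R h t))"
            by (simp add: algebra_simps)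
          also have "\<dots> \<le> e/2 * \<bar>u - t\<bar> + e/2 * \<bar>v - t\<bar>"
            by (rule order_trans[OF norm_triangle_ineq4 add_mono[OF du dv]])
          also have "\<dots> = e/2 * (v - u)"
            using uv by (simp add: field_simps)
          finally show ?thesis
            using 3 uv uv' by (auto simp: h'_def p1_def)
        qed
      qed
      have fp: "finite p" using tag(1) .
      have "norm ((\<Sum>(t, K)\<in>p. Henstock_Kurzweil_Integration.content K *\<^sub>R h' t) - (x b - x a)) \<le> (\<Sum>q\<in>p. ?f q)"
        unfolding ba(2) sum_subtractf[symmetric] by (rule sum_norm_le) auto
      also have "\<dots> \<le> (\<Sum>(t,K)\<in>p. (if (t,K) \<in> p1 then norm (x (Sup K) - x (Inf K)) else 0) + e/2 * (Sup K - Inf K))"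
        using bound by (intro sum_mono) auto
      also have "\<dots> = (\<Sum>(t,K)\<in>p1. norm (x (Sup K) - x (Inf K))) + e/2 * (b - a)"
        unfolding ba(1) split_def sum.distrib sum_distrib_left using p1 fp
        by (simp add: sum.If_cases Int_absorb1 Int_absorb2)
      also have "\<dots> \<le> e * Henstock_Kurzweil_Integration.content {a..b}"
        using s1 ab by (simp add: e1_def field_simps)
      finally show "norm ((\<Sum>(t, K)\<in>p. Henstock_Kurzweil_Integration.content K *\<^sub>R h' t) - (x b - x a)) \<le> e * Henstock_Kurzweil_Integration.content {a..b}" .
    qed
  qed
  then show ?thesis
    by (rule has_integral_spike[OF N, rotated]) (auto simp: h'_def)
qed

text \<open>Lebesgue differentiation. \<open>integrable_ccontinuous_explicit\<close> treats averages
  to the right of a point; left averages are right averages of x |-> f (-x), whose null set is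
  reflected back. The exceptional set does not depend on a, since increments of the primitive do not
  see the base point.\<close>

lemma integral_has_vector_derivative_AE:
  fixes f :: "real \<Rightarrow> 'v::euclidean_space"
  assumes f: "\<And>a b. f integrable_on {a..b}"
  shows "AE t in lebesgue. \<forall>a<t. ((\<lambda>u. integral {a..u} f) has_vector_derivative f t) (at t)"
proof -
  obtain N1 where N1: "negligible N1"
       "\<And>x e. \<lbrakk>x \<notin> N1; 0 < e\<rbrakk> \<Longrightarrow>
               \<exists>d>0. \<forall>h. 0 < h \<and> h < d \<longrightarrow> norm (integral {x..x+h} f /\<^sub>R h - f x) < e"
    using integrable_ccontinuous_explicit[of f] f by (auto simp: algebra_simps)
  have f': "(\<lambda>x. f (-x)) integrable_on {a..b}" for a b
    using Henstock_Kurzweil_Integration.integrable_reflect_real[where f=f and a="-b" and b="-a"] f by simp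
  obtain N2 where N2: "negligible N2"
       "\<And>x e. \<lbrakk>x \<notin> N2; 0 < e\<rbrakk> \<Longrightarrow>
               \<exists>d>0. \<forall>h. 0 < h \<and> h < d \<longrightarrow> norm (integral {x..x+h} (\<lambda>x. f (-x)) /\<^sub>R h - f (-x)) < e"
    using integrable_ccontinuous_explicit[of "\<lambda>x. f (-x)"] f' by (auto simp: algebra_simps)
  have refl: "integral {-t..-t+h} (\<lambda>x. f (-x)) = integral {t-h..t} f" for t h
    using Henstock_Kurzweil_Integration.integral_reflect_real[where f=f and b=t and a="t-h"] by (simp add: algebra_simps)
  define N where "N = N1 \<union> uminus ` N2"
  have N: "negligible N"
    using N1 N2 by (auto simp: N_def intro!: negligible_differentiable_image_negligible derivative_intros differentiable_on_minus)
  show ?thesis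
  proof (rule AE_lebesgue_negligibleI[OF N], intro allI impI)
    fix t a :: real assume t: "t \<notin> N" and a: "a < t"
    have t1: "t \<notin> N1" and t2: "-t \<notin> N2"
      using t by (auto simp: N_def image_iff)
    show "((\<lambda>u. integral {a..u} f) has_vector_derivative f t) (at t)"
      unfolding has_vector_derivative_def has_derivative_at_alt
    proof (intro conjI allI impI)
      fix e :: real assume e: "e > 0"
      obtain d1 where d1: "d1 > 0" "\<And>h. 0 < h \<Longrightarrow> h < d1 \<Longrightarrow> norm (integral {t..t+h} f /\<^sub>R h - f t) < e"
        using N1(2)[OF t1 e] by blast
      obtain d2 where d2: "d2 > 0" "\<And>h. 0 < h \<Longrightarrow> h < d2 \<Longrightarrow> norm (integral {t-h..t} f /\<^sub>R h - f t) < e"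
        using N2(2)[OF t2 e] unfolding refl by auto
      have scale: "norm (v - h *\<^sub>R w) \<le> e * h" if "norm (v /\<^sub>R h - w) < e" "h > 0" for v w :: 'v and h
      proof -
        have "v - h *\<^sub>R w = h *\<^sub>R (v /\<^sub>R h - w)" using that by (simp add: algebra_simps)
        then have "norm (v - h *\<^sub>R w) = h * norm (v /\<^sub>R h - w)" using that by simp
        also have "\<dots> \<le> h * e" using that by (intro mult_left_mono) auto
        finally show ?thesis by (simp add: mult.commute)
      qed
      show "\<exists>d>0. \<forall>y. norm (y - t) < d \<longrightarrow>
          norm (integral {a..y} f - integral {a..t} f - (y - t) *\<^sub>R f t) \<le> e * norm (y - t)"
      proof (intro exI conjI allI impI)
        show "min (min d1 d2) (t - a) > 0" using d1 d2 a by simp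
        fix y assume y: "norm (y - t) < min (min d1 d2) (t - a)"
        consider "y = t" | "y > t" | "y < t" by linarith
        then show "norm (integral {a..y} f - integral {a..t} f - (y - t) *\<^sub>R f t) \<le> e * norm (y - t)"
        proof cases
          case 2
          have "integral {a..t} f + integral {t..y} f = integral {a..y} f"
            using 2 a f by (intro Henstock_Kurzweil_Integration.integral_combine) auto
          then have "integral {a..y} f - integral {a..t} f = integral {t..y} f"
            by (metis add_diff_cancel_left')
          then show ?thesis
            using scale[OF d1(2)[of "y - t"]] 2 y by simp
        next
          case 3
          have "integral {a..y} f + integral {y..t} f = integral {a..t} f"
            using 3 y a f by (intro Henstock_Kurzweil_Integration.integral_combine) auto
          from this[symmetric] have "integral {a..y} f - integral {a..t} f - (y - t) *\<^sub>R f t = - (integral {y..t} f - (t - y) *\<^sub>R f t)"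
            by (simp add: algebra_simps)
          then show ?thesis
            using scale[OF d2(2)[of "t - y"]] 3 y by (simp only: norm_minus_cancel) simp
        qed simp
      qed
    qed (rule bounded_linear_scaleR_left)
  qed
qed

text \<open>Truncation: norm (f t) splits into a part bounded by n, which contributes at most n
  times the length of the division, and a remainder whose integral over all of {a..b} is below
  \<epsilon>/2.\<close>

lemma abs_continuous_integral:
  fixes f :: "real \<Rightarrow> 'v::euclidean_space"
  assumes f: "f absolutely_integrable_on {a..b}"
    and x: "\<And>t. t \<in> {a..b} \<Longrightarrow> x t = c + integral {a..t} f"
  shows "abs_continuous_on a b x"
  unfolding abs_continuous_on_def
proof (intro allI impI)
  fix \<epsilon> :: real assume \<epsilon>: "\<epsilon> > 0"
  have fn: "(\<lambda>t. norm (f t)) integrable_on {a..b}" and fi: "f integrable_on {a..b}"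
    using f by (auto simp: absolutely_integrable_on_def)
  have "(\<lambda>t. norm (f t)) \<in> borel_measurable (lebesgue_on {a..b})"
    using fn by (rule integrable_imp_measurable)
  then have m: "(\<lambda>t. norm (f t) - min (norm (f t)) (real n)) \<in> borel_measurable (lebesgue_on {a..b})" for n
    by measurable
  have "(\<lambda>n. integral {a..b} (\<lambda>t. norm (f t) - min (norm (f t)) (real n))) \<longlonglongrightarrow> integral {a..b} (\<lambda>t. 0::real)"
  proof (rule dominated_convergence_AE(2)[OF m fn])
    show "AE t in lebesgue. t \<in> {a..b} \<longrightarrow> (\<lambda>n. norm (f t) - min (norm (f t)) (real n)) \<longlonglongrightarrow> 0"
    proof (intro AE_I2 impI)
      fix t
      have "eventually (\<lambda>n. norm (f t) - min (norm (f t)) (real n) = 0) sequentially"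
        using eventually_ge_at_top[of "nat \<lceil>norm (f t)\<rceil>"]
        by eventually_elim (simp add: nat_ceiling_le_eq)
      then show "(\<lambda>n. norm (f t) - min (norm (f t)) (real n)) \<longlonglongrightarrow> 0"
        by (rule tendsto_eventually)
    qed
  qed auto
  then have "eventually (\<lambda>n. integral {a..b} (\<lambda>t. norm (f t) - min (norm (f t)) (real n)) < \<epsilon>/2) sequentially"
    using \<epsilon> by (intro order_tendstoD) auto
  then obtain n where n: "integral {a..b} (\<lambda>t. norm (f t) - min (norm (f t)) (real n)) < \<epsilon>/2"
    by (auto simp: eventually_sequentially)
  let ?r = "\<lambda>t. norm (f t) - min (norm (f t)) (real n)"
  have r: "?r integrable_on {a..b}"
    using integrable_dominated_AE(1)[OF m fn] by (auto simp: absolutely_integrable_on_def)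
  have r0: "0 \<le> ?r t" for t by simp
  show "\<exists>\<delta>>0. \<forall>\<D>. \<D> division_of \<Union>\<D> \<and> \<Union>\<D> \<subseteq> {a..b} \<and> (\<Sum>k\<in>\<D>. Sup k - Inf k) < \<delta> \<longrightarrow>
     (\<Sum>k\<in>\<D>. norm (x (Sup k) - x (Inf k))) < \<epsilon>"
  proof (intro exI conjI allI impI)
    \<comment> \<open>n + 1 in place of n keeps the quotient positive when n = 0.\<close>
    show "\<epsilon> / (2 * (real n + 1)) > 0" using \<epsilon> by simp
    fix \<D> :: "real set set"
    assume *: "\<D> division_of \<Union>\<D> \<and> \<Union>\<D> \<subseteq> {a..b} \<and> (\<Sum>k\<in>\<D>. Sup k - Inf k) < \<epsilon> / (2 * (real n + 1))"
    then have D: "\<D> division_of \<Union>\<D>" and sub: "\<Union>\<D> \<subseteq> {a..b}" by auto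
    have le: "norm (x (Sup k) - x (Inf k)) \<le> integral k ?r + real n * (Sup k - Inf k)" if kD: "k \<in> \<D>" for k
    proof -
      obtain u v where k: "k = {u..v}" "u \<le> v"
        using division_ofD(3,4)[OF D kD] by fastforce
      have "{u..v} \<subseteq> {a..b}" using sub kD k by blast
      then have uv: "a \<le> u" "v \<le> b" using k by auto
      have fu: "f integrable_on {u..v}" and ru: "?r integrable_on {u..v}"
        using uv integrable_on_subinterval[OF fi] integrable_on_subinterval[OF r] by auto
      have "integral {a..u} f + integral {u..v} f = integral {a..v} f"
        using uv k
        by (intro Henstock_Kurzweil_Integration.integral_combine integrable_on_subinterval[OF fi]) auto
      then have "x v - x u = integral {u..v} f"
        using x[of u] x[of v] uv k by (simp add: algebra_simps)
      moreover have "norm (integral {u..v} f) \<le> integral {u..v} (\<lambda>t. ?r t + real n)"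
        using fu ru by (intro integral_norm_bound_integral integrable_add) auto
      moreover have "integral {u..v} (\<lambda>t. ?r t + real n) = integral {u..v} ?r + real n * (v - u)"
        using ru k by (subst integral_add) auto
      ultimately show ?thesis using k by simp
    qed
    have rD: "?r integrable_on \<Union>\<D>"
      using integrable_on_subdivision[OF D r sub] .
    have "(\<Sum>k\<in>\<D>. norm (x (Sup k) - x (Inf k))) \<le> (\<Sum>k\<in>\<D>. integral k ?r) + real n * (\<Sum>k\<in>\<D>. Sup k - Inf k)"
      unfolding sum_distrib_left sum.distrib[symmetric] using le by (rule sum_mono)
    also have "(\<Sum>k\<in>\<D>. integral k ?r) = integral (\<Union>\<D>) ?r"
      using integral_combine_division_topdown[OF rD D] by simp
    also have "integral (\<Union>\<D>) ?r \<le> integral {a..b} ?r"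
      using r rD sub by (intro integral_subset_le) auto
    also have "\<dots> + real n * (\<Sum>k\<in>\<D>. Sup k - Inf k) < \<epsilon>/2 + \<epsilon>/2"
    proof (rule add_less_le_mono[OF n])
      have "real n * (\<Sum>k\<in>\<D>. Sup k - Inf k) \<le> real n * (\<epsilon> / (2 * (real n + 1)))"
        using * by (intro mult_left_mono) auto
      also have "\<dots> \<le> \<epsilon>/2" using \<epsilon> by (simp add: field_simps)
      finally show "real n * (\<Sum>k\<in>\<D>. Sup k - Inf k) \<le> \<epsilon>/2" .
    qed
    finally show "(\<Sum>k\<in>\<D>. norm (x (Sup k) - x (Inf k))) < \<epsilon>" by simp
  qed
qed

section \<open>Integral inequalities\<close>

lemma borel_measurable_lebesgue_on:
  "f \<in> borel_measurable borel \<Longrightarrow> f \<in> borel_measurable (lebesgue_on S)"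
  by (intro measurable_restrict_space1 measurable_completion) simp

lemma continuous_on_measurable_lebesgue_on:
  fixes f :: "real \<Rightarrow> 'v::euclidean_space"
  shows "continuous_on {a..b} f \<Longrightarrow> f \<in> borel_measurable (lebesgue_on {a..b})"
  by (intro continuous_imp_measurable_on_sets_lebesgue) auto

lemma integral_shift_real:
  fixes f :: "real \<Rightarrow> 'v::euclidean_space"
  shows "integral {a..b} (\<lambda>s. f (s + c)) = integral {a+c..b+c} f"
  using integral_shift_Icc_real[of a b f c] by (simp add: o_def add.commute)

lemma integrable_shift_real:
  fixes f :: "real \<Rightarrow> 'v::euclidean_space"
  shows "(\<lambda>s. f (s + c)) integrable_on {a..b} \<longleftrightarrow> f integrable_on {a+c..b+c}"
  using has_integral_shift_Icc_real[of f c _ a b] by (simp add: o_def add.commute integrable_on_def)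

lemma sum3_power_le:
  fixes x y z :: real
  assumes "0 \<le> x" "0 \<le> y" "0 \<le> z"
  shows "(x + y + z) ^ p \<le> 3 ^ p * (x ^ p + y ^ p + z ^ p)"
proof -
  define m where "m = max x (max y z)"
  have "(x + y + z) ^ p \<le> (3 * m) ^ p"
    using assms by (intro power_mono) (auto simp: m_def)
  also have "\<dots> = 3 ^ p * m ^ p" by (simp add: power_mult_distrib)
  also have "m ^ p \<le> x ^ p + y ^ p + z ^ p"
    using assms by (auto simp: m_def max_def)
  finally show ?thesis by simp
qed

lemma convex_comb_power_le:
  fixes x y \<mu> \<nu> :: real
  assumes "0 \<le> x" "0 \<le> y" "0 \<le> \<mu>" "0 \<le> \<nu>" "\<mu> + \<nu> = 1"
  shows "(\<mu> * x + \<nu> * y) ^ p \<le> \<mu> * x ^ p + \<nu> * y ^ p"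
proof -
  have "convex_on {0..} (\<lambda>x::real. x ^ p)"
    using convex_power_even[of p] convex_power_odd[of p] convex_on_subset by (cases "even p") blast+
  then show ?thesis
    using assms by (auto simp: convex_on_def)
qed

text \<open>By convexity of the power, applied to the normalized functions.\<close>

lemma Lp_triangle:
  fixes u v w :: "real \<Rightarrow> real"
  assumes p: "1 \<le> p" and N: "negligible N"
    and int: "(\<lambda>t. w t ^ p) integrable_on {a..b}" "(\<lambda>t. u t ^ p) integrable_on {a..b}" "(\<lambda>t. v t ^ p) integrable_on {a..b}"
    and le: "\<And>t. t \<in> {a..b} \<Longrightarrow> t \<notin> N \<Longrightarrow> 0 \<le> w t \<and> 0 \<le> u t \<and> 0 \<le> v t \<and> w t \<le> u t + v t"
  shows "root p (integral {a..b} (\<lambda>t. w t ^ p)) \<le>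
    root p (integral {a..b} (\<lambda>t. u t ^ p)) + root p (integral {a..b} (\<lambda>t. v t ^ p))"
proof (rule field_le_epsilon)
  fix e :: real assume e: "e > 0"
  let ?I = "\<lambda>u. integral {a..b} (\<lambda>t. u t ^ p)"
  have p0: "0 < p" using p by simp
  have nn: "0 \<le> ?I h" if "\<And>t. t \<in> {a..b} \<Longrightarrow> t \<notin> N \<Longrightarrow> 0 \<le> h t" "(\<lambda>t. h t ^ p) integrable_on {a..b}" for h :: "real \<Rightarrow> real"
  proof -
    have "?I h = integral {a..b} (\<lambda>t. if t \<in> N then 0 else h t ^ p)"
      by (rule integral_spike[OF N]) auto
    also have "\<dots> \<ge> 0" using that(1) by (intro integral_nonneg integrable_spike[OF that(2) N]) auto
    finally show ?thesis .
  qed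
  have U0: "0 \<le> ?I u" and V0: "0 \<le> ?I v" using le int nn by blast+
  \<comment> \<open>Adding e/2 keeps the normalizing constants positive when an integral vanishes;
    the surplus e is absorbed by \<open>field_le_epsilon\<close>.\<close>
  define A where "A = root p (?I u) + e/2"
  define B where "B = root p (?I v) + e/2"
  have A: "A > 0" and B: "B > 0"
    using U0 V0 e p0 by (auto simp: A_def B_def intro!: add_nonneg_pos)
  have AU: "?I u \<le> A ^ p"
    using U0 e p0 power_mono[of "root p (?I u)" A p] by (simp add: A_def)
  have BV: "?I v \<le> B ^ p"
    using V0 e p0 power_mono[of "root p (?I v)" B p] by (simp add: B_def)
  \<comment> \<open>Weights for which (u + v) / (A + B) is a convex combination of u / A and v /
    B.\<close>
  define \<mu> where "\<mu> = A / (A + B)"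
  define \<nu> where "\<nu> = B / (A + B)"
  have \<mu>\<nu>: "0 \<le> \<mu>" "0 \<le> \<nu>" "\<mu> + \<nu> = 1"
    using A B by (auto simp: \<mu>_def \<nu>_def add_divide_distrib[symmetric])
  define R where "R t = (A + B) ^ p * (\<mu> / A ^ p * u t ^ p + \<nu> / B ^ p * v t ^ p)" for t
  have wR: "w t ^ p \<le> R t" if "t \<in> {a..b}" "t \<notin> N" for t
  proof -
    have eq: "u t + v t = (A + B) * (\<mu> * (u t / A) + \<nu> * (v t / B))"
    proof -
      have "A + B \<noteq> 0" using A B by simp
      then have "(A + B) * \<mu> = A" "(A + B) * \<nu> = B" by (simp_all add: \<mu>_def \<nu>_def)
      then have "(A + B) * (\<mu> * (u t / A) + \<nu> * (v t / B)) = A * (u t / A) + B * (v t / B)"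
        unfolding distrib_left mult.assoc[symmetric] by simp
      then show ?thesis using A B by simp
    qed
    have "w t ^ p \<le> (u t + v t) ^ p"
      using le[OF that] by (intro power_mono) auto
    also have "\<dots> = (A + B) ^ p * (\<mu> * (u t / A) + \<nu> * (v t / B)) ^ p"
      by (subst eq) (simp add: power_mult_distrib)
    also have "\<dots> \<le> (A + B) ^ p * (\<mu> * (u t / A) ^ p + \<nu> * (v t / B) ^ p)"
      using le[OF that] A B \<mu>\<nu> by (intro mult_left_mono convex_comb_power_le) auto
    finally show ?thesis by (simp add: R_def power_divide)
  qed
  have Ri: "R integrable_on {a..b}"
    unfolding R_def using int by (intro integrable_on_mult_right integrable_add) auto
  have "?I w \<le> integral {a..b} R"
  proof -
    have "?I w = integral {a..b} (\<lambda>t. if t \<in> N then R t else w t ^ p)"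
      by (rule integral_spike[OF N]) auto
    also have "\<dots> \<le> integral {a..b} R"
    proof (rule integral_le)
      show "(\<lambda>t. if t \<in> N then R t else w t ^ p) integrable_on {a..b}"
        by (rule integrable_spike[OF int(1) N]) auto
    qed (use Ri wR in auto)
    finally show ?thesis .
  qed
  also have "integral {a..b} R = (A + B) ^ p * (\<mu> / A ^ p * ?I u + \<nu> / B ^ p * ?I v)"
    unfolding R_def using int
    by (subst integral_mult_right, subst integral_add)
      (simp_all add: integrable_on_mult_right del: times_divide_eq_left)
  also have "\<dots> \<le> (A + B) ^ p * (\<mu> + \<nu>)"
  proof (intro mult_left_mono add_mono)
    show "\<mu> / A ^ p * ?I u \<le> \<mu>"
      using mult_left_mono[OF AU \<mu>\<nu>(1)] A by (simp add: field_simps)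
    show "\<nu> / B ^ p * ?I v \<le> \<nu>"
      using mult_left_mono[OF BV \<mu>\<nu>(2)] B by (simp add: field_simps)
  qed (use A B in auto)
  finally have "?I w \<le> (A + B) ^ p" by (simp add: \<mu>\<nu>)
  then have "root p (?I w) \<le> root p ((A + B) ^ p)"
    using p0 by simp
  also have "\<dots> = A + B" using A B p0 by (simp add: real_root_power_cancel)
  finally show "root p (?I w) \<le> root p (?I u) + root p (?I v) + e"
    by (simp add: A_def B_def)
qed

lemma integrable_norm_power_diff:
  fixes u v :: "real \<Rightarrow> 'v::euclidean_space"
  assumes "u \<in> borel_measurable (lebesgue_on {a..b})" "v \<in> borel_measurable (lebesgue_on {a..b})"
    and "(\<lambda>s. norm (u s) ^ p) integrable_on {a..b}" "(\<lambda>s. norm (v s) ^ p) integrable_on {a..b}"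
  shows "(\<lambda>s. norm (u s - v s) ^ p) integrable_on {a..b}"
proof (rule measurable_bounded_by_integrable_imp_integrable)
  show "(\<lambda>s. 3 ^ p * (norm (u s) ^ p + norm (v s) ^ p + 0 ^ p)) integrable_on {a..b}"
    using assms by (intro integrable_on_mult_right integrable_add) auto
  show "norm (norm (u s - v s) ^ p) \<le> 3 ^ p * (norm (u s) ^ p + norm (v s) ^ p + 0 ^ p)" for s
    using power_mono[OF norm_triangle_ineq4[of "u s" "v s"], of p] sum3_power_le[of "norm (u s)" "norm (v s)" 0 p]
    by simp
  show "(\<lambda>s. norm (u s - v s) ^ p) \<in> borel_measurable (lebesgue_on {a..b})"
    using assms(1,2) by measurable
qed auto

section \<open>Continuous functions and translations in L^p\<close>

text \<open>Truncation at height n, then a.e. approximation of the truncated function by continuous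
  ones. These are projected onto the ball of radius n, which preserves continuity and the limit and
  supplies the constant bound for dominated convergence.\<close>

lemma Lp_dense_continuous:
  fixes u :: "real \<Rightarrow> 'v::euclidean_space"
  assumes p: "1 \<le> p" and u: "u \<in> borel_measurable (lebesgue_on {a..b})"
    and int: "(\<lambda>s. norm (u s) ^ p) integrable_on {a..b}" and e: "0 < e"
  obtains c where "continuous_on UNIV c"
    "integral {a..b} (\<lambda>s. norm (u s - c s) ^ p) < e"
proof -
  have p0: "p > 0" using p by simp
  define v where "v n s = (if norm (u s) \<le> real n then u s else 0)" for n s
  have v: "v n \<in> borel_measurable (lebesgue_on {a..b})" for n
    unfolding v_def using u by measurable
  have m1: "(\<lambda>s. norm (u s - v n s) ^ p) \<in> borel_measurable (lebesgue_on {a..b})" for n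
    using u v[of n] by measurable
  have "(\<lambda>n. integral {a..b} (\<lambda>s. norm (u s - v n s) ^ p)) \<longlonglongrightarrow> integral {a..b} (\<lambda>s. 0::real)"
  proof (rule dominated_convergence_AE(2)[OF m1 int])
    show "AE s in lebesgue. s \<in> {a..b} \<longrightarrow> (\<forall>n. norm (norm (u s - v n s) ^ p) \<le> norm (u s) ^ p)"
      using p0 by (auto simp: v_def)
    show "AE s in lebesgue. s \<in> {a..b} \<longrightarrow> (\<lambda>n. norm (u s - v n s) ^ p) \<longlonglongrightarrow> 0"
    proof (intro AE_I2 impI)
      fix s
      have "eventually (\<lambda>n. norm (u s - v n s) ^ p = 0) sequentially"
        using eventually_ge_at_top[of "nat \<lceil>norm (u s)\<rceil>"]
        by eventually_elim (use p0 in \<open>simp add: v_def nat_ceiling_le_eq\<close>)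
      then show "(\<lambda>n. norm (u s - v n s) ^ p) \<longlonglongrightarrow> 0"
        by (rule tendsto_eventually)
    qed
  qed
  then have "eventually (\<lambda>n. integral {a..b} (\<lambda>s. norm (u s - v n s) ^ p) < e / (2 * 3 ^ p)) sequentially"
    using e by (intro order_tendstoD) auto
  then obtain n where n: "integral {a..b} (\<lambda>s. norm (u s - v n s) ^ p) < e / (2 * 3 ^ p)"
    by (auto simp: eventually_sequentially)
  have "v n measurable_on {a..b}"
    using v by (simp add: measurable_on_iff_borel_measurable)
  then obtain N g where N: "negligible N" and g: "\<And>k. continuous_on UNIV (g k)"
    and lim: "\<And>s. s \<notin> N \<Longrightarrow> (\<lambda>k. g k s) \<longlonglongrightarrow> (if s \<in> {a..b} then v n s else 0)"
    unfolding measurable_on_def by blast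
  define c where "c k s = closest_point (cball 0 (real n)) (g k s)" for k s
  have cp: "continuous_on UNIV (closest_point (cball (0::'v) (real n)))"
    by (rule continuous_on_closest_point) auto
  have c: "continuous_on UNIV (c k)" for k
    unfolding c_def using continuous_on_compose2[OF cp g[of k]] by auto
  have cn: "norm (c k s) \<le> real n" for k s
    using closest_point_in_set[of "cball (0::'v) (real n)" "g k s"] by (auto simp: c_def)
  have vn: "norm (v n s) \<le> real n" for s by (simp add: v_def)
  have clim: "(\<lambda>k. c k s) \<longlonglongrightarrow> v n s" if "s \<notin> N" "s \<in> {a..b}" for s
  proof -
    have "(\<lambda>k. c k s) \<longlonglongrightarrow> closest_point (cball 0 (real n)) (v n s)"
      unfolding c_def using cp lim[OF that(1)] that(2)
      by (intro isCont_tendsto_compose[where g="closest_point (cball 0 (real n))"])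
        (auto simp: continuous_on_eq_continuous_at)
    then show ?thesis using vn[of s] closest_point_self[of "v n s" "cball 0 (real n)"] by simp
  qed
  have m2: "(\<lambda>s. norm (v n s - c k s) ^ p) \<in> borel_measurable (lebesgue_on {a..b})" for k
    using v[of n] continuous_on_measurable_lebesgue_on[OF continuous_on_subset[OF c[of k]], of a b]
    by measurable
  have "(\<lambda>k. integral {a..b} (\<lambda>s. norm (v n s - c k s) ^ p)) \<longlonglongrightarrow> integral {a..b} (\<lambda>s. 0::real)"
  proof (rule dominated_convergence_AE(2)[OF m2])
    show "(\<lambda>s. (2 * real n) ^ p) integrable_on {a..b}" by (rule integrable_const_ivl)
    have "norm (v n s - c k s) \<le> 2 * real n" for k s
      using norm_triangle_ineq4[of "v n s" "c k s"] cn[of k s] vn[of s] by simp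
    then have "norm (v n s - c k s) ^ p \<le> (2 * real n) ^ p" for k s
      by (intro power_mono) auto
    then show "AE s in lebesgue. s \<in> {a..b} \<longrightarrow> (\<forall>k. norm (norm (v n s - c k s) ^ p) \<le> (2 * real n) ^ p)"
      by (intro AE_I2) (simp del: power_mult_distrib)
    show "AE s in lebesgue. s \<in> {a..b} \<longrightarrow> (\<lambda>k. norm (v n s - c k s) ^ p) \<longlonglongrightarrow> 0"
    proof (rule AE_lebesgue_negligibleI[OF N], intro impI)
      fix s assume "s \<notin> N" "s \<in> {a..b}"
      then have "(\<lambda>k. norm (v n s - c k s) ^ p) \<longlonglongrightarrow> norm (v n s - v n s) ^ p"
        by (intro tendsto_intros clim)
      moreover have "(0::real) ^ p = 0" using p0 by simp
      ultimately show "(\<lambda>k. norm (v n s - c k s) ^ p) \<longlonglongrightarrow> 0" by (simp only: diff_self norm_zero)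
    qed
  qed
  then have "eventually (\<lambda>k. integral {a..b} (\<lambda>s. norm (v n s - c k s) ^ p) < e / (2 * 3 ^ p)) sequentially"
    using e by (intro order_tendstoD) auto
  then obtain k where k: "integral {a..b} (\<lambda>s. norm (v n s - c k s) ^ p) < e / (2 * 3 ^ p)"
    by (auto simp: eventually_sequentially)
  have ck: "c k \<in> borel_measurable (lebesgue_on {a..b})"
    by (rule continuous_on_measurable_lebesgue_on[OF continuous_on_subset[OF c[of k]]]) simp
  have ip: "(\<lambda>s. norm (h s) ^ p) integrable_on {a..b}" if "\<And>s. norm (h s) \<le> real n"
    "h \<in> borel_measurable (lebesgue_on {a..b})" for h :: "real \<Rightarrow> 'v"
  proof (rule measurable_bounded_by_integrable_imp_integrable)
    show "(\<lambda>s. norm (h s) ^ p) \<in> borel_measurable (lebesgue_on {a..b})"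
      using that(2) by measurable
    show "norm (norm (h s) ^ p) \<le> real n ^ p" for s
      using power_mono[OF that(1)[of s], of p] by simp
  qed auto
  have iv: "(\<lambda>s. norm (v n s) ^ p) integrable_on {a..b}"
    using ip[of "v n"] vn v[of n] by simp
  have ic: "(\<lambda>s. norm (c k s) ^ p) integrable_on {a..b}"
    using ip[of "c k"] cn[of k] ck by simp
  note i1 = integrable_norm_power_diff[OF u v[of n] int iv]
  note i2 = integrable_norm_power_diff[OF v[of n] ck iv ic]
  note i3 = integrable_norm_power_diff[OF u ck int ic]
  have "integral {a..b} (\<lambda>s. norm (u s - c k s) ^ p)
      \<le> integral {a..b} (\<lambda>s. 3 ^ p * (norm (u s - v n s) ^ p + norm (v n s - c k s) ^ p))"
  proof (rule integral_le[OF i3])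
    show "(\<lambda>s. 3 ^ p * (norm (u s - v n s) ^ p + norm (v n s - c k s) ^ p)) integrable_on {a..b}"
      using i1 i2 by (intro integrable_on_mult_right integrable_add)
    fix s
    have "norm (u s - c k s) \<le> norm (u s - v n s) + norm (v n s - c k s) + 0"
      using norm_triangle_ineq[of "u s - v n s" "v n s - c k s"] by simp
    then have "norm (u s - c k s) ^ p \<le> (norm (u s - v n s) + norm (v n s - c k s) + 0) ^ p"
      by (intro power_mono) auto
    also have "\<dots> \<le> 3 ^ p * (norm (u s - v n s) ^ p + norm (v n s - c k s) ^ p + 0 ^ p)"
      by (intro sum3_power_le) auto
    also have "\<dots> = 3 ^ p * (norm (u s - v n s) ^ p + norm (v n s - c k s) ^ p)"
      using p0 by simp
    finally show "norm (u s - c k s) ^ p \<le> 3 ^ p * (norm (u s - v n s) ^ p + norm (v n s - c k s) ^ p)"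
      by simp
  qed
  also have "\<dots> = 3 ^ p * (integral {a..b} (\<lambda>s. norm (u s - v n s) ^ p) + integral {a..b} (\<lambda>s. norm (v n s - c k s) ^ p))"
    using integral_add[OF i1 i2] by simp
  also have "\<dots> < 3 ^ p * (e / (2 * 3 ^ p) + e / (2 * 3 ^ p))"
    using n k by (intro mult_strict_left_mono add_strict_mono) auto
  also have "\<dots> = e" by (simp add: field_simps)
  finally show ?thesis by (rule that[OF c[of k]])
qed

text \<open>Density argument: u is replaced by a continuous c, with the same error for every shift
  near t0, and c is uniformly continuous on an enlarged interval.\<close>

lemma Lp_shift_continuous:
  fixes u :: "real \<Rightarrow> 'v::euclidean_space"
  assumes p: "1 \<le> p" and u: "u \<in> borel_measurable borel"
    and int: "\<And>a b. (\<lambda>s. norm (u s) ^ p) integrable_on {a..b}" and e: "0 < e"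
  obtains \<delta> where "\<delta> > 0"
    "\<And>t. \<bar>t - t0\<bar> < \<delta> \<Longrightarrow> integral {a..b} (\<lambda>s. norm (u (s + t) - u (s + t0)) ^ p) < e"
proof -
  define L where "L = \<bar>b - a\<bar> + 1"
  have L: "L > 0" by (simp add: L_def)
  \<comment> \<open>Three error terms, each carrying the factor 3^p of
    \<open>sum3_power_le\<close>.\<close>
  define e1 where "e1 = e / (3 * 3 ^ p)"
  have e1: "e1 > 0" using e by (simp add: e1_def)
  \<comment> \<open>The margin 1 keeps {a+t..b+t} inside for every t within 1 of t0.\<close>
  let ?A = "a + t0 - 1" and ?B = "b + t0 + 1"
  obtain c where c: "continuous_on UNIV c" and ce: "integral {?A..?B} (\<lambda>s. norm (u s - c s) ^ p) < e1"
    by (rule Lp_dense_continuous[OF p borel_measurable_lebesgue_on[OF u] int e1])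
  have cm: "c \<in> borel_measurable borel" using c by (rule borel_measurable_continuous_onI)
  have ci: "(\<lambda>s. norm (c s) ^ p) integrable_on {x..y}" for x y
    by (intro integrable_continuous_real continuous_intros continuous_on_subset[OF c]) auto
  \<comment> \<open>r \<le> 1 gives r^p \<le> r, hence r^p \<le> e1 / L.\<close>
  define r where "r = min 1 (e1 / L)"
  have r: "r > 0" using e1 L by (simp add: r_def)
  have rp: "r ^ p \<le> e1 / L"
    using p r self_le_power power_decreasing[of 1 p r] by (auto simp: r_def)
  have "uniformly_continuous_on {?A..?B} c"
    by (intro compact_uniformly_continuous continuous_on_subset[OF c]) auto
  then obtain \<delta> where \<delta>: "\<delta> > 0" "\<And>x y. x \<in> {?A..?B} \<Longrightarrow> y \<in> {?A..?B} \<Longrightarrow> dist x y < \<delta> \<Longrightarrow> dist (c x) (c y) < r"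
    unfolding uniformly_continuous_on_def using r by (meson dist_commute)
  show ?thesis
  proof (rule that[of "min \<delta> 1"])
    show "min \<delta> 1 > 0" using \<delta> by simp
    fix t assume t: "\<bar>t - t0\<bar> < min \<delta> 1"
    let ?x = "\<lambda>s. norm (u (s + t) - c (s + t))"
    let ?y = "\<lambda>s. norm (c (s + t) - c (s + t0))"
    let ?z = "\<lambda>s. norm (u (s + t0) - c (s + t0))"
    have iuc: "(\<lambda>s. norm (u s - c s) ^ p) integrable_on {x..y}" for x y
      by (intro integrable_norm_power_diff borel_measurable_lebesgue_on u cm int ci)
    have shi: "(\<lambda>s. norm (u (s + t') - c (s + t')) ^ p) integrable_on {a..b}" for t'
      using iuc integrable_shift_real[of "\<lambda>s. norm (u s - c s) ^ p" t'] by simp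
    have shI: "integral {a..b} (\<lambda>s. norm (u (s + t') - c (s + t')) ^ p) < e1" if "\<bar>t' - t0\<bar> \<le> 1" for t'
    proof -
      have "integral {a..b} (\<lambda>s. norm (u (s + t') - c (s + t')) ^ p) = integral {a+t'..b+t'} (\<lambda>s. norm (u s - c s) ^ p)"
        using integral_shift_real[of a b "\<lambda>s. norm (u s - c s) ^ p" t'] by simp
      also have "\<dots> \<le> integral {?A..?B} (\<lambda>s. norm (u s - c s) ^ p)"
        using that by (intro integral_subset_le iuc) auto
      finally show ?thesis using ce by simp
    qed
    have yi: "(\<lambda>s. ?y s ^ p) integrable_on {a..b}"
      by (intro integrable_continuous_real continuous_intros continuous_on_compose2[OF c]) auto
    have yb: "?y s ^ p \<le> e1 / L" if "s \<in> {a..b}" for s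
    proof -
      have "?y s \<le> r"
      proof -
        have "s + t \<in> {?A..?B}" "s + t0 \<in> {?A..?B}" "dist (s + t) (s + t0) < \<delta>"
          using that t by (auto simp: dist_real_def abs_if split: if_splits)
        from \<delta>(2)[OF this] show ?thesis by (simp add: dist_norm)
      qed
      then have "?y s ^ p \<le> r ^ p" by (intro power_mono) auto
      with rp show ?thesis by simp
    qed
    have yI: "integral {a..b} (\<lambda>s. ?y s ^ p) \<le> e1"
    proof (cases "a \<le> b")
      case True
      have "integral {a..b} (\<lambda>s. ?y s ^ p) \<le> integral {a..b} (\<lambda>s. e1 / L)"
        using yb by (intro integral_le yi) auto
      also have "\<dots> = (b - a) * (e1 / L)" using True by simp
      also have "\<dots> \<le> L * (e1 / L)" using e1 L by (intro mult_right_mono) (auto simp: L_def)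
      finally show ?thesis using L by simp
    qed (use e1 in simp)
    have sm: "(\<lambda>s. u (s + t')) \<in> borel_measurable borel" for t' using u by measurable
    have si: "(\<lambda>s. norm (u (s + t')) ^ p) integrable_on {a..b}" for t'
      using int integrable_shift_real[of "\<lambda>s. norm (u s) ^ p" t'] by simp
    have "integral {a..b} (\<lambda>s. norm (u (s + t) - u (s + t0)) ^ p)
        \<le> integral {a..b} (\<lambda>s. 3 ^ p * (?x s ^ p + ?y s ^ p + ?z s ^ p))"
    proof (rule integral_le)
      show "(\<lambda>s. norm (u (s + t) - u (s + t0)) ^ p) integrable_on {a..b}"
        by (intro integrable_norm_power_diff borel_measurable_lebesgue_on sm si)
      show "(\<lambda>s. 3 ^ p * (?x s ^ p + ?y s ^ p + ?z s ^ p)) integrable_on {a..b}"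
        using shi yi by (intro integrable_on_mult_right integrable_add)
      fix s
      have "norm (u (s + t) - u (s + t0)) \<le> ?x s + ?y s + ?z s"
        using norm_triangle_ineq[of "u (s + t) - c (s + t)" "c (s + t) - u (s + t0)"]
          norm_triangle_ineq[of "c (s + t) - c (s + t0)" "c (s + t0) - u (s + t0)"]
        by (simp add: norm_minus_commute)
      then have "norm (u (s + t) - u (s + t0)) ^ p \<le> (?x s + ?y s + ?z s) ^ p"
        by (intro power_mono) auto
      also have "\<dots> \<le> 3 ^ p * (?x s ^ p + ?y s ^ p + ?z s ^ p)"
        by (intro sum3_power_le) auto
      finally show "norm (u (s + t) - u (s + t0)) ^ p \<le> 3 ^ p * (?x s ^ p + ?y s ^ p + ?z s ^ p)" .
    qed
    also have "\<dots> = 3 ^ p * (integral {a..b} (\<lambda>s. ?x s ^ p) + integral {a..b} (\<lambda>s. ?y s ^ p) + integral {a..b} (\<lambda>s. ?z s ^ p))"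
      using shi yi by (simp add: integral_add integrable_add)
    also have "\<dots> < 3 ^ p * (e1 + e1 + e1)"
      using shI[of t] shI[of t0] yI t by (intro mult_strict_left_mono) auto
    also have "\<dots> = e" by (simp add: e1_def)
    finally show "integral {a..b} (\<lambda>s. norm (u (s + t) - u (s + t0)) ^ p) < e" .
  qed
qed

text \<open>For a merely integrable kernel the interval is cut into pieces on which the kernel has
  integral at most \<open>1/2\<close>, and the bound is propagated from piece to piece.\<close>

lemma Gronwall_increments:
  fixes l :: "real \<Rightarrow> real"
  assumes T: "0 \<le> T" and l: "l integrable_on {0..T}" and l0: "\<And>s. 0 \<le> l s"
  shows "\<exists>A\<ge>1. \<forall>T' u e. T' \<le> T \<longrightarrow> continuous_on {0..T'} u \<longrightarrow> 0 \<le> e \<longrightarrow> u 0 \<le> e \<longrightarrow>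
      (\<forall>\<tau> t M. 0 \<le> \<tau> \<longrightarrow> \<tau> \<le> t \<longrightarrow> t \<le> T' \<longrightarrow> e \<le> M \<longrightarrow> (\<forall>s\<in>{0..t}. u s \<le> M) \<longrightarrow>
          u t \<le> u \<tau> + e + M * integral {\<tau>..t} l) \<longrightarrow>
      (\<forall>t\<in>{0..T'}. u t \<le> A * (e::real))"
proof -
  have uc: "uniformly_continuous_on {0..T} (\<lambda>t. integral {0..t} l)"
    by (intro compact_uniformly_continuous indefinite_integral_continuous_1 l) auto
  then obtain \<delta> where \<delta>: "\<delta> > 0"
    "\<And>s t. s \<in> {0..T} \<Longrightarrow> t \<in> {0..T} \<Longrightarrow> dist s t < \<delta> \<Longrightarrow> dist (integral {0..s} l) (integral {0..t} l) < 1/2"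
    using uc[unfolded uniformly_continuous_on_def, rule_format, of "1/2"] by (auto simp: dist_commute)
  have small: "integral {s..t} l \<le> 1/2" if "0 \<le> s" "s \<le> t" "t \<le> T" "t - s < \<delta>" for s t
  proof -
    have "integral {0..s} l + integral {s..t} l = integral {0..t} l"
      using that by (intro Henstock_Kurzweil_Integration.integral_combine integrable_on_subinterval[OF l]) auto
    moreover have "\<bar>integral {0..t} l - integral {0..s} l\<bar> < 1/2"
      using \<delta>(2)[of t s] that by (auto simp: dist_real_def)
    ultimately show ?thesis by linarith
  qed
  define d where "d = \<delta>/2"
  have d: "0 < d" "d < \<delta>" using \<delta> by (auto simp: d_def)
  \<comment> \<open>Growth of the constant over one piece: U \<le> a e + e + max U e / 2 implies U
    \<le> (2 a + 3) e, whichever of U and e is larger.\<close>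
  define aa where "aa = rec_nat (1::real) (\<lambda>_ a. 2 * a + 3)"
  have aa: "aa 0 = 1" "\<And>n. aa (Suc n) = 2 * aa n + 3" by (auto simp: aa_def)
  have aa1: "aa n \<ge> 1" for n by (induction n) (auto simp: aa)
  have step: "u t \<le> aa n * e"
    if u: "continuous_on {0..T'} u" and T': "T' \<le> T" and e: "0 \<le> e" "u 0 \<le> e"
    and inc: "\<And>\<tau> t M. 0 \<le> \<tau> \<Longrightarrow> \<tau> \<le> t \<Longrightarrow> t \<le> T' \<Longrightarrow> e \<le> M \<Longrightarrow> (\<forall>s\<in>{0..t}. u s \<le> M) \<Longrightarrow>
          u t \<le> u \<tau> + e + M * integral {\<tau>..t} l"
    and t: "t \<in> {0..T'}" "t \<le> real n * d" for u :: "real \<Rightarrow> real" and T' e t n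
    using t
  proof (induction n arbitrary: t)
    case 0
    then show ?case using e by (simp add: aa)
  next
    case (Suc n)
    have "continuous_on {0..t} u" using u Suc.prems by (auto intro: continuous_on_subset)
    \<comment> \<open>The increment inequality refers to a bound M for u on the whole past. At the
      maximum point m of u on {0..t} this bound is u m itself (or e), so the inequality closes and
      can be solved for u m.\<close>
    then obtain m where m: "m \<in> {0..t}" "\<And>s. s \<in> {0..t} \<Longrightarrow> u s \<le> u m"
      using continuous_attains_sup[of "{0..t}" u] Suc.prems by auto
    show ?case
    proof (cases "m \<le> real n * d")
      case True
      have "u t \<le> u m" using m Suc.prems by auto
      also have "\<dots> \<le> aa n * e" using Suc.IH[of m] m True Suc.prems by auto
      also have "\<dots> \<le> aa (Suc n) * e" using aa1[of n] e by (intro mult_right_mono) (auto simp: aa)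
      finally show ?thesis .
    next
      case False
      define \<tau> where "\<tau> = real n * d"
      have \<tau>: "0 \<le> \<tau>" "\<tau> \<le> m" "m - \<tau> < \<delta>" using False d Suc.prems m by (auto simp: \<tau>_def algebra_simps)
      have "u \<tau> \<le> aa n * e" using Suc.IH[of \<tau>] \<tau> m Suc.prems by (auto simp: \<tau>_def)
      moreover have "integral {\<tau>..m} l \<le> 1/2" using small[of \<tau> m] \<tau> m Suc.prems T' by auto
      then have "max (u m) e * integral {\<tau>..m} l \<le> max (u m) e * (1/2)"
        using e by (intro mult_left_mono) auto
      moreover have "u m \<le> u \<tau> + e + max (u m) e * integral {\<tau>..m} l"
        using \<tau> m Suc.prems by (intro inc) (auto simp: le_max_iff_disj)
      ultimately have "u m \<le> aa n * e + e + max (u m) e / 2" by linarith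
      moreover have "aa n * e \<ge> 0" using aa1[of n] e by (intro mult_nonneg_nonneg) auto
      ultimately have "u m \<le> 2 * (aa n * e) + 3 * e" using e by (auto simp: max_def split: if_splits)
      moreover have "u t \<le> u m" using m Suc.prems by auto
      ultimately show ?thesis by (simp add: aa algebra_simps)
    qed
  qed
  obtain n where n: "T \<le> real n * d"
    using real_arch_simple[of "T / d"] d by (auto simp: field_simps)
  show ?thesis
  proof (intro exI[of _ "aa n"] conjI allI impI ballI, rule aa1)
    fix T' u e t
    assume *: "T' \<le> T" "continuous_on {0..T'} u" "0 \<le> e" "u 0 \<le> e"
      "\<forall>\<tau> t M. 0 \<le> \<tau> \<longrightarrow> \<tau> \<le> t \<longrightarrow> t \<le> T' \<longrightarrow> e \<le> M \<longrightarrow> (\<forall>s\<in>{0..t}. u s \<le> M) \<longrightarrow>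
          u t \<le> u \<tau> + e + M * integral {\<tau>..t} l"
      "t \<in> {0..T'}"
    show "u t \<le> aa n * (e::real)"
      by (rule step[OF *(2,1,3,4) *(5)[rule_format] *(6)]) (use n * in auto)
  qed
qed

section \<open>Caratheodory functions and their classes\<close>

lemma measurable_translation_lebesgue:
  fixes h :: "real \<Rightarrow> real"
  assumes "h \<in> borel_measurable lebesgue"
  shows "(\<lambda>s. h (s + t)) \<in> borel_measurable lebesgue"
proof -
  have "(\<lambda>s. s + t) \<in> lebesgue \<rightarrow>\<^sub>M (lebesgue :: real measure)"
    using lebesgue_affine_measurable[where c="\<lambda>x::real. 1" and t=t] by (simp add: add.commute)
  then show ?thesis using assms by (rule measurable_compose)
qed

lemma Lp_loc_iff:
  "h \<in> Lp_loc p \<longleftrightarrow> h \<in> borel_measurable lebesgue \<and> (\<forall>a b. (\<lambda>t. \<bar>h t\<bar> ^ p) integrable_on {a..b})"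
proof -
  have "set_integrable lebesgue {a..b} (\<lambda>t. \<bar>h t\<bar> ^ p) \<longleftrightarrow> (\<lambda>t. \<bar>h t\<bar> ^ p) integrable_on {a..b}" for a b
    using absolutely_integrable_on_iff_nonneg[of "{a..b}" "\<lambda>t. \<bar>h t\<bar> ^ p"] by simp
  then show ?thesis by (simp add: Lp_loc_def)
qed

lemma Lp_locI_bound:
  assumes "h \<in> borel_measurable lebesgue" and "\<And>a b. k integrable_on {a..b}" and "\<And>t. \<bar>h t\<bar> ^ p \<le> k t"
  shows "h \<in> Lp_loc p"
  unfolding Lp_loc_iff
proof (intro conjI allI)
  fix a b
  have "h \<in> borel_measurable (lebesgue_on {a..b})"
    using assms(1) by (rule measurable_restrict_space1)
  then have "(\<lambda>t. \<bar>h t\<bar> ^ p) \<in> borel_measurable (lebesgue_on {a..b})" by measurable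
  then show "(\<lambda>t. \<bar>h t\<bar> ^ p) integrable_on {a..b}"
    by (rule measurable_bounded_by_integrable_imp_integrable[OF _ assms(2)]) (use assms(3) in auto)
qed (fact assms(1))

lemma Lp_loc_add:
  assumes "h \<in> Lp_loc p" "k \<in> Lp_loc p"
  shows "(\<lambda>t. \<bar>h t\<bar> + \<bar>k t\<bar>) \<in> Lp_loc p"
proof (rule Lp_locI_bound)
  show "(\<lambda>t. \<bar>h t\<bar> + \<bar>k t\<bar>) \<in> borel_measurable lebesgue"
  proof -
    have "h \<in> borel_measurable lebesgue" "k \<in> borel_measurable lebesgue"
      using assms by (auto simp: Lp_loc_iff)
    then show ?thesis by measurable
  qed
  show "(\<lambda>t. 3 ^ p * (\<bar>h t\<bar> ^ p + \<bar>k t\<bar> ^ p + 0 ^ p)) integrable_on {a..b}" for a b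
    using assms unfolding Lp_loc_iff by (intro integrable_on_mult_right integrable_add) auto
  show "\<bar>\<bar>h t\<bar> + \<bar>k t\<bar>\<bar> ^ p \<le> 3 ^ p * (\<bar>h t\<bar> ^ p + \<bar>k t\<bar> ^ p + 0 ^ p)" for t
    using sum3_power_le[of "\<bar>h t\<bar>" "\<bar>k t\<bar>" 0 p] by simp
qed

lemma le_one_plus_power:
  fixes x :: real assumes "0 \<le> x" "1 \<le> p" shows "x \<le> 1 + x ^ p"
proof (cases "x \<le> 1")
  case True then show ?thesis using assms by (smt (verit) zero_le_power)
next
  case False
  then have "x ^ 1 \<le> x ^ p" using assms by (intro power_increasing) auto
  then show ?thesis by simp
qed

lemma Lp_loc_mono:
  assumes "1 \<le> p" "h \<in> Lp_loc p" shows "h \<in> Lp_loc 1"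
proof (rule Lp_locI_bound)
  show "(\<lambda>t. 1 + \<bar>h t\<bar> ^ p) integrable_on {a..b}" for a b
    using assms unfolding Lp_loc_iff by (intro integrable_add) auto
  show "\<bar>h t\<bar> ^ 1 \<le> 1 + \<bar>h t\<bar> ^ p" for t
    using le_one_plus_power[of "\<bar>h t\<bar>" p] assms by simp
qed (use assms in \<open>simp add: Lp_loc_iff\<close>)

lemma Lp_loc_shift:
  assumes "h \<in> Lp_loc p" shows "(\<lambda>s. h (s + t)) \<in> Lp_loc p"
  using assms measurable_translation_lebesgue[of h t] integrable_shift_real[of "\<lambda>s. \<bar>h s\<bar> ^ p" t]
  unfolding Lp_loc_iff by simp

lemma AE_lebesgue_shift:
  assumes "AE t in lebesgue. P t" shows "AE s in lebesgue. P (s + (c::real))"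
proof -
  obtain N where N: "negligible N" "\<And>t. t \<notin> N \<Longrightarrow> P t"
    using assms by (rule AE_lebesgue_negligibleD) blast
  have "negligible ((+) (-c) ` N)" by (rule negligible_translation[OF N(1)])
  then show ?thesis
  proof (rule AE_lebesgue_negligibleI)
    fix s assume "s \<notin> (+) (-c) ` N"
    then have "s + c \<notin> N" by (auto simp: image_iff)
    then show "P (s + c)" by (rule N(2))
  qed
qed

lemma LC_measurable: "g \<in> LC p \<Longrightarrow> (\<lambda>(t, z). g t z) \<in> borel_measurable borel"
  by (simp add: LC_def)

text \<open>Absolute values make the bounds nonnegative at every time, and one null set N serves
  both estimates and all states of the ball, as is required for estimates along curves.\<close>

lemma LC_bounds:
  fixes g :: "('v::euclidean_space) delay_field"
  assumes "g \<in> LC p"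
  obtains m l N where "m \<in> Lp_loc p" "l \<in> Lp_loc p" "negligible N" "\<And>t. 0 \<le> m t" "\<And>t. 0 \<le> l t"
    "\<And>a b. (\<lambda>t. m t ^ p) integrable_on {a..b}" "\<And>a b. (\<lambda>t. l t ^ p) integrable_on {a..b}"
    "\<And>t z. t \<notin> N \<Longrightarrow> norm z \<le> R \<Longrightarrow> norm (g t z) \<le> m t"
    "\<And>t z1 z2. t \<notin> N \<Longrightarrow> norm z1 \<le> R \<Longrightarrow> norm z2 \<le> R \<Longrightarrow> norm (g t z1 - g t z2) \<le> l t * norm (z1 - z2)"
proof -
  have "compact (cball (0::'v \<times> 'v) R)" by simp
  with assms obtain m l where ml: "m \<in> Lp_loc p" "l \<in> Lp_loc p"
    "AE t in lebesgue. (\<forall>z\<in>cball 0 R. norm (g t z) \<le> m t) \<and>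
        (\<forall>z1\<in>cball 0 R. \<forall>z2\<in>cball 0 R. norm (g t z1 - g t z2) \<le> l t * norm (z1 - z2))"
    unfolding LC_def by blast
  obtain N where N: "negligible N" "\<And>t. t \<notin> N \<Longrightarrow> (\<forall>z\<in>cball 0 R. norm (g t z) \<le> m t) \<and>
        (\<forall>z1\<in>cball 0 R. \<forall>z2\<in>cball 0 R. norm (g t z1 - g t z2) \<le> l t * norm (z1 - z2))"
    using ml(3) by (rule AE_lebesgue_negligibleD) blast
  show ?thesis
  proof (rule that[of "\<lambda>t. \<bar>m t\<bar>" "\<lambda>t. \<bar>l t\<bar>" N])
    show "(\<lambda>t. \<bar>m t\<bar>) \<in> Lp_loc p" "(\<lambda>t. \<bar>l t\<bar>) \<in> Lp_loc p"
      using ml(1,2) unfolding Lp_loc_iff by auto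
    show "(\<lambda>t. \<bar>m t\<bar> ^ p) integrable_on {a..b}" "(\<lambda>t. \<bar>l t\<bar> ^ p) integrable_on {a..b}" for a b
      using ml(1,2) unfolding Lp_loc_iff by auto
    show "norm (g t z) \<le> \<bar>m t\<bar>" if "t \<notin> N" "norm z \<le> R" for t z
      using N(2)[OF that(1)] that(2) by force
    show "norm (g t z1 - g t z2) \<le> \<bar>l t\<bar> * norm (z1 - z2)" if "t \<notin> N" "norm z1 \<le> R" "norm z2 \<le> R" for t z1 z2
    proof -
      have "norm (g t z1 - g t z2) \<le> l t * norm (z1 - z2)"
        using N(2)[OF that(1)] that(2,3) by simp
      also have "\<dots> \<le> \<bar>l t\<bar> * norm (z1 - z2)" by (intro mult_right_mono) auto
      finally show ?thesis .
    qed
  qed (use N in auto)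
qed

lemma LC_I:
  assumes "(\<lambda>(t, z). g t z) \<in> borel_measurable borel"
    and "\<And>R. \<exists>m\<in>Lp_loc p. \<exists>l\<in>Lp_loc p. AE t in lebesgue.
        (\<forall>z\<in>cball 0 R. norm (g t z) \<le> m t) \<and>
        (\<forall>z1\<in>cball 0 R. \<forall>z2\<in>cball 0 R. norm (g t z1 - g t z2) \<le> l t * norm (z1 - z2))"
  shows "g \<in> LC p"
  unfolding LC_def
proof (intro CollectI conjI allI impI)
  fix K :: "('a \<times> 'a) set" assume "compact K"
  then obtain R where R: "K \<subseteq> cball 0 R"
    using compact_imp_bounded[of K] unfolding bounded_iff by (auto simp: subset_iff)
  obtain m l where ml: "m\<in>Lp_loc p" "l\<in>Lp_loc p" "AE t in lebesgue.
        (\<forall>z\<in>cball 0 R. norm (g t z) \<le> m t) \<and>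
        (\<forall>z1\<in>cball 0 R. \<forall>z2\<in>cball 0 R. norm (g t z1 - g t z2) \<le> l t * norm (z1 - z2))"
    using assms(2) by blast
  have "AE t in lebesgue. (\<forall>z\<in>K. norm (g t z) \<le> m t) \<and>
        (\<forall>z1\<in>K. \<forall>z2\<in>K. norm (g t z1 - g t z2) \<le> l t * norm (z1 - z2))"
    by (rule eventually_mono[OF ml(3)]) (use R in blast)
  with ml show "\<exists>m\<in>Lp_loc p. \<exists>l\<in>Lp_loc p. AE t in lebesgue. (\<forall>z\<in>K. norm (g t z) \<le> m t) \<and>
        (\<forall>z1\<in>K. \<forall>z2\<in>K. norm (g t z1 - g t z2) \<le> l t * norm (z1 - z2))" by blast
qed (fact assms(1))

lemma LC_mono:
  assumes "1 \<le> p" "g \<in> LC p" shows "g \<in> LC 1"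
  using assms(2) Lp_loc_mono[OF assms(1)] unfolding LC_def by blast

lemma LC_translate:
  fixes g :: "('v::euclidean_space) delay_field"
  assumes "g \<in> LC p" shows "translate t g \<in> LC p"
proof (rule LC_I)
  have "(\<lambda>(s, z). (s + t, z)) \<in> borel_measurable (borel :: (real \<times> 'v \<times> 'v) measure)"
    by (intro borel_measurable_continuous_onI) (auto simp: split_def intro!: continuous_intros)
  from measurable_compose[OF this LC_measurable[OF assms]]
  show "(\<lambda>(s, z). translate t g s z) \<in> borel_measurable borel"
    by (simp add: translate_def split_def)
  fix R
  obtain m l N where *: "m \<in> Lp_loc p" "l \<in> Lp_loc p" "negligible N" "\<And>t. 0 \<le> m t" "\<And>t. 0 \<le> l t"
    "\<And>t z. t \<notin> N \<Longrightarrow> norm z \<le> R \<Longrightarrow> norm (g t z) \<le> m t"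
    "\<And>t z1 z2. t \<notin> N \<Longrightarrow> norm z1 \<le> R \<Longrightarrow> norm z2 \<le> R \<Longrightarrow> norm (g t z1 - g t z2) \<le> l t * norm (z1 - z2)"
    by (rule LC_bounds[OF assms, of R]) blast
  have "AE t in lebesgue. (\<forall>z\<in>cball 0 R. norm (g t z) \<le> m t) \<and>
        (\<forall>z1\<in>cball 0 R. \<forall>z2\<in>cball 0 R. norm (g t z1 - g t z2) \<le> l t * norm (z1 - z2))"
    by (rule AE_lebesgue_negligibleI[OF *(3)]) (use *(6,7) in auto)
  from AE_lebesgue_shift[OF this, of t]
  show "\<exists>m\<in>Lp_loc p. \<exists>l\<in>Lp_loc p. AE s in lebesgue. (\<forall>z\<in>cball 0 R. norm (translate t g s z) \<le> m s) \<and>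
        (\<forall>z1\<in>cball 0 R. \<forall>z2\<in>cball 0 R. norm (translate t g s z1 - translate t g s z2) \<le> l s * norm (z1 - z2))"
    unfolding translate_def
    by (intro bexI[OF _ Lp_loc_shift[OF *(1), of t]] bexI[OF _ Lp_loc_shift[OF *(2), of t]])
qed

lemma LC_diff:
  fixes g h :: "('v::euclidean_space) delay_field"
  assumes "g \<in> LC p" "h \<in> LC p" shows "g - h \<in> LC p"
proof (rule LC_I)
  show "(\<lambda>(s, z). (g - h) s z) \<in> borel_measurable borel"
    using borel_measurable_diff[OF LC_measurable[OF assms(1)] LC_measurable[OF assms(2)]]
    by (simp add: split_def)
  fix R
  obtain m l N where *: "m \<in> Lp_loc p" "l \<in> Lp_loc p" "negligible N" "\<And>t. 0 \<le> m t" "\<And>t. 0 \<le> l t"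
    "\<And>t z. t \<notin> N \<Longrightarrow> norm z \<le> R \<Longrightarrow> norm (g t z) \<le> m t"
    "\<And>t z1 z2. t \<notin> N \<Longrightarrow> norm z1 \<le> R \<Longrightarrow> norm z2 \<le> R \<Longrightarrow> norm (g t z1 - g t z2) \<le> l t * norm (z1 - z2)"
    by (rule LC_bounds[OF assms(1), of R]) blast
  obtain m' l' N' where **: "m' \<in> Lp_loc p" "l' \<in> Lp_loc p" "negligible N'" "\<And>t. 0 \<le> m' t" "\<And>t. 0 \<le> l' t"
    "\<And>t z. t \<notin> N' \<Longrightarrow> norm z \<le> R \<Longrightarrow> norm (h t z) \<le> m' t"
    "\<And>t z1 z2. t \<notin> N' \<Longrightarrow> norm z1 \<le> R \<Longrightarrow> norm z2 \<le> R \<Longrightarrow> norm (h t z1 - h t z2) \<le> l' t * norm (z1 - z2)"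
    by (rule LC_bounds[OF assms(2), of R]) blast
  have "AE t in lebesgue. (\<forall>z\<in>cball (0::'v \<times> 'v) R. norm ((g - h) t z) \<le> \<bar>m t\<bar> + \<bar>m' t\<bar>) \<and>
      (\<forall>z1\<in>cball (0::'v \<times> 'v) R. \<forall>z2\<in>cball (0::'v \<times> 'v) R. norm ((g - h) t z1 - (g - h) t z2) \<le> (\<bar>l t\<bar> + \<bar>l' t\<bar>) * norm (z1 - z2))"
  proof (rule AE_lebesgue_negligibleI[OF negligible_Un[OF *(3) **(3)]], intro conjI ballI)
    fix t and z :: "'v \<times> 'v" assume "t \<notin> N \<union> N'" "z \<in> cball 0 R"
    then have "norm (g t z) \<le> m t" "norm (h t z) \<le> m' t" using * ** by auto
    then show "norm ((g - h) t z) \<le> \<bar>m t\<bar> + \<bar>m' t\<bar>"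
      using norm_triangle_ineq4[of "g t z" "h t z"] by simp
  next
    fix t and z1 z2 :: "'v \<times> 'v" assume "t \<notin> N \<union> N'" "z1 \<in> cball 0 R" "z2 \<in> cball 0 R"
    then have "norm (g t z1 - g t z2) \<le> l t * norm (z1 - z2)" "norm (h t z1 - h t z2) \<le> l' t * norm (z1 - z2)"
      using * ** by auto
    then show "norm ((g - h) t z1 - (g - h) t z2) \<le> (\<bar>l t\<bar> + \<bar>l' t\<bar>) * norm (z1 - z2)"
      using norm_triangle_ineq4[of "g t z1 - g t z2" "h t z1 - h t z2"] *(5)[of t] **(5)[of t]
      by (simp add: algebra_simps)
  qed
  then show "\<exists>m\<in>Lp_loc p. \<exists>l\<in>Lp_loc p. AE t in lebesgue. (\<forall>z\<in>cball (0::'v \<times> 'v) R. norm ((g - h) t z) \<le> m t) \<and>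
      (\<forall>z1\<in>cball 0 R. \<forall>z2\<in>cball 0 R. norm ((g - h) t z1 - (g - h) t z2) \<le> l t * norm (z1 - z2))"
    using Lp_loc_add[OF *(1) **(1)] Lp_loc_add[OF *(2) **(2)] by (intro bexI)
qed

text \<open>The pair (s, z s) is only Lebesgue measurable in s; joint Borel measurability of g is
  what makes the composition measurable.\<close>

lemma LC_comp_measurable:
  fixes g :: "('v::euclidean_space) delay_field"
  assumes g: "g \<in> LC p" and z: "z \<in> borel_measurable (lebesgue_on S)"
  shows "(\<lambda>s. g s (z s)) \<in> borel_measurable (lebesgue_on S)"
proof -
  have "(\<lambda>s. (s, z s)) \<in> borel_measurable (lebesgue_on S)"
    using z borel_measurable_lebesgue_on[of "\<lambda>s. s" S] by (intro borel_measurable_Pair) auto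
  from measurable_compose[OF this LC_measurable[OF g]] show ?thesis by simp
qed

lemma LC_comp_power_integrable:
  fixes g :: "('v::euclidean_space) delay_field"
  assumes g: "g \<in> LC p" and z: "z \<in> borel_measurable (lebesgue_on {a..b})"
    and R: "\<And>s. s \<in> {a..b} \<Longrightarrow> norm (z s) \<le> R"
  shows "(\<lambda>s. norm (g s (z s)) ^ p) integrable_on {a..b}"
proof -
  obtain m l N where *: "negligible N" "\<And>t. 0 \<le> m t"
    "\<And>a b. (\<lambda>t. m t ^ p) integrable_on {a..b}"
    "\<And>t z. t \<notin> N \<Longrightarrow> norm z \<le> R \<Longrightarrow> norm (g t z) \<le> m t"
    by (rule LC_bounds[OF g, of R]) blast
  have m: "(\<lambda>s. norm (g s (z s)) ^ p) \<in> borel_measurable (lebesgue_on {a..b})"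
    using LC_comp_measurable[OF g z] by measurable
  have "AE t in lebesgue. t \<in> {a..b} \<longrightarrow> norm (norm (g t (z t)) ^ p) \<le> m t ^ p"
  proof (rule AE_lebesgue_negligibleI[OF *(1)], rule impI)
    fix t assume t: "t \<notin> N" "t \<in> {a..b}"
    show "norm (norm (g t (z t)) ^ p) \<le> m t ^ p"
      using power_mono[OF *(4)[OF t(1) R[OF t(2)]], of p] by simp
  qed
  from integrable_dominated_AE(1)[OF m *(3) this] show ?thesis
    by (simp add: absolutely_integrable_on_def)
qed

lemma LC_comp_integrable:
  fixes g :: "('v::euclidean_space) delay_field"
  assumes g: "g \<in> LC 1" and z: "z \<in> borel_measurable (lebesgue_on {a..b})"
    and R: "\<And>s. s \<in> {a..b} \<Longrightarrow> norm (z s) \<le> R"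
  shows "(\<lambda>s. g s (z s)) absolutely_integrable_on {a..b}"
proof (rule integrable_dominated_AE(1))
  show "(\<lambda>s. norm (g s (z s)) ^ 1) integrable_on {a..b}"
    by (rule LC_comp_power_integrable[OF assms])
qed (use LC_comp_measurable[OF g z] in auto)

lemma LC_comp_continuous_integrable:
  fixes g :: "('v::euclidean_space) delay_field"
  assumes g: "g \<in> LC 1" and z: "continuous_on {a..b} z"
  shows "(\<lambda>s. g s (z s)) absolutely_integrable_on {a..b}"
proof -
  have "bounded (z ` {a..b})"
    using z by (intro compact_imp_bounded compact_continuous_image) auto
  then obtain R where "\<And>s. s \<in> {a..b} \<Longrightarrow> norm (z s) \<le> R"
    unfolding bounded_iff by blast
  then show ?thesis
    by (rule LC_comp_integrable[OF g continuous_on_measurable_lebesgue_on[OF z]])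
qed

section \<open>Equality almost everywhere, classes and their translates\<close>

text \<open>For almost every time, equality in all states at once: the exceptional times do not
  depend on the state, so equality persists along every curve.\<close>

definition ae_eq :: "('v::euclidean_space) delay_field \<Rightarrow> 'v delay_field \<Rightarrow> bool" where
  "ae_eq g h \<longleftrightarrow> (AE t in lebesgue. \<forall>z. g t z = h t z)"

lemma negligible_lborel_iff:
  "S \<in> sets borel \<Longrightarrow> negligible S \<longleftrightarrow> (AE x in lborel. x \<notin> S)"
  by (simp add: negligible_iff_null_sets null_sets_completion_iff AE_iff_null_sets AE_completion_iff)

text \<open>By Fubini, almost every time section of the exceptional set is null; by local Lipschitz
  continuity in the state it is then empty.\<close>

lemma ae_rel_iff:
  fixes g h :: "('v::euclidean_space) delay_field"
  shows "(g, h) \<in> ae_rel p \<longleftrightarrow> g \<in> LC p \<and> h \<in> LC p \<and> ae_eq g h"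
proof (cases "g \<in> LC p \<and> h \<in> LC p")
  case False
  then show ?thesis by (auto simp: ae_rel_def)
next
  case True
  then have g: "g \<in> LC p" and h: "h \<in> LC p" by auto
  let ?S = "{(t, z). g t z \<noteq> h t z}"
  have "{x \<in> space borel. (\<lambda>(t, z). g t z) x \<noteq> (\<lambda>(t, z). h t z) x} \<in> sets borel"
    using LC_measurable[OF g] LC_measurable[OF h] by measurable
  then have S: "?S \<in> sets borel" by (simp add: split_def)
  have S': "{x \<in> space (lborel \<Otimes>\<^sub>M lborel). g (fst x) (snd x) = h (fst x) (snd x)} \<in> sets (lborel \<Otimes>\<^sub>M lborel)"
  proof -
    have "{x \<in> space borel. (\<lambda>(t, z). g t z) x = (\<lambda>(t, z). h t z) x} \<in> sets borel"
      using LC_measurable[OF g] LC_measurable[OF h] by measurable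
    then show ?thesis unfolding lborel_prod by (simp add: split_def)
  qed
  have "negligible ?S \<longleftrightarrow> (AE x in (lborel \<Otimes>\<^sub>M lborel). g (fst x) (snd x) = h (fst x) (snd x))"
    unfolding lborel_prod using negligible_lborel_iff[OF S] by (simp add: split_def)
  also have "\<dots> \<longleftrightarrow> (AE t in lborel. AE z in lborel. g t z = h t z)"
    by (rule lborel_pair.AE_pair_iff[symmetric]) (fact S')
  also have "\<dots> \<longleftrightarrow> ae_eq g h"
  proof
    assume "ae_eq g h"
    then show "AE t in lborel. AE z in lborel. g t z = h t z"
      by (simp add: ae_eq_def AE_completion_iff) (auto elim!: eventually_mono)
  next
    assume *: "AE t in lborel. AE z in lborel. g t z = h t z"
    \<comment> \<open>The Lipschitz bound, and with it the null set, belongs to one ball; countably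
      many balls are combined to get continuity in the state on the whole space.\<close>
    have cont: "AE t in lebesgue. continuous_on (cball 0 (real n)) (k t)" if kLC: "k \<in> LC p" for k :: "'v delay_field" and n
    proof -
      obtain l N where lN: "negligible N" "\<And>t. 0 \<le> l t"
        "\<And>t z1 z2. t \<notin> N \<Longrightarrow> norm z1 \<le> real n \<Longrightarrow> norm z2 \<le> real n \<Longrightarrow> norm (k t z1 - k t z2) \<le> l t * norm (z1 - z2)"
        by (rule LC_bounds[OF kLC, of "real n"]) blast
      show ?thesis
      proof (rule AE_lebesgue_negligibleI[OF lN(1)])
        fix t assume "t \<notin> N"
        then have "(l t)-lipschitz_on (cball 0 (real n)) (k t)"
          using lN by (intro lipschitz_onI) (auto simp: dist_norm)
        then show "continuous_on (cball 0 (real n)) (k t)" by (rule lipschitz_on_continuous_on)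
      qed
    qed
    have "AE t in lebesgue. AE z in lborel. g t z = h t z" using * by (simp add: AE_completion)
    moreover have "AE t in lebesgue. \<forall>n. continuous_on (cball 0 (real n)) (g t)"
      using cont[OF g] by (simp add: AE_all_countable)
    moreover have "AE t in lebesgue. \<forall>n. continuous_on (cball 0 (real n)) (h t)"
      using cont[OF h] by (simp add: AE_all_countable)
    ultimately show "ae_eq g h"
      unfolding ae_eq_def
    proof eventually_elim
      case (elim t)
      have con: "continuous_on UNIV (k t)" if "\<forall>n. continuous_on (cball 0 (real n)) (k t)" for k :: "'v delay_field"
      proof (rule continuous_at_imp_continuous_on, rule ballI)
        fix z :: "'v \<times> 'v"
        obtain n where "norm z < real n" using reals_Archimedean2 by blast
        then have "z \<in> interior (cball 0 (real n))" by (simp add: interior_cball)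
        then show "isCont (k t) z"
          using that by (meson continuous_on_interior)
      qed
      have "open (- {z. g t z = h t z})"
        using closed_Collect_eq[OF con con] elim by (simp add: open_closed)
      moreover have "negligible (- {z. g t z = h t z})"
      proof -
        have "- {z. g t z = h t z} \<in> sets borel" using calculation by (rule borel_open)
        then show ?thesis using elim(1) by (simp add: negligible_lborel_iff)
      qed
      ultimately have "- {z. g t z = h t z} = {}" using open_not_negligible by blast
      then show "\<forall>z. g t z = h t z" by blast
    qed
  qed
  finally show ?thesis using g h by (simp add: ae_rel_def)
qed

lemma ae_eq_refl [simp]: "ae_eq g g"
  by (simp add: ae_eq_def)

lemma ae_eq_sym: "ae_eq g h \<Longrightarrow> ae_eq h g"
  by (simp add: ae_eq_def eq_commute)

lemma ae_eq_trans:
  assumes "ae_eq g h" "ae_eq h k" shows "ae_eq g k"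
  using assms unfolding ae_eq_def by eventually_elim simp

lemma equiv_ae_rel: "equiv (LC p) (ae_rel p)"
proof (rule equivI)
  show "ae_rel p \<subseteq> LC p \<times> LC p" by (auto simp: ae_rel_iff)
  show "refl_on (LC p) (ae_rel p)" by (auto simp: refl_on_def ae_rel_iff)
  show "sym (ae_rel p)" by (auto simp: sym_def ae_rel_iff intro: ae_eq_sym)
  show "trans (ae_rel p)" by (auto simp: trans_def ae_rel_iff intro: ae_eq_trans)
qed

lemma mem_LC_class: "h \<in> LC_class p g \<longleftrightarrow> g \<in> LC p \<and> h \<in> LC p \<and> ae_eq g h"
  by (simp add: LC_class_def ae_rel_iff)

lemma LC_class_in: "g \<in> LC p \<Longrightarrow> LC_class p g \<in> LC_classes p"
  unfolding LC_class_def LC_classes_def by (rule quotientI)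

lemma LC_classes_member:
  assumes "G \<in> LC_classes p" "g \<in> G"
  shows "g \<in> LC p" "G = LC_class p g"
proof -
  obtain h where h: "h \<in> LC p" "G = LC_class p h"
    using assms(1) unfolding LC_classes_def LC_class_def by (auto elim: quotientE)
  with assms(2) show "g \<in> LC p" by (simp add: mem_LC_class)
  have "(h, g) \<in> ae_rel p" using h assms(2) by (simp add: LC_class_def)
  then show "G = LC_class p g"
    unfolding h(2) LC_class_def by (rule equiv_class_eq[OF equiv_ae_rel])
qed

lemma LC_classes_ex: "G \<in> LC_classes p \<Longrightarrow> \<exists>g. g \<in> G"
  unfolding LC_classes_def LC_class_def
  by (metis equiv_ae_rel in_quotient_imp_non_empty ex_in_conv)

lemma Union_LC_classes: "\<Union>(LC_classes p) = LC p"
  unfolding LC_classes_def by (rule Union_quotient[OF equiv_ae_rel])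

lemma translate_translate: "translate s (translate t g) = translate (s + t) g"
  by (simp add: translate_def add_ac)

lemma translate_0 [simp]: "translate 0 g = g"
  by (simp add: translate_def)

lemma ae_eq_translate: "ae_eq g h \<Longrightarrow> ae_eq (translate t g) (translate t h)"
  unfolding ae_eq_def translate_def by (rule AE_lebesgue_shift)

text \<open>Translation by -t inverts translation by t, so the image of a class is a whole class and
  not merely part of one. This lets the flow act on classes by images.\<close>

lemma translate_LC_class:
  assumes "g \<in> LC p"
  shows "translate t ` LC_class p g = LC_class p (translate t g)"
proof (intro equalityI subsetI)
  fix h assume "h \<in> translate t ` LC_class p g"
  then show "h \<in> LC_class p (translate t g)"
    using assms by (auto simp: mem_LC_class intro: LC_translate ae_eq_translate)
next
  fix h assume "h \<in> LC_class p (translate t g)"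
  then have "translate (-t) h \<in> LC_class p g"
    using LC_translate[of h p "-t"] ae_eq_translate[of "translate t g" h "-t"] assms
    by (auto simp: mem_LC_class translate_translate)
  moreover have "h = translate t (translate (-t) h)" by (simp add: translate_translate)
  ultimately show "h \<in> translate t ` LC_class p g" by blast
qed

lemma integral_ae_eq:
  assumes "ae_eq g h" shows "integral {a..b} (\<lambda>s. F s (g s (z s))) = integral {a..b} (\<lambda>s. F s (h s (z s)))"
proof -
  obtain N where N: "negligible N" "\<And>t. t \<notin> N \<Longrightarrow> \<forall>z. g t z = h t z"
    using assms unfolding ae_eq_def by (rule AE_lebesgue_negligibleD) blast
  show ?thesis by (rule integral_spike[OF N(1)]) (simp add: N(2))
qed

section \<open>The delay equation in integral form\<close>

text \<open>Closed intervals, with T = 0 allowed, so that a continuous history alone already is a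
  solution. Continuity of \<phi> on {-1..0} follows from that of x.\<close>

definition integral_solution ::
    "('v::euclidean_space) delay_field \<Rightarrow> (real \<Rightarrow> 'v) \<Rightarrow> real \<Rightarrow> (real \<Rightarrow> 'v) \<Rightarrow> bool" where
  "integral_solution g \<phi> T x \<longleftrightarrow> 0 \<le> T \<and> continuous_on {-1..T} x \<and> (\<forall>t\<in>{-1..0}. x t = \<phi> t) \<and>
     (\<forall>t\<in>{0..T}. x t = \<phi> 0 + integral {0..t} (\<lambda>s. g s (x s, x (s - 1))))"

lemma integral_solutionD:
  assumes "integral_solution g \<phi> T x"
  shows "0 \<le> T" "continuous_on {-1..T} x" "\<And>t. t \<in> {-1..0} \<Longrightarrow> x t = \<phi> t"
    "\<And>t. t \<in> {0..T} \<Longrightarrow> x t = \<phi> 0 + integral {0..t} (\<lambda>s. g s (x s, x (s - 1)))"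
  using assms by (auto simp: integral_solution_def)

lemma continuous_on_delay_pair:
  fixes x :: "real \<Rightarrow> 'v::topological_space"
  assumes "continuous_on {-1..T} x" "0 \<le> a" "b \<le> T"
  shows "continuous_on {a..b} (\<lambda>s. (x s, x (s - 1)))"
  using assms
  by (intro continuous_on_Pair continuous_on_compose2[OF assms(1)] continuous_intros) auto

lemma delay_pair_integrable:
  assumes "g \<in> LC 1" "continuous_on {-1..T} x" "0 \<le> a" "b \<le> T"
  shows "(\<lambda>s. g s (x s, x (s - 1))) absolutely_integrable_on {a..b}"
    and "(\<lambda>s. g s (x s, x (s - 1))) integrable_on {a..b}"
  using LC_comp_continuous_integrable[OF assms(1) continuous_on_delay_pair[OF assms(2-4)]]
  by (auto simp: absolutely_integrable_on_def)

lemma integral_solution_increment: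
  assumes g: "g \<in> LC 1" and x: "integral_solution g \<phi> T x" and "0 \<le> \<tau>" "\<tau> \<le> t" "t \<le> T"
  shows "x t - x \<tau> = integral {\<tau>..t} (\<lambda>s. g s (x s, x (s - 1)))"
proof -
  have "integral {0..\<tau>} (\<lambda>s. g s (x s, x (s - 1))) + integral {\<tau>..t} (\<lambda>s. g s (x s, x (s - 1)))
      = integral {0..t} (\<lambda>s. g s (x s, x (s - 1)))"
    using assms by (intro Henstock_Kurzweil_Integration.integral_combine delay_pair_integrable(2)[OF g, of T] integral_solutionD(2)[OF x]) auto
  then show ?thesis
    using integral_solutionD(4)[OF x, of t] integral_solutionD(4)[OF x, of \<tau>] assms
    by (simp add: algebra_simps)
qed

lemma integral_solution_cong:
  assumes x: "integral_solution g \<phi> T x" and eq: "\<And>t. t \<in> {-1..T} \<Longrightarrow> y t = x t"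
    and \<phi>: "\<And>t. t \<in> {-1..0} \<Longrightarrow> \<psi> t = \<phi> t"
  shows "integral_solution g \<psi> T y"
  unfolding integral_solution_def
proof (intro conjI ballI)
  note D = integral_solutionD[OF x]
  show "0 \<le> T" by (rule D)
  show "continuous_on {-1..T} y" using D(2) eq by (subst continuous_on_cong[of _ _ _ x]) auto
  show "y t = \<psi> t" if "t \<in> {-1..0}" for t using that D eq \<phi> by auto
  show "y t = \<psi> 0 + integral {0..t} (\<lambda>s. g s (y s, y (s - 1)))" if t: "t \<in> {0..T}" for t
  proof -
    have "integral {0..t} (\<lambda>s. g s (y s, y (s - 1))) = integral {0..t} (\<lambda>s. g s (x s, x (s - 1)))"
      using t eq by (intro integral_cong) auto
    then show ?thesis using D(4)[OF t] eq[of t] \<phi>[of 0] t by simp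
  qed
qed

lemma integral_solution_mono:
  assumes "integral_solution g \<phi> T x" "0 \<le> T'" "T' \<le> T" shows "integral_solution g \<phi> T' x"
  using assms continuous_on_subset[of "{-1..T}" x "{-1..T'}"] by (auto simp: integral_solution_def)

lemma integral_solution_ae_eq:
  assumes "ae_eq g h" shows "integral_solution g \<phi> T x \<longleftrightarrow> integral_solution h \<phi> T x"
  unfolding integral_solution_def
  using integral_ae_eq[OF assms, where F="\<lambda>s v. v" and z="\<lambda>s. (x s, x (s - 1))"] by simp

text \<open>Continuity is local, and each point of the half-open interval has a closed subinterval
  {-1..T} as a relative neighbourhood.\<close>

lemma continuous_on_life_interval:
  assumes "\<And>T. 0 \<le> T \<Longrightarrow> ereal T < b \<Longrightarrow> continuous_on {-1..T} x" and b: "0 < b"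
  shows "continuous_on (life_interval b) x"
  unfolding continuous_on_eq_continuous_within
proof
  fix t assume t: "t \<in> life_interval b"
  then have "ereal (max t 0) < b" using b by (auto simp: life_interval_def max_def zero_ereal_def)
  then obtain T where T: "ereal (max t 0) < ereal T" "ereal T < b" using ereal_dense2 by blast
  then have "continuous_on {-1..T} x" using assms(1)[of T] by auto
  then have "continuous (at t within {-1..T}) x"
    using t T by (auto simp: continuous_on_eq_continuous_within life_interval_def)
  moreover have "at t within {-1..T} = at t within life_interval b"
    by (rule at_within_nhd[of t "{..<T}"])
      (use T in \<open>auto simp: life_interval_def intro: less_trans[OF _ T(2)]\<close>)
  ultimately show "continuous (at t within life_interval b) x" by simp
qed

text \<open>The integrand is extended by 0 outside {0..T}, so that differentiation of primitives on
  the whole line applies.\<close>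

lemma integral_solution_derivative:
  assumes g: "g \<in> LC 1" and x: "integral_solution g \<phi> T x"
  shows "AE t in lebesgue. 0 < t \<and> t < T \<longrightarrow> (x has_vector_derivative g t (x t, x (t - 1))) (at t)"
proof -
  let ?F = "\<lambda>s. g s (x s, x (s - 1))"
  define f where "f s = (if s \<in> {0..T} then ?F s else 0)" for s
  have "?F integrable_on {0..T}"
    using delay_pair_integrable(2)[OF g integral_solutionD(2)[OF x]] by simp
  then have "f integrable_on UNIV" unfolding f_def by (simp only: integrable_restrict_UNIV)
  then have "f integrable_on {a..b}" for a b
    by (rule integrable_on_subinterval) auto
  from integral_has_vector_derivative_AE[OF this] show ?thesis
  proof (rule eventually_mono, intro impI)
    fix t assume *: "\<forall>a<t. ((\<lambda>u. integral {a..u} f) has_vector_derivative f t) (at t)" and t: "0 < t \<and> t < T"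
    have "((\<lambda>u. \<phi> 0 + integral {0..u} f) has_vector_derivative 0 + f t) (at t)"
      using * t by (intro has_vector_derivative_add has_vector_derivative_const) auto
    then have "(x has_vector_derivative 0 + f t) (at t)"
    proof (rule has_vector_derivative_transform_within_open[where S="{0<..<T}"])
      fix u assume u: "u \<in> {0<..<T}"
      have "integral {0..u} f = integral {0..u} ?F"
        using u by (intro integral_cong) (auto simp: f_def)
      then show "\<phi> 0 + integral {0..u} f = x u" using integral_solutionD(4)[OF x, of u] u by simp
    qed (use t in auto)
    then show "(x has_vector_derivative ?F t) (at t)" using t by (simp add: f_def)
  qed
qed

text \<open>One direction is the fundamental theorem for absolutely continuous functions, the other
  absolute continuity and a.e. differentiability of primitives.\<close>

lemma caratheodory_solution_iff:
  assumes g: "g \<in> LC 1"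
  shows "caratheodory_solution g \<phi> b x \<longleftrightarrow>
    0 < b \<and> (\<forall>T\<ge>0. ereal T < b \<longrightarrow> integral_solution g \<phi> T x)"
proof (intro iffI conjI allI impI)
  assume c: "caratheodory_solution g \<phi> b x"
  then show "0 < b" by (simp add: caratheodory_solution_def)
  fix T :: real assume T: "0 \<le> T" "ereal T < b"
  show "integral_solution g \<phi> T x"
    unfolding integral_solution_def
  proof (intro conjI ballI)
    show "0 \<le> T" by fact
    have "{-1..T} \<subseteq> life_interval b"
      by (auto simp: life_interval_def intro: le_less_trans[OF _ T(2)])
    then show "continuous_on {-1..T} x"
      using c continuous_on_subset unfolding caratheodory_solution_def by blast
    show "x t = \<phi> t" if "t \<in> {-1..0}" for t
      using that c unfolding caratheodory_solution_def by blast
    fix t assume t: "t \<in> {0..T}"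
    then have tb: "ereal t < b" by (auto intro: le_less_trans[OF _ T(2)])
    have "((\<lambda>s. g s (x s, x (s - 1))) has_integral (x t - x 0)) {0..t}"
    proof (rule abs_continuous_FTC)
      show "abs_continuous_on 0 t x"
        using c t tb unfolding caratheodory_solution_def by auto
      have "AE s in lebesgue. 0 < s \<and> ereal s < b \<longrightarrow> (x has_vector_derivative g s (x s, x (s - 1))) (at s)"
        using c unfolding caratheodory_solution_def by blast
      then show "AE s in lebesgue. 0 < s \<and> s < t \<longrightarrow> (x has_vector_derivative g s (x s, x (s - 1))) (at s)"
        by (rule eventually_mono) (use tb in \<open>auto intro: less_trans[OF _ tb]\<close>)
    qed (use t in auto)
    moreover have "x 0 = \<phi> 0" using c unfolding caratheodory_solution_def by auto
    ultimately show "x t = \<phi> 0 + integral {0..t} (\<lambda>s. g s (x s, x (s - 1)))"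
      by (simp add: integral_unique)
  qed
next
  assume *: "0 < b \<and> (\<forall>T\<ge>0. ereal T < b \<longrightarrow> integral_solution g \<phi> T x)"
  then have b: "0 < b" and sol: "\<And>T. 0 \<le> T \<Longrightarrow> ereal T < b \<Longrightarrow> integral_solution g \<phi> T x" by auto
  show "caratheodory_solution g \<phi> b x"
    unfolding caratheodory_solution_def
  proof (intro conjI ballI allI impI)
    show "continuous_on (life_interval b) x"
      by (rule continuous_on_life_interval[OF integral_solutionD(2)[OF sol] b])
    show "x t = \<phi> t" if "t \<in> {-1..0}" for t
      using integral_solutionD(3)[OF sol[of 0] that] b by (simp add: zero_ereal_def)
    show "abs_continuous_on 0 c x" if "0 \<le> c" "ereal c < b" for c
      using sol[OF that] that
      by (intro abs_continuous_integral[OF delay_pair_integrable(1)[OF g integral_solutionD(2)[OF sol[OF that]]]])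
        (auto dest: integral_solutionD(4))
    \<comment> \<open>Each horizon q comes with its own null set; the rational q below b exhaust the
      lifetime with countably many of them.\<close>
    have "AE t in lebesgue. \<forall>q\<in>\<rat>. 0 \<le> q \<and> ereal q < b \<longrightarrow> (0 < t \<and> t < q \<longrightarrow>
        (x has_vector_derivative g t (x t, x (t - 1))) (at t))"
    proof (subst AE_ball_countable[OF countable_rat], rule ballI)
      fix q :: real
      show "AE t in lebesgue. 0 \<le> q \<and> ereal q < b \<longrightarrow> (0 < t \<and> t < q \<longrightarrow>
        (x has_vector_derivative g t (x t, x (t - 1))) (at t))"
        using integral_solution_derivative[OF g sol[of q]] by (cases "0 \<le> q \<and> ereal q < b") auto
    qed
    then show "AE t in lebesgue. 0 < t \<and> ereal t < b \<longrightarrow> (x has_vector_derivative g t (x t, x (t - 1))) (at t)"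
    proof (rule eventually_mono, intro impI)
      fix t assume q: "\<forall>q\<in>\<rat>. 0 \<le> q \<and> ereal q < b \<longrightarrow> (0 < t \<and> t < q \<longrightarrow>
        (x has_vector_derivative g t (x t, x (t - 1))) (at t))" and t: "0 < t \<and> ereal t < b"
      then obtain r :: rat where "ereal t < ereal (real_of_rat r)" "ereal (real_of_rat r) < b"
        using ereal_dense3[of "ereal t" b] by auto
      moreover from this(1) t have "0 \<le> real_of_rat r" by (simp del: zero_le_of_rat_iff)
      ultimately show "(x has_vector_derivative g t (x t, x (t - 1))) (at t)"
        using q[rule_format, of "real_of_rat r"] t by (auto simp del: zero_le_of_rat_iff)
    qed
  qed (fact b)
qed

lemma norm_Pair_le_add: "norm (a, b) \<le> norm a + norm b"
  by (simp add: norm_Pair sqrt_sum_squares_le_sum)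

section \<open>Comparison with approximate solutions\<close>

text \<open>Here y satisfies the equation of g only up to e in integrated form, which is how a
  solution for another right-hand side looks from g. The factor A is obtained before T', y and e,
  hence is uniform in them.\<close>

lemma solution_estimate:
  fixes g :: "('v::euclidean_space) delay_field"
  assumes g: "g \<in> LC 1" and x: "integral_solution g \<phi> T x"
    and xR': "\<forall>t\<in>{-1..T}. norm (x t) \<le> R"
  shows "\<exists>A\<ge>1. \<forall>T' y e. 0 \<le> T' \<longrightarrow> T' \<le> T \<longrightarrow> continuous_on {-1..T'} y \<longrightarrow>
      (\<forall>t\<in>{-1..T'}. norm (y t) \<le> R) \<longrightarrow>
      (\<forall>t\<in>{-1..0}. norm (y t - x t) \<le> e) \<longrightarrow>
      (\<forall>t\<in>{0..T'}. norm (y t - y 0 - integral {0..t} (\<lambda>s. g s (y s, y (s - 1)))) \<le> e) \<longrightarrow>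
      (\<forall>t\<in>{-1..T'}. norm (y t - x t) \<le> A * e)"
proof -
  note xR = xR'[rule_format]
  have T: "0 \<le> T" using x by (rule integral_solutionD)
  \<comment> \<open>2 * R bounds the pairs (y s, y (s - 1)) and (x s, x (s - 1)). The kernel will be
    2 * l because both components of the pair contribute to the difference.\<close>
  obtain l N where N: "negligible N" and l0: "\<And>t. 0 \<le> l t" and li: "\<And>a b. (\<lambda>t. l t ^ 1) integrable_on {a..b}"
    and lip: "\<And>t z1 z2. t \<notin> N \<Longrightarrow> norm z1 \<le> 2 * R \<Longrightarrow> norm z2 \<le> 2 * R \<Longrightarrow> norm (g t z1 - g t z2) \<le> l t * norm (z1 - z2)"
    by (rule LC_bounds[OF g, of "2 * R"]) blast
  have li: "l integrable_on {a..b}" for a b using li by simp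
  have i2: "(\<lambda>t. 2 * l t) integrable_on {0..T}" using li by (intro integrable_on_mult_right)
  have "0 \<le> 2 * l s" for s using l0 by simp
  from Gronwall_increments[OF T i2 this]
  obtain A where A: "A \<ge> 1"
    and gron: "\<forall>T' u e. T' \<le> T \<longrightarrow> continuous_on {0..T'} u \<longrightarrow> 0 \<le> e \<longrightarrow> u 0 \<le> e \<longrightarrow>
      (\<forall>\<tau> t M. 0 \<le> \<tau> \<longrightarrow> \<tau> \<le> t \<longrightarrow> t \<le> T' \<longrightarrow> e \<le> M \<longrightarrow> (\<forall>s\<in>{0..t}. u s \<le> M) \<longrightarrow>
          u t \<le> u \<tau> + e + M * integral {\<tau>..t} (\<lambda>t. 2 * l t)) \<longrightarrow>
      (\<forall>t\<in>{0..T'}. u t \<le> A * (e::real))" by (elim exE conjE)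
  show ?thesis
  \<comment> \<open>Gronwall is run with 2 * e, since the error of y enters at \<tau> and at
    t.\<close>
  proof (intro exI[of _ "2 * A"] conjI allI impI ballI)
    show "2 * A \<ge> 1" using A by simp
    fix T' y e t
    assume T': "0 \<le> T'" "T' \<le> T" and yc: "continuous_on {-1..T'} y"
      and yR': "\<forall>t\<in>{-1..T'}. norm (y t) \<le> R"
      and hist': "\<forall>t\<in>{-1..0}. norm (y t - x t) \<le> e"
      and err': "\<forall>t\<in>{0..T'}. norm (y t - y 0 - integral {0..t} (\<lambda>s. g s (y s, y (s - 1)))) \<le> e"
      and t: "t \<in> {-1..T'}"
    note yR = yR'[rule_format] and hist = hist'[rule_format] and err = err'[rule_format]
    have e: "0 \<le> e" using order_trans[OF norm_ge_zero hist[of 0]] by simp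
    define u where "u t = norm (y t - x t)" for t
    have xc: "continuous_on {-1..T'} x"
      using integral_solutionD(2)[OF x] T' by (auto intro: continuous_on_subset)
    let ?G = "\<lambda>s. g s (y s, y (s - 1))" and ?F = "\<lambda>s. g s (x s, x (s - 1))"
    have key: "u t \<le> A * (2 * e)" if "t \<in> {0..T'}" for t
    proof (rule gron[rule_format, where T'=T' and u=u and e="2 * e" and t=t, OF T'(2) _ _ _ _ that])
      show "continuous_on {0..T'} u"
        unfolding u_def by (intro continuous_intros continuous_on_subset[OF yc] continuous_on_subset[OF xc]) auto
      show "u 0 \<le> 2 * e" using hist[of 0] e by (simp add: u_def)
      fix \<tau> t M assume *: "0 \<le> \<tau>" "\<tau> \<le> t" "t \<le> T'" "2 * e \<le> M" and M: "\<And>s. s \<in> {0..t} \<Longrightarrow> u s \<le> M"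
      have Gi: "?G integrable_on {a..b}" if "0 \<le> a" "b \<le> T'" for a b
        using delay_pair_integrable(2)[OF g yc that] .
      have Fi: "?F integrable_on {a..b}" if "0 \<le> a" "b \<le> T'" for a b
        using delay_pair_integrable(2)[OF g xc that] .
      have "integral {0..\<tau>} ?G + integral {\<tau>..t} ?G = integral {0..t} ?G"
        using * by (intro Henstock_Kurzweil_Integration.integral_combine Gi) auto
      then have eq: "y t - x t = (y \<tau> - x \<tau>) + (y t - y 0 - integral {0..t} ?G) - (y \<tau> - y 0 - integral {0..\<tau>} ?G)
          + (integral {\<tau>..t} ?G - integral {\<tau>..t} ?F)"
        using integral_solution_increment[OF g x, of \<tau> t] * T' by (simp add: algebra_simps)
      have 1: "u t \<le> u \<tau> + e + e + norm (integral {\<tau>..t} ?G - integral {\<tau>..t} ?F)"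
      proof -
        have tri: "norm (a + b - c + d) \<le> norm a + norm b + norm c + norm d" for a b c d :: 'v
          using norm_triangle_ineq[of "a + b - c" d] norm_triangle_ineq4[of "a + b" c] norm_triangle_ineq[of a b] by linarith
        show ?thesis
          using tri[of "y \<tau> - x \<tau>" "y t - y 0 - integral {0..t} ?G" "y \<tau> - y 0 - integral {0..\<tau>} ?G"
              "integral {\<tau>..t} ?G - integral {\<tau>..t} ?F"] err[of t] err[of \<tau>] *
          unfolding u_def eq by simp
      qed
      \<comment> \<open>The delayed argument may fall into {-1..0}, where the difference is at most
        e \<le> M. This is why the Gronwall hypothesis carries a bound on the whole past together
        with e \<le> M.\<close>
      have small: "norm (y s - x s) \<le> M" if "s \<in> {-1..t}" for s
        using * M[of s] hist[of s] that e by (cases "s \<le> 0") (auto simp: u_def)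
      have "norm (integral {\<tau>..t} (\<lambda>s. ?G s - ?F s)) \<le> integral {\<tau>..t} (\<lambda>s. M * (2 * l s))"
      proof (rule integrable_dominated_AE(2))
        show "(\<lambda>s. ?G s - ?F s) \<in> borel_measurable (lebesgue_on {\<tau>..t})"
          using * by (intro borel_measurable_diff integrable_imp_measurable Gi Fi) auto
        show "(\<lambda>s. M * (2 * l s)) integrable_on {\<tau>..t}" using li by (intro integrable_on_mult_right)
        show "AE s in lebesgue. s \<in> {\<tau>..t} \<longrightarrow> norm (?G s - ?F s) \<le> M * (2 * l s)"
        proof (rule AE_lebesgue_negligibleI[OF N], rule impI)
          fix s assume s: "s \<notin> N" "s \<in> {\<tau>..t}"
          have "norm (y s, y (s - 1)) \<le> 2 * R"
            using norm_Pair_le_add[of "y s" "y (s - 1)"] yR[of s] yR[of "s - 1"] s * by auto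
          moreover have "norm (x s, x (s - 1)) \<le> 2 * R"
            using norm_Pair_le_add[of "x s" "x (s - 1)"] xR[of s] xR[of "s - 1"] s * T' by auto
          ultimately have "norm (?G s - ?F s) \<le> l s * norm ((y s, y (s - 1)) - (x s, x (s - 1)))"
            using lip[OF s(1)] by blast
          also have "\<dots> \<le> l s * (2 * M)"
            using norm_Pair_le_add[of "y s - x s" "y (s - 1) - x (s - 1)"] small[of s] small[of "s - 1"] s *
            by (intro mult_left_mono l0) auto
          finally show "norm (?G s - ?F s) \<le> M * (2 * l s)"
            by (simp add: algebra_simps)
        qed
      qed
      also have "integral {\<tau>..t} (\<lambda>s. M * (2 * l s)) = M * integral {\<tau>..t} (\<lambda>s. 2 * l s)" by simp
      finally have 2: "norm (integral {\<tau>..t} ?G - integral {\<tau>..t} ?F) \<le> M * integral {\<tau>..t} (\<lambda>s. 2 * l s)"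
        using Gi[of \<tau> t] Fi[of \<tau> t] * by (simp add: integral_diff)
      show "u t \<le> u \<tau> + 2 * e + M * integral {\<tau>..t} (\<lambda>t. 2 * l t)"
        using 1 2 by simp
    qed (use e in auto)
    show "norm (y t - x t) \<le> 2 * A * e"
    proof (cases "t \<le> 0")
      case True
      have "norm (y t - x t) \<le> e" using hist[of t] t True by simp
      also have "\<dots> \<le> 2 * A * e" using A e mult_right_mono[of 1 "2 * A" e] by simp
      finally show ?thesis .
    next
      case False
      then show ?thesis using key[of t] t by (simp add: u_def)
    qed
  qed
qed

text \<open>\<open>solution_estimate\<close> with error e = 0 on the common interval.\<close>

lemma integral_solution_unique:
  assumes g: "g \<in> LC 1" and x: "integral_solution g \<phi> T x" and y: "integral_solution g \<phi> T' y"
    and le: "T' \<le> T" and t: "t \<in> {-1..T'}"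
  shows "y t = x t"
proof -
  have x': "integral_solution g \<phi> T' x" using integral_solution_mono[OF x _ le] integral_solutionD(1)[OF y] by simp
  have "bounded (x ` {-1..T'} \<union> y ` {-1..T'})"
    using integral_solutionD(2)[OF x'] integral_solutionD(2)[OF y]
    by (intro bounded_Un[THEN iffD2] conjI compact_imp_bounded compact_continuous_image) auto
  then obtain R where R: "\<And>v. v \<in> x ` {-1..T'} \<union> y ` {-1..T'} \<Longrightarrow> norm v \<le> R"
    unfolding bounded_iff by blast
  have "\<forall>t\<in>{-1..T'}. norm (x t) \<le> R" using R by blast
  from solution_estimate[OF g x' this]
  obtain A where A: "A \<ge> 1" and est:
    "\<forall>T'' y e. 0 \<le> T'' \<longrightarrow> T'' \<le> T' \<longrightarrow> continuous_on {-1..T''} y \<longrightarrow>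
      (\<forall>t\<in>{-1..T''}. norm (y t) \<le> R) \<longrightarrow>
      (\<forall>t\<in>{-1..0}. norm (y t - x t) \<le> e) \<longrightarrow>
      (\<forall>t\<in>{0..T''}. norm (y t - y 0 - integral {0..t} (\<lambda>s. g s (y s, y (s - 1)))) \<le> e) \<longrightarrow>
      (\<forall>t\<in>{-1..T''}. norm (y t - x t) \<le> A * e)" by (elim exE conjE)
  have "norm (y t - x t) \<le> A * 0"
  proof (rule est[rule_format, of T'])
    show "norm (y t - y 0 - integral {0..t} (\<lambda>s. g s (y s, y (s - 1)))) \<le> 0" if "t \<in> {0..T'}" for t
      using integral_solutionD(4)[OF y that] integral_solutionD(3)[OF y, of 0] by simp
    show "norm (y t - x t) \<le> 0" if "t \<in> {-1..0}" for t
      using integral_solutionD(3)[OF y that] integral_solutionD(3)[OF x that] by simp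
  qed (use R t integral_solutionD[OF y] in auto)
  then show ?thesis by simp
qed

section \<open>Maximal solutions\<close>

text \<open>Banach fixed point. With T \<le> 1 the delayed argument meets only the history, so the
  equation becomes an ordinary one; \<integral> m \<le> 1 makes the unit ball around the constant
  \<phi> 0 invariant, and \<integral> l \<le> 1/2 makes the map a contraction.\<close>

lemma local_solution:
  fixes g :: "('v::euclidean_space) delay_field"
  assumes g: "g \<in> LC 1" and \<phi>: "continuous_on {-1..0} \<phi>"
  shows "\<exists>T>0. \<exists>x. integral_solution g \<phi> T x"
proof -
  have "bounded (\<phi> ` {-1..0})"
    using \<phi> by (intro compact_imp_bounded compact_continuous_image) auto
  then obtain B where B: "\<And>t. t \<in> {-1..0} \<Longrightarrow> norm (\<phi> t) \<le> B"
    unfolding bounded_iff by blast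
  \<comment> \<open>Bounds the pair of a value within 1 of \<phi> 0 and a value of the
    history.\<close>
  define R where "R = 2 * (B + 1)"
  obtain m l N where N: "negligible N" and m0: "\<And>t. 0 \<le> m t" and l0: "\<And>t. 0 \<le> l t"
    and mi: "\<And>a b. (\<lambda>t. m t ^ 1) integrable_on {a..b}" and li: "\<And>a b. (\<lambda>t. l t ^ 1) integrable_on {a..b}"
    and bd: "\<And>t z. t \<notin> N \<Longrightarrow> norm z \<le> R \<Longrightarrow> norm (g t z) \<le> m t"
    and lip: "\<And>t z1 z2. t \<notin> N \<Longrightarrow> norm z1 \<le> R \<Longrightarrow> norm z2 \<le> R \<Longrightarrow> norm (g t z1 - g t z2) \<le> l t * norm (z1 - z2)"
    by (rule LC_bounds[OF g, of R]) blast
  have mi: "m integrable_on {a..b}" and li: "l integrable_on {a..b}" for a b using mi li by simp_all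
  have "\<exists>d>0. \<forall>t. 0 \<le> t \<and> t < d \<longrightarrow> integral {0..t} h < 1/2" if h: "\<And>a b. h integrable_on {a..b}" for h :: "real \<Rightarrow> real"
  proof -
    have "continuous_on {0..1} (\<lambda>t. integral {0..t} h)"
      by (rule indefinite_integral_continuous_1[OF h])
    then have "\<forall>e>0. \<exists>d>0. \<forall>t\<in>{0..1}. dist t 0 < d \<longrightarrow> dist (integral {0..t} h) (integral {0..0} h) < e"
      unfolding continuous_on_iff by (rule bspec) simp
    from this[rule_format, of "1/2"] obtain d where d: "d > 0" "\<forall>t\<in>{0..1}. dist t 0 < d \<longrightarrow> dist (integral {0..t} h) (integral {0..0} h) < 1/2"
      by auto
    show ?thesis
      by (rule exI[of _ "min d 1"]) (use d in \<open>auto simp: dist_real_def\<close>)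
  qed
  from this[OF mi] this[OF li] obtain d1 d2 where d: "d1 > 0" "d2 > 0"
    "\<And>t. 0 \<le> t \<Longrightarrow> t < d1 \<Longrightarrow> integral {0..t} m < 1/2"
    "\<And>t. 0 \<le> t \<Longrightarrow> t < d2 \<Longrightarrow> integral {0..t} l < 1/2" by blast
  define T where "T = min 1 (min d1 d2 / 2)"
  have T: "0 < T" "T \<le> 1" "integral {0..T} m \<le> 1" "integral {0..T} l \<le> 1/2"
  proof -
    have *: "0 < T" "T \<le> 1" "T < d1" "T < d2" using d(1,2) by (auto simp: T_def min_def)
    then show "0 < T" "T \<le> 1" "integral {0..T} m \<le> 1" "integral {0..T} l \<le> 1/2"
      using d(3)[of T] d(4)[of T] by auto
  qed
  \<comment> \<open>Clamping time to {0..T} turns the Picard iterates into bounded continuous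
    functions on the whole line, which form a complete space.\<close>
  define c where "c t = max 0 (min T t)" for t :: real
  have cT: "c t \<in> {0..T}" for t using T by (auto simp: c_def)
  define X where "X = cball (const_bcontfun (\<phi> 0) :: (real, 'v) bcontfun) 1"
  have X: "norm (apply_bcontfun x t - \<phi> 0) \<le> 1" if "x \<in> X" for x t
    using dist_bounded[of x t "const_bcontfun (\<phi> 0)"] that
    by (simp add: X_def dist_commute dist_norm norm_minus_commute)
  define F where "F x s = g s (apply_bcontfun x s, \<phi> (s - 1))" for x s
  define P where "P x t = \<phi> 0 + integral {0..c t} (F x)" for x t
  have zc: "continuous_on {0..T} (\<lambda>s. (apply_bcontfun x s, \<phi> (s - 1)))" for x
    using T by (intro continuous_intros continuous_on_compose2[OF \<phi>]) (auto intro: continuous_on_subset[OF _ subset_UNIV])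
  have zR: "norm (apply_bcontfun x s, \<phi> (s - 1)) \<le> R" if "x \<in> X" "s \<in> {0..T}" for x s
  proof -
    have "norm (apply_bcontfun x s) \<le> B + 1"
      using X[OF that(1), of s] B[of 0] norm_triangle_sub[of "apply_bcontfun x s" "\<phi> 0"] by simp
    moreover have "norm (\<phi> (s - 1)) \<le> B" using that T by (intro B) auto
    ultimately show ?thesis
      using norm_Pair_le_add[of "apply_bcontfun x s" "\<phi> (s - 1)"] by (simp add: R_def)
  qed
  have Fm: "F x \<in> borel_measurable (lebesgue_on {0..t})" if "t \<in> {0..T}" for x t
    unfolding F_def using that
    by (intro LC_comp_measurable[OF g] continuous_on_measurable_lebesgue_on continuous_on_subset[OF zc]) auto
  have Fi: "F x integrable_on {0..t}" if "t \<in> {0..T}" for x t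
    unfolding F_def using that LC_comp_continuous_integrable[OF g continuous_on_subset[OF zc, of "{0..t}" x]]
    by (auto simp: absolutely_integrable_on_def)
  have Pc: "continuous_on UNIV (P x)" for x
    unfolding P_def
  proof (intro continuous_intros)
    have "continuous_on {0..T} (\<lambda>t. integral {0..t} (F x))"
      using T by (intro indefinite_integral_continuous_1 Fi) auto
    then show "continuous_on UNIV (\<lambda>t. integral {0..c t} (F x))"
      by (rule continuous_on_compose2) (use cT in \<open>auto simp: c_def intro!: continuous_intros\<close>)
  qed
  have Pb: "norm (P x t - \<phi> 0) \<le> 1" if "x \<in> X" for x t
  proof -
    have "norm (integral {0..c t} (F x)) \<le> integral {0..c t} m"
    proof (rule integrable_dominated_AE(2)[OF Fm[OF cT] mi])
      show "AE s in lebesgue. s \<in> {0..c t} \<longrightarrow> norm (F x s) \<le> m s"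
        by (rule AE_lebesgue_negligibleI[OF N], unfold F_def, intro impI bd zR that) (use cT[of t] in auto)
    qed
    also have "\<dots> \<le> integral {0..T} m"
      using cT[of t] m0 by (intro integral_subset_le mi) auto
    finally show ?thesis using T by (simp add: P_def)
  qed
  have "bounded (range (P x))" if "x \<in> X" for x
  proof -
    have "norm (P x t) \<le> norm (\<phi> 0) + 1" for t
      using Pb[OF that, of t] norm_triangle_sub[of "P x t" "\<phi> 0"] by simp
    then show ?thesis unfolding bounded_iff by blast
  qed
  then have PB: "P x \<in> bcontfun" if "x \<in> X" for x
    using Pc that by (simp add: bcontfun_def)
  have "\<exists>!x\<in>X. Bcontfun (P x) = x"
  proof (rule Banach_fix)
    show "complete X" by (simp add: X_def complete_eq_closed)
    show "X \<noteq> {}" by (simp add: X_def)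
    show "(\<lambda>x. Bcontfun (P x)) ` X \<subseteq> X"
    proof safe
      fix x assume x: "x \<in> X"
      have "dist (Bcontfun (P x)) (const_bcontfun (\<phi> 0)) \<le> 1"
        using Pb[OF x] by (intro dist_bound) (simp add: Bcontfun_inverse[OF PB[OF x]] dist_norm)
      then show "Bcontfun (P x) \<in> X" by (simp add: X_def dist_commute)
    qed
    show "dist (Bcontfun (P x)) (Bcontfun (P y)) \<le> 1/2 * dist x y" if x: "x \<in> X" and y: "y \<in> X" for x y
    proof (rule dist_bound)
      fix t
      have "norm (integral {0..c t} (\<lambda>s. F x s - F y s)) \<le> integral {0..c t} (\<lambda>s. dist x y * l s)"
      proof (rule integrable_dominated_AE(2))
        show "(\<lambda>s. F x s - F y s) \<in> borel_measurable (lebesgue_on {0..c t})"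
          by (intro borel_measurable_diff Fm cT)
        show "(\<lambda>s. dist x y * l s) integrable_on {0..c t}" by (intro integrable_on_mult_right li)
        show "AE s in lebesgue. s \<in> {0..c t} \<longrightarrow> norm (F x s - F y s) \<le> dist x y * l s"
        proof (rule AE_lebesgue_negligibleI[OF N], rule impI)
          fix s assume s: "s \<notin> N" "s \<in> {0..c t}"
          then have sT: "s \<in> {0..T}" using cT[of t] by auto
          have "norm (F x s - F y s) \<le> l s * norm ((apply_bcontfun x s, \<phi> (s - 1)) - (apply_bcontfun y s, \<phi> (s - 1)))"
            unfolding F_def by (rule lip[OF s(1) zR[OF x sT] zR[OF y sT]])
          also have "\<dots> \<le> l s * dist x y"
            using dist_bounded[of x s y] by (intro mult_left_mono l0) (simp add: norm_Pair dist_norm)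
          finally show "norm (F x s - F y s) \<le> dist x y * l s" by (simp add: mult.commute)
        qed
      qed
      also have "\<dots> = dist x y * integral {0..c t} l" by simp
      also have "\<dots> \<le> dist x y * integral {0..T} l"
        using cT[of t] l0 by (intro mult_left_mono integral_subset_le li) auto
      also have "\<dots> \<le> dist x y * (1/2)" using T by (intro mult_left_mono) auto
      finally have "norm (P x t - P y t) \<le> 1/2 * dist x y"
        using Fi[OF cT[of t]] by (simp add: P_def integral_diff)
      then show "dist (apply_bcontfun (Bcontfun (P x)) t) (apply_bcontfun (Bcontfun (P y)) t) \<le> 1/2 * dist x y"
        by (simp add: Bcontfun_inverse PB x y dist_norm)
    qed
  qed auto
  then obtain x where xX: "x \<in> X" and fx: "Bcontfun (P x) = x" by blast
  have xP: "apply_bcontfun x t = P x t" for t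
    using Bcontfun_inverse[OF PB[OF xX]] fx by metis
  define y where "y t = (if t \<le> 0 then \<phi> t else apply_bcontfun x t)" for t
  have x0: "apply_bcontfun x 0 = \<phi> 0" using T by (simp add: xP P_def c_def)
  have "integral_solution g \<phi> T y"
    unfolding integral_solution_def
  proof (intro conjI ballI)
    have "{-1..T} = {-1..0} \<union> {0..T}" using T by auto
    then show "continuous_on {-1..T} y"
      unfolding y_def using x0
      by (auto intro!: continuous_on_If \<phi> intro: continuous_on_subset[OF _ subset_UNIV])
    show "y t = \<phi> 0 + integral {0..t} (\<lambda>s. g s (y s, y (s - 1)))" if t: "t \<in> {0..T}" for t
    proof -
      have "y t = P x t" using t x0 xP[of t] xP[of 0] by (auto simp: y_def)
      also have "\<dots> = \<phi> 0 + integral {0..t} (F x)" using t by (simp add: P_def c_def)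
      also have "integral {0..t} (F x) = integral {0..t} (\<lambda>s. g s (y s, y (s - 1)))"
      proof (rule integral_cong)
        fix s assume s: "s \<in> {0..t}"
        then have "y s = apply_bcontfun x s" "y (s - 1) = \<phi> (s - 1)"
          using x0 t T by (auto simp: y_def)
        then show "F x s = g s (y s, y (s - 1))" by (simp add: F_def)
      qed
      finally show ?thesis .
    qed
  qed (use T in \<open>auto simp: y_def\<close>)
  then show ?thesis using T by blast
qed

lemma integral_solution_glue:
  fixes g :: "('v::euclidean_space) delay_field"
  assumes g: "g \<in> LC 1" and x: "integral_solution g \<phi> s x"
    and y: "integral_solution (translate s g) \<psi> T y" and \<psi>: "\<And>u. u \<in> {-1..0} \<Longrightarrow> \<psi> u = x (s + u)"
  shows "integral_solution g \<phi> (s + T) (\<lambda>t. if t \<le> s then x t else y (t - s))"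
proof -
  define z where "z t = (if t \<le> s then x t else y (t - s))" for t
  note xD = integral_solutionD[OF x] and yD = integral_solutionD[OF y]
  \<comment> \<open>On {s-1..s} both branches agree through the history \<psi>; hence z is a shift
    of y also at the delayed times u - 1 belonging to u > s.\<close>
  have zy: "z t = y (t - s)" if "t \<in> {s-1..s+T}" for t
    using yD(3)[of "t - s"] \<psi>[of "t - s"] that by (auto simp: z_def)
  have "integral_solution g \<phi> (s + T) z"
    unfolding integral_solution_def
  proof (intro conjI ballI)
    have "{-1..s+T} = {-1..s} \<union> {s..s+T}" using xD(1) yD(1) by auto
    moreover have "continuous_on {s..s+T} (\<lambda>t. y (t - s))"
      by (intro continuous_on_compose2[OF yD(2)] continuous_intros) auto
    moreover have "x s = y (s - s)" using yD(3)[of 0] \<psi>[of 0] by simp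
    ultimately show zc: "continuous_on {-1..s+T} z"
      unfolding z_def using xD(2) by (auto intro!: continuous_on_If)
    show "z t = \<phi> t" if "t \<in> {-1..0}" for t using that xD by (auto simp: z_def)
    fix t assume t: "t \<in> {0..s+T}"
    show "z t = \<phi> 0 + integral {0..t} (\<lambda>u. g u (z u, z (u - 1)))"
    proof (cases "t \<le> s")
      case True
      have "integral {0..t} (\<lambda>u. g u (z u, z (u - 1))) = integral {0..t} (\<lambda>u. g u (x u, x (u - 1)))"
        using True by (intro integral_cong) (auto simp: z_def)
      then show ?thesis using xD(4)[of t] True t by (simp add: z_def)
    next
      case False
      have i1: "integral {0..s} (\<lambda>u. g u (z u, z (u - 1))) = integral {0..s} (\<lambda>u. g u (x u, x (u - 1)))"
        by (intro integral_cong) (auto simp: z_def)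
      have "integral {0..t-s} (\<lambda>u. translate s g u (y u, y (u - 1)))
          = integral {0..t-s} (\<lambda>u. g (u + s) (z (u + s), z (u + s - 1)))"
      proof (intro integral_cong)
        fix u assume "u \<in> {0..t-s}"
        then have "z (u + s) = y u" "z (u + s - 1) = y (u - 1)"
          using zy[of "u + s"] zy[of "u + s - 1"] t by (auto simp: algebra_simps)
        then show "translate s g u (y u, y (u - 1)) = g (u + s) (z (u + s), z (u + s - 1))"
          by (simp add: translate_def)
      qed
      also have "\<dots> = integral {s..t} (\<lambda>u. g u (z u, z (u - 1)))"
        using integral_shift_real[of 0 "t - s" "\<lambda>u. g u (z u, z (u - 1))" s] by simp
      finally have i2: "integral {s..t} (\<lambda>u. g u (z u, z (u - 1))) =
          integral {0..t-s} (\<lambda>u. translate s g u (y u, y (u - 1)))" by simp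
      have "integral {0..s} (\<lambda>u. g u (z u, z (u - 1))) + integral {s..t} (\<lambda>u. g u (z u, z (u - 1)))
          = integral {0..t} (\<lambda>u. g u (z u, z (u - 1)))"
        using False t xD(1)
        by (intro Henstock_Kurzweil_Integration.integral_combine delay_pair_integrable(2)[OF g zc]) auto
      moreover have "z t = \<psi> 0 + integral {0..t-s} (\<lambda>u. translate s g u (y u, y (u - 1)))"
        using yD(4)[of "t - s"] False t by (simp add: z_def)
      moreover have "\<psi> 0 = \<phi> 0 + integral {0..s} (\<lambda>u. g u (x u, x (u - 1)))"
        using \<psi>[of 0] xD(4)[of s] xD(1) by simp
      ultimately show ?thesis using i1 i2 by (simp add: algebra_simps)
    qed
  qed (use xD yD in auto)
  then show ?thesis by (simp add: z_def[abs_def])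
qed

text \<open>Restart at T with the last unit of the solution as history. Hence no solution on a
  closed interval is the longest one, and lifetimes are half open.\<close>

lemma integral_solution_extend:
  fixes g :: "('v::euclidean_space) delay_field"
  assumes g: "g \<in> LC 1" and x: "integral_solution g \<phi> T x"
  shows "\<exists>T'>T. \<exists>y. integral_solution g \<phi> T' y"
proof -
  have "continuous_on {-1..0} (\<lambda>u. x (T + u))"
    using integral_solutionD(1)[OF x]
    by (intro continuous_on_compose2[OF integral_solutionD(2)[OF x]] continuous_intros) auto
  then obtain S y where "S > 0" "integral_solution (translate T g) (\<lambda>u. x (T + u)) S y"
    using local_solution[OF LC_translate[OF g, of T]] by blast
  then show ?thesis
    using integral_solution_glue[OF g x, of "\<lambda>u. x (T + u)" S y] by (intro exI[of _ "T + S"]) auto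
qed

text \<open>Along a bounded solution the m-bound of g makes the right-hand side integrable up to the
  end point, so the integral equation itself defines the value at b.\<close>

lemma integral_solution_closed_end:
  fixes g :: "('v::euclidean_space) delay_field"
  assumes g: "g \<in> LC 1" and b: "0 < b"
    and x: "\<And>T. 0 \<le> T \<Longrightarrow> T < b \<Longrightarrow> integral_solution g \<phi> T x"
    and R: "\<And>t. -1 \<le> t \<Longrightarrow> t < b \<Longrightarrow> norm (x t) \<le> R"
  shows "\<exists>y. integral_solution g \<phi> b y"
proof -
  \<comment> \<open>Cutting x off by 0 gives a bounded Borel function on the whole line, although x
    is controlled only before b.\<close>
  define xb where "xb t = indicator {-1..<b} t *\<^sub>R x t" for t
  have xeq: "xb t = x t" if "t \<in> {-1..<b}" for t using that by (simp add: xb_def)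
  have "continuous_on (life_interval (ereal b)) x"
    using x b by (intro continuous_on_life_interval) (auto intro: integral_solutionD(2))
  moreover have "life_interval (ereal b) = {-1..<b}" by (auto simp: life_interval_def)
  ultimately have xbm: "xb \<in> borel_measurable borel"
    unfolding xb_def by (intro borel_measurable_continuous_on_indicator) auto
  have "0 \<le> R" using R[of 0] b norm_ge_zero[of "x 0"] by linarith
  then have xbR: "norm (xb t) \<le> R" for t
    using R[of t] by (cases "t \<in> {-1..<b}") (auto simp: xb_def)
  define F where "F s = g s (xb s, xb (s - 1))" for s
  have Fi: "F integrable_on {0..b}"
  proof -
    have "(\<lambda>s. (xb s, xb (s - 1))) \<in> borel_measurable borel" using xbm by measurable
    then have "F absolutely_integrable_on {0..b}"
      unfolding F_def
      by (rule LC_comp_integrable[OF g borel_measurable_lebesgue_on, where R="2 * R"])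
        (use norm_Pair_le_add xbR in \<open>smt (verit)\<close>)
    then show ?thesis by (simp add: absolutely_integrable_on_def)
  qed
  define y where "y t = (if t \<le> 0 then \<phi> t else \<phi> 0 + integral {0..t} F)" for t
  have yx: "y t = x t" if t: "t \<in> {-1..<b}" for t
  proof (cases "t \<le> 0")
    case True
    then show ?thesis using integral_solutionD(3)[OF x[of 0], of t] b t by (simp add: y_def)
  next
    case False
    have "integral {0..t} F = integral {0..t} (\<lambda>s. g s (x s, x (s - 1)))"
      using t by (intro integral_cong) (auto simp: F_def xeq)
    then show ?thesis using integral_solutionD(4)[OF x[of t], of t] False t by (simp add: y_def)
  qed
  have "integral_solution g \<phi> b y"
    unfolding integral_solution_def
  proof (intro conjI ballI)
    have "{-1..b} = {-1..0} \<union> {0..b}" using b by auto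
    moreover have "continuous_on {-1..0} \<phi>"
      using integral_solutionD(2,3)[OF x[of 0]] b continuous_on_cong[of "{-1..0}" "{-1..0}" \<phi> x] by simp
    ultimately show "continuous_on {-1..b} y"
      unfolding y_def
      by (auto intro!: continuous_on_If continuous_intros indefinite_integral_continuous_1 Fi)
    show "y t = \<phi> 0 + integral {0..t} (\<lambda>s. g s (y s, y (s - 1)))" if t: "t \<in> {0..b}" for t
    proof -
      have "integral {0..t} F = integral {0..t} (\<lambda>s. g s (y s, y (s - 1)))"
        by (rule integral_spike[of "{b}"]) (use t in \<open>auto simp: F_def xeq yx\<close>)
      then show ?thesis by (cases "t = 0") (use t in \<open>auto simp: y_def\<close>)
    qed
  qed (use b in \<open>auto simp: y_def\<close>)
  then show ?thesis by blast
qed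

text \<open>Stronger in form than \<open>maximal_solution\<close>: every integral solution, not only
  an extension of x, has to end before b. In this form maximality depends on g only through its
  integral solutions and matches a supremum of horizons.\<close>

definition maximal_integral_solution ::
    "('v::euclidean_space) delay_field \<Rightarrow> (real \<Rightarrow> 'v) \<Rightarrow> ereal \<Rightarrow> (real \<Rightarrow> 'v) \<Rightarrow> bool" where
  "maximal_integral_solution g \<phi> b x \<longleftrightarrow> 0 < b \<and> x \<in> extensional (life_interval b) \<and>
     (\<forall>T\<ge>0. ereal T < b \<longrightarrow> integral_solution g \<phi> T x) \<and>
     (\<forall>T y. integral_solution g \<phi> T y \<longrightarrow> ereal T < b)"

lemma maximal_integral_solution_ex:
  fixes g :: "('v::euclidean_space) delay_field"
  assumes g: "g \<in> LC 1" and \<phi>: "continuous_on {-1..0} \<phi>"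
  shows "\<exists>b x. maximal_integral_solution g \<phi> b x"
proof -
  define S where "S = {T. \<exists>y. integral_solution g \<phi> T y}"
  define b where "b = (SUP T\<in>S. ereal T)"
  have up: "ereal T < b" if T: "T \<in> S" for T
  proof -
    obtain T' where "T' > T" "T' \<in> S"
      using T integral_solution_extend[OF g] unfolding S_def by blast
    then have "ereal T' \<le> b" unfolding b_def by (intro SUP_upper)
    with \<open>T' > T\<close> show ?thesis by (simp add: less_le_trans[of "ereal T" "ereal T'"])
  qed
  have down: "T \<in> S" if T: "0 \<le> T" "ereal T < b" for T
  proof -
    obtain T' where "T' \<in> S" "T < T'" using T(2) unfolding b_def less_SUP_iff by auto
    then show ?thesis using integral_solution_mono[of g \<phi> T' _ T] T(1) unfolding S_def by auto
  qed
  obtain T0 where "T0 > 0" "T0 \<in> S" using local_solution[OF g \<phi>] unfolding S_def by blast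
  with up[of T0] have b0: "0 < b" by (meson ereal_less(2) less_trans)
  define X where "X T = (SOME y. integral_solution g \<phi> T y)" for T
  have X: "integral_solution g \<phi> T (X T)" if "T \<in> S" for T
  proof -
    have "\<exists>y. integral_solution g \<phi> T y" using that by (simp add: S_def)
    then show ?thesis unfolding X_def by (rule someI_ex)
  qed
  \<comment> \<open>At time t the solution chosen for the horizon max t 0 is evaluated; uniqueness
    makes the choices for different horizons agree.\<close>
  define x where "x t = (if t \<in> life_interval b then X (max t 0) t else undefined)" for t
  have xX: "x t = X T t" if T: "T \<in> S" "t \<in> {-1..T}" for T t
  proof -
    have T0: "0 \<le> T" using integral_solutionD(1)[OF X[OF T(1)]] .
    have "max t 0 \<in> S" using T T0 integral_solution_mono[OF X[OF T(1)], of "max t 0"] unfolding S_def by auto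
    then have "X (max t 0) t = X T t"
      using T T0 by (intro integral_solution_unique[OF g X[OF T(1)] X]) auto
    moreover have "t \<in> life_interval b"
      using T up[OF T(1)] by (auto simp: life_interval_def intro: le_less_trans[of "ereal t" "ereal T" b])
    ultimately show ?thesis by (simp add: x_def)
  qed
  have "maximal_integral_solution g \<phi> b x"
    unfolding maximal_integral_solution_def
  proof (intro conjI allI impI)
    show "x \<in> extensional (life_interval b)" by (simp add: x_def extensional_def)
    show "integral_solution g \<phi> T x" if "0 \<le> T" "ereal T < b" for T
      by (rule integral_solution_cong[OF X[OF down[OF that]]]) (use xX[OF down[OF that]] in auto)
    show "ereal T < b" if "integral_solution g \<phi> T y" for T y
      using that by (intro up) (auto simp: S_def)
  qed (fact b0)
  then show ?thesis by blast
qed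

lemma maximal_integral_solution_le:
  assumes x: "maximal_integral_solution g \<phi> b x"
    and c: "\<And>T. 0 \<le> T \<Longrightarrow> ereal T < c \<Longrightarrow> integral_solution g \<phi> T y"
  shows "c \<le> b"
proof (rule ccontr)
  assume "\<not> c \<le> b"
  then obtain T where T: "b < ereal T" "ereal T < c" using ereal_dense2 by (metis not_le)
  have "0 < b" using x by (simp add: maximal_integral_solution_def)
  then have "0 < ereal T" using T(1) by (rule less_trans)
  then have "integral_solution g \<phi> T y" using c T(2) by simp
  then have "ereal T < b" using x unfolding maximal_integral_solution_def by blast
  with T show False by simp
qed

lemma maximal_integral_solution_unique:
  assumes g: "g \<in> LC 1" and x: "maximal_integral_solution g \<phi> b x" and y: "maximal_integral_solution g \<phi> c y"
  shows "b = c \<and> x = y"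
proof -
  have bc: "b = c"
    using maximal_integral_solution_le[OF x, of c y] maximal_integral_solution_le[OF y, of b x] x y
    unfolding maximal_integral_solution_def by (intro antisym) auto
  have "x = y"
  proof (rule extensionalityI[of _ "life_interval b"])
    fix t assume t: "t \<in> life_interval b"
    then have m: "ereal (max t 0) < b"
      using x by (auto simp: life_interval_def max_def maximal_integral_solution_def zero_ereal_def)
    show "x t = y t"
      by (rule integral_solution_unique[OF g, of \<phi> "max t 0" y "max t 0" x])
        (use x y m bc t in \<open>auto simp: maximal_integral_solution_def life_interval_def\<close>)
  qed (use x y bc in \<open>auto simp: maximal_integral_solution_def\<close>)
  with bc show ?thesis by simp
qed

text \<open>For the nontrivial direction x is compared with a solution y that is maximal in the
  strong sense: y extends x by uniqueness, so maximality of x forces equal lifetimes, and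
  extensionality equal functions.\<close>

lemma maximal_solution_iff:
  fixes g :: "('v::euclidean_space) delay_field"
  assumes g: "g \<in> LC 1" and \<phi>: "continuous_on {-1..0} \<phi>"
  shows "x \<in> extensional (life_interval b) \<and> maximal_solution g \<phi> b x \<longleftrightarrow> maximal_integral_solution g \<phi> b x"
proof
  assume x: "maximal_integral_solution g \<phi> b x"
  then have "caratheodory_solution g \<phi> b x"
    by (simp add: caratheodory_solution_iff[OF g] maximal_integral_solution_def)
  moreover have "c = b" if "caratheodory_solution g \<phi> c y" "b \<le> c" for c y
    using maximal_integral_solution_le[OF x, of c y] that by (auto simp: caratheodory_solution_iff[OF g])
  ultimately show "x \<in> extensional (life_interval b) \<and> maximal_solution g \<phi> b x"
    using x unfolding maximal_solution_def maximal_integral_solution_def by blast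
next
  assume x: "x \<in> extensional (life_interval b) \<and> maximal_solution g \<phi> b x"
  then have cx: "0 < b" "\<And>T. 0 \<le> T \<Longrightarrow> ereal T < b \<Longrightarrow> integral_solution g \<phi> T x"
    by (auto simp: maximal_solution_def caratheodory_solution_iff[OF g])
  obtain c y where y: "maximal_integral_solution g \<phi> c y"
    using maximal_integral_solution_ex[OF g \<phi>] by blast
  have bc: "b \<le> c" using maximal_integral_solution_le[OF y cx(2)] .
  have eq: "y t = x t" if t: "t \<in> life_interval b" for t
  proof -
    have m: "ereal (max t 0) < b"
      using t cx(1) by (auto simp: life_interval_def max_def zero_ereal_def)
    then have "ereal (max t 0) < c" using bc by (rule less_le_trans)
    then show ?thesis
      using y t cx(2)[OF _ m] unfolding maximal_integral_solution_def
      by (intro integral_solution_unique[OF g, of \<phi> "max t 0" x "max t 0" y]) (auto simp: life_interval_def)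
  qed
  have "caratheodory_solution g \<phi> c y"
    using y by (simp add: caratheodory_solution_iff[OF g] maximal_integral_solution_def)
  then have "c = b" using x bc eq unfolding maximal_solution_def by blast
  moreover have "y = x"
    by (rule extensionalityI[of _ "life_interval b"])
      (use x y eq \<open>c = b\<close> in \<open>auto simp: maximal_integral_solution_def\<close>)
  ultimately show "maximal_integral_solution g \<phi> b x" using y by simp
qed

section \<open>Solutions attached to classes and the semigroup identity\<close>

text \<open>Representatives of one class have the same integral solutions, hence the same maximal
  one; this makes the definite description in \<open>max_sol\<close> denote.\<close>

lemma max_sol_maximal:
  fixes G :: "('v::euclidean_space) delay_field set"
  assumes p: "1 \<le> p" and G: "G \<in> LC_classes p" and gG: "g \<in> G" and \<phi>: "continuous_on {-1..0} \<phi>"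
  shows "maximal_integral_solution g \<phi> (fst (max_sol G \<phi>)) (sol G \<phi>)"
proof -
  have LC1: "h \<in> LC 1" if "h \<in> G" for h
    using LC_classes_member(1)[OF G that] LC_mono[OF p] by blast
  have ae: "maximal_integral_solution h \<phi> b x \<longleftrightarrow> maximal_integral_solution g \<phi> b x" if "h \<in> G" for h b x
  proof -
    have "ae_eq h g"
      using LC_classes_member(2)[OF G that] gG by (auto simp: mem_LC_class)
    from integral_solution_ae_eq[OF this] show ?thesis by (simp add: maximal_integral_solution_def)
  qed
  have iff: "(x \<in> extensional (life_interval b) \<and> (\<forall>h\<in>G. maximal_solution h \<phi> b x)) \<longleftrightarrow> maximal_integral_solution g \<phi> b x" for b x
    using maximal_solution_iff[OF LC1 \<phi>] ae gG by blast
  obtain b x where bx: "maximal_integral_solution g \<phi> b x"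
    using maximal_integral_solution_ex[OF LC1[OF gG] \<phi>] by blast
  have "max_sol G \<phi> = (THE (b, x). maximal_integral_solution g \<phi> b x)"
    unfolding max_sol_def iff ..
  also have "\<dots> = (b, x)"
  proof (rule the_equality)
    fix q assume "case q of (c, y) \<Rightarrow> maximal_integral_solution g \<phi> c y"
    then have "maximal_integral_solution g \<phi> (fst q) (snd q)" by (simp add: split_def)
    from maximal_integral_solution_unique[OF LC1[OF gG] this bx] show "q = (b, x)"
      by (simp add: prod_eq_iff)
  qed (use bx in simp)
  finally show ?thesis using bx by (simp add: sol_def)
qed

lemma mspace_history_space:
  "\<phi> \<in> mspace (history_space :: (real \<Rightarrow> 'v::euclidean_space) metric) \<longleftrightarrow>
    \<phi> \<in> extensional {-1..0} \<and> continuous_on {-1..0} \<phi>"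
proof -
  have "bounded (\<phi> ` {-1..0})" if "continuous_on {-1..0} \<phi>"
    using that by (intro compact_imp_bounded compact_continuous_image) auto
  then show ?thesis by (auto simp: history_space_def)
qed

lemma mdist_history_le:
  fixes \<phi> \<psi> :: "real \<Rightarrow> 'v::euclidean_space"
  assumes "\<phi> \<in> mspace history_space" "\<psi> \<in> mspace history_space"
  shows "mdist history_space \<phi> \<psi> \<le> a \<longleftrightarrow> (\<forall>t\<in>{-1..0}. norm (\<psi> t - \<phi> t) \<le> a)"
  using cfunspace_mdist_le[of \<phi> "top_of_set {-1..0}" euclidean_metric \<psi> a] assms
  by (simp add: history_space_def dist_norm norm_minus_commute)

text \<open>Reduces lifetimes to the existence of a solution on a closed interval, for any one
  representative of the class.\<close>

lemma sol_interval_iff: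
  fixes G :: "('v::euclidean_space) delay_field set"
  assumes "1 \<le> p" "G \<in> LC_classes p" "g \<in> G" "\<phi> \<in> mspace history_space" "0 \<le> t"
  shows "t \<in> sol_interval G \<phi> \<longleftrightarrow> (\<exists>y. integral_solution g \<phi> t y)"
    and "t \<in> sol_interval G \<phi> \<Longrightarrow> integral_solution g \<phi> t (sol G \<phi>)"
  using max_sol_maximal[OF assms(1-3), of \<phi>] assms(4,5)
  unfolding mspace_history_space maximal_integral_solution_def sol_interval_def life_interval_def
  by auto

lemma sol_eqI:
  fixes G :: "('v::euclidean_space) delay_field set"
  assumes "1 \<le> p" "G \<in> LC_classes p" "g \<in> G" "\<phi> \<in> mspace history_space"
    and y: "integral_solution g \<phi> T y" and t: "t \<in> {-1..T}"
  shows "sol G \<phi> t = y t"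
proof -
  have T: "0 \<le> T" using y by (rule integral_solutionD)
  have g: "g \<in> LC 1" using LC_mono[OF assms(1)] LC_classes_member(1)[OF assms(2,3)] by blast
  have "T \<in> sol_interval G \<phi>" using sol_interval_iff(1)[OF assms(1-4) T] y by blast
  then have "integral_solution g \<phi> T (sol G \<phi>)" by (rule sol_interval_iff(2)[OF assms(1-4) T])
  then show ?thesis by (rule integral_solution_unique[OF g y]) (use t in auto)
qed

lemma translate_LC_classes:
  assumes "G \<in> LC_classes p" "g \<in> G"
  shows "translate t ` G \<in> LC_classes p" "translate t g \<in> translate t ` G"
  using LC_classes_member[OF assms] translate_LC_class[of g p t] LC_class_in[OF LC_translate[of g p t]] assms(2)
  by auto

text \<open>The solution up to s and the solution of the translated equation started from the
  history at s are glued; uniqueness identifies the result with \<open>sol G \<phi>\<close>.\<close>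

lemma flow_semigroup:
  fixes G :: "('v::euclidean_space) delay_field set"
  assumes p: "1 \<le> p" and G: "G \<in> LC_classes p" and \<phi>: "\<phi> \<in> mspace history_space"
    and s: "0 \<le> s" "s \<in> sol_interval G \<phi>"
    and \<psi>: "\<psi> = restrict (\<lambda>u. sol G \<phi> (s + u)) {-1..0}"
    and t: "0 \<le> t" "t \<in> sol_interval (translate s ` G) \<psi>"
  shows "t + s \<in> sol_interval G \<phi>"
    and "\<And>u. u \<in> {-1..0} \<Longrightarrow> sol G \<phi> (t + s + u) = sol (translate s ` G) \<psi> (t + u)"
    and "\<psi> \<in> mspace history_space"
proof -
  obtain g where gG: "g \<in> G" using LC_classes_ex[OF G] by blast
  have g: "g \<in> LC 1" using LC_mono[OF p] LC_classes_member(1)[OF G gG] by blast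
  have x: "integral_solution g \<phi> s (sol G \<phi>)" using sol_interval_iff(2)[OF p G gG \<phi> s] .
  have "continuous_on {-1..0} (\<lambda>u. sol G \<phi> (s + u))"
    using s by (intro continuous_on_compose2[OF integral_solutionD(2)[OF x]] continuous_intros) auto
  then show \<psi>m: "\<psi> \<in> mspace history_space"
    unfolding mspace_history_space \<psi> by (auto intro: continuous_on_eq)
  note sg = translate_LC_classes[OF G gG, of s]
  have y: "integral_solution (translate s g) \<psi> t (sol (translate s ` G) \<psi>)"
    using sol_interval_iff(2)[OF p sg \<psi>m t] .
  have z: "integral_solution g \<phi> (s + t) (\<lambda>u. if u \<le> s then sol G \<phi> u else sol (translate s ` G) \<psi> (u - s))"
    by (rule integral_solution_glue[OF g x y]) (simp add: \<psi>)
  show "t + s \<in> sol_interval G \<phi>"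
    using sol_interval_iff(1)[OF p G gG \<phi>, of "t + s"] s t z by (auto simp: add.commute)
  fix u :: real assume u: "u \<in> {-1..0}"
  have "sol G \<phi> (t + s + u) = (if t + s + u \<le> s then sol G \<phi> (t + s + u) else sol (translate s ` G) \<psi> (t + s + u - s))"
    using sol_eqI[OF p G gG \<phi> z, of "t + s + u"] u s t by simp
  also have "\<dots> = sol (translate s ` G) \<psi> (t + u)"
    using integral_solutionD(3)[OF y, of "t + u"] u t by (auto simp: \<psi> algebra_simps)
  finally show "sol G \<phi> (t + s + u) = sol (translate s ` G) \<psi> (t + u)" .
qed

section \<open>Continuous dependence on equation and history\<close>

lemma first_exit:
  fixes u :: "real \<Rightarrow> real"
  assumes u: "continuous_on {a..b} u" and a: "u a < R" and ex: "\<exists>t\<in>{a..b}. R < u t"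
  shows "\<exists>t\<in>{a..b}. u t = R \<and> (\<forall>s\<in>{a..t}. u s \<le> R)"
proof -
  define C where "C = {a..b} \<inter> u -` {R..}"
  have C: "closed C" unfolding C_def by (rule continuous_closed_preimage[OF u]) auto
  have ne: "C \<noteq> {}" using ex by (auto simp: C_def)
  have bb: "bdd_below C" by (rule bdd_belowI[of _ a]) (auto simp: C_def)
  have t: "Inf C \<in> C" by (rule closed_contains_Inf[OF ne bb C])
  have lt: "u s < R" if "s \<in> {a..<Inf C}" for s
  proof (rule ccontr)
    assume "\<not> u s < R"
    then have "s \<in> C" using that t by (auto simp: C_def)
    then show False using cInf_lower[OF _ bb] that by fastforce
  qed
  \<comment> \<open>At the infimum only u \<ge> R is known. The intermediate value theorem yields a
    point with equality, and by the strict bound before \<open>Inf C\<close> this point is the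
    infimum.\<close>
  have "\<exists>s\<ge>a. s \<le> Inf C \<and> u s = R"
    using t a by (intro IVT') (auto simp: C_def intro: continuous_on_subset[OF u])
  then obtain s where s: "a \<le> s" "s \<le> Inf C" "u s = R" by blast
  then have "s = Inf C" using lt[of s] by force
  moreover have "u v \<le> R" if "v \<in> {a..Inf C}" for v
    using lt[of v] that calculation s by (cases "v = Inf C") auto
  ultimately show ?thesis
    using s t by (intro bexI[of _ "Inf C"]) (auto simp: C_def)
qed

text \<open>The error is only controlled along solutions inside the ball of radius \<open>R\<close>; a first exit argument
  shows that these solutions do not leave it.\<close>

lemma solution_perturbation:
  fixes g :: "('v::euclidean_space) delay_field"
  assumes g: "g \<in> LC 1" and x: "integral_solution g \<phi> T x"
  shows "\<exists>R. \<forall>\<epsilon>>0. \<exists>\<eta>>0. \<forall>h\<in>LC 1. \<forall>\<psi>. continuous_on {-1..0} \<psi> \<longrightarrow>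
    (\<forall>t\<in>{-1..0}. norm (\<psi> t - \<phi> t) \<le> \<eta>) \<longrightarrow>
    (\<forall>S y. S \<le> T \<longrightarrow> integral_solution h \<psi> S y \<longrightarrow> (\<forall>t\<in>{-1..S}. norm (y t) \<le> R) \<longrightarrow>
      norm (integral {0..S} (\<lambda>s. h s (y s, y (s - 1)) - g s (y s, y (s - 1)))) \<le> \<eta>) \<longrightarrow>
    (\<exists>y. integral_solution h \<psi> T y \<and> (\<forall>t\<in>{-1..T}. norm (y t - x t) \<le> \<epsilon>))"
proof -
  have T: "0 \<le> T" using x by (rule integral_solutionD)
  have "bounded (x ` {-1..T})"
    using integral_solutionD(2)[OF x] by (intro compact_imp_bounded compact_continuous_image) auto
  then obtain B where B: "\<And>t. t \<in> {-1..T} \<Longrightarrow> norm (x t) \<le> B"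
    unfolding bounded_iff by blast
  \<comment> \<open>One unit of room between x and the sphere of radius R. R is fixed before
    \<epsilon>, because the error condition imposed on h refers to it.\<close>
  define R where "R = B + 1"
  have "\<forall>t\<in>{-1..T}. norm (x t) \<le> R" using B by (force simp: R_def)
  from solution_estimate[OF g x this] obtain A where A: "A \<ge> 1" and est:
    "\<forall>S y e. 0 \<le> S \<longrightarrow> S \<le> T \<longrightarrow> continuous_on {-1..S} y \<longrightarrow>
      (\<forall>t\<in>{-1..S}. norm (y t) \<le> R) \<longrightarrow>
      (\<forall>t\<in>{-1..0}. norm (y t - x t) \<le> e) \<longrightarrow>
      (\<forall>t\<in>{0..S}. norm (y t - y 0 - integral {0..t} (\<lambda>s. g s (y s, y (s - 1)))) \<le> e) \<longrightarrow>
      (\<forall>t\<in>{-1..S}. norm (y t - x t) \<le> A * e)" by (elim exE conjE)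
  show ?thesis
  proof (rule exI[of _ R], intro allI impI)
    fix \<epsilon> :: real assume \<epsilon>: "\<epsilon> > 0"
    \<comment> \<open>A * \<eta> \<le> 1/2 keeps y away from the sphere of radius R as long as it
      can be compared with x, and \<eta> \<le> 1/2 does the same for its history.\<close>
    define \<eta> where "\<eta> = min \<epsilon> (1/2) / A"
    have \<eta>: "\<eta> > 0" "A * \<eta> \<le> \<epsilon>" "A * \<eta> \<le> 1/2" "\<eta> \<le> 1/2"
    proof -
      show "\<eta> > 0" "A * \<eta> \<le> \<epsilon>" "A * \<eta> \<le> 1/2" using A \<epsilon> by (auto simp: \<eta>_def)
      have "\<eta> \<le> A * \<eta>" using A \<open>\<eta> > 0\<close> by simp
      with \<open>A * \<eta> \<le> 1/2\<close> show "\<eta> \<le> 1/2" by simp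
    qed
    show "\<exists>\<eta>>0. \<forall>h\<in>LC 1. \<forall>\<psi>. continuous_on {-1..0} \<psi> \<longrightarrow>
      (\<forall>t\<in>{-1..0}. norm (\<psi> t - \<phi> t) \<le> \<eta>) \<longrightarrow>
      (\<forall>S y. S \<le> T \<longrightarrow> integral_solution h \<psi> S y \<longrightarrow> (\<forall>t\<in>{-1..S}. norm (y t) \<le> R) \<longrightarrow>
        norm (integral {0..S} (\<lambda>s. h s (y s, y (s - 1)) - g s (y s, y (s - 1)))) \<le> \<eta>) \<longrightarrow>
      (\<exists>y. integral_solution h \<psi> T y \<and> (\<forall>t\<in>{-1..T}. norm (y t - x t) \<le> \<epsilon>))"
    proof (intro exI[of _ \<eta>] conjI ballI allI impI)
      fix h :: "'v delay_field" and \<psi>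
      assume h: "h \<in> LC 1" and \<psi>: "continuous_on {-1..0} \<psi>"
        and \<psi>\<phi>: "\<forall>t\<in>{-1..0}. norm (\<psi> t - \<phi> t) \<le> \<eta>"
        and err: "\<forall>S y. S \<le> T \<longrightarrow> integral_solution h \<psi> S y \<longrightarrow> (\<forall>t\<in>{-1..S}. norm (y t) \<le> R) \<longrightarrow>
          norm (integral {0..S} (\<lambda>s. h s (y s, y (s - 1)) - g s (y s, y (s - 1)))) \<le> \<eta>"
      have close: "\<forall>t\<in>{-1..S}. norm (y t - x t) \<le> A * \<eta>"
        if S: "S \<le> T" and y: "integral_solution h \<psi> S y" and yR: "\<forall>t\<in>{-1..S}. norm (y t) \<le> R" for S y
      proof (rule est[rule_format, THEN ballI])
        note yD = integral_solutionD[OF y]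
        show "0 \<le> S" "continuous_on {-1..S} y" by (rule yD)+
        show "S \<le> T" by fact
        show "norm (y t) \<le> R" if "t \<in> {-1..S}" for t using yR that by blast
        show "norm (y t - x t) \<le> \<eta>" if "t \<in> {-1..0}" for t
          using \<psi>\<phi> yD(3)[OF that] integral_solutionD(3)[OF x that] that by simp
        fix t assume t: "t \<in> {0..S}"
        then have yt: "integral_solution h \<psi> t y" using integral_solution_mono[OF y, of t] by simp
        have "norm (integral {0..t} (\<lambda>s. h s (y s, y (s - 1)) - g s (y s, y (s - 1)))) \<le> \<eta>"
          using err[rule_format, OF _ yt] t S yR by auto
        moreover have "integral {0..t} (\<lambda>s. h s (y s, y (s - 1)) - g s (y s, y (s - 1)))
            = integral {0..t} (\<lambda>s. h s (y s, y (s - 1))) - integral {0..t} (\<lambda>s. g s (y s, y (s - 1)))"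
          using t by (intro integral_diff delay_pair_integrable(2)[OF h yD(2)] delay_pair_integrable(2)[OF g yD(2)]) auto
        ultimately show "norm (y t - y 0 - integral {0..t} (\<lambda>s. g s (y s, y (s - 1)))) \<le> \<eta>"
          using yD(4)[OF t] yD(3)[of 0] by simp
      qed
      obtain b y where ymax: "maximal_integral_solution h \<psi> b y"
        using maximal_integral_solution_ex[OF h \<psi>] by blast
      have ysol: "integral_solution h \<psi> S y" if "0 \<le> S" "ereal S < b" for S
        using ymax that by (simp add: maximal_integral_solution_def)
      have bound: "\<forall>t\<in>{-1..S}. norm (y t) \<le> R" if S: "0 \<le> S" "ereal S < b" "S \<le> T" for S
      proof (rule ccontr)
        assume neg: "\<not> (\<forall>t\<in>{-1..S}. norm (y t) \<le> R)"
        note y = ysol[OF S(1,2)]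
        note yD = integral_solutionD[OF y]
        have hist: "norm (y t) < R" if "t \<in> {-1..0}" for t
          using \<psi>\<phi>[rule_format, OF that] yD(3)[OF that] integral_solutionD(3)[OF x that] B[of t] that T \<eta>(4)
            norm_triangle_sub[of "y t" "x t"] by (auto simp: R_def)
        have "continuous_on {-1..S} (\<lambda>t. norm (y t))" using yD(2) by (intro continuous_intros)
        moreover have "\<exists>t\<in>{-1..S}. R < norm (y t)" using neg by force
        ultimately obtain t1 where t1: "t1 \<in> {-1..S}" "norm (y t1) = R" "\<forall>s\<in>{-1..t1}. norm (y s) \<le> R"
          using first_exit[of "-1" S "\<lambda>t. norm (y t)" R] hist[of "-1"] by auto
        have "t1 > 0" using hist[of t1] t1 by force
        then have "norm (y t1 - x t1) \<le> A * \<eta>"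
          using close[OF _ integral_solution_mono[OF y, of t1] t1(3)] t1(1) S by auto
        moreover have "norm (x t1) \<le> B" using B t1(1) S by auto
        ultimately show False
          using \<eta>(3) t1(2) norm_triangle_sub[of "y t1" "x t1"] by (simp add: R_def)
      qed
      \<comment> \<open>A solution bounded by R cannot stop at a finite c \<le> T: it would extend
        to the closed interval ending at c, contrary to maximality.\<close>
      have "ereal T < b"
      proof (rule ccontr)
        assume "\<not> ereal T < b"
        moreover have "0 < b" using ymax by (simp add: maximal_integral_solution_def)
        ultimately obtain c where c: "b = ereal c" "0 < c" "c \<le> T"
          by (cases b) auto
        have "\<exists>z. integral_solution h \<psi> c z"
        proof (rule integral_solution_closed_end[OF h c(2)])
          show "integral_solution h \<psi> S y" if "0 \<le> S" "S < c" for S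
            using ysol that c by simp
          show "norm (y t) \<le> R" if "-1 \<le> t" "t < c" for t
            using bound[of "max t 0"] that c by auto
        qed
        then have "ereal c < b" using ymax unfolding maximal_integral_solution_def by blast
        with c show False by simp
      qed
      with T have yT: "integral_solution h \<psi> T y" by (rule ysol)
      have "\<forall>t\<in>{-1..T}. norm (y t - x t) \<le> A * \<eta>"
        by (rule close[OF order_refl yT bound[OF T \<open>ereal T < b\<close> order_refl]])
      with yT show "\<exists>y. integral_solution h \<psi> T y \<and> (\<forall>t\<in>{-1..T}. norm (y t - x t) \<le> \<epsilon>)"
        using \<eta>(2) by (intro exI[of _ y]) force
    qed (rule \<eta>(1))
  qed
qed

section \<open>Semiflows on hulls for abstract seminorm topologies\<close>

lemma continuous_map_mtopology_ofI:
  assumes "\<And>x \<epsilon>. x \<in> topspace X \<Longrightarrow> 0 < \<epsilon> \<Longrightarrow> \<exists>U. openin X U \<and> x \<in> U \<and>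
      (\<forall>y\<in>U. h x \<in> mspace m \<and> h y \<in> mspace m \<and> mdist m (h x) (h y) < \<epsilon>)"
  shows "continuous_map X (mtopology_of m) h"
  unfolding mtopology_of_def Metric_space.continuous_map_to_metric[OF Metric_space_mspace_mdist]
    Metric_space.in_mball[OF Metric_space_mspace_mdist]
  using assms by blast

text \<open>Membership in the closure of the orbit, expressed for representatives: each finite
  family of seminorms is served by a single translate of f. Properties of f that are uniform in
  \<tau> are transferred to g through such a translate.\<close>

definition in_hull :: "nat \<Rightarrow> (('v::euclidean_space) delay_field \<Rightarrow> real) set \<Rightarrow> 'v delay_field \<Rightarrow> 'v delay_field \<Rightarrow> bool" where
  "in_hull p P f g \<longleftrightarrow> g \<in> LC p \<and>
     (\<forall>F \<epsilon>. finite F \<longrightarrow> F \<subseteq> P \<longrightarrow> 0 < \<epsilon> \<longrightarrow> (\<exists>\<tau>. \<forall>\<rho>\<in>F. \<rho> (translate \<tau> f - g) < \<epsilon>))"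

text \<open>The last two assumptions are what the concrete topologies have to supply: continuity of
  \<open>(t, g) \<mapsto> g\<^sub>t\<close>, and smallness of the error \<open>\<integral> h(s, z) - g(s, z) ds\<close> along the delay
  pairs \<open>z\<close> of bounded solutions for \<open>h\<close> when \<open>h\<close> is close to \<open>g\<close>.\<close>

locale hull_seminorms =
  fixes p :: nat and P :: "(('v::euclidean_space) delay_field \<Rightarrow> real) set" and f :: "'v delay_field"
  assumes p: "1 \<le> p" and f: "f \<in> LC p" and nonempty: "P \<noteq> {}"
    and zero: "\<rho> \<in> P \<Longrightarrow> g \<in> LC p \<Longrightarrow> \<rho> (g - g) = 0"
    and ae_cong: "\<rho> \<in> P \<Longrightarrow> g \<in> LC p \<Longrightarrow> h \<in> LC p \<Longrightarrow> ae_eq g h \<Longrightarrow> \<rho> g = \<rho> h"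
    and triangle: "\<rho> \<in> P \<Longrightarrow> g \<in> LC p \<Longrightarrow> h \<in> LC p \<Longrightarrow> k \<in> LC p \<Longrightarrow> \<rho> (g - h) \<le> \<rho> (g - k) + \<rho> (k - h)"
    and translation: "in_hull p P f g \<Longrightarrow> \<rho> \<in> P \<Longrightarrow> 0 < \<epsilon> \<Longrightarrow> \<exists>F \<delta>. finite F \<and> F \<subseteq> P \<and> 0 < \<delta> \<and>
        (\<forall>h t. in_hull p P f h \<longrightarrow> \<bar>t - t0\<bar> < \<delta> \<longrightarrow> (\<forall>\<sigma>\<in>F. \<sigma> (h - g) < \<delta>) \<longrightarrow>
           \<rho> (translate t h - translate t0 g) < \<epsilon>)"
    and solution_error: "in_hull p P f g \<Longrightarrow> continuous_on {-1..0} \<phi> \<Longrightarrow> 0 < \<eta> \<Longrightarrow>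
        \<exists>F \<delta>. finite F \<and> F \<subseteq> P \<and> 0 < \<delta> \<and>
        (\<forall>h \<psi> S y. in_hull p P f h \<longrightarrow> (\<forall>\<sigma>\<in>F. \<sigma> (h - g) < \<delta>) \<longrightarrow>
           (\<forall>t\<in>{-1..0}. norm (\<psi> t - \<phi> t) \<le> \<delta>) \<longrightarrow> S \<le> T \<longrightarrow> integral_solution h \<psi> S y \<longrightarrow>
           (\<forall>t\<in>{-1..S}. norm (y t) \<le> R) \<longrightarrow>
           norm (integral {0..S} (\<lambda>s. h s (y s, y (s - 1)) - g s (y s, y (s - 1)))) \<le> \<eta>)"
begin

abbreviation T where "T \<equiv> seminorm_topology (LC_classes p) P"
abbreviation H where "H \<equiv> Hull p T f"

text \<open>The existential over representatives in the subbasic balls is harmless, since every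
  representative gives the same value.\<close>

lemma cong_diff:
  assumes "\<rho> \<in> P" "G \<in> LC_classes p" "g \<in> G" "g' \<in> G" "h \<in> LC p"
  shows "\<rho> (g - h) = \<rho> (g' - h)"
proof (rule ae_cong[OF assms(1)])
  have gg: "g \<in> LC p" "g' \<in> LC p" "ae_eq g g'"
    using LC_classes_member[OF assms(2,3)] LC_classes_member(1)[OF assms(2,4)] assms(4)
    by (auto simp: mem_LC_class)
  then show "g - h \<in> LC p" "g' - h \<in> LC p" using assms by (auto intro: LC_diff)
  show "ae_eq (g - h) (g' - h)" using gg(3) unfolding ae_eq_def by eventually_elim simp
qed

lemma openin_ball:
  assumes "\<rho> \<in> P" "h \<in> LC p" "0 < \<epsilon>"
  shows "openin T {G \<in> LC_classes p. \<exists>g\<in>G. \<rho> (g - h) < \<epsilon>}"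
  unfolding seminorm_topology_def
  by (rule topology_generated_by_Basis) (use assms in \<open>auto simp: Union_LC_classes\<close>)

lemma topspace_T: "topspace T = LC_classes p"
proof
  show "topspace T \<subseteq> LC_classes p"
    unfolding seminorm_topology_def topology_generated_by_topspace by auto
  show "LC_classes p \<subseteq> topspace T"
  proof
    fix G :: "'v delay_field set" assume G: "G \<in> LC_classes p"
    obtain g where g: "g \<in> G" using LC_classes_ex[OF G] by blast
    obtain \<rho> where \<rho>: "\<rho> \<in> P" using nonempty by blast
    have gL: "g \<in> LC p" using LC_classes_member(1)[OF G g] .
    have "G \<in> {G \<in> LC_classes p. \<exists>g'\<in>G. \<rho> (g' - g) < 1}"
      using G g zero[OF \<rho> gL] by (auto intro!: bexI[of _ g])
    with openin_subset[OF openin_ball[OF \<rho> gL zero_less_one]] show "G \<in> topspace T" by blast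
  qed
qed

lemma topspace_H: "topspace H = T closure_of range (\<lambda>t. LC_class p (translate t f))"
  unfolding Hull_def topspace_subtopology using closure_of_subset_topspace[of T] by blast

lemma topspace_H_classes: "G \<in> topspace H \<Longrightarrow> G \<in> LC_classes p"
  using closure_of_subset_topspace[of T] topspace_H topspace_T by blast

definition nbhd :: "('v delay_field \<Rightarrow> real) set \<Rightarrow> real \<Rightarrow> 'v delay_field \<Rightarrow> 'v delay_field set set" where
  "nbhd F \<delta> g = {G \<in> topspace H. \<forall>\<sigma>\<in>F. \<exists>g'\<in>G. \<sigma> (g' - g) < \<delta>}"

lemma openin_finite_balls:
  assumes "finite F" "F \<subseteq> P" "g \<in> LC p" "0 < \<delta>"
  shows "openin T {G \<in> LC_classes p. \<forall>\<sigma>\<in>F. \<exists>g'\<in>G. \<sigma> (g' - g) < \<delta>}"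
proof -
  have "openin T ((\<Inter>\<sigma>\<in>F. {G \<in> LC_classes p. \<exists>g'\<in>G. \<sigma> (g' - g) < \<delta>}) \<inter> topspace T)"
    using assms by (intro openin_INT openin_ball) auto
  also have "(\<Inter>\<sigma>\<in>F. {G \<in> LC_classes p. \<exists>g'\<in>G. \<sigma> (g' - g) < \<delta>}) \<inter> topspace T =
      {G \<in> LC_classes p. \<forall>\<sigma>\<in>F. \<exists>g'\<in>G. \<sigma> (g' - g) < \<delta>}"
    unfolding topspace_T by auto
  finally show ?thesis .
qed

lemma openin_nbhd:
  assumes "finite F" "F \<subseteq> P" "g \<in> LC p" "0 < \<delta>"
  shows "openin H (nbhd F \<delta> g)"
proof -
  have "nbhd F \<delta> g = {G \<in> LC_classes p. \<forall>\<sigma>\<in>F. \<exists>g'\<in>G. \<sigma> (g' - g) < \<delta>} \<inter> T closure_of range (\<lambda>t. LC_class p (translate t f))"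
    unfolding nbhd_def topspace_H[symmetric] using topspace_H_classes by auto
  then show ?thesis
    unfolding Hull_def openin_subtopology using openin_finite_balls[OF assms] by blast
qed

lemma nbhd_self:
  assumes "G \<in> topspace H" "g \<in> G" "F \<subseteq> P" "0 < \<delta>" shows "G \<in> nbhd F \<delta> g"
proof -
  have "g \<in> LC p" using LC_classes_member(1)[OF topspace_H_classes[OF assms(1)] assms(2)] .
  then have "\<sigma> (g - g) < \<delta>" if "\<sigma> \<in> F" for \<sigma>
    using zero[of \<sigma> g] that assms(3,4) by auto
  then show ?thesis using assms(1,2) unfolding nbhd_def by blast
qed

lemma nbhdD:
  assumes "G \<in> nbhd F \<delta> g" "h \<in> G" "F \<subseteq> P" "g \<in> LC p" "\<sigma> \<in> F"
  shows "\<sigma> (h - g) < \<delta>"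
proof -
  obtain g' where "g' \<in> G" "\<sigma> (g' - g) < \<delta>" using assms(1,5) unfolding nbhd_def by blast
  moreover have "G \<in> LC_classes p" using assms(1) topspace_H_classes unfolding nbhd_def by blast
  ultimately show ?thesis using cong_diff[of \<sigma> G h g' g] assms by auto
qed

lemma topspace_H_in_hull:
  assumes G: "G \<in> topspace H" and g: "g \<in> G"
  shows "in_hull p P f g"
  unfolding in_hull_def
proof (intro conjI allI impI)
  have GE: "G \<in> LC_classes p" using topspace_H_classes[OF G] .
  show gL: "g \<in> LC p" using LC_classes_member(1)[OF GE g] .
  fix F and \<epsilon> :: real assume F: "finite F" "F \<subseteq> P" and \<epsilon>: "0 < \<epsilon>"
  have "G \<in> {G \<in> LC_classes p. \<forall>\<sigma>\<in>F. \<exists>g'\<in>G. \<sigma> (g' - g) < \<epsilon>}"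
    using nbhd_self[OF G g F(2) \<epsilon>] GE unfolding nbhd_def by blast
  then have "\<exists>K. K \<in> range (\<lambda>t. LC_class p (translate t f)) \<and>
      K \<in> {G \<in> LC_classes p. \<forall>\<sigma>\<in>F. \<exists>g'\<in>G. \<sigma> (g' - g) < \<epsilon>}"
    using G openin_finite_balls[OF F gL \<epsilon>] unfolding topspace_H in_closure_of
    by (elim conjE) (drule spec, erule mp, rule conjI)
  then obtain \<tau> where \<tau>: "LC_class p (translate \<tau> f) \<in> LC_classes p"
    "\<forall>\<sigma>\<in>F. \<exists>g'\<in>LC_class p (translate \<tau> f). \<sigma> (g' - g) < \<epsilon>"
    by auto
  have "translate \<tau> f \<in> LC_class p (translate \<tau> f)"
    using LC_translate[OF f] by (simp add: mem_LC_class)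
  note tf = this
  have "\<sigma> (translate \<tau> f - g) < \<epsilon>" if \<sigma>: "\<sigma> \<in> F" for \<sigma>
  proof -
    obtain g' where g': "g' \<in> LC_class p (translate \<tau> f)" "\<sigma> (g' - g) < \<epsilon>" using \<tau>(2) \<sigma> by blast
    have "\<sigma> \<in> P" using \<sigma> F by blast
    from cong_diff[OF this \<tau>(1) tf g'(1) gL] g'(2) show ?thesis by simp
  qed
  then show "\<exists>\<tau>. \<forall>\<rho>\<in>F. \<rho> (translate \<tau> f - g) < \<epsilon>" by blast
qed

lemma openin_time_nbhd:
  "openin (top_of_set {0..}) ({0..} \<inter> ball t0 \<delta> :: real set)"
  by (rule openin_open_Int) simp

section \<open>Continuity of both components of the flow\<close>

text \<open>The target is the whole function space: that translates stay in the hull is deduced from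
  this continuity afterwards.\<close>

lemma translation_continuous:
  "continuous_map (prod_topology (top_of_set {0..}) H) T (\<lambda>(t, G). translate t ` G)"
proof -
  define X where "X = prod_topology (top_of_set {0::real..}) H"
  let ?X = "prod_topology (top_of_set {0::real..}) H"
  define S where "S = {{G \<in> LC_classes p. \<exists>g\<in>G. \<rho> (g - h) < \<epsilon>} |\<rho> h \<epsilon>. \<rho> \<in> P \<and> h \<in> \<Union> (LC_classes p) \<and> 0 < \<epsilon>}"
  have T_eq: "T = topology_generated_by S" by (simp add: seminorm_topology_def S_def)
  have US: "\<Union>S = LC_classes p"
    using topspace_T unfolding T_eq topology_generated_by_topspace .
  have "continuous_map X (topology_generated_by S) (\<lambda>(t, G). translate t ` G)"
  proof (rule continuous_on_generated_topo)
    show "(\<lambda>(t, G). translate t ` G) ` topspace X \<subseteq> \<Union>S"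
      unfolding US
    proof (rule image_subsetI)
      fix q assume "q \<in> topspace X"
      then have "snd q \<in> topspace H" unfolding X_def by (simp add: mem_Times_iff)
      then have "snd q \<in> LC_classes p" by (rule topspace_H_classes)
      then show "(\<lambda>(t, G). translate t ` G) q \<in> LC_classes p"
        using LC_classes_ex[of "snd q" p] translate_LC_classes(1)[of "snd q" p] by (cases q) auto
    qed
  fix B :: "'v delay_field set set"
  assume "B \<in> S"
  then obtain \<rho> h \<epsilon> where B: "B = {G \<in> LC_classes p. \<exists>g\<in>G. \<rho> (g - h) < \<epsilon>}" and \<rho>: "\<rho> \<in> P"
    and h: "h \<in> LC p" and \<epsilon>: "0 < \<epsilon>" unfolding S_def Union_LC_classes by blast
  have "openin ?X ((\<lambda>(t, G). translate t ` G) -` B \<inter> topspace ?X)"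
  proof (subst openin_subopen, safe)
    fix t0 G assume tG: "translate t0 ` G \<in> B" and "(t0, G) \<in> topspace ?X"
    then have t0: "0 \<le> t0" and G: "G \<in> topspace H" by auto
    note GE = topspace_H_classes[OF G]
    obtain g where g: "g \<in> G" using LC_classes_ex[OF GE] by blast
    have gL: "g \<in> LC p" using LC_classes_member(1)[OF GE g] .
    note tg = translate_LC_classes[OF GE g, of t0]
    have lt: "\<rho> (translate t0 g - h) < \<epsilon>"
    proof -
      obtain g' where g': "g' \<in> translate t0 ` G" "\<rho> (g' - h) < \<epsilon>" using tG unfolding B by blast
      then show ?thesis using cong_diff[OF \<rho> tg(1) tg(2) g'(1) h] by simp
    qed
    \<comment> \<open>The room left around the translate of g inside the ball centred at h; the
      triangle inequality passes from one centre to the other.\<close>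
    define e where "e = \<epsilon> - \<rho> (translate t0 g - h)"
    have "0 < e" using lt by (simp add: e_def)
    from translation[OF topspace_H_in_hull[OF G g] \<rho> this, of t0]
    obtain F \<delta> where F: "finite F" "F \<subseteq> P" "0 < \<delta>"
      and tr: "\<And>k t. in_hull p P f k \<Longrightarrow> \<bar>t - t0\<bar> < \<delta> \<Longrightarrow> (\<forall>\<sigma>\<in>F. \<sigma> (k - g) < \<delta>) \<Longrightarrow>
           \<rho> (translate t k - translate t0 g) < e" by blast
    show "\<exists>W. openin ?X W \<and> (t0, G) \<in> W \<and> W \<subseteq> (\<lambda>(t, G). translate t ` G) -` B \<inter> topspace ?X"
    proof (intro exI conjI)
      show "openin ?X (({0..} \<inter> ball t0 \<delta>) \<times> nbhd F \<delta> g)"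
        unfolding openin_prod_Times_iff using openin_time_nbhd openin_nbhd[OF F(1,2) gL F(3)] by blast
      show "(t0, G) \<in> ({0..} \<inter> ball t0 \<delta>) \<times> nbhd F \<delta> g"
        using t0 F nbhd_self[OF G g] by auto
      show "({0..} \<inter> ball t0 \<delta>) \<times> nbhd F \<delta> g \<subseteq> (\<lambda>(t, G). translate t ` G) -` B \<inter> topspace ?X"
      proof (rule subsetI)
        fix q assume qW: "q \<in> ({0..} \<inter> ball t0 \<delta>) \<times> nbhd F \<delta> g"
        obtain t K where q: "q = (t, K)" by (cases q)
        have t: "t \<in> ball t0 \<delta>" "t \<in> {0..}" and K: "K \<in> nbhd F \<delta> g" using qW by (auto simp: q)
        then have KH: "K \<in> topspace H" by (simp add: nbhd_def)
        note KE = topspace_H_classes[OF KH]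
        obtain k where k: "k \<in> K" using LC_classes_ex[OF KE] by blast
        have kL: "k \<in> LC p" using LC_classes_member(1)[OF KE k] .
        have "\<rho> (translate t k - translate t0 g) < e"
          using t nbhdD[OF K k F(2) gL]
          by (intro tr topspace_H_in_hull[OF KH k]) (auto simp: dist_real_def abs_minus_commute)
        moreover have "\<rho> (translate t k - h) \<le> \<rho> (translate t k - translate t0 g) + \<rho> (translate t0 g - h)"
          using \<rho> h LC_translate[OF kL] LC_translate[OF gL] by (intro triangle) auto
        ultimately have "\<rho> (translate t k - h) < \<epsilon>" by (simp add: e_def)
        then have "translate t ` K \<in> B"
          unfolding B using translate_LC_classes[OF KE k, of t] by blast
        then show "q \<in> (\<lambda>(t, G). translate t ` G) -` B \<inter> topspace ?X" using t KH by (simp add: q)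
      qed
    qed
  qed
  then show "openin X ((\<lambda>(t, G). translate t ` G) -` B \<inter> topspace X)" by (simp only: X_def)
  qed
  then show ?thesis by (simp only: X_def T_eq)
qed

text \<open>A continuous map sends the closure of the orbit into the closure of its image, and the
  orbit is invariant under translation.\<close>

lemma translate_topspace_H:
  assumes G: "G \<in> topspace H" and t: "0 \<le> t"
  shows "translate t ` G \<in> topspace H"
proof -
  let ?O = "range (\<lambda>t. LC_class p (translate t f))"
  have "continuous_map H (prod_topology (top_of_set {0..}) H) (\<lambda>G. (t, G))"
    using t by (simp add: continuous_map_pairwise o_def)
  from continuous_map_compose[OF this translation_continuous]
  have c: "continuous_map H T (\<lambda>G. translate t ` G)" by (simp add: o_def)
  have sub: "?O \<subseteq> T closure_of ?O"
    by (rule closure_of_subset) (auto simp: topspace_T intro!: LC_class_in LC_translate f)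
  have "H closure_of ?O = topspace H"
    unfolding topspace_H unfolding Hull_def closure_of_subtopology using sub by (simp add: Int_absorb1)
  then have "translate t ` G \<in> (\<lambda>G. translate t ` G) ` (H closure_of ?O)" using G by blast
  also have "\<dots> \<subseteq> T closure_of ((\<lambda>G. translate t ` G) ` ?O)"
    by (rule continuous_map_image_closure_subset[OF c])
  also have "\<dots> \<subseteq> T closure_of ?O"
    by (rule closure_of_mono) (auto simp: translate_LC_class[OF LC_translate[OF f]] translate_translate)
  finally show ?thesis unfolding topspace_H .
qed

text \<open>One neighbourhood W, a product of a time ball, a seminorm neighbourhood and a ball of
  histories, yields both openness of the domain and continuity of the second component.\<close>

lemma solution_continuous:
  assumes tG: "(t0, G, \<phi>) \<in> flow_domain H" and \<epsilon>: "0 < \<epsilon>"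
  shows "\<exists>W. openin (prod_topology (top_of_set {0..}) (prod_topology H (mtopology_of history_space))) W \<and>
    (t0, G, \<phi>) \<in> W \<and> W \<subseteq> flow_domain H \<and>
    (\<forall>(t, K, \<psi>)\<in>W. \<forall>s\<in>{-1..0}. norm (sol K \<psi> (t + s) - sol G \<phi> (t0 + s)) \<le> \<epsilon>)"
proof -
  have G: "G \<in> topspace H" and \<phi>: "\<phi> \<in> mspace history_space" and t0: "0 \<le> t0" "t0 \<in> sol_interval G \<phi>"
    using tG by (auto simp: flow_domain_def)
  note GE = topspace_H_classes[OF G]
  obtain g where g: "g \<in> G" using LC_classes_ex[OF GE] by blast
  have gL: "g \<in> LC p" using LC_classes_member(1)[OF GE g] .
  have g1: "g \<in> LC 1" using LC_mono[OF p gL] .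
  define x where "x = sol G \<phi>"
  \<comment> \<open>The solution is continued beyond t0, so that times slightly larger than t0 are
    covered as well.\<close>
  obtain T' y where T': "T' > t0" and y: "integral_solution g \<phi> T' y"
    using integral_solution_extend[OF g1 sol_interval_iff(2)[OF p GE g \<phi> t0]] by blast
  have "T' \<in> sol_interval G \<phi>" "0 \<le> T'" using sol_interval_iff(1)[OF p GE g \<phi>, of T'] y T' t0 by auto
  then have x: "integral_solution g \<phi> T' x" unfolding x_def by (intro sol_interval_iff(2)[OF p GE g \<phi>])
  from solution_perturbation[OF g1 x] obtain R where R: "\<forall>\<epsilon>>0. \<exists>\<eta>>0. \<forall>h\<in>LC 1. \<forall>\<psi>. continuous_on {-1..0} \<psi> \<longrightarrow>
    (\<forall>t\<in>{-1..0}. norm (\<psi> t - \<phi> t) \<le> \<eta>) \<longrightarrow>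
    (\<forall>S y. S \<le> T' \<longrightarrow> integral_solution h \<psi> S y \<longrightarrow> (\<forall>t\<in>{-1..S}. norm (y t) \<le> R) \<longrightarrow>
      norm (integral {0..S} (\<lambda>s. h s (y s, y (s - 1)) - g s (y s, y (s - 1)))) \<le> \<eta>) \<longrightarrow>
    (\<exists>y. integral_solution h \<psi> T' y \<and> (\<forall>t\<in>{-1..T'}. norm (y t - x t) \<le> \<epsilon>))" by (elim exE)
  \<comment> \<open>One half of \<epsilon> is for the change of equation and history at a fixed
    time; the other half pays for moving from t0 to t along x.\<close>
  from R[THEN spec, THEN mp, OF half_gt_zero[OF \<epsilon>]] obtain \<eta> where \<eta>: "\<eta> > 0"
    and pert: "\<forall>h\<in>LC 1. \<forall>\<psi>. continuous_on {-1..0} \<psi> \<longrightarrow>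
    (\<forall>t\<in>{-1..0}. norm (\<psi> t - \<phi> t) \<le> \<eta>) \<longrightarrow>
    (\<forall>S y. S \<le> T' \<longrightarrow> integral_solution h \<psi> S y \<longrightarrow> (\<forall>t\<in>{-1..S}. norm (y t) \<le> R) \<longrightarrow>
      norm (integral {0..S} (\<lambda>s. h s (y s, y (s - 1)) - g s (y s, y (s - 1)))) \<le> \<eta>) \<longrightarrow>
    (\<exists>y. integral_solution h \<psi> T' y \<and> (\<forall>t\<in>{-1..T'}. norm (y t - x t) \<le> \<epsilon>/2))" by (elim exE conjE)
  have \<phi>c: "continuous_on {-1..0} \<phi>" using \<phi> by (simp add: mspace_history_space)
  from solution_error[OF topspace_H_in_hull[OF G g] \<phi>c \<eta>, of T' R]
  obtain F \<delta> where F: "finite F" "F \<subseteq> P" "0 < \<delta>" and err: "\<forall>h \<psi> S y. in_hull p P f h \<longrightarrow> (\<forall>\<sigma>\<in>F. \<sigma> (h - g) < \<delta>) \<longrightarrow>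
           (\<forall>t\<in>{-1..0}. norm (\<psi> t - \<phi> t) \<le> \<delta>) \<longrightarrow> S \<le> T' \<longrightarrow> integral_solution h \<psi> S y \<longrightarrow>
           (\<forall>t\<in>{-1..S}. norm (y t) \<le> R) \<longrightarrow>
           norm (integral {0..S} (\<lambda>s. h s (y s, y (s - 1)) - g s (y s, y (s - 1)))) \<le> \<eta>"
    by (elim exE conjE)
  have "uniformly_continuous_on {-1..T'} x"
    using integral_solutionD(2)[OF x] by (intro compact_uniformly_continuous) auto
  then have ex_d: "\<exists>d>0. \<forall>u\<in>{-1..T'}. \<forall>v\<in>{-1..T'}. dist v u < d \<longrightarrow> dist (x v) (x u) < \<epsilon>/2"
    unfolding uniformly_continuous_on_def using half_gt_zero[OF \<epsilon>] by blast
  then obtain d where d: "d > 0" "\<And>u v. u \<in> {-1..T'} \<Longrightarrow> v \<in> {-1..T'} \<Longrightarrow> dist v u < d \<Longrightarrow> dist (x v) (x u) < \<epsilon>/2"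
    by auto
  define d' where "d' = min d (T' - t0)"
  have d': "0 < d'" using d(1) T' by (simp add: d'_def)
  define W where "W = ({0..} \<inter> ball t0 d') \<times> nbhd F \<delta> g \<times> mball_of history_space \<phi> (min \<delta> \<eta>)"
  have "openin (mtopology_of history_space) (mball_of history_space \<phi> (min \<delta> \<eta>))"
    by (simp add: mball_of_def mtopology_of_def Metric_space.openin_mball)
  then have 1: "openin (prod_topology (top_of_set {0..}) (prod_topology H (mtopology_of history_space))) W"
    unfolding W_def openin_prod_Times_iff using openin_time_nbhd openin_nbhd[OF F(1,2) gL F(3)] by blast
  have 2: "(t0, G, \<phi>) \<in> W"
  proof -
    have "mdist history_space \<phi> \<phi> \<le> 0" using mdist_history_le[OF \<phi> \<phi>, of 0] by simp
    then show ?thesis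
      unfolding W_def using t0 d' nbhd_self[OF G g F(2,3)] \<phi> F(3) \<eta> by simp
  qed
  have key: "t \<in> sol_interval K \<psi> \<and> 0 \<le> t \<and> K \<in> topspace H \<and> \<psi> \<in> mspace history_space \<and>
      (\<forall>s\<in>{-1..0}. norm (sol K \<psi> (t + s) - sol G \<phi> (t0 + s)) \<le> \<epsilon>)" if W: "(t, K, \<psi>) \<in> W" for t K \<psi>
  proof -
    have t: "0 \<le> t" "\<bar>t - t0\<bar> < d'" and K: "K \<in> nbhd F \<delta> g" and \<psi>: "\<psi> \<in> mspace history_space"
      and \<psi>d: "mdist history_space \<phi> \<psi> < min \<delta> \<eta>"
      using W by (auto simp: W_def dist_real_def)
    have KH: "K \<in> topspace H" using K by (simp add: nbhd_def)
    note KE = topspace_H_classes[OF KH]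
    obtain k where k: "k \<in> K" using LC_classes_ex[OF KE] by blast
    have k1: "k \<in> LC 1" using LC_mono[OF p LC_classes_member(1)[OF KE k]] .
    have \<psi>\<phi>: "\<forall>t\<in>{-1..0}. norm (\<psi> t - \<phi> t) \<le> min \<delta> \<eta>"
      using mdist_history_le[OF \<phi> \<psi>, of "min \<delta> \<eta>"] \<psi>d by simp
    have "\<exists>y. integral_solution k \<psi> T' y \<and> (\<forall>t\<in>{-1..T'}. norm (y t - x t) \<le> \<epsilon>/2)"
    proof (rule pert[THEN bspec, OF k1, THEN spec, THEN mp, THEN mp, THEN mp])
      show "continuous_on {-1..0} \<psi>" using \<psi> by (simp add: mspace_history_space)
      show "\<forall>t\<in>{-1..0}. norm (\<psi> t - \<phi> t) \<le> \<eta>" using \<psi>\<phi> by simp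
      show "\<forall>S y. S \<le> T' \<longrightarrow> integral_solution k \<psi> S y \<longrightarrow> (\<forall>t\<in>{-1..S}. norm (y t) \<le> R) \<longrightarrow>
        norm (integral {0..S} (\<lambda>s. k s (y s, y (s - 1)) - g s (y s, y (s - 1)))) \<le> \<eta>"
      proof (intro allI impI)
        fix S y assume "S \<le> T'" "integral_solution k \<psi> S y" "\<forall>t\<in>{-1..S}. norm (y t) \<le> R"
        then show "norm (integral {0..S} (\<lambda>s. k s (y s, y (s - 1)) - g s (y s, y (s - 1)))) \<le> \<eta>"
          using err[THEN spec, of k, THEN spec, of \<psi>, THEN spec, of S, THEN spec, of y]
            topspace_H_in_hull[OF KH k] nbhdD[OF K k F(2) gL] \<psi>\<phi> by simp
      qed
    qed
    then obtain y where y: "integral_solution k \<psi> T' y" "\<forall>t\<in>{-1..T'}. norm (y t - x t) \<le> \<epsilon>/2" by blast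
    have "t - t0 < T' - t0" using t(2) unfolding d'_def by linarith
    then have tT: "t \<le> T'" by simp
    have "t \<in> sol_interval K \<psi>"
      using sol_interval_iff(1)[OF p KE k \<psi> t(1)] integral_solution_mono[OF y(1) t(1) tT] by blast
    moreover have "norm (sol K \<psi> (t + s) - sol G \<phi> (t0 + s)) \<le> \<epsilon>" if s: "s \<in> {-1..0}" for s
    proof -
      have "sol K \<psi> (t + s) = y (t + s)"
        using sol_eqI[OF p KE k \<psi> y(1), of "t + s"] s t tT by auto
      moreover have "norm (y (t + s) - x (t + s)) \<le> \<epsilon>/2" using y(2) s t tT by auto
      moreover have "norm (x (t + s) - x (t0 + s)) < \<epsilon>/2"
        using d(2)[of "t0 + s" "t + s"] s t t0 tT T' by (auto simp: dist_norm d'_def)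
      ultimately show ?thesis
        using norm_triangle_ineq[of "y (t + s) - x (t + s)" "x (t + s) - x (t0 + s)"] by (simp add: x_def)
    qed
    ultimately show ?thesis using t KH \<psi> by blast
  qed
  have "W \<subseteq> flow_domain H" using key unfolding flow_domain_def by auto
  moreover have "\<forall>(t, K, \<psi>)\<in>W. \<forall>s\<in>{-1..0}. norm (sol K \<psi> (t + s) - sol G \<phi> (t0 + s)) \<le> \<epsilon>"
    using key by blast
  ultimately show ?thesis using 1 2 by blast
qed

lemma flow_history:
  assumes "(t, G, \<phi>) \<in> flow_domain H"
  shows "restrict (\<lambda>s. sol G \<phi> (t + s)) {-1..0} \<in> mspace history_space"
proof -
  have G: "G \<in> LC_classes p" and \<phi>: "\<phi> \<in> mspace history_space" and t: "0 \<le> t" "t \<in> sol_interval G \<phi>"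
    using assms topspace_H_classes by (auto simp: flow_domain_def)
  obtain g where g: "g \<in> G" using LC_classes_ex[OF G] by blast
  have x: "integral_solution g \<phi> t (sol G \<phi>)" using sol_interval_iff(2)[OF p G g \<phi> t] .
  have "continuous_on {-1..0} (\<lambda>s. sol G \<phi> (t + s))"
    using t by (intro continuous_on_compose2[OF integral_solutionD(2)[OF x]] continuous_intros) auto
  then show ?thesis unfolding mspace_history_space by (auto intro: continuous_on_eq)
qed

lemma continuous_map_into_H:
  assumes "continuous_map X T h" "h \<in> topspace X \<rightarrow> topspace H"
  shows "continuous_map X H h"
proof -
  have "H = subtopology T (topspace H)" unfolding topspace_H unfolding Hull_def ..
  then show ?thesis using continuous_map_into_subtopology[OF assms] by (simp only:)
qed

theorem local_skew_product_semiflow_hull: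
  "local_skew_product_semiflow H (mtopology_of history_space) (flow_domain H) flow"
proof -
  let ?Z = "mtopology_of (history_space :: (real \<Rightarrow> 'v) metric)"
  let ?X = "prod_topology (top_of_set {0::real..}) (prod_topology H ?Z)"
  let ?U = "flow_domain H"
  have dom: "G \<in> topspace H \<and> \<phi> \<in> mspace history_space \<and> 0 \<le> t \<and> t \<in> sol_interval G \<phi>"
    if "(t, G, \<phi>) \<in> ?U" for t G \<phi> using that by (auto simp: flow_domain_def)
  have op: "openin ?X ?U"
  proof (subst openin_subopen, safe)
    fix t G \<phi> assume "(t, G, \<phi>) \<in> ?U"
    from solution_continuous[OF this zero_less_one]
    show "\<exists>W. openin ?X W \<and> (t, G, \<phi>) \<in> W \<and> W \<subseteq> ?U" by blast
  qed
  \<comment> \<open>The history is itself a solution with T = 0; this gives both that time 0 belongs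
    to every lifetime and that the flow is the identity there.\<close>
  have zero_sol: "sol G \<phi> s = \<phi> s \<and> 0 \<in> sol_interval G \<phi>"
    if G: "G \<in> topspace H" and \<phi>: "\<phi> \<in> mspace history_space" and s: "s \<in> {-1..0}" for G \<phi> s
  proof -
    note GE = topspace_H_classes[OF G]
    obtain g where g: "g \<in> G" using LC_classes_ex[OF GE] by blast
    have "integral_solution g \<phi> 0 \<phi>"
      using \<phi> by (auto simp: integral_solution_def mspace_history_space)
    then show ?thesis
      using sol_interval_iff(1)[OF p GE g \<phi>, of 0] sol_eqI[OF p GE g \<phi> _ s] by blast
  qed
  have Usub: "?U \<subseteq> topspace ?X" using openin_subset[OF op] .
  have tops: "topspace (subtopology ?X ?U) = ?U" using Usub by auto
  have c1: "continuous_map (subtopology ?X ?U) H (\<lambda>(t, G, \<phi>). translate t ` G)"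
  proof (rule continuous_map_into_H)
    have "continuous_map ?X (prod_topology (top_of_set {0::real..}) H) (\<lambda>q. (fst q, fst (snd q)))"
      by (intro continuous_map_pairedI continuous_map_fst continuous_map_compose[OF continuous_map_snd continuous_map_fst, unfolded o_def])
    from continuous_map_compose[OF this translation_continuous]
    have "continuous_map ?X T (\<lambda>(t, G, \<phi>). translate t ` G)" by (simp add: o_def split_def)
    then show "continuous_map (subtopology ?X ?U) T (\<lambda>(t, G, \<phi>). translate t ` G)"
      by (rule continuous_map_from_subtopology)
    show "(\<lambda>(t, G, \<phi>). translate t ` G) \<in> topspace (subtopology ?X ?U) \<rightarrow> topspace H"
      unfolding tops using dom translate_topspace_H by auto
  qed
  have c2: "continuous_map (subtopology ?X ?U) ?Z (\<lambda>(t, G, \<phi>). restrict (\<lambda>s. sol G \<phi> (t + s)) {-1..0})"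
  proof (rule continuous_map_mtopology_ofI)
    fix q and \<epsilon> :: real assume "q \<in> topspace (subtopology ?X ?U)" and \<epsilon>: "0 < \<epsilon>"
    then have q: "q \<in> ?U" unfolding tops by blast
    obtain t0 G \<phi> where qe: "q = (t0, G, \<phi>)" by (cases q)
    obtain W where W: "openin ?X W" "(t0, G, \<phi>) \<in> W" "W \<subseteq> ?U"
      and near: "\<forall>(t, K, \<psi>)\<in>W. \<forall>s\<in>{-1..0}. norm (sol K \<psi> (t + s) - sol G \<phi> (t0 + s)) \<le> \<epsilon>/2"
      using solution_continuous[OF q[unfolded qe] half_gt_zero[OF \<epsilon>]] by blast
    let ?f = "\<lambda>(t, G, \<phi>). restrict (\<lambda>s. sol G \<phi> (t + s)) {-1..0}"
    show "\<exists>V. openin (subtopology ?X ?U) V \<and> q \<in> V \<and>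
        (\<forall>r\<in>V. ?f q \<in> mspace history_space \<and> ?f r \<in> mspace history_space \<and> mdist history_space (?f q) (?f r) < \<epsilon>)"
    proof (intro exI[of _ W] conjI[where P="openin _ _"] conjI[where P="q \<in> _"] ballI)
      show "openin (subtopology ?X ?U) W"
        using W op by (simp add: openin_open_subtopology)
      show "q \<in> W" using W qe by simp
      fix r assume r: "r \<in> W"
      obtain t K \<psi> where re: "r = (t, K, \<psi>)" by (cases r)
      have m1: "?f q \<in> mspace history_space" using flow_history q qe by auto
      have m2: "?f r \<in> mspace history_space" using flow_history[of t K \<psi>] r re W(3) by auto
      have "mdist history_space (?f q) (?f r) \<le> \<epsilon>/2"
        unfolding mdist_history_le[OF m1 m2] using near r re qe by auto
      then have "mdist history_space (?f q) (?f r) < \<epsilon>" using \<epsilon> by simp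
      with m1 m2 show "?f q \<in> mspace history_space \<and> ?f r \<in> mspace history_space \<and> mdist history_space (?f q) (?f r) < \<epsilon>"
        by blast
    qed
  qed
  have "local_semiflow (prod_topology H ?Z) ?U flow"
    unfolding local_semiflow_def
  proof (intro conjI allI ballI impI)
    show "openin ?X ?U" by fact
    show "{0} \<times> topspace (prod_topology H ?Z) \<subseteq> ?U"
      using zero_sol[of _ _ 0] by (auto simp: flow_domain_def)
    have "continuous_map (subtopology ?X ?U) (prod_topology H ?Z)
       (\<lambda>q. ((\<lambda>(t, G, \<phi>). translate t ` G) q, (\<lambda>(t, G, \<phi>). restrict (\<lambda>s. sol G \<phi> (t + s)) {-1..0}) q))"
      by (rule continuous_map_pairedI[OF c1 c2])
    moreover have "(\<lambda>q. ((\<lambda>(t, G, \<phi>). translate t ` G) q, (\<lambda>(t, G, \<phi>). restrict (\<lambda>s. sol G \<phi> (t + s)) {-1..0}) q))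
        = (flow :: real \<times> 'v delay_field set \<times> (real \<Rightarrow> 'v) \<Rightarrow> _)"
      by (auto simp: flow_def fun_eq_iff)
    ultimately show "continuous_map (subtopology ?X ?U) (prod_topology H ?Z) flow" by (simp only:)
    show "flow (0, q) = q" if "q \<in> topspace (prod_topology H ?Z)" for q
    proof -
      obtain G \<phi> where q: "q = (G, \<phi>)" by (cases q)
      have G: "G \<in> topspace H" and \<phi>: "\<phi> \<in> mspace history_space" using that q by auto
      have "restrict (sol G \<phi>) {-1..0} = \<phi>"
        using zero_sol[OF G \<phi>] \<phi> by (intro extensionalityI[of _ "{-1..0}"]) (auto simp: mspace_history_space)
      then show ?thesis by (simp add: flow_def q)
    qed
    fix s t q assume *: "(s, q) \<in> ?U \<and> (t, flow (s, q)) \<in> ?U"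
    obtain G \<phi> where q: "q = (G, \<phi>)" by (cases q)
    have sU: "(s, G, \<phi>) \<in> ?U" using * q by simp
    define \<psi> where "\<psi> = restrict (\<lambda>u. sol G \<phi> (s + u)) {-1..0}"
    have fl: "flow (s, q) = (translate s ` G, \<psi>)" by (simp add: flow_def q \<psi>_def)
    have tU: "(t, translate s ` G, \<psi>) \<in> ?U" using * fl by simp
    note d1 = dom[OF sU] and d2 = dom[OF tU]
    have GE: "G \<in> LC_classes p" using d1 topspace_H_classes by blast
    have semi: "t + s \<in> sol_interval G \<phi>"
      "\<And>u. u \<in> {-1..0} \<Longrightarrow> sol G \<phi> (t + s + u) = sol (translate s ` G) \<psi> (t + u)"
      using flow_semigroup[OF p GE, of \<phi> s \<psi> t] d1 d2 \<psi>_def by auto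
    show "(t + s, q) \<in> ?U" using d1 d2 semi(1) by (simp add: flow_domain_def q)
    have "translate t ` translate s ` G = translate (t + s) ` G"
      by (simp add: image_image translate_translate)
    moreover have "restrict (\<lambda>u. sol G \<phi> (t + s + u)) {-1..0} = restrict (\<lambda>u. sol (translate s ` G) \<psi> (t + u)) {-1..0}"
      using semi(2) by (auto simp: restrict_def)
    ultimately show "flow (t + s, q) = flow (t, flow (s, q))"
      unfolding fl by (simp add: flow_def q)
  qed
  then show ?thesis
    unfolding local_skew_product_semiflow_def by (auto simp: flow_def)
qed

end

section \<open>\<open>L\<^sup>p\<close> norms along curves\<close>

definition Lp_norm_along :: "nat \<Rightarrow> real \<Rightarrow> real \<Rightarrow> ('v::euclidean_space) delay_field \<Rightarrow> (real \<Rightarrow> 'v \<times> 'v) \<Rightarrow> real" where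
  "Lp_norm_along p a b k z = root p (integral {a..b} (\<lambda>t. norm (k t (z t)) ^ p))"

text \<open>Measurability in place of continuity, so that constants, continuous curves and step
  functions are treated alike.\<close>

definition admissible :: "real \<Rightarrow> real \<Rightarrow> real \<Rightarrow> (real \<Rightarrow> 'a::euclidean_space) \<Rightarrow> bool" where
  "admissible R a b z \<longleftrightarrow> z \<in> borel_measurable (lebesgue_on {a..b}) \<and> (\<forall>t\<in>{a..b}. norm (z t) \<le> R)"

lemma admissibleD:
  assumes "admissible R a b z"
  shows "z \<in> borel_measurable (lebesgue_on {a..b})" "\<And>t. t \<in> {a..b} \<Longrightarrow> norm (z t) \<le> R"
  using assms by (auto simp: admissible_def)

lemma admissible_const: "norm d \<le> R \<Longrightarrow> admissible R a b (\<lambda>_. d)"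
  by (simp add: admissible_def)

lemma admissible_continuous:
  fixes z :: "real \<Rightarrow> 'a::euclidean_space"
  shows "continuous_on {a..b} z \<Longrightarrow> z ` {a..b} \<subseteq> cball 0 R \<Longrightarrow> admissible R a b z"
  by (auto simp: admissible_def continuous_on_measurable_lebesgue_on)

lemma admissible_subinterval:
  assumes "admissible R a b z" "a \<le> a'" "b' \<le> b" shows "admissible R a' b' z"
  unfolding admissible_def
proof
  have "{a'..b'} \<subseteq> {a..b}" using assms by auto
  then show "z \<in> borel_measurable (lebesgue_on {a'..b'})"
    by (rule measurable_restrict_mono[OF admissibleD(1)[OF assms(1)]])
  show "\<forall>t\<in>{a'..b'}. norm (z t) \<le> R" using admissibleD(2)[OF assms(1)] assms by auto
qed

lemma along_integrable:
  fixes k :: "('v::euclidean_space) delay_field"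
  assumes "k \<in> LC p" "admissible R a b z"
  shows "(\<lambda>t. norm (k t (z t)) ^ p) integrable_on {a..b}"
  using LC_comp_power_integrable[OF assms(1) admissibleD(1)[OF assms(2)]] admissibleD(2)[OF assms(2)] by blast

lemma along_abs_integrable:
  fixes k :: "('v::euclidean_space) delay_field"
  assumes "k \<in> LC 1" "admissible R a b z"
  shows "(\<lambda>t. k t (z t)) absolutely_integrable_on {a..b}"
    and "(\<lambda>t. k t (z t)) integrable_on {a..b}" and "(\<lambda>t. norm (k t (z t))) integrable_on {a..b}"
proof -
  show "(\<lambda>t. k t (z t)) absolutely_integrable_on {a..b}"
    using LC_comp_integrable[OF assms(1) admissibleD(1)[OF assms(2)]] admissibleD(2)[OF assms(2)] by blast
  then show "(\<lambda>t. k t (z t)) integrable_on {a..b}" "(\<lambda>t. norm (k t (z t))) integrable_on {a..b}"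
    by (auto simp: absolutely_integrable_on_def)
qed

lemma LINT_along:
  fixes k :: "('v::euclidean_space) delay_field"
  assumes "k \<in> LC p" "admissible R a b z"
  shows "(LINT t:{a..b}|lebesgue. norm (k t (z t)) ^ p) = integral {a..b} (\<lambda>t. norm (k t (z t)) ^ p)"
  by (rule set_lebesgue_integral_eq_integral(2), rule nonnegative_absolutely_integrable_1)
    (use along_integrable[OF assms] in auto)

lemma Lp_norm_along_triangle:
  fixes g h k :: "('v::euclidean_space) delay_field"
  assumes p: "1 \<le> p" and g: "g \<in> LC p" and h: "h \<in> LC p" and k: "k \<in> LC p" and z: "admissible R a b z"
  shows "Lp_norm_along p a b (g - h) z \<le> Lp_norm_along p a b (g - k) z + Lp_norm_along p a b (k - h) z"
  unfolding Lp_norm_along_def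
proof (rule Lp_triangle[OF p negligible_empty])
  show "0 \<le> norm ((g - h) t (z t)) \<and> 0 \<le> norm ((g - k) t (z t)) \<and> 0 \<le> norm ((k - h) t (z t)) \<and>
      norm ((g - h) t (z t)) \<le> norm ((g - k) t (z t)) + norm ((k - h) t (z t))" for t
    using norm_triangle_ineq[of "g t (z t) - k t (z t)" "k t (z t) - h t (z t)"] by simp
qed (intro along_integrable[OF _ z] LC_diff g h k)+

lemma Lp_norm_along_ae_eq: "ae_eq g h \<Longrightarrow> Lp_norm_along p a b g z = Lp_norm_along p a b h z"
  unfolding Lp_norm_along_def using integral_ae_eq[of g h, where F="\<lambda>_ v. norm v ^ p"] by simp

lemma Lp_norm_along_self: "1 \<le> p \<Longrightarrow> Lp_norm_along p a b (g - g) z = 0"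
  by (simp add: Lp_norm_along_def power_0_left)

text \<open>Holds for every k and z, because the integral of a nonintegrable function is 0 and thus
  still nonnegative.\<close>

lemma Lp_norm_along_power:
  assumes "1 \<le> p"
  shows "Lp_norm_along p a b k z ^ p = integral {a..b} (\<lambda>t. norm (k t (z t)) ^ p)"
proof -
  have "0 \<le> integral {a..b} (\<lambda>t. norm (k t (z t)) ^ p)"
    by (cases "(\<lambda>t. norm (k t (z t)) ^ p) integrable_on {a..b}")
      (auto intro: integral_nonneg simp: not_integrable_integral)
  then show ?thesis using assms by (simp add: Lp_norm_along_def)
qed

lemma Lp_norm_along_nonneg: "1 \<le> p \<Longrightarrow> 0 \<le> Lp_norm_along p a b k z"
  unfolding Lp_norm_along_def
  by (cases "(\<lambda>t. norm (k t (z t)) ^ p) integrable_on {a..b}")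
    (auto intro!: integral_nonneg real_root_ge_zero simp: not_integrable_integral)

lemma Lp_norm_along_less_iff:
  assumes "1 \<le> p" "0 \<le> e"
  shows "Lp_norm_along p a b k z < e \<longleftrightarrow> integral {a..b} (\<lambda>t. norm (k t (z t)) ^ p) < e ^ p"
  unfolding Lp_norm_along_power[OF assms(1), symmetric]
  using assms Lp_norm_along_nonneg[OF assms(1), of a b k z] power_mono_iff[of e "Lp_norm_along p a b k z" p]
  by (simp add: not_le[symmetric])

text \<open>A rational interval shifted by t is in general not rational. The norm over it is
  therefore dominated by the norm over a larger interval, along a curve z' that continues the
  shifted z.\<close>

lemma Lp_norm_along_translate_le:
  fixes k :: "('v::euclidean_space) delay_field"
  assumes p: "1 \<le> p" and k: "k \<in> LC p" and z: "admissible R a' b' z'"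
    and sub: "a' \<le> a + t" "b + t \<le> b'" and eq: "\<And>s. s \<in> {a..b} \<Longrightarrow> z' (s + t) = z s"
  shows "Lp_norm_along p a b (translate t k) z \<le> Lp_norm_along p a' b' k z'"
proof -
  have "integral {a..b} (\<lambda>s. norm (translate t k s (z s)) ^ p) = integral {a..b} (\<lambda>s. norm (k (s + t) (z' (s + t))) ^ p)"
    using eq by (intro integral_cong) (simp add: translate_def)
  also have "\<dots> = integral {a+t..b+t} (\<lambda>s. norm (k s (z' s)) ^ p)"
    by (rule integral_shift_real)
  also have "\<dots> \<le> integral {a'..b'} (\<lambda>s. norm (k s (z' s)) ^ p)"
  proof (rule integral_subset_le)
    show "(\<lambda>s. norm (k s (z' s)) ^ p) integrable_on {a'..b'}" by (rule along_integrable[OF k z])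
    show "(\<lambda>s. norm (k s (z' s)) ^ p) integrable_on {a+t..b+t}"
      by (rule along_integrable[OF k admissible_subinterval[OF z sub]])
  qed (use sub in auto)
  finally show ?thesis unfolding Lp_norm_along_def using p by simp
qed

text \<open>Takes the place of Hoelder's inequality: pointwise u \<le> e + u^p / e^(p-1), by
  distinguishing u \<le> e from u > e. If the integral of u^p is below e^p, both terms are of order
  e.\<close>

lemma L1_le_Lp:
  fixes u :: "real \<Rightarrow> real"
  assumes p: "1 \<le> p" and e: "0 < e" and ab: "a \<le> b" and u: "u integrable_on {a..b}"
    and up: "(\<lambda>t. u t ^ p) integrable_on {a..b}" and u0: "\<And>t. 0 \<le> u t"
  shows "integral {a..b} u \<le> e * (b - a) + integral {a..b} (\<lambda>t. u t ^ p) / e ^ (p - 1)"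
proof -
  have "integral {a..b} u \<le> integral {a..b} (\<lambda>t. e + u t ^ p / e ^ (p - 1))"
  proof (rule integral_le[OF u])
    show "(\<lambda>t. e + u t ^ p / e ^ (p - 1)) integrable_on {a..b}"
      using up by (intro integrable_add integrable_on_divide) auto
    fix t
    show "u t \<le> e + u t ^ p / e ^ (p - 1)"
    proof (cases "u t \<le> e")
      case True
      then show ?thesis using e u0[of t] by (simp add: add_increasing2)
    next
      case False
      have "u t * e ^ (p - 1) \<le> u t * u t ^ (p - 1)"
        using False e u0[of t] by (intro mult_left_mono power_mono) auto
      also have "\<dots> = u t ^ p" using p by (simp add: power_eq_if)
      finally have "u t \<le> u t ^ p / e ^ (p - 1)" using e by (simp add: field_simps)
      then show ?thesis using e by simp
    qed
  qed
  also have "\<dots> = e * (b - a) + integral {a..b} (\<lambda>t. u t ^ p) / e ^ (p - 1)"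
    using up ab by (subst integral_add) (auto intro: integrable_on_divide)
  finally show ?thesis .
qed

lemma along_L1_less:
  fixes k :: "('v::euclidean_space) delay_field"
  assumes p: "1 \<le> p" and k: "k \<in> LC p" and z: "admissible R a b z" and e: "0 < e" and ab: "a \<le> b"
    and less: "Lp_norm_along p a b k z < e"
  shows "integral {a..b} (\<lambda>t. norm (k t (z t))) < e * (b - a + 1)"
proof -
  have "integral {a..b} (\<lambda>t. norm (k t (z t))) \<le> e * (b - a) + integral {a..b} (\<lambda>t. norm (k t (z t)) ^ p) / e ^ (p - 1)"
    by (rule L1_le_Lp[OF p e ab along_abs_integrable(3)[OF LC_mono[OF p k] z] along_integrable[OF k z]]) simp
  also have "integral {a..b} (\<lambda>t. norm (k t (z t)) ^ p) / e ^ (p - 1) < e ^ p / e ^ (p - 1)"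
    using less e unfolding Lp_norm_along_less_iff[OF p less_imp_le[OF e]] by (intro divide_strict_right_mono) auto
  also have "e ^ p = e * e ^ (p - 1)" using p by (cases p) auto
  also have "e * e ^ (p - 1) / e ^ (p - 1) = e" using e by simp
  finally show ?thesis by (simp add: algebra_simps)
qed

lemma Lp_shift_eventually:
  fixes g :: "('v::euclidean_space) delay_field"
  assumes p: "1 \<le> p" and g: "g \<in> LC p" and e: "0 < e"
  shows "eventually (\<lambda>t. integral {a..b} (\<lambda>s. norm ((translate t g - translate t0 g) s d) ^ p) < e) (nhds t0)"
proof -
  have "(\<lambda>s. (s, d)) \<in> borel_measurable (borel :: real measure)"
    by (intro borel_measurable_continuous_onI continuous_intros)
  from measurable_compose[OF this LC_measurable[OF g]]
  have m: "(\<lambda>s. g s d) \<in> borel_measurable borel" by simp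
  have "(\<lambda>s. norm (g s d) ^ p) integrable_on {x..y}" for x y
    by (rule along_integrable[OF g admissible_const[OF order_refl]])
  from Lp_shift_continuous[OF p m this e, of t0 a b]
  obtain \<delta> where \<delta>: "\<delta> > 0" "\<And>t. \<bar>t - t0\<bar> < \<delta> \<Longrightarrow> integral {a..b} (\<lambda>s. norm (g (s + t) d - g (s + t0) d) ^ p) < e"
    by blast
  then show ?thesis
    unfolding eventually_nhds_metric by (auto simp: dist_real_def translate_def)
qed

lemma seminorm_TD_eq:
  fixes k :: "('v::euclidean_space) delay_field"
  assumes "k \<in> LC p"
  shows "root p (LINT t:{a..b}|lebesgue. norm (k t d) ^ p) = Lp_norm_along p a b k (\<lambda>_. d)"
  unfolding Lp_norm_along_def using LINT_along[OF assms admissible_const[OF order_refl]] by simp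

lemma seminorm_sigmaD_eq:
  fixes k :: "('v::euclidean_space) delay_field"
  assumes "k \<in> LC 1"
  shows "(LINT t:{a..b}|lebesgue. k t d) = integral {a..b} (\<lambda>t. k t d)"
  using along_abs_integrable(1)[OF assms admissible_const[OF order_refl]]
  by (rule set_lebesgue_integral_eq_integral)

lemma translate_diff: "translate t (g - h) = translate t g - translate t h"
  by (simp add: translate_def fun_eq_iff)

lemma LC_diff_translate:
  assumes "g \<in> LC p" "h \<in> LC p" shows "translate t g - translate s h \<in> LC p"
  by (intro LC_diff LC_translate assms)

lemma delay_pair_admissible:
  fixes y :: "real \<Rightarrow> 'v::euclidean_space"
  assumes "continuous_on {-1..S} y" "\<And>t. t \<in> {-1..S} \<Longrightarrow> norm (y t) \<le> R"
  shows "continuous_on {0..S} (\<lambda>s. (y s, y (s - 1)))" "\<And>s. s \<in> {0..S} \<Longrightarrow> norm (y s, y (s - 1)) \<le> 2 * R"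
proof -
  show "continuous_on {0..S} (\<lambda>s. (y s, y (s - 1)))" by (rule continuous_on_delay_pair[OF assms(1)]) auto
  show "norm (y s, y (s - 1)) \<le> 2 * R" if "s \<in> {0..S}" for s
    using norm_Pair_le_add[of "y s" "y (s - 1)"] assms(2)[of s] assms(2)[of "s - 1"] that by auto
qed

lemma rational_bounds: "\<exists>q\<in>\<rat>. x \<le> q" "\<exists>q\<in>\<rat>. q \<le> (x::real)"
proof -
  show "\<exists>q\<in>\<rat>. x \<le> q" using Rats_no_top_le[of x] by blast
  show "\<exists>q\<in>\<rat>. q \<le> x" using Rats_no_bot_less[of x] by (meson less_imp_le)
qed

text \<open>Uniformity over the curves \<open>z\<close> comes from the Lipschitz bound and a finite net of the ball.\<close>

lemma translate_small_along:
  fixes g :: "('v::euclidean_space) delay_field"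
  assumes p: "1 \<le> p" and g: "g \<in> LC p" and e: "0 < e"
  shows "\<exists>\<delta>>0. \<forall>t. \<bar>t - t0\<bar> < \<delta> \<longrightarrow> (\<forall>z. admissible R a b z \<longrightarrow>
    integral {a..b} (\<lambda>s. norm ((translate t g - translate t0 g) s (z s)) ^ p) < e)"
proof -
  obtain l N where N: "negligible N" and l0: "\<And>t. 0 \<le> l t" and li: "\<And>a b. (\<lambda>t. l t ^ p) integrable_on {a..b}"
    and lip: "\<And>t z1 z2. t \<notin> N \<Longrightarrow> norm z1 \<le> R \<Longrightarrow> norm z2 \<le> R \<Longrightarrow> norm (g t z1 - g t z2) \<le> l t * norm (z1 - z2)"
    by (rule LC_bounds[OF g, of R]) blast
  \<comment> \<open>Bounds the integral of l^p over {a+t..b+t} for all t within 1 of t0.\<close>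
  define Lb where "Lb = integral {a+t0-1..b+t0+1} (\<lambda>t. l t ^ p)"
  have Lb: "0 \<le> Lb" unfolding Lb_def using l0 by (intro integral_nonneg li) auto
  \<comment> \<open>Radius of the net: r \<le> 1 gives r^p \<le> r, and the denominator makes the
    two Lipschitz terms together at most e/4.\<close>
  define r where "r = min 1 (e / (8 * 3 ^ p * (Lb + 1)))"
  have r: "0 < r" "r \<le> 1" using e Lb by (auto simp: r_def)
  have rp: "3 ^ p * (2 * r ^ p * Lb) \<le> e / 4"
  proof -
    have "r ^ p \<le> r" using r p power_decreasing[of 1 p r] by simp
    then have "r ^ p * Lb \<le> r * (Lb + 1)" using Lb r by (intro mult_mono) auto
    also have "\<dots> \<le> e / (8 * 3 ^ p * (Lb + 1)) * (Lb + 1)" using Lb by (intro mult_right_mono) (auto simp: r_def)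
    also have "\<dots> = e / (8 * 3 ^ p)" using Lb by simp
    finally have "3 ^ p * 2 * (r ^ p * Lb) \<le> 3 ^ p * 2 * (e / (8 * 3 ^ p))" by (intro mult_left_mono) auto
    then show ?thesis by (simp add: algebra_simps)
  qed
  obtain D0 where D0: "finite D0" "D0 \<subseteq> cball (0::'v \<times> 'v) R" "cball 0 R \<subseteq> (\<Union>d\<in>D0. ball d r)"
    using compactE_image[OF compact_cball[of "0::'v \<times> 'v" R], of "cball 0 R" "\<lambda>d. ball d r"] r(1) by force
  \<comment> \<open>Makes the contribution of the net at most e/4; the + 1 takes care of an empty
    net.\<close>
  define e1 where "e1 = e / (4 * 3 ^ p * (real (card D0) + 1))"
  have e1: "0 < e1" using e by (simp add: e1_def)
  have "eventually (\<lambda>t. \<forall>d\<in>D0. integral {a..b} (\<lambda>s. norm ((translate t g - translate t0 g) s d) ^ p) < e1) (nhds t0)"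
    by (intro eventually_ball_finite D0(1) ballI Lp_shift_eventually[OF p g e1])
  then obtain \<delta> where \<delta>: "\<delta> > 0" "\<And>t d. \<bar>t - t0\<bar> < \<delta> \<Longrightarrow> d \<in> D0 \<Longrightarrow>
      integral {a..b} (\<lambda>s. norm ((translate t g - translate t0 g) s d) ^ p) < e1"
    unfolding eventually_nhds_metric by (auto simp: dist_real_def)
  show ?thesis
  proof (intro exI conjI allI impI)
    show "min \<delta> 1 > 0" using \<delta> by simp
    fix t and z :: "real \<Rightarrow> 'v \<times> 'v" assume t: "\<bar>t - t0\<bar> < min \<delta> 1" and z: "admissible R a b z"
    let ?\<Delta> = "translate t g - translate t0 g"
    have \<Delta>: "?\<Delta> \<in> LC p" using LC_diff_translate[OF g g] .
    \<comment> \<open>The net point nearest to z s depends on s, hence the sum over the whole net: a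
      majorant that does not mention z.\<close>
    let ?h = "\<lambda>s. 3 ^ p * ((\<Sum>d\<in>D0. norm (?\<Delta> s d) ^ p) + r ^ p * l (s + t) ^ p + r ^ p * l (s + t0) ^ p)"
    have di: "(\<lambda>s. norm (?\<Delta> s d) ^ p) integrable_on {a..b}" for d
      by (rule along_integrable[OF \<Delta> admissible_const[OF order_refl]])
    have lti: "(\<lambda>s. l (s + t') ^ p) integrable_on {a..b}" for t'
      using li integrable_shift_real[of "\<lambda>s. l s ^ p" t'] by simp
    have hi: "?h integrable_on {a..b}"
      using D0(1) di lti by (intro integrable_on_mult_right integrable_add integrable_sum) auto
    have "norm (integral {a..b} (\<lambda>s. norm (?\<Delta> s (z s)) ^ p)) \<le> integral {a..b} ?h"
    proof (rule integrable_dominated_AE(2)[OF integrable_imp_measurable hi])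
      show "(\<lambda>s. norm (?\<Delta> s (z s)) ^ p) integrable_on {a..b}" by (rule along_integrable[OF \<Delta> z])
      have ae: "AE s in lebesgue. s + t' \<notin> N" for t'
        by (rule AE_lebesgue_shift[OF AE_lebesgue_negligibleI[OF N]])
      from ae[of t] ae[of t0]
      show "AE s in lebesgue. s \<in> {a..b} \<longrightarrow> norm (norm (?\<Delta> s (z s)) ^ p) \<le> ?h s"
      proof eventually_elim
        case (elim s)
        show ?case
        proof
          assume s: "s \<in> {a..b}"
          have zR: "norm (z s) \<le> R" using admissibleD(2)[OF z s] .
          then obtain d where d: "d \<in> D0" "dist d (z s) < r" using D0(3) by force
          have dR: "norm d \<le> R" using d(1) D0(2) by auto
          have zd: "norm (z s - d) \<le> r" using d(2) by (simp add: dist_norm norm_minus_commute)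
          have "norm (g (s + t) (z s) - g (s + t) d) \<le> l (s + t) * norm (z s - d)"
            by (rule lip[OF elim(1) zR dR])
          also have "\<dots> \<le> r * l (s + t)" using mult_left_mono[OF zd l0[of "s + t"]] by (simp add: mult.commute)
          finally have 1: "norm (g (s + t) (z s) - g (s + t) d) \<le> r * l (s + t)" .
          have "norm (g (s + t0) (z s) - g (s + t0) d) \<le> l (s + t0) * norm (z s - d)"
            by (rule lip[OF elim(2) zR dR])
          also have "\<dots> \<le> r * l (s + t0)" using mult_left_mono[OF zd l0[of "s + t0"]] by (simp add: mult.commute)
          finally have 2: "norm (g (s + t0) (z s) - g (s + t0) d) \<le> r * l (s + t0)" .
          have "?\<Delta> s (z s) = ?\<Delta> s d + (g (s + t) (z s) - g (s + t) d) - (g (s + t0) (z s) - g (s + t0) d)"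
            by (simp add: translate_def)
          then have "norm (?\<Delta> s (z s)) \<le> norm (?\<Delta> s d) + norm (g (s + t) (z s) - g (s + t) d) + norm (g (s + t0) (z s) - g (s + t0) d)"
            using norm_triangle_ineq4[of "?\<Delta> s d + (g (s + t) (z s) - g (s + t) d)" "g (s + t0) (z s) - g (s + t0) d"]
              norm_triangle_ineq[of "?\<Delta> s d" "g (s + t) (z s) - g (s + t) d"] by simp
          with 1 2 have "norm (?\<Delta> s (z s)) ^ p \<le> (norm (?\<Delta> s d) + r * l (s + t) + r * l (s + t0)) ^ p"
            by (intro power_mono) auto
          also have "\<dots> \<le> 3 ^ p * (norm (?\<Delta> s d) ^ p + (r * l (s + t)) ^ p + (r * l (s + t0)) ^ p)"
            using r l0 by (intro sum3_power_le) auto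
          also have "\<dots> \<le> ?h s"
          proof -
            have "norm (?\<Delta> s d) ^ p \<le> (\<Sum>d\<in>D0. norm (?\<Delta> s d) ^ p)"
              using d(1) D0(1) by (intro member_le_sum) auto
            then show ?thesis by (simp add: power_mult_distrib)
          qed
          finally show "norm (norm (?\<Delta> s (z s)) ^ p) \<le> ?h s" by simp
        qed
      qed
    qed
    also have "integral {a..b} ?h = 3 ^ p * ((\<Sum>d\<in>D0. integral {a..b} (\<lambda>s. norm (?\<Delta> s d) ^ p)) +
        r ^ p * integral {a..b} (\<lambda>s. l (s + t) ^ p) + r ^ p * integral {a..b} (\<lambda>s. l (s + t0) ^ p))"
      using D0(1) di lti
      by (simp add: integral_add integrable_add integrable_sum integral_sum integrable_on_mult_right)
    also have "\<dots> \<le> 3 ^ p * (real (card D0) * e1 + r ^ p * Lb + r ^ p * Lb)"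
    proof -
      have "integral {a..b} (\<lambda>s. l (s + t') ^ p) \<le> Lb" if "\<bar>t' - t0\<bar> \<le> 1" for t'
        unfolding Lb_def integral_shift_real[of a b "\<lambda>s. l s ^ p" t'] using that l0
        by (intro integral_subset_le li) auto
      moreover have "(\<Sum>d\<in>D0. integral {a..b} (\<lambda>s. norm (?\<Delta> s d) ^ p)) \<le> real (card D0) * e1"
        using \<delta>(2) t by (intro sum_bounded_above) (auto intro: less_imp_le)
      ultimately show ?thesis using t r by (intro mult_left_mono add_mono) auto
    qed
    also have "\<dots> = 3 ^ p * (real (card D0) * e1) + 3 ^ p * (2 * r ^ p * Lb)" by (simp add: algebra_simps)
    also have "\<dots> \<le> e/4 + e/4"
    proof (rule add_mono[OF _ rp])
      have "3 ^ p * (real (card D0) * e1) = e / 4 * (real (card D0) / (real (card D0) + 1))" by (simp add: e1_def)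
      also have "\<dots> \<le> e / 4 * 1" using e by (intro mult_left_mono) auto
      finally show "3 ^ p * (real (card D0) * e1) \<le> e / 4" by simp
    qed
    finally show "integral {a..b} (\<lambda>s. norm (?\<Delta> s (z s)) ^ p) < e" using e by simp
  qed
qed

section \<open>The topology of uniform convergence along bounded curves\<close>

abbreviation curves :: "real \<Rightarrow> real \<Rightarrow> nat \<Rightarrow> (real \<Rightarrow> 'v::euclidean_space) set" where
  "curves a b j \<equiv> {z. continuous_on {a..b} z \<and> z ` {a..b} \<subseteq> cball 0 (real j)}"

lemma curves_nonempty: "(\<lambda>_. 0) \<in> curves a b j"
  by auto

lemma curve_admissible: "z \<in> curves a b j \<Longrightarrow> admissible (real j) a b z"
  by (auto intro: admissible_continuous)

lemma seminorm_TB_eq: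
  fixes k :: "('v::euclidean_space) delay_field"
  assumes "k \<in> LC p"
  shows "(SUP z \<in> curves a b j. root p (LINT t:{a..b}|lebesgue. norm (k t (z t)) ^ p)) =
    (SUP z \<in> curves a b j. Lp_norm_along p a b k z)"
proof (rule SUP_cong[OF refl])
  fix z :: "real \<Rightarrow> 'v \<times> 'v" assume "z \<in> curves a b j"
  from LINT_along[OF assms curve_admissible[OF this]]
  show "root p (LINT t:{a..b}|lebesgue. norm (k t (z t)) ^ p) = Lp_norm_along p a b k z"
    by (simp add: Lp_norm_along_def)
qed

text \<open>Gives the real-valued supremum in the seminorm its meaning; the m-bound on the ball of
  radius j serves all curves simultaneously.\<close>

lemma bdd_above_along:
  fixes k :: "('v::euclidean_space) delay_field"
  assumes p: "1 \<le> p" and k: "k \<in> LC p"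
  shows "bdd_above (Lp_norm_along p a b k ` curves a b j)"
proof -
  obtain m N where N: "negligible N" and mi: "\<And>a b. (\<lambda>t. m t ^ p) integrable_on {a..b}"
    and m: "\<And>t z. t \<notin> N \<Longrightarrow> norm z \<le> real j \<Longrightarrow> norm (k t z) \<le> m t"
    by (rule LC_bounds[OF k, of "real j"]) blast
  show ?thesis
  proof (rule bdd_aboveI2)
    fix z :: "real \<Rightarrow> 'v \<times> 'v" assume "z \<in> curves a b j"
    note z = curve_admissible[OF this]
    have "norm (integral {a..b} (\<lambda>t. norm (k t (z t)) ^ p)) \<le> integral {a..b} (\<lambda>t. m t ^ p)"
    proof (rule integrable_dominated_AE(2)[OF integrable_imp_measurable mi])
      show "(\<lambda>t. norm (k t (z t)) ^ p) integrable_on {a..b}" by (rule along_integrable[OF k z])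
      show "AE t in lebesgue. t \<in> {a..b} \<longrightarrow> norm (norm (k t (z t)) ^ p) \<le> m t ^ p"
      proof (rule AE_lebesgue_negligibleI[OF N], rule impI)
        fix t assume "t \<notin> N" "t \<in> {a..b}"
        from power_mono[OF m[OF this(1) admissibleD(2)[OF z this(2)]], of p]
        show "norm (norm (k t (z t)) ^ p) \<le> m t ^ p" by simp
      qed
    qed
    then show "Lp_norm_along p a b k z \<le> root p (integral {a..b} (\<lambda>t. m t ^ p))"
      using p unfolding Lp_norm_along_def by simp
  qed
qed

lemma TB_upper:
  fixes k :: "('v::euclidean_space) delay_field"
  assumes "1 \<le> p" "k \<in> LC p" "z \<in> curves a b j"
  shows "Lp_norm_along p a b k z \<le> (SUP z \<in> curves a b j. Lp_norm_along p a b k z)"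
  by (rule cSUP_upper[OF assms(3) bdd_above_along[OF assms(1,2)]])

lemma TB_least:
  assumes "\<And>z. z \<in> curves a b j \<Longrightarrow> Lp_norm_along p a b k z \<le> c"
  shows "(SUP z \<in> curves a b j. Lp_norm_along p a b k z) \<le> c"
  by (rule cSUP_least) (use assms curves_nonempty in blast)+

lemma seminorms_TB_I:
  assumes "q1 \<in> \<rat>" "q2 \<in> \<rat>" "q1 \<le> q2"
  shows "(\<lambda>f. SUP z \<in> curves q1 q2 j. root p (LINT t:{q1..q2}|lebesgue. norm (f t (z t)) ^ p)) \<in> seminorms_TB p"
  unfolding seminorms_TB_def using assms by blast

lemma seminorms_TB_E:
  assumes "\<rho> \<in> seminorms_TB p"
  obtains q1 q2 j where "q1 \<in> \<rat>" "q2 \<in> \<rat>" "q1 \<le> q2"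
    "\<And>k. k \<in> LC p \<Longrightarrow> \<rho> k = (SUP z \<in> curves q1 q2 j. Lp_norm_along p q1 q2 k z)"
proof -
  obtain q1 q2 j where q: "q1 \<in> \<rat>" "q2 \<in> \<rat>" "q1 \<le> q2"
    and \<rho>: "\<rho> = (\<lambda>f. SUP z \<in> curves q1 q2 j. root p (LINT t:{q1..q2}|lebesgue. norm (f t (z t)) ^ p))"
    using assms unfolding seminorms_TB_def by blast
  show ?thesis by (rule that[OF q]) (simp only: \<rho> seminorm_TB_eq)
qed

text \<open>Composition with the clamp continues a curve by its end values, which makes a curve on a
  larger, rational interval out of one on an arbitrary interval.\<close>

definition clamp_to :: "real \<Rightarrow> real \<Rightarrow> real \<Rightarrow> real" where
  "clamp_to a b s = max a (min b s)"

lemma clamp_to: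
  "a \<le> b \<Longrightarrow> clamp_to a b s \<in> {a..b}" "s \<in> {a..b} \<Longrightarrow> clamp_to a b s = s" "continuous_on A (clamp_to a b)"
  by (auto simp: clamp_to_def[abs_def] intro!: continuous_intros)

lemma continuous_on_clamped:
  assumes "continuous_on {a..b} z" "a \<le> b" shows "continuous_on A (\<lambda>s. z (clamp_to a b (s - c)))"
proof (rule continuous_on_compose2[OF assms(1)])
  show "continuous_on A (\<lambda>s. clamp_to a b (s - c))"
    by (intro continuous_on_compose2[OF clamp_to(3)[of UNIV]] continuous_intros) auto
qed (use clamp_to(1)[OF assms(2)] in auto)

text \<open>For the translation property, h_t - g_(t0) is split into (h - g)_t, whose norm is
  dominated by a norm of h - g over a larger interval, and g_t - g_(t0), which is small uniformly
  over curves.\<close>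

lemma hull_seminorms_TB:
  fixes f :: "('v::euclidean_space) delay_field"
  assumes p: "1 \<le> p" and f: "f \<in> LC p"
  shows "hull_seminorms p (seminorms_TB p) f"
proof
  show "1 \<le> p" "f \<in> LC p" by fact+
  show "seminorms_TB p \<noteq> ({} :: ('v delay_field \<Rightarrow> real) set)"
  proof -
    have "\<exists>\<rho>. \<rho> \<in> (seminorms_TB p :: ('v delay_field \<Rightarrow> real) set)"
      by (rule exI, rule seminorms_TB_I[OF Rats_0 Rats_0 order_refl])
    then show ?thesis by auto
  qed
next
  fix \<rho> :: "'v delay_field \<Rightarrow> real" and g :: "'v delay_field" assume \<rho>: "\<rho> \<in> seminorms_TB p" and g: "g \<in> LC p"
  obtain q1 q2 j where R: "\<And>k. k \<in> LC p \<Longrightarrow> \<rho> k = (SUP z \<in> curves q1 q2 j. Lp_norm_along p q1 q2 k z)"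
    using \<rho> by (rule seminorms_TB_E) blast
  have "curves q1 q2 j \<noteq> ({} :: (real \<Rightarrow> 'v \<times> 'v) set)" using curves_nonempty[of q1 q2 j] by blast
  then show "\<rho> (g - g) = 0"
    unfolding R[OF LC_diff[OF g g]] Lp_norm_along_self[OF p] by (rule cSUP_const)
next
  fix \<rho> :: "'v delay_field \<Rightarrow> real" and g h :: "'v delay_field" assume \<rho>: "\<rho> \<in> seminorms_TB p" and gh: "g \<in> LC p" "h \<in> LC p" "ae_eq g h"
  obtain q1 q2 j where R: "\<And>k. k \<in> LC p \<Longrightarrow> \<rho> k = (SUP z \<in> curves q1 q2 j. Lp_norm_along p q1 q2 k z)"
    using \<rho> by (rule seminorms_TB_E) blast
  show "\<rho> g = \<rho> h"
    unfolding R[OF gh(1)] R[OF gh(2)] by (rule SUP_cong[OF refl]) (rule Lp_norm_along_ae_eq[OF gh(3)])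
next
  fix \<rho> :: "'v delay_field \<Rightarrow> real" and g h k :: "'v delay_field" assume \<rho>: "\<rho> \<in> seminorms_TB p" and gh: "g \<in> LC p" "h \<in> LC p" "k \<in> LC p"
  obtain q1 q2 j where R: "\<And>k. k \<in> LC p \<Longrightarrow> \<rho> k = (SUP z \<in> curves q1 q2 j. Lp_norm_along p q1 q2 k z)"
    using \<rho> by (rule seminorms_TB_E) blast
  show "\<rho> (g - h) \<le> \<rho> (g - k) + \<rho> (k - h)"
    unfolding R[OF LC_diff[OF gh(1,2)]] R[OF LC_diff[OF gh(1,3)]] R[OF LC_diff[OF gh(3,2)]]
  proof (rule TB_least)
    fix z :: "real \<Rightarrow> 'v \<times> 'v" assume z: "z \<in> curves q1 q2 j"
    show "Lp_norm_along p q1 q2 (g - h) z \<le> (SUP z \<in> curves q1 q2 j. Lp_norm_along p q1 q2 (g - k) z) +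
        (SUP z \<in> curves q1 q2 j. Lp_norm_along p q1 q2 (k - h) z)"
      by (rule order_trans[OF Lp_norm_along_triangle[OF p gh curve_admissible[OF z]]
        add_mono[OF TB_upper[OF p LC_diff[OF gh(1,3)] z] TB_upper[OF p LC_diff[OF gh(3,2)] z]]])
  qed
next
  fix g :: "'v delay_field" and \<rho> :: "'v delay_field \<Rightarrow> real" and \<epsilon> t0 :: real
  assume gh: "in_hull p (seminorms_TB p) f g" and \<rho>: "\<rho> \<in> seminorms_TB p" and \<epsilon>: "0 < \<epsilon>"
  have g: "g \<in> LC p" using gh by (simp add: in_hull_def)
  obtain q1 q2 j where q: "q1 \<in> \<rat>" "q2 \<in> \<rat>" "q1 \<le> q2"
    and R: "\<And>k. k \<in> LC p \<Longrightarrow> \<rho> k = (SUP z \<in> curves q1 q2 j. Lp_norm_along p q1 q2 k z)"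
    using \<rho> by (rule seminorms_TB_E) blast
  \<comment> \<open>A rational interval that contains {q1+t..q2+t} for all t within 1 of t0.\<close>
  obtain r1 r2 where r: "r1 \<in> \<rat>" "r2 \<in> \<rat>" "r1 \<le> q1 + t0 - 1" "q2 + t0 + 1 \<le> r2"
    using rational_bounds by meson
  define \<sigma> :: "'v delay_field \<Rightarrow> real"
    where "\<sigma> = (\<lambda>f. SUP z \<in> curves r1 r2 j. root p (LINT t:{r1..r2}|lebesgue. norm (f t (z t)) ^ p))"
  have \<sigma>: "\<sigma> \<in> seminorms_TB p" unfolding \<sigma>_def using r q by (intro seminorms_TB_I) auto
  have \<sigma>eq: "\<sigma> k = (SUP z \<in> curves r1 r2 j. Lp_norm_along p r1 r2 k z)" if "k \<in> LC p" for k
    unfolding \<sigma>_def by (rule seminorm_TB_eq[OF that])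
  have "0 < (\<epsilon>/3) ^ p" using \<epsilon> by simp
  from translate_small_along[OF p g this, of t0 "real j" q1 q2]
  obtain \<delta> where \<delta>: "\<delta> > 0" "\<forall>t. \<bar>t - t0\<bar> < \<delta> \<longrightarrow> (\<forall>z. admissible (real j) q1 q2 z \<longrightarrow>
    integral {q1..q2} (\<lambda>s. norm ((translate t g - translate t0 g) s (z s)) ^ p) < (\<epsilon>/3) ^ p)" by (elim exE conjE)
  show "\<exists>F \<delta>. finite F \<and> F \<subseteq> seminorms_TB p \<and> 0 < \<delta> \<and>
        (\<forall>h t. in_hull p (seminorms_TB p) f h \<longrightarrow> \<bar>t - t0\<bar> < \<delta> \<longrightarrow> (\<forall>\<sigma>\<in>F. \<sigma> (h - g) < \<delta>) \<longrightarrow>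
           \<rho> (translate t h - translate t0 g) < \<epsilon>)"
  proof (rule exI[of _ "{\<sigma>}"], rule exI[of _ "min (min \<delta> 1) (\<epsilon>/3)"], intro conjI allI impI)
    show "finite {\<sigma>}" "{\<sigma>} \<subseteq> seminorms_TB p" "0 < min (min \<delta> 1) (\<epsilon>/3)" using \<sigma> \<delta> \<epsilon> by auto
    fix h t assume hh: "in_hull p (seminorms_TB p) f h" and t: "\<bar>t - t0\<bar> < min (min \<delta> 1) (\<epsilon>/3)"
      and close: "\<forall>\<sigma>'\<in>{\<sigma>}. \<sigma>' (h - g) < min (min \<delta> 1) (\<epsilon>/3)"
    have h: "h \<in> LC p" using hh by (simp add: in_hull_def)
    have cl: "(SUP z \<in> curves r1 r2 j. Lp_norm_along p r1 r2 (h - g) z) < \<epsilon>/3"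
      using close by (simp add: \<sigma>eq[OF LC_diff[OF h g]])
    have "\<rho> (translate t h - translate t0 g) \<le> \<epsilon>/3 + \<epsilon>/3"
      unfolding R[OF LC_diff_translate[OF h g]]
    proof (rule TB_least)
      fix z :: "real \<Rightarrow> 'v \<times> 'v" assume z: "z \<in> curves q1 q2 j"
      define z' where "z' s = z (clamp_to q1 q2 (s - t))" for s
      have z': "z' \<in> curves r1 r2 j"
        unfolding z'_def using z continuous_on_clamped[of q1 q2 z "{r1..r2}" t] clamp_to(1)[OF q(3)] q(3) by auto
      have "Lp_norm_along p q1 q2 (translate t (h - g)) z \<le> Lp_norm_along p r1 r2 (h - g) z'"
      proof (rule Lp_norm_along_translate_le[OF p LC_diff[OF h g] curve_admissible[OF z']])
        show "r1 \<le> q1 + t" "q2 + t \<le> r2" using r t by (auto simp: abs_less_iff)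
        show "z' (s + t) = z s" if "s \<in> {q1..q2}" for s using clamp_to(2)[OF that] by (simp add: z'_def)
      qed
      also have "\<dots> < \<epsilon>/3" using TB_upper[OF p LC_diff[OF h g] z'] cl by simp
      finally have 1: "Lp_norm_along p q1 q2 (translate t h - translate t g) z < \<epsilon>/3"
        by (simp add: translate_diff)
      have 2: "Lp_norm_along p q1 q2 (translate t g - translate t0 g) z < \<epsilon>/3"
        using \<delta>(2) t curve_admissible[OF z] \<epsilon> by (subst Lp_norm_along_less_iff[OF p]) auto
      show "Lp_norm_along p q1 q2 (translate t h - translate t0 g) z \<le> \<epsilon>/3 + \<epsilon>/3"
        using Lp_norm_along_triangle[OF p LC_translate[OF h] LC_translate[OF g] LC_translate[OF g] curve_admissible[OF z], of t t0 t] 1 2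
        by simp
    qed
    then show "\<rho> (translate t h - translate t0 g) < \<epsilon>" using \<epsilon> by simp
  qed
next
  fix g :: "'v delay_field" and \<phi> :: "real \<Rightarrow> 'v" and \<eta> T R :: real
  assume gh: "in_hull p (seminorms_TB p) f g" and \<eta>: "0 < \<eta>"
  have g: "g \<in> LC p" using gh by (simp add: in_hull_def)
  obtain q where q: "q \<in> \<rat>" "max T 0 \<le> q" using rational_bounds(1) by blast
  obtain j where j: "2 * R \<le> real j" using real_arch_simple by blast
  define \<sigma> :: "'v delay_field \<Rightarrow> real"
    where "\<sigma> = (\<lambda>f. SUP z \<in> curves 0 q j. root p (LINT t:{0..q}|lebesgue. norm (f t (z t)) ^ p))"
  have \<sigma>: "\<sigma> \<in> seminorms_TB p" unfolding \<sigma>_def using q by (intro seminorms_TB_I) auto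
  have \<sigma>eq: "\<sigma> k = (SUP z \<in> curves 0 q j. Lp_norm_along p 0 q k z)" if "k \<in> LC p" for k
    unfolding \<sigma>_def by (rule seminorm_TB_eq[OF that])
  \<comment> \<open>q + 1 is the factor by which \<open>along_L1_less\<close> turns a bound on the
    L^p norm over {0..q} into a bound on the integral of the norm.\<close>
  define e where "e = \<eta> / (q + 1)"
  have e: "0 < e" using \<eta> q by (simp add: e_def)
  show "\<exists>F \<delta>. finite F \<and> F \<subseteq> seminorms_TB p \<and> 0 < \<delta> \<and>
        (\<forall>h \<psi> S y. in_hull p (seminorms_TB p) f h \<longrightarrow> (\<forall>\<sigma>\<in>F. \<sigma> (h - g) < \<delta>) \<longrightarrow>
           (\<forall>t\<in>{-1..0}. norm (\<psi> t - \<phi> t) \<le> \<delta>) \<longrightarrow> S \<le> T \<longrightarrow> integral_solution h \<psi> S y \<longrightarrow>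
           (\<forall>t\<in>{-1..S}. norm (y t) \<le> R) \<longrightarrow>
           norm (integral {0..S} (\<lambda>s. h s (y s, y (s - 1)) - g s (y s, y (s - 1)))) \<le> \<eta>)"
  proof (rule exI[of _ "{\<sigma>}"], rule exI[of _ e], intro conjI allI impI)
    show "finite {\<sigma>}" "{\<sigma>} \<subseteq> seminorms_TB p" using \<sigma> by auto
    show "0 < e" by fact
    fix h and \<psi> :: "real \<Rightarrow> 'v" and S y
    assume hh: "in_hull p (seminorms_TB p) f h" and close: "\<forall>\<sigma>'\<in>{\<sigma>}. \<sigma>' (h - g) < e"
      and S: "S \<le> T" and y: "integral_solution h \<psi> S y" and yR: "\<forall>t\<in>{-1..S}. norm (y t) \<le> R"
    have h: "h \<in> LC p" using hh by (simp add: in_hull_def)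
    note yD = integral_solutionD[OF y]
    have pr: "continuous_on {0..S} (\<lambda>s. (y s, y (s - 1)))" "\<And>s. s \<in> {0..S} \<Longrightarrow> norm (y s, y (s - 1)) \<le> 2 * R"
      using delay_pair_admissible[OF yD(2), of R] yR by blast+
    \<comment> \<open>S is arbitrary and y is controlled only up to S, so the delay pair is frozen
      after S to become a curve on {0..q}.\<close>
    define z where "z s = (\<lambda>s. (y s, y (s - 1))) (clamp_to 0 S (s - 0))" for s
    have zc: "z \<in> curves 0 q j"
    proof -
      have "continuous_on {0..q} z" unfolding z_def by (rule continuous_on_clamped[OF pr(1) yD(1)])
      moreover have "norm (z s) \<le> real j" for s
        unfolding z_def using order_trans[OF pr(2)[OF clamp_to(1)[OF yD(1)]] j] by simp
      ultimately show ?thesis by auto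
    qed
    have hg1: "h - g \<in> LC 1" using LC_mono[OF p LC_diff[OF h g]] .
    have Sq: "S \<le> q" using S q by simp
    have i: "(\<lambda>s. norm ((h - g) s (z s))) integrable_on {0..b}" if "b \<le> q" for b
      by (rule along_abs_integrable(3)[OF hg1 admissible_subinterval[OF curve_admissible[OF zc] order_refl that]])
    have "Lp_norm_along p 0 q (h - g) z < e"
      using TB_upper[OF p LC_diff[OF h g] zc] close by (simp add: \<sigma>eq[OF LC_diff[OF h g]])
    then have lt: "integral {0..q} (\<lambda>s. norm ((h - g) s (z s))) < e * (q - 0 + 1)"
      using q by (intro along_L1_less[OF p LC_diff[OF h g] curve_admissible[OF zc] e]) auto
    have "integral {0..S} (\<lambda>s. h s (y s, y (s - 1)) - g s (y s, y (s - 1))) = integral {0..S} (\<lambda>s. (h - g) s (z s))"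
      using clamp_to(2) by (intro integral_cong) (simp add: z_def)
    also have "norm \<dots> \<le> integral {0..S} (\<lambda>s. norm ((h - g) s (z s)))"
      using along_abs_integrable(2)[OF hg1 admissible_subinterval[OF curve_admissible[OF zc] order_refl Sq]] i[OF Sq]
      by (intro integral_norm_bound_integral) auto
    also have "\<dots> \<le> integral {0..q} (\<lambda>s. norm ((h - g) s (z s)))"
      using Sq by (intro integral_subset_le i) auto
    also have "\<dots> \<le> \<eta>" using lt q by (simp add: e_def)
    finally show "norm (integral {0..S} (\<lambda>s. h s (y s, y (s - 1)) - g s (y s, y (s - 1)))) \<le> \<eta>" .
  qed
qed

section \<open>Uniform bounds on translates\<close>

text \<open>The comparison runs through monotonicity of the nonnegative integral, which holds for
  arbitrary V.\<close>

lemma integral_le_nn_integral: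
  fixes v :: "real \<Rightarrow> real"
  assumes v: "v integrable_on {a..b}" and v0: "\<And>s. 0 \<le> v s"
    and V: "\<And>s. s \<in> {a..b} \<Longrightarrow> ennreal (v s) \<le> V s" and sub: "{a..b} \<subseteq> B"
    and M: "(\<integral>\<^sup>+ s \<in> B. V s \<partial>lebesgue) \<le> ennreal M" "0 \<le> M"
  shows "integral {a..b} v \<le> M"
proof -
  have ai: "v absolutely_integrable_on {a..b}"
    using v v0 by (intro nonnegative_absolutely_integrable_1) auto
  then have i: "integrable lebesgue (\<lambda>s. indicator {a..b} s *\<^sub>R v s)"
    by (simp add: set_integrable_def)
  have "ennreal (integral {a..b} v) = ennreal (integral\<^sup>L lebesgue (\<lambda>s. indicator {a..b} s *\<^sub>R v s))"
    using set_lebesgue_integral_eq_integral(2)[OF ai] by (simp add: set_lebesgue_integral_def)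
  also have "\<dots> = (\<integral>\<^sup>+ s. ennreal (indicator {a..b} s *\<^sub>R v s) \<partial>lebesgue)"
    using v0 by (intro nn_integral_eq_integral[symmetric] i) (auto simp: indicator_def)
  also have "\<dots> \<le> (\<integral>\<^sup>+ s \<in> B. V s \<partial>lebesgue)"
    using V sub by (intro nn_integral_mono) (auto simp: indicator_def)
  also have "\<dots> \<le> ennreal M" by (fact M)
  finally show ?thesis using M(2) by simp
qed

text \<open>\<open>lbound\<close> and \<open>mbound\<close> need not be measurable; they are only used as upper bounds for
  measurable functions under the upper integral.\<close>

lemma lbounds_estimate:
  fixes f :: "('v::euclidean_space) delay_field"
  assumes q: "1 \<le> q" and f: "f \<in> LC q" and lb: "Lloc_bounded_lbounds q f" and r: "0 < r"
  shows "\<exists>C>0. \<forall>\<tau> a b w w' \<eta>. -r \<le> a \<longrightarrow> b \<le> r \<longrightarrow> 0 < \<eta> \<longrightarrow> admissible (real j) a b w \<longrightarrow>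
    admissible (real j) a b w' \<longrightarrow> (\<forall>s\<in>{a..b}. norm (w s - w' s) \<le> \<eta>) \<longrightarrow>
    norm (integral {a..b} (\<lambda>s. translate \<tau> f s (w s)) - integral {a..b} (\<lambda>s. translate \<tau> f s (w' s))) \<le> C * \<eta>"
proof -
  define X where "X = (SUP \<tau>::real. \<integral>\<^sup>+ t \<in> {-r..r}. lbound j (translate \<tau> f) t ^ q \<partial>lebesgue)"
  have "X < \<infinity>" using lb r unfolding Lloc_bounded_lbounds_def X_def by blast
  define M where "M = enn2real X"
  have M: "0 \<le> M" "X = ennreal M" using \<open>X < \<infinity>\<close> by (auto simp: M_def)
  have XM: "(\<integral>\<^sup>+ t \<in> {-r..r}. lbound j (translate \<tau> f) t ^ q \<partial>lebesgue) \<le> ennreal M" for \<tau>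
    unfolding M(2)[symmetric] X_def by (rule SUP_upper) simp
  show ?thesis
  \<comment> \<open>M bounds the integral of u^q for all \<tau>; 2 * r comes from integrating the 1
    in u \<le> 1 + u^q over an interval of length at most 2 * r.\<close>
  proof (intro exI[of _ "2 * r + M"] conjI allI impI)
    show "0 < 2 * r + M" using r M by simp
    fix \<tau> a b and w w' :: "real \<Rightarrow> 'v \<times> 'v" and \<eta> :: real
    assume ab: "-r \<le> a" "b \<le> r" and \<eta>: "0 < \<eta>" and w: "admissible (real j) a b w"
      and w': "admissible (real j) a b w'" and near: "\<forall>s\<in>{a..b}. norm (w s - w' s) \<le> \<eta>"
    let ?f = "translate \<tau> f"
    have fq: "?f \<in> LC q" by (rule LC_translate[OF f])
    have f1: "?f \<in> LC 1" by (rule LC_mono[OF q fq])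
    \<comment> \<open>Dividing by the uniform distance \<eta> rather than by the pointwise one keeps
      u meaningful where w and w' coincide, and still below \<open>lbound\<close>.\<close>
    define u where "u s = norm (?f s (w s) - ?f s (w' s)) / \<eta>" for s
    have u0: "0 \<le> u s" for s using \<eta> by (simp add: u_def)
    have di: "(\<lambda>s. ?f s (w s) - ?f s (w' s)) absolutely_integrable_on {a..b}"
      by (rule set_integral_diff(1)[OF along_abs_integrable(1)[OF f1 w] along_abs_integrable(1)[OF f1 w']])
    then have ui: "u integrable_on {a..b}"
      unfolding u_def by (intro integrable_on_divide) (simp add: absolutely_integrable_on_def)
    have "(\<lambda>s. norm (?f s (w s) - ?f s (w' s)) ^ q) integrable_on {a..b}"
      by (rule integrable_norm_power_diff[OF LC_comp_measurable[OF fq admissibleD(1)[OF w]]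
          LC_comp_measurable[OF fq admissibleD(1)[OF w']] along_integrable[OF fq w] along_integrable[OF fq w']])
    then have uqi: "(\<lambda>s. u s ^ q) integrable_on {a..b}"
      unfolding u_def power_divide by (intro integrable_on_divide)
    have uq: "integral {a..b} (\<lambda>s. u s ^ q) \<le> M"
    proof (rule integral_le_nn_integral[OF uqi _ _ _ XM M(1)])
      show "0 \<le> u s ^ q" for s using u0 by simp
      show "{a..b} \<subseteq> {-r..r}" using ab by auto
      fix s assume s: "s \<in> {a..b}"
      have "ennreal (u s) \<le> lbound j ?f s"
      proof (cases "w s = w' s")
        case True
        then show ?thesis by (simp add: u_def)
      next
        case False
        then have pos: "0 < norm (w s - w' s)" by simp
        have "u s \<le> norm (?f s (w s) - ?f s (w' s)) / norm (w s - w' s)"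
          unfolding u_def using near s pos \<eta> by (intro divide_left_mono) auto
        then have "ennreal (u s) \<le> ennreal (norm (?f s (w s) - ?f s (w' s)) / norm (w s - w' s))"
          by (rule ennreal_leI)
        also have "\<dots> \<le> lbound j ?f s"
          unfolding lbound_def
          by (rule SUP_upper2[of "(w s, w' s)"]) (use False admissibleD(2)[OF w s] admissibleD(2)[OF w' s] in auto)
        finally show ?thesis .
      qed
      then have "ennreal (u s) ^ q \<le> lbound j ?f s ^ q" by (rule power_mono) simp
      then show "ennreal (u s ^ q) \<le> lbound j ?f s ^ q" using u0 by (simp add: ennreal_power)
    qed
    have "integral {a..b} u \<le> 2 * r + M"
    proof (cases "a \<le> b")
      case True
      have "integral {a..b} u \<le> integral {a..b} (\<lambda>s. 1 + u s ^ q)"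
        using le_one_plus_power[OF u0 q] by (intro integral_le ui integrable_add uqi) auto
      also have "\<dots> = (b - a) + integral {a..b} (\<lambda>s. u s ^ q)"
        using True uqi by (subst integral_add) auto
      finally show ?thesis using uq ab by simp
    qed (use r M in simp)
    then have "\<eta> * integral {a..b} u \<le> \<eta> * (2 * r + M)" using \<eta> by (intro mult_left_mono) auto
    moreover have "\<eta> * integral {a..b} u = integral {a..b} (\<lambda>s. norm (?f s (w s) - ?f s (w' s)))"
    proof -
      have "(\<lambda>s. \<eta> * u s) = (\<lambda>s. norm (?f s (w s) - ?f s (w' s)))" using \<eta> by (auto simp: u_def)
      then show ?thesis by (simp flip: integral_mult_right)
    qed
    moreover have "norm (integral {a..b} (\<lambda>s. ?f s (w s) - ?f s (w' s))) \<le> integral {a..b} (\<lambda>s. norm (?f s (w s) - ?f s (w' s)))"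
      using di by (intro integral_norm_bound_integral) (auto simp: absolutely_integrable_on_def)
    moreover have "integral {a..b} (\<lambda>s. ?f s (w s) - ?f s (w' s)) = integral {a..b} (\<lambda>s. ?f s (w s)) - integral {a..b} (\<lambda>s. ?f s (w' s))"
      by (rule integral_diff[OF along_abs_integrable(2)[OF f1 w] along_abs_integrable(2)[OF f1 w']])
    ultimately show "norm (integral {a..b} (\<lambda>s. ?f s (w s)) - integral {a..b} (\<lambda>s. ?f s (w' s))) \<le> (2 * r + M) * \<eta>"
      by (simp add: mult.commute)
  qed
qed

lemma mbounds_estimate:
  fixes f :: "('v::euclidean_space) delay_field"
  assumes f: "f \<in> LC 1" and mb: "L1loc_equicontinuous_mbounds f" and r: "0 < r" and \<epsilon>: "0 < \<epsilon>"
  shows "\<exists>\<delta>>0. \<forall>\<tau> a b w. -r \<le> a \<longrightarrow> a \<le> b \<longrightarrow> b \<le> r \<longrightarrow> b - a < \<delta> \<longrightarrow> admissible (real j) a b w \<longrightarrow>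
    norm (integral {a..b} (\<lambda>s. translate \<tau> f s (w s))) \<le> \<epsilon>"
proof -
  obtain \<delta> where \<delta>: "0 < \<delta>" and est: "\<And>s t. -r \<le> s \<Longrightarrow> s \<le> t \<Longrightarrow> t \<le> r \<Longrightarrow> t - s < \<delta> \<Longrightarrow>
     (SUP \<tau>::real. \<integral>\<^sup>+ u \<in> {s..t}. mbound j (translate \<tau> f) u \<partial>lebesgue) < ennreal \<epsilon>"
    using mb[unfolded L1loc_equicontinuous_mbounds_def, rule_format, OF r \<epsilon>, of j] by auto
  show ?thesis
  proof (intro exI[of _ \<delta>] conjI allI impI)
    fix \<tau> a b and w :: "real \<Rightarrow> 'v \<times> 'v"
    assume ab: "-r \<le> a" "a \<le> b" "b \<le> r" "b - a < \<delta>" and w: "admissible (real j) a b w"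
    let ?f = "translate \<tau> f"
    have f1: "?f \<in> LC 1" by (rule LC_translate[OF f])
    have "integral {a..b} (\<lambda>s. norm (?f s (w s))) \<le> \<epsilon>"
    proof (rule integral_le_nn_integral[OF along_abs_integrable(3)[OF f1 w]])
      have "(\<integral>\<^sup>+ u \<in> {a..b}. mbound j ?f u \<partial>lebesgue) \<le> (SUP \<tau>::real. \<integral>\<^sup>+ u \<in> {a..b}. mbound j (translate \<tau> f) u \<partial>lebesgue)"
        by (rule SUP_upper) simp
      with est[OF ab] show "(\<integral>\<^sup>+ u \<in> {a..b}. mbound j ?f u \<partial>lebesgue) \<le> ennreal \<epsilon>" by simp
      show "ennreal (norm (?f s (w s))) \<le> mbound j ?f s" if "s \<in> {a..b}" for s
        unfolding mbound_def by (rule SUP_upper) (use admissibleD(2)[OF w that] in simp)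
    qed (use \<epsilon> in auto)
    moreover have "norm (integral {a..b} (\<lambda>s. ?f s (w s))) \<le> integral {a..b} (\<lambda>s. norm (?f s (w s)))"
      using along_abs_integrable[OF f1 w] by (intro integral_norm_bound_integral) auto
    ultimately show "norm (integral {a..b} (\<lambda>s. ?f s (w s))) \<le> \<epsilon>" by simp
  qed (fact \<delta>)
qed

section \<open>Weak limits of translates\<close>

text \<open>Since the grid points are rational, \<open>\<sigma>\<^sub>D\<close> controls integrals along grid step functions with values in \<open>D\<close>.\<close>

definition grid_step :: "nat \<Rightarrow> (int \<Rightarrow> 'a) \<Rightarrow> real \<Rightarrow> 'a" where
  "grid_step K c s = c \<lfloor>real K * s\<rfloor>"

lemma grid_step_measurable:
  fixes c :: "int \<Rightarrow> 'a::euclidean_space"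
  shows "grid_step K c \<in> borel_measurable borel"
proof -
  have "(\<lambda>s. \<lfloor>real K * s\<rfloor>) \<in> borel \<rightarrow>\<^sub>M count_space UNIV" by measurable
  from measurable_compose[OF this, of c borel] show ?thesis
    by (simp add: grid_step_def[abs_def])
qed

lemma grid_step_admissible:
  fixes c :: "int \<Rightarrow> 'a::euclidean_space"
  assumes "\<And>s. s \<in> {a..b} \<Longrightarrow> norm (grid_step K c s) \<le> R"
  shows "admissible R a b (grid_step K c)"
  using assms borel_measurable_lebesgue_on[OF grid_step_measurable] by (simp add: admissible_def)

text \<open>The right end point has index i1, one more than the last cell; bounds on the values are
  therefore imposed on the closed range of indices.\<close>

lemma grid_floor:
  assumes K: "1 \<le> K" and s: "s \<in> {real_of_int i0 / real K..real_of_int i1 / real K}"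
  shows "\<lfloor>real K * s\<rfloor> \<in> {i0..i1}"
proof -
  have "real_of_int i0 \<le> real K * s" "real K * s \<le> real_of_int i1" using K s by (auto simp: field_simps)
  then show ?thesis by (simp add: le_floor_iff) linarith
qed

lemma grid_step_bounded_ex:
  fixes c :: "int \<Rightarrow> 'a::euclidean_space"
  shows "\<exists>R. admissible R a b (grid_step K c)"
proof -
  have "finite (c ` {\<lfloor>real K * a\<rfloor>..\<lfloor>real K * b\<rfloor>})" by simp
  then have "bounded (c ` {\<lfloor>real K * a\<rfloor>..\<lfloor>real K * b\<rfloor>})" by (rule finite_imp_bounded)
  then obtain R where R: "\<And>i. i \<in> {\<lfloor>real K * a\<rfloor>..\<lfloor>real K * b\<rfloor>} \<Longrightarrow> norm (c i) \<le> R"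
    unfolding bounded_iff by blast
  have "admissible R a b (grid_step K c)"
  proof (rule grid_step_admissible)
    fix s assume "s \<in> {a..b}"
    then have "\<lfloor>real K * s\<rfloor> \<in> {\<lfloor>real K * a\<rfloor>..\<lfloor>real K * b\<rfloor>}"
      by (auto intro!: floor_mono mult_left_mono)
    then show "norm (grid_step K c s) \<le> R" unfolding grid_step_def by (rule R)
  qed
  then show ?thesis by blast
qed

text \<open>The upper limit b may lie inside the cell. The right end point of the cell already
  carries the next value, a discrepancy on a null set.\<close>

lemma grid_cell_integral:
  fixes g :: "('v::euclidean_space) delay_field"
  assumes K: "1 \<le> K" and b: "b \<le> real_of_int (i + 1) / real K"
  shows "integral {real_of_int i / real K..b} (\<lambda>s. g s (grid_step K c s)) =
    integral {real_of_int i / real K..b} (\<lambda>s. g s (c i))"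
proof (rule integral_spike[of "{real_of_int (i + 1) / real K}"])
  fix s assume s: "s \<in> {real_of_int i / real K..b} - {real_of_int (i + 1) / real K}"
  have "s < real_of_int (i + 1) / real K" using s b by auto
  then have "real_of_int i \<le> real K * s" "real K * s < real_of_int (i + 1)"
    using K s by (auto simp: field_simps)
  then have "\<lfloor>real K * s\<rfloor> = i" by (simp add: floor_eq_iff)
  then show "g s (c i) = g s (grid_step K c s)" by (simp add: grid_step_def)
qed simp

lemma grid_integral_sum:
  fixes g :: "('v::euclidean_space) delay_field"
  assumes K: "1 \<le> K" and g: "g \<in> LC 1"
  shows "integral {real_of_int i0 / real K..real_of_int (i0 + int n) / real K} (\<lambda>s. g s (grid_step K c s)) =
    (\<Sum>i<n. integral {real_of_int (i0 + int i) / real K..real_of_int (i0 + int i + 1) / real K} (\<lambda>s. g s (c (i0 + int i))))"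
proof (induction n)
  case (Suc n)
  let ?G = "\<lambda>s. g s (grid_step K c s)"
  let ?a = "real_of_int i0 / real K" and ?b = "real_of_int (i0 + int n) / real K"
    and ?c = "real_of_int (i0 + int (Suc n)) / real K"
  obtain R where "admissible R ?a ?c (grid_step K c)" using grid_step_bounded_ex by blast
  then have "?G integrable_on {?a..?c}" by (rule along_abs_integrable(2)[OF g])
  then have "integral {?a..?c} ?G = integral {?a..?b} ?G + integral {?b..?c} ?G"
    using K by (intro Henstock_Kurzweil_Integration.integral_combine[symmetric]) (auto intro!: divide_right_mono)
  also have "integral {?b..?c} ?G = integral {?b..?c} (\<lambda>s. g s (c (i0 + int n)))"
    by (rule grid_cell_integral[OF K]) (simp add: add_ac)
  finally show ?case using Suc by (simp add: add_ac)
qed simp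

lemma seminorms_sigmaD_I:
  assumes "q1 \<in> \<rat>" "q2 \<in> \<rat>" "q1 \<le> q2" "d \<in> D"
  shows "(\<lambda>f. norm (LINT t:{q1..q2}|lebesgue. f t d)) \<in> seminorms_sigmaD D"
  unfolding seminorms_sigmaD_def using assms by blast

text \<open>Dominated convergence with curve and interval varying together: the m-bound dominates,
  the l-bound gives continuity in the state, and a time other than a and b eventually lies in the
  moving interval.\<close>

lemma LC_integral_limit:
  fixes g :: "('v::euclidean_space) delay_field"
  assumes g: "g \<in> LC 1"
    and w: "\<And>m. admissible R a b (w m)" and z: "\<And>s. s \<in> {a..b} \<Longrightarrow> norm (z s) \<le> R"
    and lim: "\<And>s. s \<in> {a..b} \<Longrightarrow> (\<lambda>m. w m s) \<longlonglongrightarrow> z s"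
    and al: "\<And>m. a \<le> a' m" "a' \<longlonglongrightarrow> a" and bl: "\<And>m. b' m \<le> b" "b' \<longlonglongrightarrow> b"
  shows "(\<lambda>m. integral {a' m..b' m} (\<lambda>s. g s (w m s))) \<longlonglongrightarrow> integral {a..b} (\<lambda>s. g s (z s))"
proof -
  obtain M l N where N: "negligible N" and M0: "\<And>t. 0 \<le> M t"
    and Mi: "\<And>a b. (\<lambda>t. M t ^ 1) integrable_on {a..b}"
    and bd: "\<And>t z. t \<notin> N \<Longrightarrow> norm z \<le> R \<Longrightarrow> norm (g t z) \<le> M t"
    and lip: "\<And>t z1 z2. t \<notin> N \<Longrightarrow> norm z1 \<le> R \<Longrightarrow> norm z2 \<le> R \<Longrightarrow> norm (g t z1 - g t z2) \<le> l t * norm (z1 - z2)"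
    by (rule LC_bounds[OF g, of R]) blast
  have Mi: "M integrable_on {a..b}" for a b using Mi by simp
  define F where "F m s = (if s \<in> {a' m..b' m} then g s (w m s) else 0)" for m s
  have Fm: "F m \<in> borel_measurable (lebesgue_on {a..b})" for m
  proof -
    have "(\<lambda>s. g s (w m s)) \<in> borel_measurable (lebesgue_on {a..b})"
      by (rule LC_comp_measurable[OF g admissibleD(1)[OF w]])
    moreover have "(\<lambda>s. indicator {a' m..b' m} s :: real) \<in> borel_measurable (lebesgue_on {a..b})"
      by (intro borel_measurable_lebesgue_on borel_measurable_indicator) simp
    ultimately have "(\<lambda>s. indicator {a' m..b' m} s *\<^sub>R g s (w m s)) \<in> borel_measurable (lebesgue_on {a..b})"
      by measurable
    moreover have "F m = (\<lambda>s. indicator {a' m..b' m} s *\<^sub>R g s (w m s))"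
      by (auto simp: F_def indicator_def)
    ultimately show ?thesis by simp
  qed
  have "(\<lambda>m. integral {a..b} (F m)) \<longlonglongrightarrow> integral {a..b} (\<lambda>s. g s (z s))"
  proof (rule dominated_convergence_AE(2)[OF Fm Mi])
    show "AE s in lebesgue. s \<in> {a..b} \<longrightarrow> (\<forall>m. norm (F m s) \<le> M s)"
      by (rule AE_lebesgue_negligibleI[OF N]) (use bd M0 admissibleD(2)[OF w] in \<open>auto simp: F_def\<close>)
    have N': "negligible (N \<union> {a, b})" using N by simp
    show "AE s in lebesgue. s \<in> {a..b} \<longrightarrow> (\<lambda>m. F m s) \<longlonglongrightarrow> g s (z s)"
    proof (rule AE_lebesgue_negligibleI[OF N'], rule impI)
      fix s assume sN: "s \<notin> N \<union> {a, b}" and s: "s \<in> {a..b}"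
      have "(\<lambda>m. l s * norm (w m s - z s)) \<longlonglongrightarrow> l s * norm (z s - z s)"
        by (intro tendsto_intros lim s)
      then have "(\<lambda>m. l s * norm (w m s - z s)) \<longlonglongrightarrow> 0" by simp
      then have "(\<lambda>m. g s (w m s) - g s (z s)) \<longlonglongrightarrow> 0"
        by (rule Lim_null_comparison[rotated]) (use lip sN z[OF s] admissibleD(2)[OF w s] in auto)
      then have *: "(\<lambda>m. g s (w m s)) \<longlonglongrightarrow> g s (z s)" by (simp add: LIM_zero_iff)
      have "a < s" "s < b" using sN s by auto
      then have "eventually (\<lambda>m. a' m < s) sequentially" "eventually (\<lambda>m. s < b' m) sequentially"
        using order_tendstoD(2)[OF al(2)] order_tendstoD(1)[OF bl(2)] by blast+
      then have "eventually (\<lambda>m. F m s = g s (w m s)) sequentially"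
        by eventually_elim (simp add: F_def)
      with * show "(\<lambda>m. F m s) \<longlonglongrightarrow> g s (z s)" by (simp add: tendsto_cong)
    qed
  qed
  moreover have "integral {a..b} (F m) = integral {a' m..b' m} (\<lambda>s. g s (w m s))" for m
  proof -
    have sub: "{a' m..b' m} \<subseteq> {a..b}" using al(1)[of m] bl(1)[of m] by auto
    have "integral {a..b} (F m) = integral ({a' m..b' m} \<inter> {a..b}) (\<lambda>s. g s (w m s))"
      unfolding F_def by (rule integral_restrict_Int)
    also have "{a' m..b' m} \<inter> {a..b} = {a' m..b' m}" using sub by blast
    finally show ?thesis .
  qed
  ultimately show ?thesis by simp
qed

section \<open>Integral bounds for all elements of the weak hull\<close>

text \<open>The l-bounds in a form that survives weak limits: a norm of a difference of integrals
  instead of an integral of norms, with C independent of \<tau>.\<close>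

definition lipschitz_translates :: "('v::euclidean_space) delay_field \<Rightarrow> nat \<Rightarrow> real \<Rightarrow> real \<Rightarrow> bool" where
  "lipschitz_translates f j r C \<longleftrightarrow> (\<forall>\<tau> a b w w' \<eta>. -r \<le> a \<longrightarrow> b \<le> r \<longrightarrow> 0 < \<eta> \<longrightarrow> admissible (real j) a b w \<longrightarrow>
    admissible (real j) a b w' \<longrightarrow> (\<forall>s\<in>{a..b}. norm (w s - w' s) \<le> \<eta>) \<longrightarrow>
    norm (integral {a..b} (\<lambda>s. translate \<tau> f s (w s)) - integral {a..b} (\<lambda>s. translate \<tau> f s (w' s))) \<le> C * \<eta>)"

text \<open>Counterpart for the m-bounds: smallness over short intervals, uniformly in \<tau> and in
  the curve.\<close>

definition small_translates :: "('v::euclidean_space) delay_field \<Rightarrow> nat \<Rightarrow> real \<Rightarrow> real \<Rightarrow> real \<Rightarrow> bool" where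
  "small_translates f j r \<delta> \<epsilon> \<longleftrightarrow> (\<forall>\<tau> a b w. -r \<le> a \<longrightarrow> a \<le> b \<longrightarrow> b \<le> r \<longrightarrow> b - a < \<delta> \<longrightarrow> admissible (real j) a b w \<longrightarrow>
    norm (integral {a..b} (\<lambda>s. translate \<tau> f s (w s))) \<le> \<epsilon>)"

lemma dense_near:
  assumes "closure D = UNIV" "0 < e" obtains d where "d \<in> D" "norm (d - x) < e"
proof -
  have "x \<in> closure D" using assms(1) by simp
  then obtain d where "d \<in> D" "dist d x < e" using assms(2) closure_approachable by blast
  then show ?thesis using that by (auto simp: dist_norm)
qed

text \<open>Setting common to \<open>TD\<close> and \<open>sigmaD\<close>: approximation by
  translates is used only in its weak form, with exponent 1.\<close>

locale weak_hull =
  fixes D :: "('v::euclidean_space \<times> 'v) set" and f :: "'v delay_field"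
  assumes f1: "f \<in> LC 1" and dense: "closure D = UNIV"
begin

abbreviation W where "W \<equiv> in_hull 1 (seminorms_sigmaD D) f"

lemma W_LC: "W g \<Longrightarrow> g \<in> LC 1"
  by (simp add: in_hull_def)

text \<open>On a cell the step function is a constant from D, so the cell integral of the difference
  is measured by one seminorm. All step functions of the finite set are approximated by the same
  translate, since two of them will be compared with each other.\<close>

lemma weak_grid:
  assumes W: "W g" and K: "1 \<le> K" and Cs: "finite Cs" "\<And>c i. c \<in> Cs \<Longrightarrow> c i \<in> D" and \<epsilon>: "0 < \<epsilon>"
  shows "\<exists>\<tau>. \<forall>c\<in>Cs. norm (integral {real_of_int i0 / real K..real_of_int (i0 + int n) / real K} (\<lambda>s. translate \<tau> f s (grid_step K c s)) -
      integral {real_of_int i0 / real K..real_of_int (i0 + int n) / real K} (\<lambda>s. g s (grid_step K c s))) \<le> \<epsilon>"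
proof -
  have g: "g \<in> LC 1" by (rule W_LC[OF W])
  let ?I = "\<lambda>i. {real_of_int (i0 + int i) / real K..real_of_int (i0 + int i + 1) / real K}"
  define \<sigma> where "\<sigma> i c k = norm (LINT t:?I i|lebesgue. k t (c (i0 + int i)))" for i c and k :: "'v delay_field"
  have \<sigma>: "\<sigma> i c \<in> seminorms_sigmaD D" if "c \<in> Cs" for i c
    unfolding \<sigma>_def[abs_def] using K Cs(2)[OF that]
    by (intro seminorms_sigmaD_I) (auto intro!: divide_right_mono)
  define e where "e = \<epsilon> / (real n + 1)"
  have e: "0 < e" using \<epsilon> by (simp add: e_def)
  let ?F = "(\<lambda>(i, c). \<sigma> i c) ` ({..<n} \<times> Cs)"
  have "finite ?F" "?F \<subseteq> seminorms_sigmaD D" using Cs(1) \<sigma> by auto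
  with W e obtain \<tau> where "\<forall>\<rho>\<in>?F. \<rho> (translate \<tau> f - g) < e" unfolding in_hull_def by meson
  then have \<tau>: "\<sigma> i c (translate \<tau> f - g) < e" if "i < n" "c \<in> Cs" for i c
    using that by auto
  have ft: "translate \<tau> f \<in> LC 1" by (rule LC_translate[OF f1])
  show ?thesis
  proof (intro exI ballI)
    fix c assume c: "c \<in> Cs"
    let ?d = "\<lambda>i. c (i0 + int i)"
    have cell: "norm (integral (?I i) (\<lambda>s. translate \<tau> f s (?d i)) - integral (?I i) (\<lambda>s. g s (?d i))) \<le> e" if "i < n" for i
    proof -
      have "integral (?I i) (\<lambda>s. translate \<tau> f s (?d i)) - integral (?I i) (\<lambda>s. g s (?d i)) =
          integral (?I i) (\<lambda>s. (translate \<tau> f - g) s (?d i))"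
        using along_abs_integrable(2)[OF ft admissible_const[OF order_refl]]
          along_abs_integrable(2)[OF g admissible_const[OF order_refl]]
        by (simp add: integral_diff)
      then show ?thesis
        using less_imp_le[OF \<tau>[OF that c]] unfolding \<sigma>_def seminorm_sigmaD_eq[OF LC_diff[OF ft g]] by (simp only:)
    qed
    have "norm (\<Sum>i<n. integral (?I i) (\<lambda>s. translate \<tau> f s (?d i)) - integral (?I i) (\<lambda>s. g s (?d i))) \<le> (\<Sum>i<n. e)"
      by (rule sum_norm_le) (use cell in simp)
    also have "\<dots> \<le> \<epsilon>" using \<epsilon> by (simp add: e_def field_simps)
    finally show "norm (integral {real_of_int i0 / real K..real_of_int (i0 + int n) / real K} (\<lambda>s. translate \<tau> f s (grid_step K c s)) -
      integral {real_of_int i0 / real K..real_of_int (i0 + int n) / real K} (\<lambda>s. g s (grid_step K c s))) \<le> \<epsilon>"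
      unfolding grid_integral_sum[OF K ft] grid_integral_sum[OF K g] sum_subtractf .
  qed
qed

lemma grid_admissible:
  assumes K: "1 \<le> K" and "\<And>i. i \<in> {i0..i1} \<Longrightarrow> norm (c i) \<le> R"
  shows "admissible R (real_of_int i0 / real K) (real_of_int i1 / real K) (grid_step K c)"
  by (rule grid_step_admissible) (use assms grid_floor[OF K] in \<open>auto simp: grid_step_def\<close>)

text \<open>Both integrals are exchanged for those of a common translate, where the bound with C
  holds; the error e of the exchange is arbitrary.\<close>

lemma grid_lipschitz:
  assumes W: "W g" and K: "1 \<le> K" and lip: "lipschitz_translates f j r C"
    and c: "\<And>i. c i \<in> D" "\<And>i. c' i \<in> D"
    and cj: "\<And>i. i \<in> {i0..i1} \<Longrightarrow> norm (c i) \<le> real j" "\<And>i. i \<in> {i0..i1} \<Longrightarrow> norm (c' i) \<le> real j"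
    and near: "\<And>i. i \<in> {i0..i1} \<Longrightarrow> norm (c i - c' i) \<le> \<eta>" and \<eta>: "0 < \<eta>" and C: "0 \<le> C"
    and r: "-r \<le> real_of_int i0 / real K" "real_of_int i1 / real K \<le> r"
  shows "norm (integral {real_of_int i0 / real K..real_of_int i1 / real K} (\<lambda>s. g s (grid_step K c s)) -
      integral {real_of_int i0 / real K..real_of_int i1 / real K} (\<lambda>s. g s (grid_step K c' s))) \<le> C * \<eta>"
proof (cases "i0 \<le> i1")
  case False
  then have "real_of_int i1 / real K < real_of_int i0 / real K" using K by (intro divide_strict_right_mono) auto
  then show ?thesis using C \<eta> by simp
next
  case True
  then obtain n where n: "i1 = i0 + int n" using zle_iff_zadd by blast
  let ?I = "{real_of_int i0 / real K..real_of_int i1 / real K}"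
  show ?thesis
  proof (rule field_le_epsilon)
    fix e :: real assume "e > 0"
    then have e: "0 < e/2" by simp
    obtain \<tau> where \<tau>: "\<forall>c\<in>{c, c'}. norm (integral ?I (\<lambda>s. translate \<tau> f s (grid_step K c s)) -
        integral ?I (\<lambda>s. g s (grid_step K c s))) \<le> e/2"
      using weak_grid[OF W K _ _ e, of "{c, c'}" i0 n] c unfolding n by blast
    have "norm (integral ?I (\<lambda>s. translate \<tau> f s (grid_step K c s)) -
        integral ?I (\<lambda>s. translate \<tau> f s (grid_step K c' s))) \<le> C * \<eta>"
    proof (rule lip[unfolded lipschitz_translates_def, rule_format])
      show "admissible (real j) (real_of_int i0 / real K) (real_of_int i1 / real K) (grid_step K c)"
        "admissible (real j) (real_of_int i0 / real K) (real_of_int i1 / real K) (grid_step K c')"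
        by (rule grid_admissible[OF K], use cj in blast)+
      show "norm (grid_step K c s - grid_step K c' s) \<le> \<eta>" if "s \<in> ?I" for s
        unfolding grid_step_def by (rule near[OF grid_floor[OF K that]])
    qed (use r \<eta> in auto)
    moreover have "norm (a - b) \<le> C * \<eta> + e"
      if "norm (x - y) \<le> C * \<eta>" "norm (x - a) \<le> e/2" "norm (y - b) \<le> e/2" for x y a b :: 'v
      using that norm_triangle_ineq4[of "x - y" "x - a"] norm_triangle_ineq[of "(x - y) - (x - a)" "y - b"] by simp
    ultimately show "norm (integral ?I (\<lambda>s. g s (grid_step K c s)) - integral ?I (\<lambda>s. g s (grid_step K c' s))) \<le> C * \<eta> + e"
      using \<tau> by blast
  qed
qed

lemma grid_small:
  assumes W: "W g" and K: "1 \<le> K" and sm: "small_translates f j r \<delta> \<epsilon>"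
    and c: "\<And>i. c i \<in> D" and cj: "\<And>i. i \<in> {i0..i1} \<Longrightarrow> norm (c i) \<le> real j" and \<epsilon>: "0 \<le> \<epsilon>"
    and r: "-r \<le> real_of_int i0 / real K" "real_of_int i1 / real K \<le> r"
    and \<delta>: "real_of_int i1 / real K - real_of_int i0 / real K < \<delta>"
  shows "norm (integral {real_of_int i0 / real K..real_of_int i1 / real K} (\<lambda>s. g s (grid_step K c s))) \<le> \<epsilon>"
proof (cases "i0 \<le> i1")
  case False
  then have "real_of_int i1 / real K < real_of_int i0 / real K" using K by (intro divide_strict_right_mono) auto
  then show ?thesis using \<epsilon> by simp
next
  case True
  then obtain n where n: "i1 = i0 + int n" using zle_iff_zadd by blast
  let ?I = "{real_of_int i0 / real K..real_of_int i1 / real K}"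
  show ?thesis
  proof (rule field_le_epsilon)
    fix e :: real assume e: "e > 0"
    obtain \<tau> where \<tau>: "norm (integral ?I (\<lambda>s. translate \<tau> f s (grid_step K c s)) -
        integral ?I (\<lambda>s. g s (grid_step K c s))) \<le> e"
      using weak_grid[OF W K _ _ e, of "{c}" i0 n] c unfolding n by blast
    have "norm (integral ?I (\<lambda>s. translate \<tau> f s (grid_step K c s))) \<le> \<epsilon>"
    proof (rule sm[unfolded small_translates_def, rule_format])
      show "admissible (real j) (real_of_int i0 / real K) (real_of_int i1 / real K) (grid_step K c)"
        by (rule grid_admissible[OF K]) (use cj in blast)
      show "real_of_int i0 / real K \<le> real_of_int i1 / real K" using True by (intro divide_right_mono) auto
    qed (use r \<delta> in auto)
    with \<tau> show "norm (integral ?I (\<lambda>s. g s (grid_step K c s))) \<le> \<epsilon> + e"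
      using norm_triangle_sub[of "integral ?I (\<lambda>s. g s (grid_step K c s))" "integral ?I (\<lambda>s. translate \<tau> f s (grid_step K c s))"]
      by (simp add: norm_minus_commute)
  qed
qed

text \<open>All grids of mesh 1 / (K (m+1)) refine the grid of mesh 1 / K. Rounding a up and b down
  approximates {a..b} from inside, where the bounds on the curves are available.\<close>

lemma grid_ends:
  assumes K: "1 \<le> K"
  shows "(\<lambda>m. real_of_int \<lfloor>real (K * Suc m) * s\<rfloor> / real (K * Suc m)) \<longlonglongrightarrow> s"
    and "(\<lambda>m. real_of_int \<lceil>real (K * Suc m) * s\<rceil> / real (K * Suc m)) \<longlonglongrightarrow> s"
    and "s \<le> real_of_int \<lceil>real (K * Suc m) * s\<rceil> / real (K * Suc m)"
    and "real_of_int \<lfloor>real (K * Suc m) * s\<rfloor> / real (K * Suc m) \<le> s"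
proof -
  have k0: "0 < real (K * Suc m)" for m using K by (simp only: of_nat_0_less_iff) simp
  have inv: "(\<lambda>m. 1 / real (K * Suc m)) \<longlonglongrightarrow> 0"
  proof (rule Lim_null_comparison[OF _ LIMSEQ_inverse_real_of_nat])
    show "eventually (\<lambda>m. norm (1 / real (K * Suc m)) \<le> inverse (real (Suc m))) sequentially"
    proof (intro always_eventually allI)
      fix m
      have "1 * Suc m \<le> K * Suc m" using K by (rule mult_le_mono1)
      then have "real (Suc m) \<le> real (K * Suc m)" by (simp only: of_nat_le_iff mult_1)
      then have "1 / real (K * Suc m) \<le> 1 / real (Suc m)" by (intro frac_le) auto
      then show "norm (1 / real (K * Suc m)) \<le> inverse (real (Suc m))"
        by (simp only: inverse_eq_divide real_norm_def abs_divide abs_one abs_of_nat)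
    qed
  qed
  have fl: "(\<lambda>m. real_of_int \<lfloor>real (K * Suc m) * s\<rfloor> / real (K * Suc m)) \<longlonglongrightarrow> s" for s
  proof -
    have "\<bar>real_of_int \<lfloor>real (K * Suc m) * s\<rfloor> / real (K * Suc m) - s\<bar> \<le> 1 / real (K * Suc m)" for m
    proof -
      have "\<bar>real_of_int \<lfloor>real (K * Suc m) * s\<rfloor> - real (K * Suc m) * s\<bar> \<le> 1" by linarith
      then have "\<bar>real_of_int \<lfloor>real (K * Suc m) * s\<rfloor> - real (K * Suc m) * s\<bar> / real (K * Suc m) \<le> 1 / real (K * Suc m)"
        by (intro divide_right_mono) auto
      moreover have "real_of_int \<lfloor>real (K * Suc m) * s\<rfloor> / real (K * Suc m) - s = (real_of_int \<lfloor>real (K * Suc m) * s\<rfloor> - real (K * Suc m) * s) / real (K * Suc m)"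
        using k0[of m] by (simp only: diff_divide_distrib) (simp del: of_nat_mult)
      ultimately show ?thesis using k0[of m] by (simp only: abs_divide abs_of_pos)
    qed
    then have "(\<lambda>m. real_of_int \<lfloor>real (K * Suc m) * s\<rfloor> / real (K * Suc m) - s) \<longlonglongrightarrow> 0"
      by (intro Lim_null_comparison[OF _ inv] always_eventually allI) (simp only: real_norm_def)
    then show ?thesis by (simp only: LIM_zero_iff)
  qed
  have ce: "(\<lambda>m. real_of_int \<lceil>real (K * Suc m) * s\<rceil> / real (K * Suc m)) \<longlonglongrightarrow> s"
    using tendsto_minus[OF fl[of "-s"]] by (simp add: ceiling_def)
  have ale: "s \<le> real_of_int \<lceil>real (K * Suc m) * s\<rceil> / real (K * Suc m)"
  proof -
    have "s * real (K * Suc m) \<le> real_of_int \<lceil>real (K * Suc m) * s\<rceil>" by (subst mult.commute) (rule le_of_int_ceiling)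
    then show ?thesis using pos_le_divide_eq[OF k0] by blast
  qed
  have ble: "real_of_int \<lfloor>real (K * Suc m) * s\<rfloor> / real (K * Suc m) \<le> s"
  proof -
    have "real_of_int \<lfloor>real (K * Suc m) * s\<rfloor> \<le> s * real (K * Suc m)" by (subst (2) mult.commute) (rule of_int_floor_le)
    then show ?thesis using pos_divide_le_eq[OF k0] by blast
  qed
  show "(\<lambda>m. real_of_int \<lfloor>real (K * Suc m) * s\<rfloor> / real (K * Suc m)) \<longlonglongrightarrow> s" by (rule fl)
  show "(\<lambda>m. real_of_int \<lceil>real (K * Suc m) * s\<rceil> / real (K * Suc m)) \<longlonglongrightarrow> s" by (rule ce)
  show "s \<le> real_of_int \<lceil>real (K * Suc m) * s\<rceil> / real (K * Suc m)" by (rule ale)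
  show "real_of_int \<lfloor>real (K * Suc m) * s\<rfloor> / real (K * Suc m) \<le> s" by (rule ble)
qed

text \<open>z is sampled at the grid points and each sample is moved into D by at most 1 / (m+1),
  which raises the bound from R to R + 1. Clamping supplies samples at grid points outside
  {a..b}.\<close>

lemma grid_approximation:
  fixes z :: "real \<Rightarrow> 'v \<times> 'v"
  assumes K: "1 \<le> K" and ab: "a \<le> b" and z: "continuous_on {a..b} z" and zR': "\<forall>s\<in>{a..b}. norm (z s) \<le> R"
  shows "\<exists>c. (\<forall>m i. c m i \<in> D) \<and> (\<forall>m i. norm (c m i) \<le> R + 1) \<and>
    (\<forall>m i. norm (c m i - z (clamp_to a b (real_of_int i / real (K * Suc m)))) \<le> 1 / real (Suc m)) \<and>
    (\<forall>g\<in>LC 1. (\<lambda>m. integral {real_of_int \<lceil>real (K * Suc m) * a\<rceil> / real (K * Suc m)..real_of_int \<lfloor>real (K * Suc m) * b\<rfloor> / real (K * Suc m)}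
        (\<lambda>s. g s (grid_step (K * Suc m) (c m) s))) \<longlonglongrightarrow> integral {a..b} (\<lambda>s. g s (z s)))"
proof -
  note zR = zR'[rule_format]
  have "\<exists>d\<in>D. norm (d - z (clamp_to a b (real_of_int i / real (K * Suc m)))) \<le> 1 / real (Suc m)" for m i
    by (rule dense_near[OF dense, of "1 / real (Suc m)"]) (auto intro: less_imp_le)
  then have ex: "\<exists>d. d \<in> D \<and> norm (d - z (clamp_to a b (real_of_int i / real (K * Suc m)))) \<le> 1 / real (Suc m)" for m i
    unfolding Bex_def .
  define c where "c m i = (SOME d. d \<in> D \<and> norm (d - z (clamp_to a b (real_of_int i / real (K * Suc m)))) \<le> 1 / real (Suc m))" for m i
  have c: "c m i \<in> D" "norm (c m i - z (clamp_to a b (real_of_int i / real (K * Suc m)))) \<le> 1 / real (Suc m)" for m i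
    using someI_ex[OF ex[of i m]] unfolding c_def by blast+
  have cR: "norm (c m i) \<le> R + 1" for m i
  proof -
    have "1 / real (Suc m) \<le> 1" by simp
    then show ?thesis
      using c(2)[of m i] zR[OF clamp_to(1)[OF ab], of "real_of_int i / real (K * Suc m)"]
        norm_triangle_sub[of "c m i" "z (clamp_to a b (real_of_int i / real (K * Suc m)))"] by linarith
  qed
  have lim: "(\<lambda>m. grid_step (K * Suc m) (c m) s) \<longlonglongrightarrow> z s" if s: "s \<in> {a..b}" for s
  proof -
    have "continuous_on UNIV (\<lambda>s. z (clamp_to a b (s - 0)))" by (rule continuous_on_clamped[OF z ab])
    then have "isCont (\<lambda>s. z (clamp_to a b s)) s" by (simp add: continuous_on_eq_continuous_at)
    from isCont_tendsto_compose[OF this grid_ends(1)[OF K, of s]]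
    have "(\<lambda>m. z (clamp_to a b (real_of_int \<lfloor>real (K * Suc m) * s\<rfloor> / real (K * Suc m)))) \<longlonglongrightarrow> z s"
      using clamp_to(2)[OF s] by simp
    moreover have "(\<lambda>m. grid_step (K * Suc m) (c m) s - z (clamp_to a b (real_of_int \<lfloor>real (K * Suc m) * s\<rfloor> / real (K * Suc m)))) \<longlonglongrightarrow> 0"
      by (rule Lim_null_comparison[OF _ LIMSEQ_inverse_real_of_nat])
        (use c(2) in \<open>auto simp: grid_step_def inverse_eq_divide intro!: always_eventually simp del: of_nat_mult of_nat_Suc mult_Suc_right\<close>)
    ultimately show ?thesis using tendsto_add by fastforce
  qed
  have adm: "admissible (R + 1) a b (grid_step (K * Suc m) (c m))" for m
    by (rule grid_step_admissible) (simp add: grid_step_def cR)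
  have zR1: "norm (z s) \<le> R + 1" if "s \<in> {a..b}" for s using zR[OF that] by simp
  show ?thesis
  proof (rule exI[of _ c], intro conjI allI ballI)
    fix g :: "'v delay_field" assume g: "g \<in> LC 1"
    show "(\<lambda>m. integral {real_of_int \<lceil>real (K * Suc m) * a\<rceil> / real (K * Suc m)..real_of_int \<lfloor>real (K * Suc m) * b\<rfloor> / real (K * Suc m)}
        (\<lambda>s. g s (grid_step (K * Suc m) (c m) s))) \<longlonglongrightarrow> integral {a..b} (\<lambda>s. g s (z s))"
      by (rule LC_integral_limit[OF g adm zR1 lim grid_ends(3)[OF K] grid_ends(2)[OF K] grid_ends(4)[OF K] grid_ends(1)[OF K]])
  qed (rule c cR)+
qed

text \<open>z is approximated by step functions on finer and finer grids,
  \<open>grid_lipschitz\<close> is applied to them and the fixed step function, and in the limit the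
  sampling error 1 / (m+1) disappears. The margin 1 in the bound on z leaves room for the
  samples.\<close>

lemma hull_lipschitz:
  fixes z :: "real \<Rightarrow> 'v \<times> 'v"
  assumes W: "W g" and K: "1 \<le> K" and lip: "lipschitz_translates f j r C" and C: "0 \<le> C"
    and ab: "-r \<le> a" "a \<le> b" "b \<le> r" and z: "continuous_on {a..b} z" and zR: "\<And>s. s \<in> {a..b} \<Longrightarrow> norm (z s) + 1 \<le> real j"
    and c: "\<And>i. c i \<in> D" and cR: "\<And>s. s \<in> {a..b} \<Longrightarrow> norm (grid_step K c s) \<le> real j"
    and near: "\<And>s. s \<in> {a..b} \<Longrightarrow> norm (z s - grid_step K c s) \<le> \<eta>" and \<eta>: "0 < \<eta>"
  shows "norm (integral {a..b} (\<lambda>s. g s (z s)) - integral {a..b} (\<lambda>s. g s (grid_step K c s))) \<le> C * \<eta>"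
proof -
  have g: "g \<in> LC 1" by (rule W_LC[OF W])
  have zR': "\<forall>s\<in>{a..b}. norm (z s) \<le> real j - 1" using zR by force
  let ?k = "\<lambda>m. K * Suc m"
  let ?a = "\<lambda>m. real_of_int \<lceil>real (?k m) * a\<rceil> / real (?k m)"
  let ?b = "\<lambda>m. real_of_int \<lfloor>real (?k m) * b\<rfloor> / real (?k m)"
  from grid_approximation[OF K ab(2) z zR']
  obtain d where d': "\<forall>m i. d m i \<in> D" and dR': "\<forall>m i. norm (d m i) \<le> real j - 1 + 1"
    and dz': "\<forall>m i. norm (d m i - z (clamp_to a b (real_of_int i / real (?k m)))) \<le> 1 / real (Suc m)"
    and lim': "\<forall>g\<in>LC 1. (\<lambda>m. integral {?a m..?b m} (\<lambda>s. g s (grid_step (?k m) (d m) s))) \<longlonglongrightarrow> integral {a..b} (\<lambda>s. g s (z s))"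
    by (elim exE conjE)
  note d = d'[rule_format] and dR = dR'[rule_format] and dz = dz'[rule_format] and lim = lim'[rule_format]
  note al = grid_ends(2)[OF K, of a] and bl = grid_ends(1)[OF K, of b]
    and ale = grid_ends(3)[OF K, of a] and ble = grid_ends(4)[OF K, where s=b]
  \<comment> \<open>Writes the coarse step function as a step function on the refined grid, so that
    both functions live on one grid.\<close>
  define c' where "c' m i = c (i div int (Suc m))" for m i
  have same: "grid_step (?k m) (c' m) = grid_step K c" for m
  proof
    fix s
    have "\<lfloor>real (?k m) * s\<rfloor> div int (Suc m) = \<lfloor>real (?k m) * s / real_of_int (int (Suc m))\<rfloor>"
      by (rule floor_divide_real_eq_div[symmetric]) simp
    also have "real (?k m) * s / real_of_int (int (Suc m)) = real K * s"
      unfolding of_nat_mult of_int_of_nat_eq using of_nat_neq_0[of m] by (simp del: of_nat_Suc)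
    finally show "grid_step (?k m) (c' m) s = grid_step K c s" by (simp only: grid_step_def c'_def)
  qed
  have "(\<lambda>m. integral {?a m..?b m} (\<lambda>s. g s (grid_step K c s))) \<longlonglongrightarrow> integral {a..b} (\<lambda>s. g s (grid_step K c s))"
    by (rule LC_integral_limit[OF g grid_step_admissible[OF cR] cR tendsto_const ale al ble bl])
  then have L: "(\<lambda>m. norm (integral {?a m..?b m} (\<lambda>s. g s (grid_step (?k m) (d m) s)) - integral {?a m..?b m} (\<lambda>s. g s (grid_step K c s))))
      \<longlonglongrightarrow> norm (integral {a..b} (\<lambda>s. g s (z s)) - integral {a..b} (\<lambda>s. g s (grid_step K c s)))"
    by (intro tendsto_norm tendsto_diff lim[OF g])
  have "(\<lambda>m. C * (\<eta> + inverse (real (Suc m)))) \<longlonglongrightarrow> C * (\<eta> + 0)"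
    by (intro tendsto_intros LIMSEQ_inverse_real_of_nat)
  moreover have "norm (integral {?a m..?b m} (\<lambda>s. g s (grid_step (?k m) (d m) s)) - integral {?a m..?b m} (\<lambda>s. g s (grid_step K c s)))
      \<le> C * (\<eta> + inverse (real (Suc m)))" for m
  proof -
    have k1: "1 \<le> ?k m" using K by simp
    have pt: "real_of_int i / real (?k m) \<in> {a..b}" if i: "i \<in> {\<lceil>real (?k m) * a\<rceil>..\<lfloor>real (?k m) * b\<rfloor>}" for i
    proof -
      have "?a m \<le> real_of_int i / real (?k m)" using i by (intro divide_right_mono) auto
      moreover have "real_of_int i / real (?k m) \<le> ?b m" using i by (intro divide_right_mono) auto
      ultimately show ?thesis using order_trans[OF ale[of m]] order_trans[OF _ ble[of m]] by simp
    qed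
    \<comment> \<open>As a value of the coarse step function at a grid point of {a..b}, c' m i
      inherits the bounds that are assumed only there.\<close>
    have ci: "c' m i = grid_step K c (real_of_int i / real (?k m))" for i
    proof -
      have "real K * (real_of_int i / real (?k m)) = real_of_int i / real_of_int (int (Suc m))"
        unfolding of_nat_mult of_int_of_nat_eq using K by (simp del: of_nat_Suc)
      then show ?thesis by (simp only: grid_step_def c'_def floor_divide_of_int_eq)
    qed
    have "norm (integral {?a m..?b m} (\<lambda>s. g s (grid_step (?k m) (d m) s)) - integral {?a m..?b m} (\<lambda>s. g s (grid_step (?k m) (c' m) s)))
        \<le> C * (\<eta> + inverse (real (Suc m)))"
    proof (rule grid_lipschitz[OF W k1 lip d])
      show "c' m i \<in> D" for i by (simp add: c'_def c)
      show "norm (d m i) \<le> real j" for i using dR[of m i] by simp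
      fix i assume i: "i \<in> {\<lceil>real (?k m) * a\<rceil>..\<lfloor>real (?k m) * b\<rfloor>}"
      show "norm (c' m i) \<le> real j" unfolding ci by (rule cR[OF pt[OF i]])
      have "norm (d m i - z (real_of_int i / real (?k m))) \<le> 1 / real (Suc m)"
        using dz[of m i] unfolding clamp_to(2)[OF pt[OF i]] .
      then show "norm (d m i - c' m i) \<le> \<eta> + inverse (real (Suc m))"
        using near[OF pt[OF i]] norm_triangle_ineq[of "d m i - z (real_of_int i / real (?k m))" "z (real_of_int i / real (?k m)) - c' m i"]
        unfolding ci inverse_eq_divide by simp
    next
      show "0 < \<eta> + inverse (real (Suc m))" using \<eta> by (intro add_pos_pos) auto
      show "-r \<le> ?a m" using ab(1) ale[of m] by linarith
      show "?b m \<le> r" using ab(3) ble[of m] by linarith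
    qed (fact C)
    then show ?thesis unfolding same .
  qed
  ultimately show ?thesis using LIMSEQ_le[OF L] by fastforce
qed

text \<open>Rounding inwards never lengthens the interval, so b - a < \<delta> persists for the
  approximating grid intervals.\<close>

lemma hull_small:
  fixes z :: "real \<Rightarrow> 'v \<times> 'v"
  assumes W: "W g" and sm: "small_translates f j r \<delta> \<epsilon>" and \<epsilon>: "0 \<le> \<epsilon>"
    and ab: "-r \<le> a" "a \<le> b" "b \<le> r" "b - a < \<delta>"
    and z: "continuous_on {a..b} z" and zR: "\<And>s. s \<in> {a..b} \<Longrightarrow> norm (z s) + 1 \<le> real j"
  shows "norm (integral {a..b} (\<lambda>s. g s (z s))) \<le> \<epsilon>"
proof -
  have g: "g \<in> LC 1" by (rule W_LC[OF W])
  have zR': "\<forall>s\<in>{a..b}. norm (z s) \<le> real j - 1" using zR by force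
  let ?k = "\<lambda>m. 1 * Suc m"
  let ?a = "\<lambda>m. real_of_int \<lceil>real (?k m) * a\<rceil> / real (?k m)"
  let ?b = "\<lambda>m. real_of_int \<lfloor>real (?k m) * b\<rfloor> / real (?k m)"
  from grid_approximation[OF order_refl ab(2) z zR']
  obtain d where d': "\<forall>m i. d m i \<in> D" and dR': "\<forall>m i. norm (d m i) \<le> real j - 1 + 1"
    and lim': "\<forall>g\<in>LC 1. (\<lambda>m. integral {?a m..?b m} (\<lambda>s. g s (grid_step (?k m) (d m) s))) \<longlonglongrightarrow> integral {a..b} (\<lambda>s. g s (z s))"
    by (elim exE conjE)
  note d = d'[rule_format] and dR = dR'[rule_format] and lim = lim'[rule_format]
  note ale = grid_ends(3)[OF order_refl, of a] and ble = grid_ends(4)[OF order_refl, where s=b]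
  have "norm (integral {?a m..?b m} (\<lambda>s. g s (grid_step (?k m) (d m) s))) \<le> \<epsilon>" for m
  proof (rule grid_small[OF W _ sm d _ \<epsilon>])
    show "norm (d m i) \<le> real j" for i using dR[of m i] by simp
    show "-r \<le> ?a m" using ab(1) ale[of m] by linarith
    show "?b m \<le> r" using ab(3) ble[of m] by linarith
    show "?b m - ?a m < \<delta>" using ab(4) ble[of m] ale[of m] by linarith
  qed simp
  then show ?thesis by (intro LIMSEQ_le_const2[OF tendsto_norm[OF lim[OF g]]]) blast
qed

end

lemma lipschitz_translates_ex:
  assumes "1 \<le> q" "f \<in> LC q" "Lloc_bounded_lbounds q f" "0 < r"
  shows "\<exists>C>0. lipschitz_translates f j r C"
  using lbounds_estimate[OF assms, of j] unfolding lipschitz_translates_def .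

lemma small_translates_ex:
  assumes "f \<in> LC 1" "L1loc_equicontinuous_mbounds f" "0 < r" "0 < \<epsilon>"
  shows "\<exists>\<delta>>0. small_translates f j r \<delta> \<epsilon>"
  using mbounds_estimate[OF assms, of j] unfolding small_translates_def .

context weak_hull
begin

section \<open>Replacing a curve by a step function over a finite net\<close>

lemma finite_net:
  assumes "0 < e" shows "\<exists>N. finite N \<and> N \<subseteq> D \<and> (\<forall>x. norm x \<le> R \<longrightarrow> (\<exists>d\<in>N. norm (d - x) < e))"
proof -
  have cov: "cball (0::'v \<times> 'v) R \<subseteq> (\<Union>d\<in>D. ball d e)"
  proof
    fix x :: "'v \<times> 'v"
    obtain d where "d \<in> D" "norm (d - x) < e" by (rule dense_near[OF dense assms])
    then show "x \<in> (\<Union>d\<in>D. ball d e)" by (auto simp: dist_norm)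
  qed
  obtain N where N: "N \<subseteq> D" "finite N" "cball (0::'v \<times> 'v) R \<subseteq> (\<Union>d\<in>N. ball d e)"
    by (rule compactE_image[OF compact_cball _ cov]) auto
  have "\<exists>d\<in>N. norm (d - x) < e" if "norm x \<le> R" for x
  proof -
    have "x \<in> cball 0 R" using that by simp
    then obtain d where "d \<in> N" "x \<in> ball d e" using N(3) by blast
    then show ?thesis by (auto simp: dist_norm)
  qed
  with N(1,2) show ?thesis by blast
qed

text \<open>One e is lost by freezing z at the left end of a cell, another by moving to the net.
  Clamped sampling puts c into N at every index, also at those outside {0..S}.\<close>

lemma net_step:
  fixes z :: "real \<Rightarrow> 'v \<times> 'v"
  assumes K: "1 \<le> K" and S: "0 \<le> S" and net: "\<forall>x. norm x \<le> R \<longrightarrow> (\<exists>d\<in>N. norm (d - x) < e)"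
    and zR: "\<forall>s\<in>{0..S}. norm (z s) \<le> R"
    and mod: "\<forall>s\<in>{0..S}. \<forall>s'\<in>{0..S}. \<bar>s - s'\<bar> \<le> 1 / real K \<longrightarrow> norm (z s - z s') \<le> e"
  shows "\<exists>c. (\<forall>i. c i \<in> N) \<and> (\<forall>i. norm (c i) \<le> R + e) \<and> (\<forall>s\<in>{0..S}. norm (z s - grid_step K c s) \<le> 2 * e)"
proof -
  let ?z = "\<lambda>i. z (clamp_to 0 S (real_of_int i / real K))"
  have zi: "norm (?z i) \<le> R" for i using zR clamp_to(1)[OF S] by blast
  define c where "c i = (SOME d. d \<in> N \<and> norm (d - ?z i) < e)" for i
  have "\<exists>d. d \<in> N \<and> norm (d - ?z i) < e" for i using net zi[of i] by blast
  then have c: "c i \<in> N \<and> norm (c i - ?z i) < e" for i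
    unfolding c_def by (rule someI_ex)
  have 1: "norm (c i) \<le> R + e" for i
    using c[of i] zi[of i] norm_triangle_sub[of "c i" "?z i"] by linarith
  have 2: "norm (z s - grid_step K c s) \<le> 2 * e" if s: "s \<in> {0..S}" for s
  proof -
    let ?i = "\<lfloor>real K * s\<rfloor>"
    have k: "0 < real K" using K by simp
    have "0 \<le> real_of_int ?i" using s k by simp
    moreover have lo: "real_of_int ?i \<le> real K * s" and hi: "real K * s < real_of_int ?i + 1" by linarith+
    ultimately have pt: "real_of_int ?i / real K \<in> {0..S}"
      using k s pos_divide_le_eq[OF k, of "real_of_int ?i" s] by (auto simp: mult.commute intro: order_trans)
    have "s - real_of_int ?i / real K = (real K * s - real_of_int ?i) / real K" using k by (simp add: field_simps)
    then have "\<bar>s - real_of_int ?i / real K\<bar> = \<bar>real K * s - real_of_int ?i\<bar> / real K" using k by (simp add: abs_divide)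
    moreover have "\<bar>real K * s - real_of_int ?i\<bar> \<le> 1" using lo hi by linarith
    ultimately have "\<bar>s - real_of_int ?i / real K\<bar> \<le> 1 / real K" using divide_right_mono[OF _ less_imp_le[OF k]] by metis
    then have "norm (z s - z (real_of_int ?i / real K)) \<le> e" using mod s pt by blast
    moreover have "norm (c ?i - z (real_of_int ?i / real K)) < e" using c[of ?i] clamp_to(2)[OF pt] by simp
    ultimately show ?thesis
      using norm_triangle_ineq4[of "z s - z (real_of_int ?i / real K)" "c ?i - z (real_of_int ?i / real K)"]
      by (simp add: grid_step_def)
  qed
  show ?thesis using c 1 2 by blast
qed

text \<open>The curve is replaced by the step function once for h and once for g, each time at cost
  C * \<eta>; only the comparison along the step function depends on the topology.\<close>

lemma error_split:
  fixes z :: "real \<Rightarrow> 'v \<times> 'v"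
  assumes W: "W g" "W h" and K: "1 \<le> K" and lip: "lipschitz_translates f j r C" and C: "0 \<le> C"
    and S: "0 \<le> S" "S \<le> r" and z: "continuous_on {0..S} z" and zR: "\<forall>s\<in>{0..S}. norm (z s) + 1 \<le> real j"
    and c: "\<forall>i. c i \<in> D" and cR: "\<forall>i. norm (c i) \<le> real j"
    and near: "\<forall>s\<in>{0..S}. norm (z s - grid_step K c s) \<le> \<eta>" and \<eta>: "0 < \<eta>"
    and err: "norm (integral {0..S} (\<lambda>s. h s (grid_step K c s)) - integral {0..S} (\<lambda>s. g s (grid_step K c s))) \<le> e"
  shows "norm (integral {0..S} (\<lambda>s. h s (z s) - g s (z s))) \<le> 2 * C * \<eta> + e"
proof -
  have L: "norm (integral {0..S} (\<lambda>s. k s (z s)) - integral {0..S} (\<lambda>s. k s (grid_step K c s))) \<le> C * \<eta>" if "W k" for k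
  proof (rule hull_lipschitz[OF that K lip C _ S(1) S(2) z])
    show "norm (grid_step K c s) \<le> real j" for s using cR by (simp add: grid_step_def)
  qed (use S zR c near \<eta> in auto)
  have "integral {0..S} (\<lambda>s. h s (z s) - g s (z s)) = integral {0..S} (\<lambda>s. h s (z s)) - integral {0..S} (\<lambda>s. g s (z s))"
    using LC_comp_continuous_integrable[OF W_LC[OF W(2)] z] LC_comp_continuous_integrable[OF W_LC[OF W(1)] z]
    by (intro integral_diff) (auto simp: absolutely_integrable_on_def)
  moreover have "norm (a - b) \<le> 2 * C * \<eta> + e"
    if "norm (a - a') \<le> C * \<eta>" "norm (b - b') \<le> C * \<eta>" "norm (a' - b') \<le> e" for a b a' b' :: 'v
    using that norm_triangle_ineq[of "(a - a') - (b - b')" "a' - b'"] norm_triangle_ineq4[of "a - a'" "b - b'"] by simp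
  ultimately show ?thesis using L[OF W(2)] L[OF W(1)] err by simp
qed

end

section \<open>The topology of convergence at the points of a dense set\<close>

lemma seminorms_TD_I:
  assumes "q1 \<in> \<rat>" "q2 \<in> \<rat>" "q1 \<le> q2" "d \<in> D"
  shows "(\<lambda>f. root p (LINT t:{q1..q2}|lebesgue. norm (f t d) ^ p)) \<in> seminorms_TD p D"
  unfolding seminorms_TD_def using assms by blast

lemma seminorms_TD_E:
  assumes "\<rho> \<in> seminorms_TD p D"
  obtains q1 q2 d where "q1 \<in> \<rat>" "q2 \<in> \<rat>" "q1 \<le> q2" "d \<in> D"
    "\<And>k. k \<in> LC p \<Longrightarrow> \<rho> k = Lp_norm_along p q1 q2 k (\<lambda>_. d)"
proof -
  obtain q1 q2 d where q: "q1 \<in> \<rat>" "q2 \<in> \<rat>" "q1 \<le> q2" "d \<in> D"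
    and \<rho>: "\<rho> = (\<lambda>f. root p (LINT t:{q1..q2}|lebesgue. norm (f t d) ^ p))"
    using assms unfolding seminorms_TD_def by blast
  show ?thesis by (rule that[OF q]) (simp only: \<rho> seminorm_TD_eq)
qed

lemma seminorms_sigmaD_E:
  assumes "\<rho> \<in> seminorms_sigmaD D"
  obtains q1 q2 d where "q1 \<in> \<rat>" "q2 \<in> \<rat>" "q1 \<le> q2" "d \<in> D"
    "\<And>k. k \<in> LC 1 \<Longrightarrow> \<rho> k = norm (integral {q1..q2} (\<lambda>t. k t d))"
proof -
  obtain q1 q2 d where q: "q1 \<in> \<rat>" "q2 \<in> \<rat>" "q1 \<le> q2" "d \<in> D"
    and \<rho>: "\<rho> = (\<lambda>f. norm (LINT t:{q1..q2}|lebesgue. f t d))"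
    using assms unfolding seminorms_sigmaD_def by blast
  show ?thesis by (rule that[OF q]) (simp only: \<rho> seminorm_sigmaD_eq)
qed

text \<open>Each weak seminorm is controlled by the norm for the same point and interval, so a
  translate close to g for \<open>TD\<close> is also close for \<open>sigmaD\<close>. This opens the
  estimates of \<open>weak_hull\<close> to the stronger topology.\<close>

lemma in_hull_TD_imp_sigmaD:
  fixes f :: "('v::euclidean_space) delay_field"
  assumes p: "1 \<le> p" and f: "f \<in> LC p" and g: "in_hull p (seminorms_TD p D) f g"
  shows "in_hull 1 (seminorms_sigmaD D) f g"
proof -
  have gL: "g \<in> LC p" using g by (simp add: in_hull_def)
  have ctrl: "\<exists>\<rho> \<delta>. \<rho> \<in> seminorms_TD p D \<and> 0 < \<delta> \<and> (\<forall>k\<in>LC p. \<rho> k < \<delta> \<longrightarrow> \<sigma> k < \<epsilon>)"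
    if \<sigma>: "\<sigma> \<in> seminorms_sigmaD D" and \<epsilon>: "0 < \<epsilon>" for \<sigma> :: "'v delay_field \<Rightarrow> real" and \<epsilon>
  proof -
    obtain q1 q2 d where q: "q1 \<in> \<rat>" "q2 \<in> \<rat>" "q1 \<le> q2" "d \<in> D"
      and \<sigma>eq: "\<And>k. k \<in> LC 1 \<Longrightarrow> \<sigma> k = norm (integral {q1..q2} (\<lambda>t. k t d))"
      using \<sigma> by (rule seminorms_sigmaD_E) blast
    define \<delta> where "\<delta> = \<epsilon> / (q2 - q1 + 1)"
    have \<delta>: "0 < \<delta>" "\<delta> * (q2 - q1 + 1) = \<epsilon>" using \<epsilon> q by (auto simp: \<delta>_def)
    let ?\<rho> = "\<lambda>f :: 'v delay_field. root p (LINT t:{q1..q2}|lebesgue. norm (f t d) ^ p)"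
    have "\<sigma> k < \<epsilon>" if k: "k \<in> LC p" and less: "?\<rho> k < \<delta>" for k
    proof -
      have k1: "k \<in> LC 1" using LC_mono[OF p k] .
      note adm = admissible_const[OF order_refl[of "norm d"], of q1 q2]
      have "\<sigma> k \<le> integral {q1..q2} (\<lambda>t. norm (k t d))"
        unfolding \<sigma>eq[OF k1] using along_abs_integrable[OF k1 adm] by (intro integral_norm_bound_integral) auto
      also have "\<dots> < \<delta> * (q2 - q1 + 1)"
        using less unfolding seminorm_TD_eq[OF k] by (rule along_L1_less[OF p k adm \<delta>(1) q(3)])
      finally show ?thesis using \<delta> by simp
    qed
    then show ?thesis using seminorms_TD_I[OF q] \<delta>(1) by blast
  qed
  show ?thesis
    unfolding in_hull_def
  proof (intro conjI allI impI)
    show "g \<in> LC 1" using LC_mono[OF p gL] .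
    fix F and \<epsilon> :: real assume F: "finite F" "F \<subseteq> seminorms_sigmaD D" and \<epsilon>: "0 < \<epsilon>"
    have "\<forall>\<sigma>\<in>F. \<exists>\<rho> \<delta>. \<rho> \<in> seminorms_TD p D \<and> 0 < \<delta> \<and> (\<forall>k\<in>LC p. \<rho> k < \<delta> \<longrightarrow> \<sigma> k < \<epsilon>)"
      using ctrl F(2) \<epsilon> by blast
    from bchoice[OF this] obtain \<rho> where "\<forall>\<sigma>\<in>F. \<exists>\<delta>. \<rho> \<sigma> \<in> seminorms_TD p D \<and> 0 < \<delta> \<and> (\<forall>k\<in>LC p. \<rho> \<sigma> k < \<delta> \<longrightarrow> \<sigma> k < \<epsilon>)" ..
    from bchoice[OF this] obtain \<delta> where \<rho>\<delta>: "\<forall>\<sigma>\<in>F. \<rho> \<sigma> \<in> seminorms_TD p D \<and> 0 < \<delta> \<sigma> \<and> (\<forall>k\<in>LC p. \<rho> \<sigma> k < \<delta> \<sigma> \<longrightarrow> \<sigma> k < \<epsilon>)" ..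
    \<comment> \<open>Inserting 1 makes the minimum meaningful for an empty F.\<close>
    define \<delta>0 where "\<delta>0 = Min (insert 1 (\<delta> ` F))"
    have \<delta>0: "0 < \<delta>0" "\<And>\<sigma>. \<sigma> \<in> F \<Longrightarrow> \<delta>0 \<le> \<delta> \<sigma>" using F(1) \<rho>\<delta> by (auto simp: \<delta>0_def)
    have "finite (\<rho> ` F)" "\<rho> ` F \<subseteq> seminorms_TD p D" using F(1) \<rho>\<delta> by auto
    with g \<delta>0(1) obtain \<tau> where "\<forall>r\<in>\<rho> ` F. r (translate \<tau> f - g) < \<delta>0" unfolding in_hull_def by meson
    then have "\<sigma> (translate \<tau> f - g) < \<epsilon>" if "\<sigma> \<in> F" for \<sigma>
    proof -
      have "\<rho> \<sigma> (translate \<tau> f - g) < \<delta> \<sigma>" using that \<delta>0(2)[OF that] \<open>\<forall>r\<in>\<rho> ` F. _\<close> by fastforce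
      then show ?thesis using \<rho>\<delta> that LC_diff[OF LC_translate[OF f] gL] by blast
    qed
    then show "\<exists>\<tau>. \<forall>\<sigma>\<in>F. \<sigma> (translate \<tau> f - g) < \<epsilon>" by blast
  qed
qed

lemma hull_seminorms_TD:
  fixes f :: "('v::euclidean_space) delay_field"
  assumes p: "1 \<le> p" and f: "f \<in> LC p" and dense: "closure D = UNIV" and lb: "Lloc_bounded_lbounds p f"
  shows "hull_seminorms p (seminorms_TD p D) f"
proof
  interpret weak_hull D f using LC_mono[OF p f] dense by unfold_locales
  have adm: "admissible (norm d) a b (\<lambda>_. d)" for d :: "'v \<times> 'v" and a b by (rule admissible_const) simp
  show "1 \<le> p" "f \<in> LC p" by fact+
  show "seminorms_TD p D \<noteq> {}"
  proof -
    obtain d where d: "d \<in> D" by (rule dense_near[OF dense zero_less_one])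
    have "\<exists>\<rho>. \<rho> \<in> seminorms_TD p D" by (rule exI, rule seminorms_TD_I[OF Rats_0 Rats_0 order_refl d])
    then show ?thesis by auto
  qed
  {
    fix \<rho> :: "'v delay_field \<Rightarrow> real" and g :: "'v delay_field" assume \<rho>: "\<rho> \<in> seminorms_TD p D" and g: "g \<in> LC p"
    obtain q1 q2 d where R: "\<And>k. k \<in> LC p \<Longrightarrow> \<rho> k = Lp_norm_along p q1 q2 k (\<lambda>_. d)"
      using \<rho> by (rule seminorms_TD_E) blast
    show "\<rho> (g - g) = 0" unfolding R[OF LC_diff[OF g g]] by (rule Lp_norm_along_self[OF p])
  }
  {
    fix \<rho> :: "'v delay_field \<Rightarrow> real" and g h :: "'v delay_field"
    assume \<rho>: "\<rho> \<in> seminorms_TD p D" and gh: "g \<in> LC p" "h \<in> LC p" "ae_eq g h"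
    obtain q1 q2 d where R: "\<And>k. k \<in> LC p \<Longrightarrow> \<rho> k = Lp_norm_along p q1 q2 k (\<lambda>_. d)"
      using \<rho> by (rule seminorms_TD_E) blast
    show "\<rho> g = \<rho> h" unfolding R[OF gh(1)] R[OF gh(2)] by (rule Lp_norm_along_ae_eq[OF gh(3)])
  }
  {
    fix \<rho> :: "'v delay_field \<Rightarrow> real" and g h k :: "'v delay_field"
    assume \<rho>: "\<rho> \<in> seminorms_TD p D" and gh: "g \<in> LC p" "h \<in> LC p" "k \<in> LC p"
    obtain q1 q2 d where R: "\<And>k. k \<in> LC p \<Longrightarrow> \<rho> k = Lp_norm_along p q1 q2 k (\<lambda>_. d)"
      using \<rho> by (rule seminorms_TD_E) blast
    show "\<rho> (g - h) \<le> \<rho> (g - k) + \<rho> (k - h)"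
      unfolding R[OF LC_diff[OF gh(1,2)]] R[OF LC_diff[OF gh(1,3)]] R[OF LC_diff[OF gh(3,2)]]
      by (rule Lp_norm_along_triangle[OF p gh adm])
  }
  {
    fix g :: "'v delay_field" and \<rho> :: "'v delay_field \<Rightarrow> real" and \<epsilon> t0 :: real
    assume gh: "in_hull p (seminorms_TD p D) f g" and \<rho>: "\<rho> \<in> seminorms_TD p D" and \<epsilon>: "0 < \<epsilon>"
    have g: "g \<in> LC p" using gh by (simp add: in_hull_def)
    obtain q1 q2 d where q: "q1 \<in> \<rat>" "q2 \<in> \<rat>" "q1 \<le> q2" "d \<in> D"
      and R: "\<And>k. k \<in> LC p \<Longrightarrow> \<rho> k = Lp_norm_along p q1 q2 k (\<lambda>_. d)"
      using \<rho> by (rule seminorms_TD_E) blast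
    obtain r1 r2 where r: "r1 \<in> \<rat>" "r2 \<in> \<rat>" "r1 \<le> q1 + t0 - 1" "q2 + t0 + 1 \<le> r2"
      using rational_bounds by meson
    define \<sigma> :: "'v delay_field \<Rightarrow> real" where "\<sigma> = (\<lambda>f. root p (LINT t:{r1..r2}|lebesgue. norm (f t d) ^ p))"
    have \<sigma>: "\<sigma> \<in> seminorms_TD p D" unfolding \<sigma>_def using r q by (intro seminorms_TD_I) auto
    have "0 < (\<epsilon>/3) ^ p" using \<epsilon> by simp
    from Lp_shift_eventually[OF p g this, of q1 q2 t0 d]
    obtain \<delta> where \<delta>: "\<delta> > 0" "\<And>t. \<bar>t - t0\<bar> < \<delta> \<Longrightarrow>
        integral {q1..q2} (\<lambda>s. norm ((translate t g - translate t0 g) s d) ^ p) < (\<epsilon>/3) ^ p"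
      unfolding eventually_nhds_metric by (auto simp: dist_real_def)
    show "\<exists>F \<delta>. finite F \<and> F \<subseteq> seminorms_TD p D \<and> 0 < \<delta> \<and>
        (\<forall>h t. in_hull p (seminorms_TD p D) f h \<longrightarrow> \<bar>t - t0\<bar> < \<delta> \<longrightarrow> (\<forall>\<sigma>\<in>F. \<sigma> (h - g) < \<delta>) \<longrightarrow>
           \<rho> (translate t h - translate t0 g) < \<epsilon>)"
    proof (rule exI[of _ "{\<sigma>}"], rule exI[of _ "min (min \<delta> 1) (\<epsilon>/3)"], intro conjI allI impI)
      show "finite {\<sigma>}" "{\<sigma>} \<subseteq> seminorms_TD p D" "0 < min (min \<delta> 1) (\<epsilon>/3)" using \<sigma> \<delta> \<epsilon> by auto
      fix h t assume hh: "in_hull p (seminorms_TD p D) f h" and t: "\<bar>t - t0\<bar> < min (min \<delta> 1) (\<epsilon>/3)"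
        and close: "\<forall>\<sigma>'\<in>{\<sigma>}. \<sigma>' (h - g) < min (min \<delta> 1) (\<epsilon>/3)"
      have h: "h \<in> LC p" using hh by (simp add: in_hull_def)
      have "Lp_norm_along p q1 q2 (translate t (h - g)) (\<lambda>_. d) \<le> Lp_norm_along p r1 r2 (h - g) (\<lambda>_. d)"
        by (rule Lp_norm_along_translate_le[OF p LC_diff[OF h g] adm]) (use r t in \<open>auto simp: abs_less_iff\<close>)
      also have "\<dots> < \<epsilon>/3" using close by (simp add: \<sigma>_def seminorm_TD_eq[OF LC_diff[OF h g], symmetric])
      finally have 1: "Lp_norm_along p q1 q2 (translate t h - translate t g) (\<lambda>_. d) < \<epsilon>/3"
        by (simp add: translate_diff)
      have 2: "Lp_norm_along p q1 q2 (translate t g - translate t0 g) (\<lambda>_. d) < \<epsilon>/3"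
        using \<delta>(2)[of t] t \<epsilon> by (subst Lp_norm_along_less_iff[OF p]) auto
      show "\<rho> (translate t h - translate t0 g) < \<epsilon>"
        unfolding R[OF LC_diff_translate[OF h g]]
        using Lp_norm_along_triangle[OF p LC_translate[OF h] LC_translate[OF g] LC_translate[OF g] adm[of d q1 q2], of t t0 t] 1 2 \<epsilon>
        by simp
    qed
  }
  {
    fix g :: "'v delay_field" and \<phi> :: "real \<Rightarrow> 'v" and \<eta> T R :: real
    assume gh: "in_hull p (seminorms_TD p D) f g" and \<eta>: "0 < \<eta>"
    have g: "g \<in> LC p" using gh by (simp add: in_hull_def)
    have Wg: "W g" by (rule in_hull_TD_imp_sigmaD[OF p f gh])
    obtain q where q: "q \<in> \<rat>" "max T 0 \<le> q" using rational_bounds(1) by blast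
    \<comment> \<open>Net values have norm at most 2 * R + e with e \<le> 1, and
      \<open>error_split\<close> asks for room 1 around the curve.\<close>
    obtain j where j: "2 * R + 1 \<le> real j" using real_arch_simple by blast
    have "0 < q + 1" using q by simp
    from lipschitz_translates_ex[OF p f lb this, of j] obtain C where C: "0 < C" and lip: "lipschitz_translates f j (q + 1) C"
      by blast
    \<comment> \<open>The step function is within 2 * e of the curve; the choice makes its two
      replacement costs together at most \<eta>/2.\<close>
    define e where "e = min 1 (\<eta> / (8 * C))"
    have e: "0 < e" "e \<le> 1" "2 * C * (2 * e) \<le> \<eta> / 2"
    proof -
      show "0 < e" "e \<le> 1" using \<eta> C by (auto simp: e_def)
      have "C * e \<le> C * (\<eta> / (8 * C))" using C by (intro mult_left_mono) (auto simp: e_def)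
      then show "2 * C * (2 * e) \<le> \<eta> / 2" using C by simp
    qed
    obtain N where N: "finite N" "N \<subseteq> D" and net: "\<forall>x. norm x \<le> 2 * R \<longrightarrow> (\<exists>d\<in>N. norm (d - x) < e)"
      using finite_net[OF e(1), of "2 * R"] by blast
    \<comment> \<open>An equal share of \<eta>/2 for each net point, divided by the factor q + 1 of
      \<open>along_L1_less\<close>.\<close>
    define e2 where "e2 = \<eta> / (2 * (real (card N) + 1) * (q + 1))"
    have e2: "0 < e2" using \<eta> q by (simp add: e2_def)
    have e2N: "real (card N) * (e2 * (q + 1)) \<le> \<eta> / 2"
    proof -
      have "q + 1 \<noteq> 0" using q by simp
      then have "e2 * (q + 1) = \<eta> / 2 / (real (card N) + 1)" by (simp add: e2_def)
      then have "real (card N) * (e2 * (q + 1)) = \<eta> / 2 * (real (card N) / (real (card N) + 1))" by simp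
      also have "\<dots> \<le> \<eta> / 2 * 1" using \<eta> by (intro mult_left_mono) auto
      finally show ?thesis by simp
    qed
    define \<sigma> :: "'v \<times> 'v \<Rightarrow> 'v delay_field \<Rightarrow> real"
      where "\<sigma> d = (\<lambda>f. root p (LINT t:{0..q}|lebesgue. norm (f t d) ^ p))" for d
    have \<sigma>: "\<sigma> ` N \<subseteq> seminorms_TD p D"
      unfolding \<sigma>_def using q N(2) by (auto intro!: seminorms_TD_I)
    show "\<exists>F \<delta>. finite F \<and> F \<subseteq> seminorms_TD p D \<and> 0 < \<delta> \<and>
        (\<forall>h \<psi> S y. in_hull p (seminorms_TD p D) f h \<longrightarrow> (\<forall>\<sigma>\<in>F. \<sigma> (h - g) < \<delta>) \<longrightarrow>
           (\<forall>t\<in>{-1..0}. norm (\<psi> t - \<phi> t) \<le> \<delta>) \<longrightarrow> S \<le> T \<longrightarrow> integral_solution h \<psi> S y \<longrightarrow>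
           (\<forall>t\<in>{-1..S}. norm (y t) \<le> R) \<longrightarrow>
           norm (integral {0..S} (\<lambda>s. h s (y s, y (s - 1)) - g s (y s, y (s - 1)))) \<le> \<eta>)"
    proof (rule exI[of _ "\<sigma> ` N"], rule exI[of _ e2], intro conjI allI impI)
      show "finite (\<sigma> ` N)" "\<sigma> ` N \<subseteq> seminorms_TD p D" "0 < e2" using N \<sigma> e2 by auto
      fix h and \<psi> :: "real \<Rightarrow> 'v" and S y
      assume hh: "in_hull p (seminorms_TD p D) f h" and close: "\<forall>\<sigma>'\<in>\<sigma> ` N. \<sigma>' (h - g) < e2"
        and ST: "S \<le> T" and y: "integral_solution h \<psi> S y" and yR: "\<forall>t\<in>{-1..S}. norm (y t) \<le> R"
      have h: "h \<in> LC p" using hh by (simp add: in_hull_def)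
      have Wh: "W h" by (rule in_hull_TD_imp_sigmaD[OF p f hh])
      have hg: "h - g \<in> LC p" by (rule LC_diff[OF h g])
      have hg1: "h - g \<in> LC 1" by (rule LC_mono[OF p hg])
      have S: "0 \<le> S" "S \<le> q" using integral_solutionD(1)[OF y] ST q by auto
      define z where "z s = (y s, y (s - 1))" for s
      have zc: "continuous_on {0..S} z" and zR: "\<forall>s\<in>{0..S}. norm (z s) \<le> 2 * R"
        unfolding z_def using delay_pair_admissible[OF integral_solutionD(2)[OF y], of R] yR by blast+
      have "uniformly_continuous_on {0..S} z" using zc by (intro compact_uniformly_continuous) auto
      then obtain d where d: "0 < d" "\<forall>s\<in>{0..S}. \<forall>s'\<in>{0..S}. dist s' s < d \<longrightarrow> dist (z s') (z s) < e"
        unfolding uniformly_continuous_on_def using e(1) by blast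
      \<comment> \<open>K depends on the modulus of continuity of y, which is allowed here: neither
        the seminorms nor e2 involve the grid.\<close>
      obtain K where K: "K > 0" "1 / real K < d"
        using reals_Archimedean[OF d(1)] by (metis inverse_eq_divide zero_less_Suc)
      have K1: "1 \<le> K" using K by simp
      have "\<forall>s\<in>{0..S}. \<forall>s'\<in>{0..S}. \<bar>s - s'\<bar> \<le> 1 / real K \<longrightarrow> norm (z s - z s') \<le> e"
      proof (intro ballI impI)
        fix s s' assume "s \<in> {0..S}" "s' \<in> {0..S}" "\<bar>s - s'\<bar> \<le> 1 / real K"
        then have "dist (z s) (z s') < e" using d(2) K(2) by (auto simp: dist_real_def)
        then show "norm (z s - z s') \<le> e" by (simp add: dist_norm)
      qed
      from net_step[OF K1 S(1) net zR this] obtain c where c: "\<forall>i. c i \<in> N" "\<forall>i. norm (c i) \<le> 2 * R + e"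
        "\<forall>s\<in>{0..S}. norm (z s - grid_step K c s) \<le> 2 * e" by blast
      let ?w = "grid_step K c"
      have wN: "?w s \<in> N" for s using c(1) by (simp add: grid_step_def)
      have wadm: "admissible (2 * R + e) 0 S ?w" by (rule grid_step_admissible) (simp add: grid_step_def c(2))
      have ni: "(\<lambda>s. norm ((h - g) s d)) integrable_on {a..b}" for d a b
        by (rule along_abs_integrable(3)[OF hg1 adm])
      \<comment> \<open>At each time the step function sits at some point of N, so the sum over N
        dominates whatever the grid is.\<close>
      have "norm (integral {0..S} (\<lambda>s. (h - g) s (?w s))) \<le> integral {0..S} (\<lambda>s. \<Sum>d\<in>N. norm ((h - g) s d))"
      proof (rule integral_norm_bound_integral)
        show "(\<lambda>s. (h - g) s (?w s)) integrable_on {0..S}" by (rule along_abs_integrable(2)[OF hg1 wadm])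
        show "(\<lambda>s. \<Sum>d\<in>N. norm ((h - g) s d)) integrable_on {0..S}" by (intro integrable_sum N(1) ni)
        show "norm ((h - g) s (?w s)) \<le> (\<Sum>d\<in>N. norm ((h - g) s d))" for s
          using wN[of s] N(1) by (intro member_le_sum[of "?w s" N "\<lambda>d. norm ((h - g) s d)"]) auto
      qed
      also have "\<dots> = (\<Sum>d\<in>N. integral {0..S} (\<lambda>s. norm ((h - g) s d)))" by (rule integral_sum[OF N(1) ni])
      also have "\<dots> \<le> (\<Sum>d\<in>N. e2 * (q + 1))"
      proof (rule sum_mono)
        fix d assume "d \<in> N"
        then have "Lp_norm_along p 0 q (h - g) (\<lambda>_. d) < e2"
          using close by (simp add: \<sigma>_def seminorm_TD_eq[OF hg, symmetric])
        from along_L1_less[OF p hg adm e2 _ this] have "integral {0..q} (\<lambda>s. norm ((h - g) s d)) < e2 * (q + 1)"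
          using q by simp
        moreover have "integral {0..S} (\<lambda>s. norm ((h - g) s d)) \<le> integral {0..q} (\<lambda>s. norm ((h - g) s d))"
          using S by (intro integral_subset_le ni) auto
        ultimately show "integral {0..S} (\<lambda>s. norm ((h - g) s d)) \<le> e2 * (q + 1)" by simp
      qed
      also have "\<dots> \<le> \<eta> / 2" using e2N by simp
      finally have "norm (integral {0..S} (\<lambda>s. (h - g) s (?w s))) \<le> \<eta> / 2" .
      moreover have "integral {0..S} (\<lambda>s. (h - g) s (?w s)) = integral {0..S} (\<lambda>s. h s (?w s)) - integral {0..S} (\<lambda>s. g s (?w s))"
        using along_abs_integrable(2)[OF LC_mono[OF p h] wadm] along_abs_integrable(2)[OF LC_mono[OF p g] wadm]
        by (simp add: integral_diff)
      ultimately have err: "norm (integral {0..S} (\<lambda>s. h s (?w s)) - integral {0..S} (\<lambda>s. g s (?w s))) \<le> \<eta> / 2" by simp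
      have "norm (integral {0..S} (\<lambda>s. h s (z s) - g s (z s))) \<le> 2 * C * (2 * e) + \<eta> / 2"
      proof (rule error_split[OF Wg Wh K1 lip less_imp_le[OF C] S(1) _ zc _ _ _ c(3) _ err])
        show "S \<le> q + 1" using S by simp
        show "\<forall>s\<in>{0..S}. norm (z s) + 1 \<le> real j" using zR j by force
        show "\<forall>i. c i \<in> D" using c(1) N(2) by blast
        show "\<forall>i. norm (c i) \<le> real j" using c(2) e(2) j by (meson add_left_mono order_trans)
        show "0 < 2 * e" using e by simp
      qed
      then show "norm (integral {0..S} (\<lambda>s. h s (y s, y (s - 1)) - g s (y s, y (s - 1)))) \<le> \<eta>"
        using e(3) by (simp add: z_def)
    qed
  }
qed

section \<open>The topology of weak convergence at the points of a dense set\<close>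

context weak_hull
begin

lemma W_const_integrable:
  "W g \<Longrightarrow> (\<lambda>s. g s d) integrable_on {a..b}"
  by (rule along_abs_integrable(2)[OF W_LC admissible_const[OF order_refl]])

lemma hull_const_small:
  assumes "W g" "small_translates f j r \<delta> \<epsilon>" "0 \<le> \<epsilon>" "-r \<le> a" "a \<le> b" "b \<le> r" "b - a < \<delta>" "norm d + 1 \<le> real j"
  shows "norm (integral {a..b} (\<lambda>s. g s d)) \<le> \<epsilon>"
  by (rule hull_small[OF assms(1-7)]) (simp_all add: assms(8))

lemma W_seminorm_diff:
  assumes "W g" "W h"
  shows "norm (LINT t:{a..b}|lebesgue. (h - g) t d) = norm (integral {a..b} (\<lambda>s. h s d) - integral {a..b} (\<lambda>s. g s d))"
  unfolding seminorm_sigmaD_eq[OF LC_diff[OF W_LC[OF assms(2)] W_LC[OF assms(1)]]]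
  using W_const_integrable[OF assms(1)] W_const_integrable[OF assms(2)] by (simp add: integral_diff)

text \<open>x and x0 are arbitrary, so the interval is cut at a rational y slightly to their left:
  up to y a seminorm applies, and the two remainders are short enough for the m-bounds.\<close>

lemma primitive_close:
  assumes mb: "L1loc_equicontinuous_mbounds f" and W: "W g" and d: "d \<in> D"
    and q0: "q0 \<in> \<rat>" "q0 \<le> x0 - 1" and \<epsilon>: "0 < \<epsilon>"
  shows "\<exists>\<sigma> \<delta>. \<sigma> \<in> seminorms_sigmaD D \<and> 0 < \<delta> \<and> (\<forall>h x. W h \<longrightarrow> \<sigma> (h - g) < \<delta> \<longrightarrow> \<bar>x - x0\<bar> < \<delta> \<longrightarrow>
    norm (integral {q0..x} (\<lambda>s. h s d) - integral {q0..x0} (\<lambda>s. g s d)) \<le> \<epsilon>)"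
proof -
  define r where "r = \<bar>q0\<bar> + \<bar>x0\<bar> + 2"
  have r: "0 < r" "-r \<le> q0" "x0 + 1 \<le> r" by (auto simp: r_def)
  obtain j where j: "norm d + 1 \<le> real j" using real_arch_simple by blast
  have e3: "0 < \<epsilon>/3" using \<epsilon> by simp
  from small_translates_ex[OF f1 mb r(1) e3, of j] obtain \<delta>1 where \<delta>1: "0 < \<delta>1" and sm: "small_translates f j r \<delta>1 (\<epsilon>/3)"
    by blast
  have "x0 - min (\<delta>1/2) (1/2) < x0" using \<delta>1 by simp
  from Rats_dense_in_real[OF this] obtain y where y: "y \<in> \<rat>" "x0 - min (\<delta>1/2) (1/2) < y" "y < x0" by blast
  have q0y: "q0 \<le> y" using y(2) q0(2) by linarith
  define \<sigma> :: "'v delay_field \<Rightarrow> real" where "\<sigma> = (\<lambda>f. norm (LINT t:{q0..y}|lebesgue. f t d))"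
  have "\<sigma> \<in> seminorms_sigmaD D" unfolding \<sigma>_def by (rule seminorms_sigmaD_I[OF q0(1) y(1) q0y d])
  moreover have "0 < min (\<epsilon>/3) (min (\<delta>1/2) (x0 - y))" using e3 \<delta>1 y by simp
  moreover have "norm (integral {q0..x} (\<lambda>s. h s d) - integral {q0..x0} (\<lambda>s. g s d)) \<le> \<epsilon>"
    if h: "W h" and close: "\<sigma> (h - g) < min (\<epsilon>/3) (min (\<delta>1/2) (x0 - y))" and x: "\<bar>x - x0\<bar> < min (\<epsilon>/3) (min (\<delta>1/2) (x0 - y))"
    for h x
  proof -
    have xy: "y \<le> x" "x - y < \<delta>1" "x \<le> x0 + 1" "-r \<le> y" "x0 - y < \<delta>1"
      using x y r q0y by (auto simp: abs_less_iff)
    have split: "integral {q0..u} (\<lambda>s. k s d) = integral {q0..y} (\<lambda>s. k s d) + integral {y..u} (\<lambda>s. k s d)"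
      if "W k" "y \<le> u" for k u
      by (rule Henstock_Kurzweil_Integration.integral_combine[symmetric, OF q0y that(2) W_const_integrable[OF that(1)]])
    have 1: "norm (integral {y..x} (\<lambda>s. h s d)) \<le> \<epsilon>/3"
      by (rule hull_const_small[OF h sm _ _ _ _ _ j]) (use xy r e3 in auto)
    have 2: "norm (integral {y..x0} (\<lambda>s. g s d)) \<le> \<epsilon>/3"
      by (rule hull_const_small[OF W sm _ _ _ _ _ j]) (use xy y r e3 in auto)
    have 3: "norm (integral {q0..y} (\<lambda>s. h s d) - integral {q0..y} (\<lambda>s. g s d)) \<le> \<epsilon>/3"
      using close unfolding \<sigma>_def W_seminorm_diff[OF W h] by simp
    have "norm ((a + b) - (a' + b')) \<le> \<epsilon>" if "norm (a - a') \<le> \<epsilon>/3" "norm b \<le> \<epsilon>/3" "norm b' \<le> \<epsilon>/3" for a b a' b' :: 'v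
      using that norm_triangle_ineq[of "a - a'" "b - b'"] norm_triangle_ineq4[of b b'] by (simp add: algebra_simps)
    from this[OF 3 1 2] show ?thesis
      unfolding split[OF h xy(1)] split[OF W less_imp_le[OF y(3)]] .
  qed
  ultimately show ?thesis by blast
qed

text \<open>A translated interval has moving end points. Writing its integral as a difference of two
  primitives from a fixed rational q0 reduces joint continuity to \<open>primitive_close\<close> at
  q1 + t0 and q2 + t0.\<close>

lemma translation_close:
  assumes mb: "L1loc_equicontinuous_mbounds f" and W: "W g" and d: "d \<in> D" and q: "q1 \<le> q2" and \<epsilon>: "0 < \<epsilon>"
  shows "\<exists>F \<delta>. finite F \<and> F \<subseteq> seminorms_sigmaD D \<and> 0 < \<delta> \<and>
    (\<forall>h t. W h \<longrightarrow> \<bar>t - t0\<bar> < \<delta> \<longrightarrow> (\<forall>\<sigma>\<in>F. \<sigma> (h - g) < \<delta>) \<longrightarrow>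
      norm (integral {q1..q2} (\<lambda>s. (translate t h - translate t0 g) s d)) < \<epsilon>)"
proof -
  obtain q0 where q0: "q0 \<in> \<rat>" "q0 \<le> q1 + t0 - 1" using rational_bounds(2) by blast
  have e3: "0 < \<epsilon>/3" using \<epsilon> by simp
  have b2: "q0 \<le> q2 + t0 - 1" using q0(2) q by simp
  from primitive_close[OF mb W d q0 e3] obtain \<sigma>1 \<delta>1 where s1: "\<sigma>1 \<in> seminorms_sigmaD D" "0 < \<delta>1"
    "\<forall>h x. W h \<longrightarrow> \<sigma>1 (h - g) < \<delta>1 \<longrightarrow> \<bar>x - (q1 + t0)\<bar> < \<delta>1 \<longrightarrow>
      norm (integral {q0..x} (\<lambda>s. h s d) - integral {q0..q1 + t0} (\<lambda>s. g s d)) \<le> \<epsilon>/3" by (elim exE conjE)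
  from primitive_close[OF mb W d q0(1) b2 e3] obtain \<sigma>2 \<delta>2 where s2: "\<sigma>2 \<in> seminorms_sigmaD D" "0 < \<delta>2"
    "\<forall>h x. W h \<longrightarrow> \<sigma>2 (h - g) < \<delta>2 \<longrightarrow> \<bar>x - (q2 + t0)\<bar> < \<delta>2 \<longrightarrow>
      norm (integral {q0..x} (\<lambda>s. h s d) - integral {q0..q2 + t0} (\<lambda>s. g s d)) \<le> \<epsilon>/3" by (elim exE conjE)
  show ?thesis
  proof (rule exI[of _ "{\<sigma>1, \<sigma>2}"], rule exI[of _ "min 1 (min \<delta>1 \<delta>2)"], intro conjI allI impI)
    show "finite {\<sigma>1, \<sigma>2}" "{\<sigma>1, \<sigma>2} \<subseteq> seminorms_sigmaD D" "0 < min 1 (min \<delta>1 \<delta>2)" using s1 s2 by auto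
    fix h t assume h: "W h" and t: "\<bar>t - t0\<bar> < min 1 (min \<delta>1 \<delta>2)" and close: "\<forall>\<sigma>\<in>{\<sigma>1, \<sigma>2}. \<sigma> (h - g) < min 1 (min \<delta>1 \<delta>2)"
    have shift: "integral {q1..q2} (\<lambda>s. translate u k s d) = integral {q0..q2 + u} (\<lambda>s. k s d) - integral {q0..q1 + u} (\<lambda>s. k s d)"
      if "W k" "q0 \<le> q1 + u" for k u
    proof -
      have "integral {q1..q2} (\<lambda>s. translate u k s d) = integral {q1 + u..q2 + u} (\<lambda>s. k s d)"
        using integral_shift_real[of q1 q2 "\<lambda>s. k s d" u] by (simp add: translate_def)
      moreover have "integral {q0..q1 + u} (\<lambda>s. k s d) + integral {q1 + u..q2 + u} (\<lambda>s. k s d) = integral {q0..q2 + u} (\<lambda>s. k s d)"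
        using q that by (intro Henstock_Kurzweil_Integration.integral_combine W_const_integrable) auto
      ultimately show ?thesis by (simp add: algebra_simps)
    qed
    have b: "q0 \<le> q1 + t" "q0 \<le> q1 + t0" using q0(2) t by (auto simp: abs_less_iff)
    have ti: "(\<lambda>s. translate u k s d) integrable_on {q1..q2}" if "W k" for k u
      by (rule along_abs_integrable(2)[OF LC_translate[OF W_LC[OF that]] admissible_const[OF order_refl]])
    have "integral {q1..q2} (\<lambda>s. (translate t h - translate t0 g) s d) =
        integral {q1..q2} (\<lambda>s. translate t h s d) - integral {q1..q2} (\<lambda>s. translate t0 g s d)"
      using ti[OF h] ti[OF W] by (simp add: integral_diff)
    moreover have "norm (integral {q0..q1 + t} (\<lambda>s. h s d) - integral {q0..q1 + t0} (\<lambda>s. g s d)) \<le> \<epsilon>/3"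
      using s1(3) h close t by simp
    moreover have "norm (integral {q0..q2 + t} (\<lambda>s. h s d) - integral {q0..q2 + t0} (\<lambda>s. g s d)) \<le> \<epsilon>/3"
      using s2(3) h close t by simp
    moreover have "norm ((b - a) - (b' - a')) < \<epsilon>" if "norm (a - a') \<le> \<epsilon>/3" "norm (b - b') \<le> \<epsilon>/3" for a b a' b' :: 'v
      using that norm_triangle_ineq4[of "b - b'" "a - a'"] \<epsilon> by (simp add: algebra_simps)
    ultimately show "norm (integral {q1..q2} (\<lambda>s. (translate t h - translate t0 g) s d)) < \<epsilon>"
      unfolding shift[OF h b(1)] shift[OF W b(2)] by simp
  qed
qed

text \<open>Increments of y after time 0 are integrals of h along a bounded continuous pair over a
  short interval, hence small by \<open>hull_small\<close> with constants that do not depend on h.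
  The factor 2 arises when s and s' lie on different sides of 0.\<close>

lemma solution_modulus:
  assumes W: "W h" and sm: "small_translates f j r \<delta> \<epsilon>" and \<epsilon>: "0 \<le> \<epsilon>" and y: "integral_solution h \<psi> S y"
    and yR: "\<forall>t\<in>{-1..S}. norm (y t) \<le> R" and j: "2 * R + 1 \<le> real j" and r: "0 \<le> r" "S \<le> r"
    and mod: "\<forall>s\<in>{-1..0}. \<forall>s'\<in>{-1..0}. \<bar>s - s'\<bar> < \<delta> \<longrightarrow> norm (\<psi> s - \<psi> s') \<le> \<epsilon>"
    and s: "s \<in> {-1..S}" "s' \<in> {-1..S}" "\<bar>s - s'\<bar> < \<delta>"
  shows "norm (y s - y s') \<le> 2 * \<epsilon>"
proof -
  note zc = continuous_on_delay_pair[OF integral_solutionD(2)[OF y]]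
  have y\<psi>: "y t = \<psi> t" if "t \<in> {-1..0}" for t using integral_solutionD(3)[OF y that] .
  have inc: "norm (y v - y u) \<le> \<epsilon>" if "0 \<le> u" "u \<le> v" "v \<le> S" "v - u < \<delta>" for u v
  proof -
    have "norm (y t, y (t - 1)) + 1 \<le> real j" if "t \<in> {u..v}" for t
      using delay_pair_admissible(2)[OF integral_solutionD(2)[OF y], of R t] yR j that \<open>0 \<le> u\<close> \<open>v \<le> S\<close> by force
    then have "norm (integral {u..v} (\<lambda>s. h s (y s, y (s - 1)))) \<le> \<epsilon>"
      using that r by (intro hull_small[OF W sm \<epsilon>] zc) auto
    then show ?thesis unfolding integral_solution_increment[OF W_LC[OF W] y that(1-3)] .
  qed
  have "norm (y v - y u) \<le> 2 * \<epsilon>" if "-1 \<le> u" "u \<le> v" "v \<le> S" "v - u < \<delta>" for u v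
  proof -
    consider "v \<le> 0" | "0 \<le> u" | "u < 0" "0 < v" by linarith
    then show ?thesis
    proof cases
      case 1
      then have "norm (\<psi> v - \<psi> u) \<le> \<epsilon>" using mod that by auto
      then show ?thesis using 1 that y\<psi> \<epsilon> by simp
    next
      case 2
      then show ?thesis using inc[of u v] that \<epsilon> by simp
    next
      case 3
      have "norm (\<psi> 0 - \<psi> u) \<le> \<epsilon>" using mod that 3 by auto
      then have "norm (y 0 - y u) \<le> \<epsilon>" using 3 that y\<psi> by simp
      moreover have "norm (y v - y 0) \<le> \<epsilon>" using inc[of 0 v] 3 that by simp
      ultimately show ?thesis using norm_triangle_ineq[of "y v - y 0" "y 0 - y u"] by simp
    qed
  qed
  from this[of s s'] this[of s' s] show ?thesis using s by (cases "s \<le> s'") (auto simp: norm_minus_commute)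
qed

text \<open>Complete cells, at most n of them, are compared by the hypothesis on cells. The cell cut
  by the arbitrary S is not among them; its integrals for h and g are each at most \<epsilon> by the
  m-bounds.\<close>

lemma grid_close:
  assumes W: "W g" "W h" and K: "1 \<le> K" and sm: "small_translates f j r \<delta> \<epsilon>" and \<epsilon>: "0 \<le> \<epsilon>" and K\<delta>: "1 / real K < \<delta>"
    and S: "0 \<le> S" "S \<le> r" and n: "real K * S \<le> real n" and cR: "\<forall>i. norm (c i) + 1 \<le> real j"
    and cells: "\<forall>i<n. norm (integral {real i / real K..real (i + 1) / real K} (\<lambda>s. h s (c (int i))) -
      integral {real i / real K..real (i + 1) / real K} (\<lambda>s. g s (c (int i)))) \<le> e"
    and e: "0 \<le> e"
  shows "norm (integral {0..S} (\<lambda>s. h s (grid_step K c s)) - integral {0..S} (\<lambda>s. g s (grid_step K c s))) \<le> real n * e + 2 * \<epsilon>"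
proof -
  define m where "m = nat \<lfloor>real K * S\<rfloor>"
  have k: "0 < real K" using K by simp
  have "0 \<le> real K * S" using S k by simp
  then have m: "real m \<le> real K * S" "real K * S \<le> real m + 1" unfolding m_def by linarith+
  have mn: "m \<le> n" using m(1) n by linarith
  have b: "0 \<le> real m / real K" "real m / real K \<le> S" "S \<le> real (m + 1) / real K" "S - real m / real K < \<delta>"
  proof -
    show "0 \<le> real m / real K" by simp
    show "real m / real K \<le> S" using m k by (simp add: pos_divide_le_eq mult.commute)
    show *: "S \<le> real (m + 1) / real K" using m k by (simp add: pos_le_divide_eq mult.commute)
    have "real (m + 1) / real K = real m / real K + 1 / real K" by (simp add: add_divide_distrib)
    then show "S - real m / real K < \<delta>" using * K\<delta> by linarith
  qed
  let ?I = "\<lambda>i. {real i / real K..real (i + 1) / real K}"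
  have decomp: "integral {0..S} (\<lambda>s. k s (grid_step K c s)) =
      (\<Sum>i<m. integral (?I i) (\<lambda>s. k s (c (int i)))) + integral {real m / real K..S} (\<lambda>s. k s (c (int m)))" if k: "W k" for k
  proof -
    let ?G = "\<lambda>s. k s (grid_step K c s)"
    obtain R where "admissible R 0 S (grid_step K c)" using grid_step_bounded_ex by blast
    then have "?G integrable_on {0..S}" by (rule along_abs_integrable(2)[OF W_LC[OF k]])
    then have "integral {0..S} ?G = integral {0..real m / real K} ?G + integral {real m / real K..S} ?G"
      using b by (intro Henstock_Kurzweil_Integration.integral_combine[symmetric]) auto
    moreover have "integral {0..real m / real K} ?G = (\<Sum>i<m. integral (?I i) (\<lambda>s. k s (c (int i))))"
      using grid_integral_sum[OF K W_LC[OF k], of 0 m c] by (simp add: add.commute)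
    moreover have "integral {real m / real K..S} ?G = integral {real m / real K..S} (\<lambda>s. k s (c (int m)))"
      using grid_cell_integral[OF K, of S "int m" k c] b(3) by (simp add: add.commute)
    ultimately show ?thesis by simp
  qed
  have last: "norm (integral {real m / real K..S} (\<lambda>s. k s (c (int m)))) \<le> \<epsilon>" if "W k" for k
  proof (rule hull_const_small[OF that sm \<epsilon>])
    show "-r \<le> real m / real K" using b(1) S by linarith
  qed (use b S cR in auto)
  have "norm ((\<Sum>i<m. integral (?I i) (\<lambda>s. h s (c (int i)))) - (\<Sum>i<m. integral (?I i) (\<lambda>s. g s (c (int i))))) \<le> real m * e"
  proof -
    have "norm (\<Sum>i<m. integral (?I i) (\<lambda>s. h s (c (int i))) - integral (?I i) (\<lambda>s. g s (c (int i)))) \<le> (\<Sum>i<m. e)"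
      by (rule sum_norm_le) (use cells mn in auto)
    then show ?thesis by (simp add: sum_subtractf)
  qed
  moreover have "real m * e \<le> real n * e" using mn e by (intro mult_right_mono) auto
  moreover have "norm ((a + b) - (a' + b')) \<le> x + 2 * \<epsilon>" if "norm (a - a') \<le> x" "norm b \<le> \<epsilon>" "norm b' \<le> \<epsilon>" for a b a' b' :: 'v and x
    using that norm_triangle_ineq[of "a - a'" "b - b'"] norm_triangle_ineq4[of b b'] by (simp add: algebra_simps)
  ultimately show ?thesis unfolding decomp[OF W(1)] decomp[OF W(2)] using last[OF W(1)] last[OF W(2)] by (meson order_trans)
qed

text \<open>Closeness of the histories enters here: \<psi> takes over the modulus of continuity of
  \<phi>, which together with the m-bounds gives a modulus for y that is known before h, \<psi> and
  y are.\<close>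

lemma sigma_solution_error:
  fixes \<phi> :: "real \<Rightarrow> 'v"
  assumes mb: "L1loc_equicontinuous_mbounds f" and lb: "Lloc_bounded_lbounds 1 f" and W: "W g"
    and \<phi>: "continuous_on {-1..0} \<phi>" and \<eta>: "0 < \<eta>"
  shows "\<exists>F \<delta>. finite F \<and> F \<subseteq> seminorms_sigmaD D \<and> 0 < \<delta> \<and>
    (\<forall>h \<psi> S y. W h \<longrightarrow> (\<forall>\<sigma>\<in>F. \<sigma> (h - g) < \<delta>) \<longrightarrow>
       (\<forall>t\<in>{-1..0}. norm (\<psi> t - \<phi> t) \<le> \<delta>) \<longrightarrow> S \<le> T \<longrightarrow> integral_solution h \<psi> S y \<longrightarrow>
       (\<forall>t\<in>{-1..S}. norm (y t) \<le> R) \<longrightarrow>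
       norm (integral {0..S} (\<lambda>s. h s (y s, y (s - 1)) - g s (y s, y (s - 1)))) \<le> \<eta>)"
proof -
  define q where "q = max T 0 + 1"
  have q: "0 < q" "T \<le> q" by (auto simp: q_def)
  \<comment> \<open>Room 2: one unit for the net values, of norm up to 2 * R + e, and one more that
    \<open>hull_const_small\<close> asks for around a constant.\<close>
  obtain j where j: "2 * R + 2 \<le> real j" using real_arch_simple by blast
  from lipschitz_translates_ex[OF order_refl f1 lb q(1), of j] obtain C where C: "0 < C" and lip: "lipschitz_translates f j q C"
    by blast
  define e where "e = min 1 (\<eta> / (8 * C))"
  have e: "0 < e" "e \<le> 1" "2 * C * (2 * e) \<le> \<eta> / 2"
  proof -
    show "0 < e" "e \<le> 1" using \<eta> C by (auto simp: e_def)
    have "C * e \<le> C * (\<eta> / (8 * C))" using C by (intro mult_left_mono) (auto simp: e_def)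
    then show "2 * C * (2 * e) \<le> \<eta> / 2" using C by simp
  qed
  obtain N where N: "finite N" "N \<subseteq> D" and net: "\<forall>x. norm x \<le> 2 * R \<longrightarrow> (\<exists>d\<in>N. norm (d - x) < e)"
    using finite_net[OF e(1), of "2 * R"] by blast
  \<comment> \<open>e / 4 leads to modulus e / 2 for y and thus e for the delay pair; \<eta> / 8 is
    spent twice on the last, incomplete cell.\<close>
  have e4: "0 < e / 4" and \<eta>8: "0 < \<eta> / 8" using e \<eta> by auto
  from small_translates_ex[OF f1 mb q(1) e4, of j] obtain \<delta>1 where \<delta>1: "0 < \<delta>1" and sm1: "small_translates f j q \<delta>1 (e / 4)" by blast
  from small_translates_ex[OF f1 mb q(1) \<eta>8, of j] obtain \<delta>3 where \<delta>3: "0 < \<delta>3" and sm3: "small_translates f j q \<delta>3 (\<eta> / 8)" by blast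
  have "uniformly_continuous_on {-1..0} \<phi>" using \<phi> by (intro compact_uniformly_continuous) auto
  \<comment> \<open>The modulus of \<phi> and the distance of \<psi> from \<phi> at two points add
    up to 3 * (e / 12) = e / 4.\<close>
  moreover have "0 < e / 12" using e by simp
  ultimately obtain \<delta>2 where \<delta>2: "0 < \<delta>2" "\<forall>s\<in>{-1..0}. \<forall>s'\<in>{-1..0}. dist s' s < \<delta>2 \<longrightarrow> dist (\<phi> s') (\<phi> s) < e / 12"
    unfolding uniformly_continuous_on_def by blast
  define \<delta>4 where "\<delta>4 = min \<delta>1 \<delta>2"
  have \<delta>4: "0 < \<delta>4" "\<delta>4 \<le> \<delta>1" "\<delta>4 \<le> \<delta>2" using \<delta>1 \<delta>2(1) by (auto simp: \<delta>4_def)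
  have sm1': "small_translates f j q \<delta>4 (e / 4)" using sm1 \<delta>4(2) unfolding small_translates_def by (meson less_le_trans)
  have "0 < min \<delta>4 \<delta>3" using \<delta>4 \<delta>3 by simp
  \<comment> \<open>K is fixed before h, \<psi> and y, because the cells of the grid become part of
    the seminorms.\<close>
  then obtain K where K: "1 \<le> K" "1 / real K < min \<delta>4 \<delta>3"
    using reals_Archimedean[of "min \<delta>4 \<delta>3"] by (metis inverse_eq_divide One_nat_def Suc_leI zero_less_Suc)
  \<comment> \<open>Enough cells to cover {0..q}, so that one family F serves every S.\<close>
  define n where "n = nat \<lceil>real K * q\<rceil>"
  have n: "real K * q \<le> real n" unfolding n_def by linarith
  define e' where "e' = \<eta> / (4 * (real n + 1))"
  have e': "0 < e'" "real n * e' \<le> \<eta> / 4"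
  proof -
    show "0 < e'" using \<eta> by (simp add: e'_def)
    have "real n * e' = \<eta> / 4 * (real n / (real n + 1))" by (simp add: e'_def)
    also have "\<dots> \<le> \<eta> / 4 * 1" using \<eta> by (intro mult_left_mono) auto
    finally show "real n * e' \<le> \<eta> / 4" by simp
  qed
  define \<sigma> :: "nat \<times> ('v \<times> 'v) \<Rightarrow> 'v delay_field \<Rightarrow> real"
    where "\<sigma> = (\<lambda>(i, d) f. norm (LINT t:{real i / real K..real (i + 1) / real K}|lebesgue. f t d))"
  define F where "F = \<sigma> ` ({..<n} \<times> N)"
  have F: "finite F" "F \<subseteq> seminorms_sigmaD D"
  proof -
    show "finite F" unfolding F_def using N(1) by simp
    show "F \<subseteq> seminorms_sigmaD D"
    proof
      fix \<rho> assume "\<rho> \<in> F"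
      then obtain i d where "d \<in> N" "\<rho> = \<sigma> (i, d)" unfolding F_def by blast
      then show "\<rho> \<in> seminorms_sigmaD D"
        using N(2) by (auto simp: \<sigma>_def intro!: seminorms_sigmaD_I divide_right_mono)
    qed
  qed
  show ?thesis
  proof (rule exI[of _ F], rule exI[of _ "min e' (e / 12)"], intro conjI allI impI)
    show "finite F" "F \<subseteq> seminorms_sigmaD D" "0 < min e' (e / 12)" using F e' e by auto
    fix h and \<psi> :: "real \<Rightarrow> 'v" and S y
    assume h: "W h" and close: "\<forall>\<rho>\<in>F. \<rho> (h - g) < min e' (e / 12)"
      and \<psi>: "\<forall>t\<in>{-1..0}. norm (\<psi> t - \<phi> t) \<le> min e' (e / 12)"
      and ST: "S \<le> T" and y: "integral_solution h \<psi> S y" and yR: "\<forall>t\<in>{-1..S}. norm (y t) \<le> R"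
    have S: "0 \<le> S" "S \<le> q" using integral_solutionD(1)[OF y] ST q by auto
    define z where "z s = (y s, y (s - 1))" for s
    have zc: "continuous_on {0..S} z" and zR: "\<forall>s\<in>{0..S}. norm (z s) \<le> 2 * R"
      unfolding z_def using delay_pair_admissible[OF integral_solutionD(2)[OF y], of R] yR by blast+
    have \<psi>mod: "\<forall>s\<in>{-1..0}. \<forall>s'\<in>{-1..0}. \<bar>s - s'\<bar> < \<delta>4 \<longrightarrow> norm (\<psi> s - \<psi> s') \<le> e / 4"
    proof (intro ballI impI)
      fix s s' :: real assume s: "s \<in> {-1..0}" "s' \<in> {-1..0}" "\<bar>s - s'\<bar> < \<delta>4"
      have "dist s s' < \<delta>2" using s(3) \<delta>4(3) by (simp add: dist_real_def)
      then have "dist (\<phi> s) (\<phi> s') < e / 12" using \<delta>2(2) s(1,2) by blast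
      moreover have "norm (\<psi> s - \<phi> s) \<le> e / 12" "norm (\<psi> s' - \<phi> s') \<le> e / 12" using \<psi> s(1,2) by auto
      ultimately show "norm (\<psi> s - \<psi> s') \<le> e / 4"
        using norm_triangle_ineq[of "\<psi> s - \<phi> s" "\<phi> s - \<psi> s'"] norm_triangle_ineq4[of "\<phi> s - \<phi> s'" "\<psi> s' - \<phi> s'"]
        by (simp add: dist_norm)
    qed
    have j1: "2 * R + 1 \<le> real j" using j by simp
    note ymod = solution_modulus[OF h sm1' less_imp_le[OF e4] y yR j1 less_imp_le[OF q(1)] S(2) \<psi>mod]
    have zmod: "\<forall>s\<in>{0..S}. \<forall>s'\<in>{0..S}. \<bar>s - s'\<bar> \<le> 1 / real K \<longrightarrow> norm (z s - z s') \<le> e"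
    proof (intro ballI impI)
      fix s s' assume s: "s \<in> {0..S}" "s' \<in> {0..S}" "\<bar>s - s'\<bar> \<le> 1 / real K"
      have "\<bar>s - s'\<bar> < \<delta>4" using s(3) K(2) by simp
      then have "norm (y s - y s') \<le> 2 * (e / 4)" "norm (y (s - 1) - y (s' - 1)) \<le> 2 * (e / 4)"
        using ymod[of s s'] ymod[of "s - 1" "s' - 1"] s S by auto
      then show "norm (z s - z s') \<le> e"
        using norm_Pair_le_add[of "y s - y s'" "y (s - 1) - y (s' - 1)"] by (simp add: z_def)
    qed
    from net_step[OF K(1) S(1) net zR zmod] obtain c where c: "\<forall>i. c i \<in> N" "\<forall>i. norm (c i) \<le> 2 * R + e"
      "\<forall>s\<in>{0..S}. norm (z s - grid_step K c s) \<le> 2 * e" by blast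
    have cj: "\<forall>i. norm (c i) + 1 \<le> real j"
    proof
      fix i show "norm (c i) + 1 \<le> real j" using c(2)[rule_format, of i] e(2) j by linarith
    qed
    have "norm (integral {0..S} (\<lambda>s. h s (grid_step K c s)) - integral {0..S} (\<lambda>s. g s (grid_step K c s))) \<le> real n * e' + 2 * (\<eta> / 8)"
    proof (rule grid_close[OF W h K(1) sm3 less_imp_le[OF \<eta>8] _ S _ cj _ less_imp_le[OF e'(1)]])
      show "1 / real K < \<delta>3" using K(2) by simp
      have "real K * S \<le> real K * q" using S by (intro mult_left_mono) auto
      then show "real K * S \<le> real n" using n by linarith
      show "\<forall>i<n. norm (integral {real i / real K..real (i + 1) / real K} (\<lambda>s. h s (c (int i))) -
          integral {real i / real K..real (i + 1) / real K} (\<lambda>s. g s (c (int i)))) \<le> e'"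
      proof (intro allI impI)
        fix i assume "i < n"
        then have "\<sigma> (i, c (int i)) \<in> F" unfolding F_def using c(1) by blast
        then have "\<sigma> (i, c (int i)) (h - g) < e'" using close by auto
        then show "norm (integral {real i / real K..real (i + 1) / real K} (\<lambda>s. h s (c (int i))) -
          integral {real i / real K..real (i + 1) / real K} (\<lambda>s. g s (c (int i)))) \<le> e'"
          unfolding \<sigma>_def prod.case W_seminorm_diff[OF W h] by (rule less_imp_le)
      qed
    qed
    then have err: "norm (integral {0..S} (\<lambda>s. h s (grid_step K c s)) - integral {0..S} (\<lambda>s. g s (grid_step K c s))) \<le> \<eta> / 2"
      using e'(2) by simp
    have "norm (integral {0..S} (\<lambda>s. h s (z s) - g s (z s))) \<le> 2 * C * (2 * e) + \<eta> / 2"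
    proof (rule error_split[OF W h K(1) lip less_imp_le[OF C] S zc _ _ _ c(3) _ err])
      show "\<forall>s\<in>{0..S}. norm (z s) + 1 \<le> real j" using zR j by force
      show "\<forall>i. c i \<in> D" using c(1) N(2) by blast
      show "\<forall>i. norm (c i) \<le> real j"
      proof
        fix i show "norm (c i) \<le> real j" using cj[rule_format, of i] by linarith
      qed
      show "0 < 2 * e" using e by simp
    qed
    then show "norm (integral {0..S} (\<lambda>s. h s (y s, y (s - 1)) - g s (y s, y (s - 1)))) \<le> \<eta>"
      using e(3) by (simp add: z_def)
  qed
qed

end

lemma hull_seminorms_sigmaD:
  fixes f :: "('v::euclidean_space) delay_field"
  assumes f: "f \<in> LC 1" and dense: "closure D = UNIV" and mb: "L1loc_equicontinuous_mbounds f" and lb: "Lloc_bounded_lbounds 1 f"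
  shows "hull_seminorms 1 (seminorms_sigmaD D) f"
proof
  interpret weak_hull D f using f dense by unfold_locales
  have int: "(\<lambda>t. k t d) integrable_on {a..b}" if "k \<in> LC 1" for k :: "'v delay_field" and d a b
    by (rule along_abs_integrable(2)[OF that admissible_const[OF order_refl]])
  show "1 \<le> (1::nat)" "f \<in> LC 1" by (simp, fact)
  show "seminorms_sigmaD D \<noteq> {}"
  proof -
    obtain d where d: "d \<in> D" by (rule dense_near[OF dense zero_less_one])
    have "\<exists>\<rho>. \<rho> \<in> seminorms_sigmaD D" by (rule exI, rule seminorms_sigmaD_I[OF Rats_0 Rats_0 order_refl d])
    then show ?thesis by auto
  qed
  {
    fix \<rho> :: "'v delay_field \<Rightarrow> real" and g :: "'v delay_field" assume \<rho>: "\<rho> \<in> seminorms_sigmaD D" and g: "g \<in> LC 1"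
    obtain q1 q2 d where R: "\<And>k. k \<in> LC 1 \<Longrightarrow> \<rho> k = norm (integral {q1..q2} (\<lambda>t. k t d))"
      using \<rho> by (rule seminorms_sigmaD_E) blast
    show "\<rho> (g - g) = 0" unfolding R[OF LC_diff[OF g g]] by simp
  }
  {
    fix \<rho> :: "'v delay_field \<Rightarrow> real" and g h :: "'v delay_field"
    assume \<rho>: "\<rho> \<in> seminorms_sigmaD D" and gh: "g \<in> LC 1" "h \<in> LC 1" "ae_eq g h"
    obtain q1 q2 d where R: "\<And>k. k \<in> LC 1 \<Longrightarrow> \<rho> k = norm (integral {q1..q2} (\<lambda>t. k t d))"
      using \<rho> by (rule seminorms_sigmaD_E) blast
    show "\<rho> g = \<rho> h"
      unfolding R[OF gh(1)] R[OF gh(2)] using integral_ae_eq[OF gh(3), of q1 q2 "\<lambda>_ x. x" "\<lambda>_. d"] by simp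
  }
  {
    fix \<rho> :: "'v delay_field \<Rightarrow> real" and g h k :: "'v delay_field"
    assume \<rho>: "\<rho> \<in> seminorms_sigmaD D" and gh: "g \<in> LC 1" "h \<in> LC 1" "k \<in> LC 1"
    obtain q1 q2 d where R: "\<And>k. k \<in> LC 1 \<Longrightarrow> \<rho> k = norm (integral {q1..q2} (\<lambda>t. k t d))"
      using \<rho> by (rule seminorms_sigmaD_E) blast
    have D: "integral {q1..q2} (\<lambda>t. (u - v) t d) = integral {q1..q2} (\<lambda>t. u t d) - integral {q1..q2} (\<lambda>t. v t d)"
      if "u \<in> LC 1" "v \<in> LC 1" for u v :: "'v delay_field"
      using int[OF that(1)] int[OF that(2)] by (simp add: integral_diff)
    show "\<rho> (g - h) \<le> \<rho> (g - k) + \<rho> (k - h)"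
      unfolding R[OF LC_diff[OF gh(1,2)]] R[OF LC_diff[OF gh(1,3)]] R[OF LC_diff[OF gh(3,2)]]
        D[OF gh(1,2)] D[OF gh(1,3)] D[OF gh(3,2)]
      using norm_triangle_ineq[of "integral {q1..q2} (\<lambda>t. g t d) - integral {q1..q2} (\<lambda>t. k t d)"
          "integral {q1..q2} (\<lambda>t. k t d) - integral {q1..q2} (\<lambda>t. h t d)"] by simp
  }
  {
    fix g :: "'v delay_field" and \<rho> :: "'v delay_field \<Rightarrow> real" and \<epsilon> t0 :: real
    assume g: "W g" and \<rho>: "\<rho> \<in> seminorms_sigmaD D" and \<epsilon>: "0 < \<epsilon>"
    obtain q1 q2 d where q: "q1 \<le> q2" "d \<in> D" and R: "\<And>k. k \<in> LC 1 \<Longrightarrow> \<rho> k = norm (integral {q1..q2} (\<lambda>t. k t d))"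
      using \<rho> by (rule seminorms_sigmaD_E) blast
    have "\<rho> (translate t h - translate t0 g) = norm (integral {q1..q2} (\<lambda>s. (translate t h - translate t0 g) s d))"
      if "W h" for h t
      by (rule R[OF LC_diff_translate[OF W_LC[OF that] W_LC[OF g]]])
    then show "\<exists>F \<delta>. finite F \<and> F \<subseteq> seminorms_sigmaD D \<and> 0 < \<delta> \<and>
        (\<forall>h t. W h \<longrightarrow> \<bar>t - t0\<bar> < \<delta> \<longrightarrow> (\<forall>\<sigma>\<in>F. \<sigma> (h - g) < \<delta>) \<longrightarrow> \<rho> (translate t h - translate t0 g) < \<epsilon>)"
      using translation_close[OF mb g q(2,1) \<epsilon>, of t0] by (elim exE conjE) (intro exI conjI, assumption+, simp)
  }
qed (rule weak_hull.sigma_solution_error[OF weak_hull.intro[OF f dense] mb lb])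

theorem theorem3p7:
  fixes p :: nat
    and D :: "((real ^ 'n) \<times> (real ^ 'n)) set"
    and f :: "(real ^ 'n) delay_field"
  assumes "1 \<le> p"
    and "countable D" and "closure D = UNIV"
    and "f \<in> LC p"
  shows
    "local_skew_product_semiflow (Hull p (TB p) f) (mtopology_of history_space)
        (flow_domain (Hull p (TB p) f)) flow \<and>
     (Lloc_bounded_lbounds p f \<longrightarrow>
       local_skew_product_semiflow (Hull p (TD p D) f) (mtopology_of history_space)
        (flow_domain (Hull p (TD p D) f)) flow) \<and>
     (L1loc_equicontinuous_mbounds f \<and> Lloc_bounded_lbounds 1 f \<longrightarrow>
       local_skew_product_semiflow (Hull 1 (sigmaD D) f) (mtopology_of history_space)
        (flow_domain (Hull 1 (sigmaD D) f)) flow)"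
proof (intro conjI impI)
  show "local_skew_product_semiflow (Hull p (TB p) f) (mtopology_of history_space)
      (flow_domain (Hull p (TB p) f)) flow"
    unfolding TB_def by (rule hull_seminorms.local_skew_product_semiflow_hull[OF hull_seminorms_TB[OF assms(1,4)]])
next
  assume "Lloc_bounded_lbounds p f"
  then show "local_skew_product_semiflow (Hull p (TD p D) f) (mtopology_of history_space)
      (flow_domain (Hull p (TD p D) f)) flow"
    unfolding TD_def
    by (intro hull_seminorms.local_skew_product_semiflow_hull[OF hull_seminorms_TD[OF assms(1,4,3)]])
next
  assume "L1loc_equicontinuous_mbounds f \<and> Lloc_bounded_lbounds 1 f"
  then show "local_skew_product_semiflow (Hull 1 (sigmaD D) f) (mtopology_of history_space)
      (flow_domain (Hull 1 (sigmaD D) f)) flow"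
    unfolding sigmaD_def
    by (intro hull_seminorms.local_skew_product_semiflow_hull[OF hull_seminorms_sigmaD[OF LC_mono[OF assms(1,4)] assms(3)]]) auto
qed

end
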